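(* Let $0<p<1$, $p\ne1/2$, $q=1-p$, $h=-p\log p-q\log q$. Let $(X_n)$ be the size of a random trie: $X_0=X_1=0$ and $X_n\stackrel{d}{=}X_{I_n}+X^*_{n-I_n}+1$ for $n\ge2$, with $I_n\sim\mathrm{Binom}(n,p)$ and $(X^*_k)$ an independent copy of $(X_k)$ independent of $I_n$. Define \[ G(-1):=\frac12-\frac1h+2\sum_{j\ge2}\frac{(-1)^j(p^j+q^j)}{1-p^j-q^j}-E, \] where $E=\frac{1}{h\log p}\sum_{j\ge1}\frac{4rj\pi^2}{\sinh\frac{2rj\pi^2}{\log p}}$ if $\frac{\log p}{\log q}=\frac r\ell$ with coprime positive integers $r,\ell$, and $E=0$ if $\frac{\log p}{\log q}\notin\mathbb{Q}$. In the rational case let $\chi_k=\frac{2rk\pi i}{\log p}$ and for $k\ne0$ \[ G(-1+\chi_k):=\chi_k\Gamma(-1+\chi_k)\Big(1-\frac{\chi_k+3}{2^{1+\chi_k}}\Big)-\frac1h\sum_{j\in\mathbb{Z}}\Gamma(\chi_j+1)\Gamma(\chi_{k-j}+1)-2\sum_{j\ge1}\frac{(-1)^j(j+1+\chi_k)\Gamma(j+\chi_k)(p^{j+1}+q^{j+1})}{(j-1)!\,(j+1)\,(1-p^{j+1}-q^{j+1})}. \] Then \[ \frac{\mathbb{V}(X_n)}{n}=\frac{G(-1)}{h}+\mathscr{F}[G](r\log_{1/p}n)+o(1), \] where $\mathscr{F}[G](x)=h^{-1}\sum_{k\ne0}G(-1+\chi_k)e^{2k\pi ix}$ in the rational case and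 $\mathscr{F}[G]\equiv0$ in the irrational case. *)

theory Defs
  imports "HOL-Probability.Probability" "HOL-Library.Landau_Symbols"
begin

text \<open>
  Throughout, \<open>q = 1 - p\<close>, and \<open>r\<close> is the numerator of \<open>ln p / ln q\<close> in lowest terms when this
  ratio is rational; in the irrational case the argument \<open>r\<close> is ignored.  All infinite sums
  below converge absolutely for \<open>0 < p < 1\<close>, \<open>r > 0\<close> (and \<open>k \<noteq> 0\<close> where applicable).
\<close>

definition trie_h :: "real \<Rightarrow> real" where
  "trie_h p = - p * ln p - (1 - p) * ln (1 - p)"

definition trie_rational :: "real \<Rightarrow> bool" where
  "trie_rational p \<longleftrightarrow> ln p / ln (1 - p) \<in> \<rat>"

definition trie_E :: "real \<Rightarrow> nat \<Rightarrow> real" where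
  "trie_E p r =
     (if trie_rational p
      then 1 / (trie_h p * ln p) *
           (\<Sum>\<^sub>\<infinity>j\<in>{1::nat..}. 4 * real r * real j * pi\<^sup>2 / sinh (2 * real r * real j * pi\<^sup>2 / ln p))
      else 0)"

text \<open>The value \<open>G(-1)\<close>.\<close>
definition trie_G0 :: "real \<Rightarrow> nat \<Rightarrow> real" where
  "trie_G0 p r =
     1 / 2 - 1 / trie_h p
     + 2 * (\<Sum>\<^sub>\<infinity>j\<in>{2::nat..}. (-1) ^ j * (p ^ j + (1 - p) ^ j) / (1 - p ^ j - (1 - p) ^ j))
     - trie_E p r"

definition trie_chi :: "real \<Rightarrow> nat \<Rightarrow> int \<Rightarrow> complex" where
  "trie_chi p r k = 2 * of_nat r * of_int k * of_real pi * \<i> / of_real (ln p)"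

text \<open>The value \<open>G(-1 + \<chi>\<^sub>k)\<close>, meant for \<open>k \<noteq> 0\<close>.\<close>
definition trie_G :: "real \<Rightarrow> nat \<Rightarrow> int \<Rightarrow> complex" where
  "trie_G p r k =
     (let c = trie_chi p r in
        c k * Gamma (-1 + c k) * (1 - (c k + 3) / 2 powr (1 + c k))
        - 1 / of_real (trie_h p) * (\<Sum>\<^sub>\<infinity>j\<in>UNIV. Gamma (c j + 1) * Gamma (c (k - j) + 1))
        - 2 * (\<Sum>\<^sub>\<infinity>j\<in>{1::nat..}.
                 (-1) ^ j * (of_nat j + 1 + c k) * Gamma (of_nat j + c k)
                   * of_real (p ^ (j + 1) + (1 - p) ^ (j + 1))
                 / (fact (j - 1) * (of_nat j + 1) * of_real (1 - p ^ (j + 1) - (1 - p) ^ (j + 1)))))"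

text \<open>The periodic function \<open>\<F>[G]\<close>.\<close>
definition trie_F :: "real \<Rightarrow> nat \<Rightarrow> real \<Rightarrow> complex" where
  "trie_F p r x =
     (if trie_rational p
      then 1 / of_real (trie_h p) *
           (\<Sum>\<^sub>\<infinity>k\<in>{k::int. k \<noteq> 0}. trie_G p r k * exp (2 * of_int k * of_real pi * \<i> * of_real x))
      else 0)"

text \<open>
  \<open>X n\<close> is the law of \<open>X\<^sub>n\<close>.  For \<open>n \<ge> 2\<close>, conditionally on \<open>I\<^sub>n = i\<close> the two summands are
  independent with laws \<open>X i\<close> and \<open>X (n - i)\<close>.  The values \<open>i = 0\<close> and \<open>i = n\<close> have positive
  probability, so the third clause is an implicit equation for \<open>X n\<close>, not a recursive definition.
\<close>
definition trie_size_laws :: "real \<Rightarrow> (nat \<Rightarrow> nat pmf) \<Rightarrow> bool" where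
  "trie_size_laws p X \<longleftrightarrow>
     X 0 = return_pmf 0 \<and> X 1 = return_pmf 0 \<and>
     (\<forall>n\<ge>2. X n =
        bind_pmf (binomial_pmf n p)
          (\<lambda>i. map_pmf (\<lambda>(x, y). x + y + 1) (pair_pmf (X i) (X (n - i)))))"

end

theory Submission
  imports Defs "HOL-Real_Asymp.Real_Asymp"
begin


text \<open>
  Let \<open>g(x) = (1 + x) exp (- x)\<close>.  In the Poisson model the variance \<open>V\<^sub>P(z)\<close> of the trie size satisfies
  \<open>V\<^sub>P(z) = V\<^sub>P(pz) + V\<^sub>P(qz) + \<phi>(z)\<close> with an exponentially small toll
  \<open>\<phi> = g (1 - g) + 2 g (M(p\<cdot>) + M(q\<cdot>))\<close>, where \<open>M\<close> is the Poissonized mean.  Since the first differences of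
  the means vary by \<open>O(1/n)\<close> and those of the variances grow at most like \<open>ln n\<close>, the law of total
  variance gives \<open>V\<^sub>n / n = V\<^sub>P(n) / n - M'(n)\<^sup>2 + o(1)\<close>.

  In the variable \<open>t = ln z\<close> both \<open>V\<^sub>P(z) / z\<close> and \<open>M'(z)\<close> solve the renewal equation
  \<open>F(t) = \<Psi>(t) + p F(t - A) + q F(t - B)\<close> with \<open>A = - ln p\<close>, \<open>B = - ln q\<close>.  A value of \<open>F\<close> near its upper
  limit forces earlier values, along all combinations \<open>iA + jB\<close>, to be near it too; comparison with the
  conserved quantity \<open>p \<integral>\<^bsub>t-A\<^esub>\<^bsup>t\<^esup> F + q \<integral>\<^bsub>t-B\<^esub>\<^bsup>t\<^esup> F\<close> (a sum over the lattice in the rational case) identifies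
  the limit as the mean of \<open>\<Psi>\<close>, or as its periodization.  Poisson summation turns the periodization into a
  Fourier series whose coefficients are Mellin transforms of \<open>\<phi>\<close>; expanding \<open>M\<close> in its Taylor series
  evaluates them termwise as Gamma functions, and squaring the series of \<open>M'\<close> gives the convolution of
  Gamma values.
\<close>


section \<open>Binomial averages\<close>

text \<open>All the equations are linear with nonnegative weights, so explicit supersolutions do the
  estimating: \<open>1 / (n + 1)\<close> for second differences of the mean,
  \<open>1 - 1 / (n + 1)\<close> for first differences, \<open>ln (n + 1)\<close> for differences of
  the variance, and \<open>x / (1 + x)\<close> with \<open>x = exp t\<close> for the renewal
  equation. The latter is invariant under translation, so the same supersolution bounds increments
  and yields the Lipschitz property that the nonlattice case needs. The recurrences are implicit,
  since a split may send everything to one side; this shapes the comparison lemma and the moment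
  bounds. The variance toll contains M(px) + M(qx) rather than M(x). The Taylor coefficients of this
  sum carry (p^n + q^n) / (1 - p^n - q^n) instead of 1 / (1 - p^n - q^n), and this geometric decay
  makes the termwise Mellin transform converge absolutely on the imaginary axis. Quadratic decay of
  the transforms along that axis then makes the Fourier series absolutely summable.\<close>

locale bernoulli_split =
  fixes p q :: real
  assumes p_pos: "0 < p" and q_pos: "0 < q" and pq_sum: "p + q = 1"
begin

lemma p_less1: "p < 1" and q_less1: "q < 1"
  using p_pos q_pos pq_sum by auto

lemma q_eq: "q = 1 - p"
  using pq_sum by simp

text \<open>The expectation of \<open>f\<close> at a Binomial(\<open>n\<close>, \<open>p\<close>)
  variable, kept as a finite sum so that the recurrences are purely algebraic.\<close>

definition bin_avg :: "nat \<Rightarrow> (nat \<Rightarrow> real) \<Rightarrow> real" where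
  "bin_avg n f = (\<Sum>i\<le>n. real (n choose i) * p ^ i * q ^ (n - i) * f i)"

lemma bin_avg_0 [simp]: "bin_avg 0 f = f 0"
  by (simp add: bin_avg_def)

text \<open>Conditioning on one of the trials. The moments below and the differencing of recurrences
  rest on this identity.\<close>

lemma bin_avg_Suc: "bin_avg (Suc n) f = p * bin_avg n (\<lambda>i. f (Suc i)) + q * bin_avg n f"
proof -
  have "bin_avg (Suc n) f = q ^ Suc n * f 0
      + (\<Sum>i\<le>n. real (Suc n choose Suc i) * p ^ Suc i * q ^ (n - i) * f (Suc i))"
    unfolding bin_avg_def by (subst sum.atMost_Suc_shift) simp
  also have "(\<Sum>i\<le>n. real (Suc n choose Suc i) * p ^ Suc i * q ^ (n - i) * f (Suc i))
      = (\<Sum>i\<le>n. real (n choose i) * p ^ Suc i * q ^ (n - i) * f (Suc i))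
      + (\<Sum>i\<le>n. real (n choose Suc i) * p ^ Suc i * q ^ (n - i) * f (Suc i))"
    by (simp add: sum.distrib[symmetric] algebra_simps)
  also have "(\<Sum>i\<le>n. real (n choose i) * p ^ Suc i * q ^ (n - i) * f (Suc i))
      = p * bin_avg n (\<lambda>i. f (Suc i))"
    by (simp add: bin_avg_def sum_distrib_left mult_ac)
  also have "q ^ Suc n * f 0 + (p * bin_avg n (\<lambda>i. f (Suc i))
      + (\<Sum>i\<le>n. real (n choose Suc i) * p ^ Suc i * q ^ (n - i) * f (Suc i)))
      = p * bin_avg n (\<lambda>i. f (Suc i)) + (\<Sum>i\<le>Suc n. real (n choose i) * p ^ i * q ^ (Suc n - i) * f i)"
    by (subst sum.atMost_Suc_shift) simp
  also have "(\<Sum>i\<le>Suc n. real (n choose i) * p ^ i * q ^ (Suc n - i) * f i) = q * bin_avg n f"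
    by (simp add: bin_avg_def sum_distrib_left Suc_diff_le mult_ac)
  finally show ?thesis .
qed

lemma bin_avg_cong: "(\<And>i. i \<le> n \<Longrightarrow> f i = g i) \<Longrightarrow> bin_avg n f = bin_avg n g"
  unfolding bin_avg_def by (intro sum.cong) auto

lemma bin_avg_add: "bin_avg n (\<lambda>i. f i + g i) = bin_avg n f + bin_avg n g"
  by (simp add: bin_avg_def sum.distrib algebra_simps)

lemma bin_avg_diff: "bin_avg n (\<lambda>i. f i - g i) = bin_avg n f - bin_avg n g"
  by (simp add: bin_avg_def sum_subtractf algebra_simps)

lemma bin_avg_cmult: "bin_avg n (\<lambda>i. c * f i) = c * bin_avg n f"
  unfolding bin_avg_def sum_distrib_left by (intro sum.cong) auto

lemma bin_avg_multc: "bin_avg n (\<lambda>i. f i * c) = bin_avg n f * c"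
  unfolding bin_avg_def sum_distrib_right by (intro sum.cong) auto

lemma bin_avg_divc: "bin_avg n (\<lambda>i. f i / c) = bin_avg n f / c"
  by (simp add: bin_avg_def sum_divide_distrib)

lemma bin_avg_uminus: "bin_avg n (\<lambda>i. - f i) = - bin_avg n f"
  by (simp add: bin_avg_def sum_negf)

lemma bin_avg_const [simp]: "bin_avg n (\<lambda>i. c) = c"
proof (induction n)
  case (Suc n)
  have "p * c + q * c = (p + q) * c" by (simp only: distrib_right)
  with Suc show ?case by (simp add: bin_avg_Suc pq_sum)
qed simp

lemmas bin_avg_linear = bin_avg_add bin_avg_diff bin_avg_cmult bin_avg_multc bin_avg_divc bin_avg_uminus

lemma bin_weight_nonneg: "0 \<le> real (n choose i) * p ^ i * q ^ (n - i)"
  using p_pos q_pos by simp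

lemma bin_avg_mono: "(\<And>i. i \<le> n \<Longrightarrow> f i \<le> g i) \<Longrightarrow> bin_avg n f \<le> bin_avg n g"
  unfolding bin_avg_def by (intro sum_mono mult_left_mono bin_weight_nonneg) auto

lemma bin_avg_nonneg: "(\<And>i. i \<le> n \<Longrightarrow> 0 \<le> f i) \<Longrightarrow> 0 \<le> bin_avg n f"
  using bin_avg_mono[of n "\<lambda>_. 0" f] by simp

lemma abs_bin_avg_le: "\<bar>bin_avg n f\<bar> \<le> bin_avg n (\<lambda>i. \<bar>f i\<bar>)"
  using bin_avg_mono[of n f "\<lambda>i. \<bar>f i\<bar>"] bin_avg_mono[of n "\<lambda>i. - f i" "\<lambda>i. \<bar>f i\<bar>"]
  by (simp add: bin_avg_uminus abs_le_iff)

text \<open>The average of \<open>(f i - c)\<^sup>2\<close> about \<open>c = bin_avg n f\<close> is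
  nonnegative.\<close>

lemma bin_avg_square_le: "(bin_avg n f)\<^sup>2 \<le> bin_avg n (\<lambda>i. (f i)\<^sup>2)"
proof -
  define c where "c = bin_avg n f"
  have "0 \<le> bin_avg n (\<lambda>i. (f i - c)\<^sup>2)"
    by (intro bin_avg_nonneg) simp
  also have "bin_avg n (\<lambda>i. (f i - c)\<^sup>2) = bin_avg n (\<lambda>i. (f i)\<^sup>2 - 2 * c * f i + c\<^sup>2)"
    by (simp add: power2_eq_square algebra_simps)
  also have "\<dots> = bin_avg n (\<lambda>i. (f i)\<^sup>2) - c\<^sup>2"
    unfolding bin_avg_linear bin_avg_const c_def[symmetric] by (simp add: power2_eq_square)
  finally show ?thesis by (simp add: c_def)
qed

lemma bin_avg_id: "bin_avg n real = real n * p"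
proof (induction n)
  case (Suc n)
  have "bin_avg (Suc n) real = p * (bin_avg n real + 1) + q * bin_avg n real"
    unfolding bin_avg_Suc of_nat_Suc bin_avg_linear bin_avg_const by simp
  also have "\<dots> = (p + q) * bin_avg n real + p" by (simp add: algebra_simps)
  finally show ?case by (simp add: pq_sum Suc algebra_simps)
qed simp

lemma bin_avg_id_square: "bin_avg n (\<lambda>i. (real i)\<^sup>2) = (real n * p)\<^sup>2 + real n * p * q"
proof (induction n)
  case (Suc n)
  have "bin_avg (Suc n) (\<lambda>i. (real i)\<^sup>2)
      = p * bin_avg n (\<lambda>i. (real i)\<^sup>2 + 2 * real i + 1) + q * bin_avg n (\<lambda>i. (real i)\<^sup>2)"
    unfolding bin_avg_Suc by (simp add: power2_eq_square algebra_simps)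
  also have "\<dots> = (p + q) * bin_avg n (\<lambda>i. (real i)\<^sup>2) + p * (2 * (real n * p) + 1)"
    unfolding bin_avg_linear bin_avg_const bin_avg_id by (simp add: algebra_simps)
  finally show ?case
    by (simp add: Suc pq_sum) (simp add: q_eq power2_eq_square algebra_simps)
qed simp

lemma bin_avg_variance: "bin_avg n (\<lambda>i. (real i - real n * p)\<^sup>2) = real n * p * q"
proof -
  have "bin_avg n (\<lambda>i. (real i - real n * p)\<^sup>2)
      = bin_avg n (\<lambda>i. (real i)\<^sup>2 - 2 * (real n * p) * real i + (real n * p)\<^sup>2)"
    by (simp add: power2_eq_square algebra_simps)
  also have "\<dots> = real n * p * q"
    unfolding bin_avg_linear bin_avg_const bin_avg_id bin_avg_id_square
    by (simp add: power2_eq_square)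
  finally show ?thesis .
qed

lemma bin_avg_reflect:
  "bin_avg n (\<lambda>i. f (n - i)) = (\<Sum>i\<le>n. real (n choose i) * q ^ i * p ^ (n - i) * f i)"
  unfolding bin_avg_def
  by (rule sum.reindex_bij_witness[of _ "\<lambda>i. n - i" "\<lambda>i. n - i"])
     (auto simp: binomial_symmetric[symmetric])

text \<open>Absorbing the factor \<open>n + 1\<close> into the binomial coefficient turns the
  average into a binomial expansion that lacks only its term \<open>q ^ Suc n\<close>. This closed
  form is why \<open>1 / (n + 1)\<close> can serve as a supersolution.\<close>

lemma bin_avg_inverse_Suc: "bin_avg n (\<lambda>i. p / real (Suc i)) = (1 - q ^ Suc n) / real (Suc n)"
proof -
  have "real (Suc n) * bin_avg n (\<lambda>i. p / real (Suc i))
      = (\<Sum>i\<le>n. real (Suc n choose Suc i) * p ^ Suc i * q ^ (Suc n - Suc i))"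
    unfolding bin_avg_def sum_distrib_left
  proof (intro sum.cong refl)
    fix i
    have "real (Suc n) * real (n choose i) = real (Suc i) * real (Suc n choose Suc i)"
      by (metis Suc_times_binomial_eq of_nat_mult mult.commute)
    then show "real (Suc n) * (real (n choose i) * p ^ i * q ^ (n - i) * (p / real (Suc i)))
        = real (Suc n choose Suc i) * p ^ Suc i * q ^ (Suc n - Suc i)"
      by (simp add: field_simps del: binomial_Suc_Suc of_nat_Suc)
  qed
  also have "\<dots> = (p + q) ^ Suc n - q ^ Suc n"
    unfolding binomial_ring sum.atMost_Suc_shift[of _ n] by simp
  finally show ?thesis by (simp add: pq_sum field_simps)
qed

text \<open>Having \<open>q\<close> as a second parameter, instead of writing \<open>1 - p\<close>,
  makes this exchange available: statements about \<open>i\<close> transfer to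
  \<open>n - i\<close>.\<close>

lemma bernoulli_split_swap: "bernoulli_split q p"
  using p_pos q_pos pq_sum by unfold_locales auto

lemma bin_avg_inverse_Suc_reflect:
  "bin_avg n (\<lambda>i. q / real (Suc (n - i))) = (1 - p ^ Suc n) / real (Suc n)"
proof -
  interpret swap: bernoulli_split q p by (rule bernoulli_split_swap)
  have "bin_avg n (\<lambda>i. q / real (Suc (n - i))) = swap.bin_avg n (\<lambda>i. q / real (Suc i))"
    unfolding bin_avg_reflect[of n "\<lambda>i. q / real (Suc i)"] swap.bin_avg_def ..
  then show ?thesis by (simp only: swap.bin_avg_inverse_Suc)
qed

text \<open>The assumption on \<open>\<alpha>\<close> and \<open>\<beta>\<close> is needed because \<open>a n\<close> itself enters the average
  with the weight \<open>\<alpha> * p ^ n + \<beta> * q ^ n\<close>.\<close>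

lemma bin_avg_comparison:
  assumes "0 \<le> \<alpha>" "0 \<le> \<beta>"
    and contr: "\<And>n. n \<ge> n0 \<Longrightarrow> \<alpha> * p ^ n + \<beta> * q ^ n < 1"
    and init: "\<And>n. n < n0 \<Longrightarrow> a n \<le> 0"
    and step: "\<And>n. n \<ge> n0 \<Longrightarrow> a n \<le> bin_avg n (\<lambda>i. \<alpha> * a i + \<beta> * a (n - i))"
  shows "a n \<le> 0"
proof (induction n rule: less_induct)
  case (less n)
  show ?case
  proof (cases "n < n0")
    case False
    \<comment> \<open>\<open>b\<close> drops the value at \<open>n\<close>, so the induction
      hypothesis covers all of it and the inequality can be solved for \<open>a n\<close>.\<close>
    define b where "b i = (if i = n then 0 else a i)" for i
    have b: "b i \<le> 0" if "i \<le> n" for i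
      using less.IH[of i] that by (auto simp: b_def)
    have a_b: "a i = b i + (if i = n then a n else 0)" for i
      by (simp add: b_def)
    have "a n \<le> bin_avg n (\<lambda>i. \<alpha> * a i + \<beta> * a (n - i))"
      using step False by simp
    also have "\<dots> = bin_avg n (\<lambda>i. (\<alpha> * b i + \<beta> * b (n - i))
        + (\<alpha> * (if i = n then a n else 0) + \<beta> * (if i = 0 then a n else 0)))"
      by (intro bin_avg_cong, subst (1 2) a_b) (auto simp: algebra_simps)
    also have "\<dots> = bin_avg n (\<lambda>i. \<alpha> * b i + \<beta> * b (n - i))
        + \<alpha> * bin_avg n (\<lambda>i. if i = n then a n else 0) + \<beta> * bin_avg n (\<lambda>i. if i = 0 then a n else 0)"
      by (simp only: bin_avg_linear add.assoc)
    also have "bin_avg n (\<lambda>i. if i = n then a n else 0) = p ^ n * a n"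
      by (simp add: bin_avg_def if_distrib cong: if_cong)
    also have "bin_avg n (\<lambda>i. if i = 0 then a n else 0) = q ^ n * a n"
      by (simp add: bin_avg_def if_distrib cong: if_cong)
    also have "bin_avg n (\<lambda>i. \<alpha> * b i + \<beta> * b (n - i)) \<le> bin_avg n (\<lambda>i. 0)"
      using b assms(1,2)
      by (intro bin_avg_mono add_nonpos_nonpos mult_nonneg_nonpos) auto
    finally have "(1 - (\<alpha> * p ^ n + \<beta> * q ^ n)) * a n \<le> 0"
      by (simp add: algebra_simps)
    with contr[of n] False show ?thesis
      by (simp add: mult_le_0_iff)
  qed (use init in auto)
qed

text \<open>One more trial raises either \<open>i\<close> (probability \<open>p\<close>) or
  \<open>n - i\<close> (probability \<open>q\<close>). Each differencing thus multiplies the weights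
  by \<open>p\<close> and \<open>q\<close>; this is the source of all bounds on differences.\<close>

lemma bin_avg_difference:
  assumes "\<And>n. a n = bin_avg n (\<lambda>i. \<alpha> * a i + \<beta> * a (n - i)) + t n"
  shows "a (Suc n) - a n = bin_avg n (\<lambda>i. \<alpha> * p * (a (Suc i) - a i)
      + \<beta> * q * (a (Suc (n - i)) - a (n - i))) + (t (Suc n) - t n)"
proof -
  have "a (Suc n) = p * bin_avg n (\<lambda>i. \<alpha> * a (Suc i) + \<beta> * a (n - i))
      + q * bin_avg n (\<lambda>i. \<alpha> * a i + \<beta> * a (Suc n - i)) + t (Suc n)"
    by (subst assms, subst bin_avg_Suc) simp
  also have "bin_avg n (\<lambda>i. \<alpha> * a i + \<beta> * a (Suc n - i))
      = bin_avg n (\<lambda>i. \<alpha> * a i + \<beta> * a (Suc (n - i)))"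
    by (intro bin_avg_cong) (simp add: Suc_diff_le)
  finally have *: "a (Suc n) = p * bin_avg n (\<lambda>i. \<alpha> * a (Suc i) + \<beta> * a (n - i))
      + q * bin_avg n (\<lambda>i. \<alpha> * a i + \<beta> * a (Suc (n - i))) + t (Suc n)" .
  have **: "a n = p * bin_avg n (\<lambda>i. \<alpha> * a i + \<beta> * a (n - i))
      + q * bin_avg n (\<lambda>i. \<alpha> * a i + \<beta> * a (n - i)) + t n"
    by (subst assms) (simp add: pq_sum distrib_right[symmetric])
  show ?thesis
    by (subst *, subst **) (simp only: bin_avg_linear algebra_simps)
qed

text \<open>A covariance does not change when both functions are centred, at any \<open>x\<close>
  and \<open>y\<close>. The weighted inequality
  \<open>2 * \<bar>u * v\<bar> \<le> u\<^sup>2 / c + c * v\<^sup>2\<close> takes the place of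
  Cauchy-Schwarz; the weight \<open>c\<close> is chosen where the orders of magnitude of
  \<open>f\<close> and \<open>g\<close> are known.\<close>

lemma bin_avg_covariance_bound:
  assumes "0 < c"
  shows "2 * \<bar>bin_avg n (\<lambda>i. f i * g i) - bin_avg n f * bin_avg n g\<bar>
      \<le> 2 * (bin_avg n (\<lambda>i. (f i - x)\<^sup>2) / c + c * bin_avg n (\<lambda>i. (g i - y)\<^sup>2))"
proof -
  define F where "F i = f i - x" for i
  define G where "G i = g i - y" for i
  have young: "2 * \<bar>u * v\<bar> \<le> u\<^sup>2 / c + c * v\<^sup>2" for u v :: real
  proof -
    have "0 \<le> (\<bar>u\<bar> - c * \<bar>v\<bar>)\<^sup>2 / c" using assms by simp
    also have "\<dots> = u\<^sup>2 / c + c * v\<^sup>2 - 2 * \<bar>u * v\<bar>"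
      using assms by (simp add: power2_eq_square field_simps abs_mult)
    finally show ?thesis by simp
  qed
  have fF: "f = (\<lambda>i. F i + x)" and gG: "g = (\<lambda>i. G i + y)" by (auto simp: F_def G_def)
  have fg: "(\<lambda>i. f i * g i) = (\<lambda>i. F i * G i + y * F i + x * G i + x * y)"
    by (auto simp: fF gG algebra_simps)
  have "bin_avg n (\<lambda>i. f i * g i) - bin_avg n f * bin_avg n g
      = bin_avg n (\<lambda>i. F i * G i) - bin_avg n F * bin_avg n G"
    unfolding fg by (simp add: fF gG bin_avg_add bin_avg_cmult algebra_simps)
  moreover have "\<bar>bin_avg n (\<lambda>i. F i * G i) - bin_avg n F * bin_avg n G\<bar>
      \<le> \<bar>bin_avg n (\<lambda>i. F i * G i)\<bar> + \<bar>bin_avg n F * bin_avg n G\<bar>"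
    by (rule abs_triangle_ineq4)
  moreover have "2 * \<bar>bin_avg n (\<lambda>i. F i * G i)\<bar>
      \<le> bin_avg n (\<lambda>i. (F i)\<^sup>2) / c + c * bin_avg n (\<lambda>i. (G i)\<^sup>2)"
  proof -
    have "2 * \<bar>bin_avg n (\<lambda>i. F i * G i)\<bar> \<le> bin_avg n (\<lambda>i. 2 * \<bar>F i * G i\<bar>)"
      using abs_bin_avg_le[of n "\<lambda>i. F i * G i"] by (simp only: bin_avg_cmult)
    also have "\<dots> \<le> bin_avg n (\<lambda>i. (F i)\<^sup>2 / c + c * (G i)\<^sup>2)"
      by (intro bin_avg_mono young)
    finally show ?thesis by (simp only: bin_avg_linear)
  qed
  moreover have "2 * \<bar>bin_avg n F * bin_avg n G\<bar>
      \<le> bin_avg n (\<lambda>i. (F i)\<^sup>2) / c + c * bin_avg n (\<lambda>i. (G i)\<^sup>2)"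
  proof -
    have "2 * \<bar>bin_avg n F * bin_avg n G\<bar> \<le> (bin_avg n F)\<^sup>2 / c + c * (bin_avg n G)\<^sup>2"
      by (rule young)
    also have "\<dots> \<le> bin_avg n (\<lambda>i. (F i)\<^sup>2) / c + c * bin_avg n (\<lambda>i. (G i)\<^sup>2)"
      using assms by (intro add_mono divide_right_mono mult_left_mono bin_avg_square_le) auto
    finally show ?thesis .
  qed
  ultimately have "2 * \<bar>bin_avg n (\<lambda>i. f i * g i) - bin_avg n f * bin_avg n g\<bar>
      \<le> 2 * (bin_avg n (\<lambda>i. (F i)\<^sup>2) / c + c * bin_avg n (\<lambda>i. (G i)\<^sup>2))"
    by simp
  then show ?thesis by (simp only: F_def G_def)
qed

text \<open>The centre has to be a natural number, because differences of means are defined only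
  there. Rounding costs at most 1, and the variance \<open>n * p * q\<close> is at most
  \<open>n\<close>.\<close>

lemma bin_avg_floor_variance:
  fixes n :: nat
  assumes "n \<ge> 1" and "j = nat \<lfloor>real n * p\<rfloor>"
  shows "bin_avg n (\<lambda>i. (real i - real j)\<^sup>2) \<le> 4 * real n"
proof -
  have j: "\<bar>real n * p - real j\<bar> \<le> 1"
  proof -
    have "real j = of_int \<lfloor>real n * p\<rfloor>" using p_pos assms(2) by simp
    then show ?thesis by linarith
  qed
  have "bin_avg n (\<lambda>i. (real i - real j)\<^sup>2) \<le> bin_avg n (\<lambda>i. 2 * (real i - real n * p)\<^sup>2 + 2)"
  proof (rule bin_avg_mono)
    fix i
    have *: "(real i - real j)\<^sup>2 + ((real i - real n * p) - (real n * p - real j))\<^sup>2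
        = 2 * (real i - real n * p)\<^sup>2 + 2 * (real n * p - real j)\<^sup>2"
      by (simp add: power2_eq_square algebra_simps)
    have "(real n * p - real j)\<^sup>2 \<le> 1" using j by (simp add: abs_square_le_1)
    with * zero_le_power2[of "(real i - real n * p) - (real n * p - real j)"]
    show "(real i - real j)\<^sup>2 \<le> 2 * (real i - real n * p)\<^sup>2 + 2" by linarith
  qed
  also have "\<dots> = 2 * (real n * p * q) + 2"
    by (simp only: bin_avg_add bin_avg_cmult bin_avg_variance bin_avg_const)
  also have "real n * p * q \<le> real n * 1 * 1"
    using p_pos q_pos p_less1 q_less1 by (intro mult_mono) auto
  finally show ?thesis using assms(1) by simp
qed

text \<open>Jensen's inequality for \<open>ln\<close>, proved with the tangent at the mean
  \<open>x = real n * p + 1\<close> of \<open>i + 1\<close>.\<close>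

lemma bin_avg_ln_le: "bin_avg n (\<lambda>i. ln (real i + 1)) \<le> ln (real n * p + 1)"
proof -
  define x where "x = real n * p + 1"
  have x: "x > 0" using p_pos by (auto simp: x_def intro!: add_nonneg_pos)
  have "bin_avg n (\<lambda>i. ln (real i + 1)) \<le> bin_avg n (\<lambda>i. ln x + (real i + 1 - x) / x)"
  proof (rule bin_avg_mono)
    fix i
    have "ln (real i + 1) - ln x = ln ((real i + 1) / x)" using x by (simp add: ln_div)
    also have "\<dots> \<le> (real i + 1) / x - 1" using x by (intro ln_le_minus_one) auto
    finally show "ln (real i + 1) \<le> ln x + (real i + 1 - x) / x" using x by (simp add: field_simps)
  qed
  also have "\<dots> = ln x"
    by (simp only: bin_avg_add bin_avg_divc bin_avg_diff bin_avg_const bin_avg_id) (simp add: x_def)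
  finally show ?thesis by (simp add: x_def)
qed

lemma pow_sum_less_1: "n \<ge> 2 \<Longrightarrow> p ^ n + q ^ n < 1"
proof -
  assume "n \<ge> 2"
  then have "p ^ n < p ^ 1" "q ^ n < q ^ 1"
    using p_pos q_pos p_less1 q_less1 by (intro power_strict_decreasing; simp)+
  then show ?thesis using pq_sum by simp
qed

end

section \<open>Smoothness of means and variances\<close>

text \<open>\<open>m\<close> and \<open>s\<close> are the first and second moments of the size. At
  \<open>n = 1\<close> the first recurrence reduces to \<open>m 1 = m 0 + m 1\<close> and leaves
  \<open>m 1\<close> free, so the initial values are separate assumptions.\<close>

locale trie_moments = bernoulli_split +
  fixes m s :: "nat \<Rightarrow> real"
  assumes m_rec: "\<And>n. m n = bin_avg n (\<lambda>i. m i + m (n - i)) + (if n \<ge> 2 then 1 else 0)"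
    and s_rec: "\<And>n. s n = bin_avg n (\<lambda>i. s i + s (n - i) + 2 * m i * m (n - i) + 2 * m i + 2 * m (n - i))
        + (if n \<ge> 2 then 1 else 0)"
    and m_0 [simp]: "m 0 = 0" and m_1 [simp]: "m (Suc 0) = 0"
    and s_0 [simp]: "s 0 = 0" and s_1 [simp]: "s (Suc 0) = 0"
begin

definition mu :: "nat \<Rightarrow> real" where "mu n = m (Suc n) - m n"
definition nu :: "nat \<Rightarrow> real" where "nu n = mu (Suc n) - mu n"

lemma mu_0 [simp]: "mu 0 = 0" by (simp add: mu_def)

lemma mu_rec: "mu n = bin_avg n (\<lambda>i. p * mu i + q * mu (n - i)) + (if n = 1 then 1 else 0)"
proof -
  have "m n = bin_avg n (\<lambda>i. 1 * m i + 1 * m (n - i)) + (if n \<ge> 2 then 1 else 0)" for n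
    by (simp only: mult_1 m_rec[symmetric])
  from bin_avg_difference[OF this, of n] show ?thesis by (auto simp: mu_def)
qed

lemma nu_rec: "nu n = bin_avg n (\<lambda>i. p\<^sup>2 * nu i + q\<^sup>2 * nu (n - i))
    + ((if n = 0 then 1 else 0) - (if n = 1 then 1 else 0))"
  using bin_avg_difference[OF mu_rec, of n] by (auto simp: nu_def power2_eq_square)

text \<open>\<open>C / (n + 1)\<close> is a supersolution for the weights \<open>p\<^sup>2\<close>,
  \<open>q\<^sup>2\<close>, with defect \<open>C * gap n\<close>. The toll lives at 0 and 1 only,
  where the defect is 4 and 1 for \<open>C = 2 / (p * q)\<close>; the value at 1 fixes this
  constant.\<close>

lemma nu_bound: "\<bar>nu n\<bar> \<le> 2 / (p * q) / real (Suc n)"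
proof -
  define C where "C = 2 / (p * q)"
  define gap where "gap n = (p * q ^ Suc n + q * p ^ Suc n) / real (Suc n)" for n
  have super: "C / real (Suc n) = bin_avg n (\<lambda>i. p\<^sup>2 * (C / real (Suc i)) + q\<^sup>2 * (C / real (Suc (n - i))))
      + C * gap n" for n
  proof -
    have "bin_avg n (\<lambda>i. p\<^sup>2 * (C / real (Suc i)) + q\<^sup>2 * (C / real (Suc (n - i))))
        = bin_avg n (\<lambda>i. p * C * (p / real (Suc i)) + q * C * (q / real (Suc (n - i))))"
      by (simp add: power2_eq_square algebra_simps)
    also have "\<dots> = p * C * ((1 - q ^ Suc n) / real (Suc n)) + q * C * ((1 - p ^ Suc n) / real (Suc n))"
      by (simp only: bin_avg_add bin_avg_cmult bin_avg_inverse_Suc bin_avg_inverse_Suc_reflect)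
    also have "\<dots> = C * ((p + q) / real (Suc n)) - C * gap n"
      by (simp add: gap_def field_simps)
    finally show ?thesis by (simp add: pq_sum)
  qed
  have gap_nonneg: "0 \<le> C * gap n" for n
    using p_pos q_pos by (simp add: gap_def C_def)
  have gap0: "C * gap 0 = 4"
    using p_pos q_pos by (simp add: C_def gap_def)
  have "p * q ^ 2 + q * p ^ 2 = p * q * (p + q)" by (simp add: power2_eq_square algebra_simps)
  then have gap1: "C * gap 1 = 1"
    using p_pos q_pos pq_sum
    by (simp add: C_def gap_def power2_eq_square) 
  have toll: "\<bar>(if n = 0 then 1 else 0) - (if n = 1 then 1 else 0)\<bar> \<le> C * gap n" for n :: nat
    using gap0 gap1 gap_nonneg[of n] by auto
  have contr: "p\<^sup>2 * p ^ n + q\<^sup>2 * q ^ n < 1" for n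
    using pow_sum_less_1[of "n + 2"] by (simp only: power_add mult.commute[of "p\<^sup>2"] mult.commute[of "q\<^sup>2"])
  have "nu n - C / real (Suc n) \<le> 0"
  proof (rule bin_avg_comparison[of "p\<^sup>2" "q\<^sup>2" 0 "\<lambda>n. nu n - C / real (Suc n)"])
    fix n
    show "nu n - C / real (Suc n)
        \<le> bin_avg n (\<lambda>i. p\<^sup>2 * (nu i - C / real (Suc i)) + q\<^sup>2 * (nu (n - i) - C / real (Suc (n - i))))"
      unfolding right_diff_distrib using nu_rec[of n] super[of n] toll[of n]
      by (simp only: bin_avg_linear)
  qed (use contr in auto)
  moreover have "- nu n - C / real (Suc n) \<le> 0"
  proof (rule bin_avg_comparison[of "p\<^sup>2" "q\<^sup>2" 0 "\<lambda>n. - nu n - C / real (Suc n)"])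
    fix n
    show "- nu n - C / real (Suc n)
        \<le> bin_avg n (\<lambda>i. p\<^sup>2 * (- nu i - C / real (Suc i)) + q\<^sup>2 * (- nu (n - i) - C / real (Suc (n - i))))"
      unfolding right_diff_distrib mult_minus_right using nu_rec[of n] super[of n] toll[of n]
      by (simp only: bin_avg_linear)
  qed (use contr in auto)
  ultimately show ?thesis by (simp add: C_def abs_le_iff)
qed

text \<open>The toll of \<open>mu_rec\<close> is nonnegative. The comparison starts at 1, since at 0
  the value enters its own average with the full weight \<open>p + q = 1\<close>.\<close>

lemma mu_nonneg: "0 \<le> mu n"
proof -
  have "- mu n \<le> 0"
  proof (rule bin_avg_comparison[of p q 1 "\<lambda>n. - mu n"])
    fix n :: nat
    show "- mu n \<le> bin_avg n (\<lambda>i. p * - mu i + q * - mu (n - i))"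
      unfolding mult_minus_right using mu_rec[of n] by (simp only: bin_avg_linear) auto
    show "p * p ^ n + q * q ^ n < 1" if "1 \<le> n"
      using pow_sum_less_1[of "Suc n"] that by simp
  qed (use p_pos q_pos in auto)
  then show ?thesis by simp
qed

text \<open>Constants have no defect because \<open>p + q = 1\<close>; subtracting
  \<open>1 / (n + 1)\<close> creates the defect
  \<open>(1 - p ^ Suc n - q ^ Suc n) / (n + 1)\<close>. At \<open>n = 1\<close> it equals
  \<open>p * q\<close> and has to pay for the toll 1, hence the factor
  \<open>1 / (p * q)\<close>.\<close>

lemma mu_le: "mu n \<le> 1 / (p * q)"
proof -
  define B :: "nat \<Rightarrow> real" where "B n = 1 - 1 / real (Suc n)" for n
  have super: "B n = bin_avg n (\<lambda>i. p * B i + q * B (n - i)) + (1 - p ^ Suc n - q ^ Suc n) / real (Suc n)" for n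
  proof -
    have "bin_avg n (\<lambda>i. p * B i + q * B (n - i))
        = bin_avg n (\<lambda>i. (p + q) - p / real (Suc i) - q / real (Suc (n - i)))"
      by (simp add: B_def algebra_simps)
    also have "\<dots> = 1 - (1 - q ^ Suc n) / real (Suc n) - (1 - p ^ Suc n) / real (Suc n)"
      by (simp only: bin_avg_diff bin_avg_const bin_avg_inverse_Suc bin_avg_inverse_Suc_reflect pq_sum)
    finally show ?thesis by (simp add: B_def diff_divide_distrib)
  qed
  have toll: "(if n = 1 then 1 else 0) \<le> 1 / (p * q) * ((1 - p ^ Suc n - q ^ Suc n) / real (Suc n))" for n :: nat
  proof (cases "n = 1")
    case True
    have "1 = (p + q)\<^sup>2" using pq_sum by simp
    then have "1 - p\<^sup>2 - q\<^sup>2 = 2 * (p * q)" unfolding power2_sum by simp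
    then show ?thesis using True p_pos q_pos by (simp add: power2_eq_square field_simps)
  next
    case False
    have "p ^ Suc n + q ^ Suc n \<le> 1"
      using pow_sum_less_1[of "Suc n"] pq_sum by (cases "n = 0") (auto simp: less_imp_le)
    then show ?thesis using False p_pos q_pos by (simp add: field_simps)
  qed
  have "mu n - 1 / (p * q) * B n \<le> 0"
  proof (rule bin_avg_comparison[of p q 1 "\<lambda>n. mu n - 1 / (p * q) * B n"])
    fix n :: nat
    have "bin_avg n (\<lambda>i. p * (mu i - 1 / (p * q) * B i) + q * (mu (n - i) - 1 / (p * q) * B (n - i)))
       = bin_avg n (\<lambda>i. (p * mu i + q * mu (n - i)) - 1 / (p * q) * (p * B i + q * B (n - i)))"
      by (simp add: algebra_simps)
    also have "\<dots> = bin_avg n (\<lambda>i. p * mu i + q * mu (n - i)) - 1 / (p * q) * bin_avg n (\<lambda>i. p * B i + q * B (n - i))"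
      by (simp only: bin_avg_linear)
    finally show "mu n - 1 / (p * q) * B n
        \<le> bin_avg n (\<lambda>i. p * (mu i - 1 / (p * q) * B i) + q * (mu (n - i) - 1 / (p * q) * B (n - i)))"
      using mu_rec[of n] toll[of n] super[of n] by (simp add: right_diff_distrib distrib_left)
    show "p * p ^ n + q * q ^ n < 1" if "1 \<le> n"
      using pow_sum_less_1[of "Suc n"] that by simp
  qed (use p_pos q_pos in \<open>auto simp: B_def\<close>)
  moreover have "1 / (p * q) * B n \<le> 1 / (p * q) * 1"
    using p_pos q_pos by (intro mult_left_mono) (auto simp: B_def)
  ultimately show ?thesis by linarith
qed


lemma mu_diff_forward:
  assumes "i \<le> k"
  shows "\<bar>mu k - mu i\<bar> \<le> 2 / (p * q) * (real k - real i) / real (Suc i)"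
  using assms
proof (induction k rule: dec_induct)
  case (step k)
  have "\<bar>mu (Suc k) - mu i\<bar> \<le> \<bar>mu k - mu i\<bar> + \<bar>nu k\<bar>"
    by (simp add: nu_def)
  also have "\<bar>nu k\<bar> \<le> 2 / (p * q) / real (Suc i)"
    using step p_pos q_pos by (intro order.trans[OF nu_bound] divide_left_mono) auto
  also note step.IH
  finally show ?case by (simp add: add_divide_distrib diff_divide_distrib algebra_simps)
qed simp

text \<open>The later estimates need the denominator \<open>j + 1\<close> whichever of
  \<open>i\<close> and \<open>j\<close> is larger. If \<open>i < j \<le> 2 * i\<close>, then
  \<open>i + 1\<close> is at least half of \<open>j + 1\<close>; if \<open>2 * i < j\<close>, the
  distance is of order \<open>j\<close> and the bound on \<open>mu\<close> itself suffices.\<close>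

lemma mu_diff_bound: "\<bar>mu i - mu j\<bar> \<le> 4 / (p * q) * \<bar>real i - real j\<bar> / real (Suc j)"
proof -
  have pq: "0 < 1 / (p * q)" using p_pos q_pos by simp
  define C where "C = 1 / (p * q)"
  have "\<bar>mu i - mu j\<bar> \<le> C * (4 * \<bar>real i - real j\<bar> / real (Suc j))"
  proof (cases "j \<le> i")
    case True
    have "\<bar>mu i - mu j\<bar> \<le> C * (2 * \<bar>real i - real j\<bar> / real (Suc j))"
      using mu_diff_forward[OF True] True by (simp add: C_def)
    also have "\<dots> \<le> C * (4 * \<bar>real i - real j\<bar> / real (Suc j))"
      using pq by (intro mult_left_mono divide_right_mono) (auto simp: C_def)
    finally show ?thesis .
  next
    case ij: False
    show ?thesis
    proof (cases "j \<le> 2 * i")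
      case True
      have "\<bar>mu i - mu j\<bar> \<le> C * (2 * \<bar>real i - real j\<bar> / real (Suc i))"
        using mu_diff_forward[of i j] ij by (simp add: C_def abs_minus_commute)
      also have "\<dots> \<le> C * (4 * \<bar>real i - real j\<bar> / real (Suc j))"
      proof (intro mult_left_mono)
        have "2 * \<bar>real i - real j\<bar> / real (Suc i) = 4 * \<bar>real i - real j\<bar> / (2 * real (Suc i))"
          by (simp add: field_simps)
        also have "\<dots> \<le> 4 * \<bar>real i - real j\<bar> / real (Suc j)"
          using True by (intro divide_left_mono) auto
        finally show "2 * \<bar>real i - real j\<bar> / real (Suc i) \<le> 4 * \<bar>real i - real j\<bar> / real (Suc j)" .
      qed (use pq in \<open>simp add: C_def\<close>)
      finally show ?thesis .
    next
      case False
      have "\<bar>mu i - mu j\<bar> \<le> C * 1"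
        using mu_nonneg[of i] mu_nonneg[of j] mu_le[of i] mu_le[of j] by (simp add: C_def)
      also have "\<dots> \<le> C * (4 * \<bar>real i - real j\<bar> / real (Suc j))"
        using False pq by (intro mult_left_mono) (auto simp: C_def field_simps)
      finally show ?thesis .
    qed
  qed
  then show ?thesis by (simp add: C_def)
qed

lemma m_diff_forward: "i \<le> k \<Longrightarrow> 0 \<le> m k - m i \<and> m k - m i \<le> 1 / (p * q) * (real k - real i)"
proof (induction k rule: dec_induct)
  case (step k)
  have "m (Suc k) = m k + mu k" by (simp add: mu_def)
  with step.IH mu_nonneg[of k] mu_le[of k] show ?case
    by (simp add: algebra_simps add_divide_distrib diff_divide_distrib)
qed simp

lemma m_nonneg: "0 \<le> m n" and m_le: "m n \<le> 1 / (p * q) * real n"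
  using m_diff_forward[of 0 n] by auto

section \<open>Variances and their increments\<close>

definition V :: "nat \<Rightarrow> real" where "V n = s n - (m n)\<^sup>2"

text \<open>The variance, over the random split, of the conditional mean size: the toll in the
  recurrence for \<open>V\<close>.\<close>

definition W :: "nat \<Rightarrow> real" where
  "W n = bin_avg n (\<lambda>i. (m i + m (n - i))\<^sup>2) - (bin_avg n (\<lambda>i. m i + m (n - i)))\<^sup>2"

lemma V_rec: "V n = bin_avg n (\<lambda>i. V i + V (n - i)) + W n"
proof -
  define A where "A = bin_avg n (\<lambda>i. m i + m (n - i))"
  \<comment> \<open>For \<open>n < 2\<close> the term \<open>2 * A\<close> in the second moment has
    no toll 1 to pair with, so it has to vanish by itself.\<close>
  have A0: "A = 0" if "n < 2"
  proof -
    have "m i + m (n - i) = 0" if "i \<le> n" for i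
      using that \<open>n < 2\<close> by (auto simp: less_2_cases_iff le_Suc_eq)
    then have "A = bin_avg n (\<lambda>i. 0)" unfolding A_def by (intro bin_avg_cong)
    then show ?thesis by simp
  qed
  have "s n = bin_avg n (\<lambda>i. (V i + V (n - i)) + (m i + m (n - i))\<^sup>2 + 2 * (m i + m (n - i)))
      + (if n \<ge> 2 then 1 else 0)"
    by (subst s_rec) (simp add: V_def power2_eq_square algebra_simps)
  also have "\<dots> = bin_avg n (\<lambda>i. V i + V (n - i)) + bin_avg n (\<lambda>i. (m i + m (n - i))\<^sup>2) + 2 * A
      + (if n \<ge> 2 then 1 else 0)"
    unfolding A_def by (simp only: bin_avg_add[of n _ "\<lambda>i. 2 * (m i + m (n - i))"] bin_avg_cmult
        bin_avg_add[of n "\<lambda>i. V i + V (n - i)" "\<lambda>i. (m i + m (n - i))\<^sup>2"])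
  finally have s: "s n = bin_avg n (\<lambda>i. V i + V (n - i)) + bin_avg n (\<lambda>i. (m i + m (n - i))\<^sup>2) + 2 * A
      + (if n \<ge> 2 then 1 else 0)" .
  have m: "m n = A + (if n \<ge> 2 then 1 else 0)"
    unfolding A_def by (rule m_rec)
  have "V n = s n - (m n)\<^sup>2" by (simp add: V_def)
  then show ?thesis unfolding W_def A_def[symmetric] s m
    using A0 by (cases "n \<ge> 2") (simp_all add: power2_eq_square distrib_left distrib_right)
qed

lemma V_0 [simp]: "V 0 = 0" and V_1 [simp]: "V (Suc 0) = 0"
  by (simp_all add: V_def)

text \<open>One more trial adds \<open>mu i\<close> or \<open>mu (n - i)\<close> to the conditional
  mean \<open>m i + m (n - i)\<close>. The first bracket is the covariance of this mean with the
  expected increment, the second the variance of the increment.\<close>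

lemma W_diff:
  "W (Suc n) - W n =
     2 * (bin_avg n (\<lambda>i. (m i + m (n - i)) * (p * mu i + q * mu (n - i)))
          - bin_avg n (\<lambda>i. m i + m (n - i)) * bin_avg n (\<lambda>i. p * mu i + q * mu (n - i)))
     + (bin_avg n (\<lambda>i. p * (mu i)\<^sup>2 + q * (mu (n - i))\<^sup>2)
        - (bin_avg n (\<lambda>i. p * mu i + q * mu (n - i)))\<^sup>2)"
proof -
  define h where "h i = m i + m (n - i)" for i
  define e where "e i = p * mu i + q * mu (n - i)" for i
  have split: "bin_avg (Suc n) (\<lambda>i. f (m i + m (Suc n - i)))
      = bin_avg n (\<lambda>i. p * f (h i + mu i) + q * f (h i + mu (n - i)))" for f
  proof -
    have "bin_avg (Suc n) (\<lambda>i. f (m i + m (Suc n - i)))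
        = p * bin_avg n (\<lambda>i. f (h i + mu i)) + q * bin_avg n (\<lambda>i. f (m i + m (Suc n - i)))"
      by (simp add: bin_avg_Suc h_def mu_def algebra_simps)
    also have "bin_avg n (\<lambda>i. f (m i + m (Suc n - i))) = bin_avg n (\<lambda>i. f (h i + mu (n - i)))"
      by (intro bin_avg_cong) (simp add: h_def mu_def Suc_diff_le)
    finally show ?thesis by (simp only: bin_avg_linear)
  qed
  have "bin_avg (Suc n) (\<lambda>i. m i + m (Suc n - i)) = bin_avg n (\<lambda>i. (p + q) * h i + e i)"
    by (subst split[of "\<lambda>x. x"]) (simp add: e_def algebra_simps)
  then have 1: "bin_avg (Suc n) (\<lambda>i. m i + m (Suc n - i)) = bin_avg n h + bin_avg n e"
    by (simp add: pq_sum bin_avg_add)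
  have "bin_avg (Suc n) (\<lambda>i. (m i + m (Suc n - i))\<^sup>2)
      = bin_avg n (\<lambda>i. (p + q) * (h i)\<^sup>2 + 2 * (h i * e i) + (p * (mu i)\<^sup>2 + q * (mu (n - i))\<^sup>2))"
    by (subst split[of "\<lambda>x. x\<^sup>2"]) (simp add: e_def power2_eq_square algebra_simps)
  then have 2: "bin_avg (Suc n) (\<lambda>i. (m i + m (Suc n - i))\<^sup>2)
      = bin_avg n (\<lambda>i. (h i)\<^sup>2) + 2 * bin_avg n (\<lambda>i. h i * e i)
        + bin_avg n (\<lambda>i. p * (mu i)\<^sup>2 + q * (mu (n - i))\<^sup>2)"
    by (simp add: pq_sum bin_avg_add bin_avg_cmult)
  show ?thesis
    unfolding W_def 1 2 h_def[symmetric] e_def[symmetric] by (simp add: power2_eq_square algebra_simps)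
qed

text \<open>In the notation of the proof, \<open>h\<close> is Lipschitz with constant
  \<open>c\<close>, so it fluctuates by order \<open>sqrt n\<close>; \<open>e\<close> is Lipschitz
  with a constant of order \<open>1 / n\<close>, so it fluctuates by order
  \<open>1 / sqrt n\<close>. Their covariance is therefore bounded.\<close>

lemma W_diff_bounded: "\<exists>C>0. \<forall>n\<ge>1. \<bar>W (Suc n) - W n\<bar> \<le> C"
proof -
  define c where "c = 1 / (p * q)"
  have c: "c > 0" using p_pos q_pos by (simp add: c_def)
  have "\<bar>W (Suc n) - W n\<bar> \<le> 2 * (4 * c\<^sup>2 + 256 * c\<^sup>2) + c\<^sup>2" if n: "n \<ge> 1" for n
  proof -
    \<comment> \<open>Rounding the mean down makes both \<open>j + 1 \<ge> n * p\<close> and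
      \<open>n - j + 1 \<ge> n * q\<close>. The weights \<open>p\<close> and \<open>q\<close> in
      \<open>e\<close> then cancel against the denominators of \<open>mu_diff_bound\<close>.\<close>
    define j where "j = nat \<lfloor>real n * p\<rfloor>"
    define h where "h i = m i + m (n - i)" for i
    define e where "e i = p * mu i + q * mu (n - i)" for i
    have "real j = of_int \<lfloor>real n * p\<rfloor>" using p_pos by (simp add: j_def)
    then have j_le: "real j \<le> real n * p" and j_ge: "real n * p \<le> real (Suc j)"
      by linarith+
    have jn: "j \<le> n"
      using j_le p_less1 n by (metis mult.right_neutral mult_left_mono of_nat_0_le_iff of_nat_le_iff order.trans less_imp_le)
    have nj_ge: "real n * q \<le> real (Suc (n - j))"
      using j_le jn by (simp add: q_eq of_nat_diff algebra_simps)
    have h: "(h i - h j)\<^sup>2 \<le> c\<^sup>2 * (real i - real j)\<^sup>2" if i: "i \<le> n" for i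
    proof -
      have "\<bar>h i - h j\<bar> \<le> c * \<bar>real i - real j\<bar>"
      proof (cases "i \<le> j")
        case True
        then show ?thesis
          using m_diff_forward[of i j] m_diff_forward[of "n - j" "n - i", OF diff_le_mono2] i jn
          by (auto simp: h_def c_def of_nat_diff)
      next
        case False
        then show ?thesis
          using m_diff_forward[of j i] m_diff_forward[of "n - i" "n - j", OF diff_le_mono2] i jn
          by (auto simp: h_def c_def of_nat_diff)
      qed
      then have "\<bar>h i - h j\<bar>\<^sup>2 \<le> (c * \<bar>real i - real j\<bar>)\<^sup>2" by (intro power_mono) auto
      then show ?thesis by (simp add: power_mult_distrib)
    qed
    have e: "(e i - e j)\<^sup>2 \<le> (8 * c / real n)\<^sup>2 * (real i - real j)\<^sup>2" if i: "i \<le> n" for i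
    proof -
      have "p * \<bar>mu i - mu j\<bar> \<le> 4 * c * \<bar>real i - real j\<bar> / real n"
      proof -
        have "p * \<bar>mu i - mu j\<bar> \<le> p * (4 / (p * q) * \<bar>real i - real j\<bar> / real (Suc j))"
          using p_pos by (intro mult_left_mono mu_diff_bound) auto
        also have "\<dots> = 4 * c * \<bar>real i - real j\<bar> * (p / real (Suc j))" by (simp add: c_def)
        also have "\<dots> \<le> 4 * c * \<bar>real i - real j\<bar> * (1 / real n)"
          using j_ge n c by (intro mult_left_mono) (auto simp: field_simps)
        finally show ?thesis by simp
      qed
      moreover have "q * \<bar>mu (n - i) - mu (n - j)\<bar> \<le> 4 * c * \<bar>real i - real j\<bar> / real n"
      proof -
        have "q * \<bar>mu (n - i) - mu (n - j)\<bar>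
            \<le> q * (4 / (p * q) * \<bar>real (n - i) - real (n - j)\<bar> / real (Suc (n - j)))"
          using q_pos by (intro mult_left_mono mu_diff_bound) auto
        also have "\<dots> = 4 * c * \<bar>real i - real j\<bar> * (q / real (Suc (n - j)))"
          using i jn by (simp add: c_def of_nat_diff abs_minus_commute)
        also have "\<dots> \<le> 4 * c * \<bar>real i - real j\<bar> * (1 / real n)"
          using nj_ge n c by (intro mult_left_mono) (auto simp: field_simps)
        finally show ?thesis by simp
      qed
      moreover have "\<bar>e i - e j\<bar> \<le> p * \<bar>mu i - mu j\<bar> + q * \<bar>mu (n - i) - mu (n - j)\<bar>"
      proof -
        have "e i - e j = p * (mu i - mu j) + q * (mu (n - i) - mu (n - j))"
          by (simp add: e_def algebra_simps)
        also have "\<bar>\<dots>\<bar> \<le> \<bar>p * (mu i - mu j)\<bar> + \<bar>q * (mu (n - i) - mu (n - j))\<bar>"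
          by (rule abs_triangle_ineq)
        finally show ?thesis using p_pos q_pos by (simp add: abs_mult)
      qed
      moreover have "8 * c / real n * \<bar>real i - real j\<bar>
          = 4 * c * \<bar>real i - real j\<bar> / real n + 4 * c * \<bar>real i - real j\<bar> / real n"
        by (simp add: add_divide_distrib[symmetric])
      ultimately have "\<bar>e i - e j\<bar> \<le> 8 * c / real n * \<bar>real i - real j\<bar>" by linarith
      then have "\<bar>e i - e j\<bar>\<^sup>2 \<le> (8 * c / real n * \<bar>real i - real j\<bar>)\<^sup>2" by (intro power_mono) auto
      then show ?thesis by (simp only: power_mult_distrib power2_abs)
    qed
    have bv: "bin_avg n (\<lambda>i. (real i - real j)\<^sup>2) \<le> 4 * real n"
      using bin_avg_floor_variance[OF n j_def] .
    have "bin_avg n (\<lambda>i. (h i - h j)\<^sup>2) \<le> c\<^sup>2 * bin_avg n (\<lambda>i. (real i - real j)\<^sup>2)"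
      unfolding bin_avg_cmult[symmetric] by (intro bin_avg_mono h)
    also have "\<dots> \<le> c\<^sup>2 * (4 * real n)" using bv by (intro mult_left_mono) auto
    finally have h': "bin_avg n (\<lambda>i. (h i - h j)\<^sup>2) / real n \<le> 4 * c\<^sup>2"
      using n by (simp add: field_simps)
    have "bin_avg n (\<lambda>i. (e i - e j)\<^sup>2) \<le> (8 * c / real n)\<^sup>2 * bin_avg n (\<lambda>i. (real i - real j)\<^sup>2)"
      unfolding bin_avg_cmult[symmetric] by (intro bin_avg_mono e)
    also have "\<dots> \<le> (8 * c / real n)\<^sup>2 * (4 * real n)" using bv by (intro mult_left_mono) auto
    also have "\<dots> = 256 * c\<^sup>2 / real n" using n by (simp add: power2_eq_square)
    finally have e': "real n * bin_avg n (\<lambda>i. (e i - e j)\<^sup>2) \<le> 256 * c\<^sup>2"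
      using n by (simp add: field_simps)
    \<comment> \<open>The weight \<open>real n\<close> balances the two variances, of order
      \<open>n\<close> for \<open>h\<close> and \<open>1 / n\<close> for \<open>e\<close>.\<close>
    have cov: "2 * \<bar>bin_avg n (\<lambda>i. h i * e i) - bin_avg n h * bin_avg n e\<bar> \<le> 2 * (4 * c\<^sup>2 + 256 * c\<^sup>2)"
      using bin_avg_covariance_bound[of "real n" n h e "h j" "e j"] n h' e' by simp
    have mu2: "(mu i)\<^sup>2 \<le> c\<^sup>2" for i
      using mu_nonneg[of i] mu_le[of i] by (intro power_mono) (auto simp: c_def)
    have "bin_avg n (\<lambda>i. p * (mu i)\<^sup>2 + q * (mu (n - i))\<^sup>2) \<le> bin_avg n (\<lambda>i. p * c\<^sup>2 + q * c\<^sup>2)"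
      using mu2 p_pos q_pos by (intro bin_avg_mono add_mono mult_left_mono) auto
    then have 1: "bin_avg n (\<lambda>i. p * (mu i)\<^sup>2 + q * (mu (n - i))\<^sup>2) \<le> c\<^sup>2"
      by (simp add: distrib_right[symmetric] pq_sum)
    have 2: "0 \<le> bin_avg n (\<lambda>i. p * (mu i)\<^sup>2 + q * (mu (n - i))\<^sup>2)"
      using p_pos q_pos by (intro bin_avg_nonneg) auto
    have e_ab: "0 \<le> e i" "e i \<le> c" for i
    proof -
      show "0 \<le> e i" using mu_nonneg p_pos q_pos by (simp add: e_def)
      have "e i \<le> p * c + q * c" unfolding e_def c_def
        using p_pos q_pos by (intro add_mono mult_left_mono mu_le) auto
      then show "e i \<le> c" by (simp add: distrib_right[symmetric] pq_sum)
    qed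
    have "0 \<le> bin_avg n e" "bin_avg n e \<le> bin_avg n (\<lambda>_. c)"
      using e_ab by (intro bin_avg_nonneg bin_avg_mono; simp)+
    then have 3: "(bin_avg n e)\<^sup>2 \<le> c\<^sup>2" "0 \<le> (bin_avg n e)\<^sup>2"
      by (auto intro!: power_mono)
    have "\<bar>2 * x + (y - z)\<bar> \<le> A + B" if "2 * \<bar>x\<bar> \<le> A" "0 \<le> y" "y \<le> B" "0 \<le> z" "z \<le> B"
      for x y z A B :: real
      using that by linarith
    from this[OF cov 2 1 3(2) 3(1)] show ?thesis
      unfolding W_diff[of n] h_def[symmetric] e_def[symmetric] .
  qed
  moreover have "2 * (4 * c\<^sup>2 + 256 * c\<^sup>2) + c\<^sup>2 > 0" using c by simp
  ultimately show ?thesis by blast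
qed

text \<open>A logarithm absorbs a bounded toll when the weights are \<open>p\<close> and
  \<open>q\<close>: by Jensen the average of \<open>ln (i + 1)\<close> falls short of
  \<open>ln (n + 1)\<close> by a fixed \<open>\<kappa>\<close>, and the factor
  \<open>K = C / \<kappa>\<close> turns this gain into \<open>C\<close>.\<close>

lemma V_diff_bound: "\<exists>K>0. \<forall>n. \<bar>V (Suc n) - V n\<bar> \<le> K * ln (real n + 1)"
proof -
  interpret swap: bernoulli_split q p by (rule bernoulli_split_swap)
  obtain C where C: "C > 0" "\<And>n. n \<ge> 1 \<Longrightarrow> \<bar>W (Suc n) - W n\<bar> \<le> C"
    using W_diff_bounded by blast
  \<comment> \<open>From \<open>(n * x + 1) / (n + 1) \<le> (1 + x) / 2\<close> for
    \<open>n \<ge> 1\<close>, with equality at \<open>n = 1\<close>.\<close>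
  define \<kappa> where "\<kappa> = min (- ln ((1 + p) / 2)) (- ln ((1 + q) / 2))"
  have \<kappa>: "\<kappa> > 0" using p_pos q_pos p_less1 q_less1 by (auto simp: \<kappa>_def ln_div)
  define K where "K = C / \<kappa>"
  have K: "K > 0" using C \<kappa> by (simp add: K_def)
  have ratio: "ln (real n * x + 1) \<le> ln (real n + 1) + ln ((1 + x) / 2)"
    if "n \<ge> 1" "0 < x" "x < 1" for n x
  proof -
    have "0 \<le> (real n - 1) * (1 - x)" using that by simp
    then have "real n * x + 1 \<le> (real n + 1) * ((1 + x) / 2)" by (simp add: algebra_simps)
    then have "ln (real n * x + 1) \<le> ln ((real n + 1) * ((1 + x) / 2))"
      using that by (intro ln_mono) (auto intro: add_nonneg_pos)
    also have "\<dots> = ln (real n + 1) + ln ((1 + x) / 2)" using that by (intro ln_mult_pos) auto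
    finally show ?thesis .
  qed
  have super: "bin_avg n (\<lambda>i. p * (K * ln (real i + 1)) + q * (K * ln (real (n - i) + 1))) + C
      \<le> K * ln (real n + 1)" if n: "n \<ge> 1" for n
  proof -
    have "bin_avg n (\<lambda>i. ln (real (n - i) + 1)) = swap.bin_avg n (\<lambda>i. ln (real i + 1))"
      using bin_avg_reflect[of n "\<lambda>i. ln (real i + 1)"] by (simp add: swap.bin_avg_def)
    also have "\<dots> \<le> ln (real n * q + 1)" by (rule swap.bin_avg_ln_le)
    also have "\<dots> \<le> ln (real n + 1) + ln ((1 + q) / 2)" using n q_pos q_less1 by (intro ratio)
    also have "\<dots> \<le> ln (real n + 1) - \<kappa>" by (simp add: \<kappa>_def)
    finally have 2: "bin_avg n (\<lambda>i. ln (real (n - i) + 1)) \<le> ln (real n + 1) - \<kappa>" .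
    have "bin_avg n (\<lambda>i. ln (real i + 1)) \<le> ln (real n * p + 1)" by (rule bin_avg_ln_le)
    also have "\<dots> \<le> ln (real n + 1) + ln ((1 + p) / 2)" using n p_pos p_less1 by (intro ratio)
    also have "\<dots> \<le> ln (real n + 1) - \<kappa>" by (simp add: \<kappa>_def)
    finally have 1: "bin_avg n (\<lambda>i. ln (real i + 1)) \<le> ln (real n + 1) - \<kappa>" .
    have "bin_avg n (\<lambda>i. p * (K * ln (real i + 1)) + q * (K * ln (real (n - i) + 1)))
        = K * (p * bin_avg n (\<lambda>i. ln (real i + 1)) + q * bin_avg n (\<lambda>i. ln (real (n - i) + 1)))"
      by (simp only: bin_avg_add bin_avg_cmult) (simp only: algebra_simps)
    also have "\<dots> \<le> K * (p * (ln (real n + 1) - \<kappa>) + q * (ln (real n + 1) - \<kappa>))"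
      using 1 2 K p_pos q_pos by (intro mult_left_mono add_mono) auto
    also have "\<dots> = K * (ln (real n + 1) - \<kappa>)"
      by (simp only: distrib_right[symmetric] pq_sum mult_1)
    also have "\<dots> = K * ln (real n + 1) - C"
      using \<kappa> by (simp add: K_def right_diff_distrib)
    finally show ?thesis by simp
  qed
  define \<delta> where "\<delta> n = V (Suc n) - V n" for n
  have \<delta>_rec: "\<delta> n = bin_avg n (\<lambda>i. p * \<delta> i + q * \<delta> (n - i)) + (W (Suc n) - W n)" for n
  proof -
    have "V n = bin_avg n (\<lambda>i. 1 * V i + 1 * V (n - i)) + W n" for n
      by (simp only: mult_1 V_rec[symmetric])
    from bin_avg_difference[OF this, of n] show ?thesis by (simp add: \<delta>_def)
  qed
  have contr: "p * p ^ n + q * q ^ n < 1" if "1 \<le> n" for n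
    using pow_sum_less_1[of "Suc n"] that by simp
  \<comment> \<open>The sign \<open>\<epsilon>\<close> yields the upper and the lower bound by one
    comparison.\<close>
  have bound: "\<epsilon> * \<delta> n - K * ln (real n + 1) \<le> 0" if \<epsilon>: "\<bar>\<epsilon>\<bar> = 1" for n \<epsilon>
  proof (rule bin_avg_comparison[of p q 1 "\<lambda>n. \<epsilon> * \<delta> n - K * ln (real n + 1)"])
    fix n :: nat assume n: "1 \<le> n"
    have "\<epsilon> * (W (Suc n) - W n) \<le> \<bar>\<epsilon> * (W (Suc n) - W n)\<bar>" by simp
    also have "\<dots> \<le> C" using \<epsilon> C(2)[OF n] by (simp add: abs_mult)
    finally have 1: "\<epsilon> * (W (Suc n) - W n) \<le> C" .
    have "bin_avg n (\<lambda>i. p * (\<epsilon> * \<delta> i - K * ln (real i + 1)) + q * (\<epsilon> * \<delta> (n - i) - K * ln (real (n - i) + 1)))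
      = bin_avg n (\<lambda>i. \<epsilon> * (p * \<delta> i + q * \<delta> (n - i))
          - (p * (K * ln (real i + 1)) + q * (K * ln (real (n - i) + 1))))"
      by (simp add: algebra_simps)
    also have "\<dots> = \<epsilon> * bin_avg n (\<lambda>i. p * \<delta> i + q * \<delta> (n - i))
       - bin_avg n (\<lambda>i. p * (K * ln (real i + 1)) + q * (K * ln (real (n - i) + 1)))"
      by (simp only: bin_avg_diff bin_avg_cmult)
    finally show "\<epsilon> * \<delta> n - K * ln (real n + 1)
      \<le> bin_avg n (\<lambda>i. p * (\<epsilon> * \<delta> i - K * ln (real i + 1)) + q * (\<epsilon> * \<delta> (n - i) - K * ln (real (n - i) + 1)))"
      using super[OF n] 1 by (subst \<delta>_rec) (simp add: distrib_left)
  qed (use p_pos q_pos contr in \<open>auto simp: \<delta>_def\<close>)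
  have "\<bar>V (Suc n) - V n\<bar> \<le> K * ln (real n + 1)" for n
    using bound[of 1 n] bound[of "-1" n] by (auto simp: \<delta>_def)
  with K show ?thesis by blast
qed

end

section \<open>Moments of the size laws\<close>

text \<open>Nonnegative integrals keep the identity valid before any moment is known to be
  finite.\<close>

lemma trie_laws_nn_integral:
  fixes f :: "nat \<Rightarrow> ennreal"
  assumes "trie_size_laws p X" "0 < p" "p < 1" "n \<ge> 2"
  shows "(\<integral>\<^sup>+x. f x \<partial>X n) = (\<Sum>i\<le>n. ennreal (real (n choose i) * p ^ i * (1 - p) ^ (n - i)) *
      (\<integral>\<^sup>+x. \<integral>\<^sup>+y. f (x + y + 1) \<partial>X (n - i) \<partial>X i))"
proof -
  have "X n = bind_pmf (binomial_pmf n p)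
          (\<lambda>i. map_pmf (\<lambda>(x, y). x + y + 1) (pair_pmf (X i) (X (n - i))))"
    using assms by (auto simp: trie_size_laws_def)
  then have "(\<integral>\<^sup>+x. f x \<partial>X n) = (\<integral>\<^sup>+x. f x \<partial>bind_pmf (binomial_pmf n p)
          (\<lambda>i. map_pmf (\<lambda>(x, y). x + y + 1) (pair_pmf (X i) (X (n - i)))))"
    by (rule arg_cong)
  also have "\<dots> = (\<integral>\<^sup>+i. (\<integral>\<^sup>+x. \<integral>\<^sup>+y. f (x + y + 1) \<partial>X (n - i) \<partial>X i) \<partial>binomial_pmf n p)"
    by (simp add: nn_integral_pair_pmf')
  also have "\<dots> = (\<Sum>i\<le>n. ennreal (real (n choose i) * p ^ i * (1 - p) ^ (n - i)) *
      (\<integral>\<^sup>+x. \<integral>\<^sup>+y. f (x + y + 1) \<partial>X (n - i) \<partial>X i))"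
    using assms by (subst nn_integral_measure_pmf_finite) (auto simp: mult.commute)
  finally show ?thesis .
qed

text \<open>The inequality can be solved for \<open>u\<close> only if \<open>u\<close> is finite,
  which is why it is applied to truncated moments.\<close>

lemma ennreal_fixpoint_bound:
  fixes u b :: ennreal and \<rho> :: real
  assumes "u \<le> ennreal \<rho> * u + b" "u < \<infinity>" "b < \<infinity>" "0 \<le> \<rho>" "\<rho> < 1"
  shows "u \<le> b / ennreal (1 - \<rho>)"
proof -
  obtain u' where u: "u = ennreal u'" "0 \<le> u'" using assms(2) by (cases u) auto
  obtain b' where b: "b = ennreal b'" "0 \<le> b'" using assms(3) by (cases b) auto
  have "ennreal u' \<le> ennreal (\<rho> * u' + b')"
    using assms(1,4) u b by (simp add: ennreal_mult)
  then have "u' \<le> \<rho> * u' + b'"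
    using assms(4) u b by (subst (asm) ennreal_le_iff) auto
  then have "u' \<le> b' / (1 - \<rho>)" using assms(5) by (simp add: field_simps)
  then show ?thesis using u b assms(5) by (simp add: divide_ennreal ennreal_leI)
qed

text \<open>As the equation for \<open>X n\<close> is implicit, finiteness of the moments does not follow by induction
  alone: the truncated second moment is bounded, uniformly in the truncation, by solving the
  inequality that it satisfies.\<close>

lemma trie_laws_second_moment_finite:
  assumes X: "trie_size_laws p X" and p: "0 < p" "p < 1"
  shows "(\<integral>\<^sup>+x. ennreal ((real x)\<^sup>2) \<partial>X n) < \<infinity>"
proof (induction n rule: less_induct)
  case (less n)
  have X0: "X 0 = return_pmf 0" "X 1 = return_pmf 0" using X by (auto simp: trie_size_laws_def)
  show ?case
  proof (cases "n \<ge> 2")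
    case False
    then show ?thesis using X0 by (auto simp: less_2_cases_iff not_le)
  next
    case n: True
    interpret bernoulli_split p "1 - p" using p by unfold_locales auto
    define w where "w i = real (n choose i) * p ^ i * (1 - p) ^ (n - i)" for i
    define \<sigma> where "\<sigma> = p ^ n + (1 - p) ^ n"
    have \<sigma>: "0 < \<sigma>" "\<sigma> < 1"
      using pow_sum_less_1[OF n] p by (auto simp: \<sigma>_def intro!: add_pos_pos)
    \<comment> \<open>With probability \<open>\<sigma>\<close> one side receives everything, and
      then the size is 1 plus a copy of \<open>X n\<close>. Squaring costs a factor
      \<open>1 + \<eta>\<close>, chosen so close to 1 that
      \<open>\<rho> = \<sigma> * (1 + \<eta>)\<close> stays below 1.\<close>
    define \<eta> where "\<eta> = (1 - \<sigma>) / 2"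
    have \<eta>: "0 < \<eta>" using \<sigma> by (simp add: \<eta>_def)
    define \<rho> where "\<rho> = \<sigma> * (1 + \<eta>)"
    have \<rho>: "0 \<le> \<rho>" "\<rho> < 1"
    proof -
      show "0 \<le> \<rho>" using \<sigma> \<eta> by (simp add: \<rho>_def)
      have "\<sigma> * (1 + \<eta>) = 1 - (1 - \<sigma>) * (2 - \<sigma>) / 2"
        by (simp add: \<eta>_def field_simps)
      then show "\<rho> < 1" using \<sigma> by (simp add: \<rho>_def)
    qed
    define c where "c = 1 + 1 / \<eta>"
    have c: "0 \<le> c" using \<eta> by (simp add: c_def)
    have young: "(a + 1)\<^sup>2 \<le> (1 + \<eta>) * a\<^sup>2 + c" for a :: real
    proof -
      have "0 \<le> (\<eta> * a - 1)\<^sup>2 / \<eta>" using \<eta> by simp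
      also have "\<dots> = (1 + \<eta>) * a\<^sup>2 + c - (a + 1)\<^sup>2"
        using \<eta> by (simp add: c_def power2_eq_square field_simps)
      finally show ?thesis by simp
    qed
    define f where "f K x = ennreal ((min (real x) (real K))\<^sup>2)" for K x :: nat
    define u where "u K = (\<integral>\<^sup>+x. f K x \<partial>X n)" for K
    define Y where "Y i = (\<integral>\<^sup>+x. \<integral>\<^sup>+y. ennreal ((real (x + y + 1))\<^sup>2) \<partial>X (n - i) \<partial>X i)" for i
    define b where "b = ennreal (\<sigma> * c) + (\<Sum>i\<in>{0<..<n}. ennreal (w i) * Y i)"
    have Y: "Y i < \<infinity>" if i: "i \<in> {0<..<n}" for i
    proof -
      have "Y i \<le> (\<integral>\<^sup>+x. \<integral>\<^sup>+y. (ennreal (3 * (real x)\<^sup>2) + ennreal (3 * (real y)\<^sup>2) + 3) \<partial>X (n - i) \<partial>X i)"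
        unfolding Y_def
      proof (intro nn_integral_mono)
        fix x y :: nat
        have "3 * (real x)\<^sup>2 + 3 * (real y)\<^sup>2 + 3 - (real (x + y + 1))\<^sup>2
            = (real x - real y)\<^sup>2 + (real x - 1)\<^sup>2 + (real y - 1)\<^sup>2"
          by (simp add: power2_eq_square algebra_simps)
        also have "\<dots> \<ge> 0" by simp
        finally have "ennreal ((real (x + y + 1))\<^sup>2) \<le> ennreal (3 * (real x)\<^sup>2 + 3 * (real y)\<^sup>2 + 3)"
          by (intro ennreal_leI) simp
        also have "\<dots> = ennreal (3 * (real x)\<^sup>2) + ennreal (3 * (real y)\<^sup>2) + 3"
          by (simp add: ennreal_plus[symmetric] del: ennreal_plus flip: ennreal_numeral)
        finally show "ennreal ((real (x + y + 1))\<^sup>2) \<le> ennreal (3 * (real x)\<^sup>2) + ennreal (3 * (real y)\<^sup>2) + 3" .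
      qed
      also have "\<dots> = 3 * (\<integral>\<^sup>+x. ennreal ((real x)\<^sup>2) \<partial>X i) + 3 * (\<integral>\<^sup>+y. ennreal ((real y)\<^sup>2) \<partial>X (n - i)) + 3"
        by (simp add: nn_integral_add nn_integral_cmult ennreal_mult measure_pmf.emeasure_space_1 flip: ennreal_numeral)
      also have "\<dots> < \<infinity>"
        using less.IH[of i] less.IH[of "n - i"] i by (simp add: ennreal_mult_less_top)
      finally show ?thesis .
    qed
    have "u K \<le> b / ennreal (1 - \<rho>)" for K
    proof (rule ennreal_fixpoint_bound)
      have "u K \<le> (\<integral>\<^sup>+x. ennreal ((real K)\<^sup>2) \<partial>X n)"
        unfolding u_def f_def by (intro nn_integral_mono ennreal_leI power_mono) auto
      then show "u K < \<infinity>" by (simp add: measure_pmf.emeasure_space_1 le_less_trans)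
      show "b < \<infinity>" using Y by (simp add: b_def ennreal_mult_less_top)
      have edge: "(\<integral>\<^sup>+x. f K (x + 1) \<partial>X n) \<le> ennreal (1 + \<eta>) * u K + ennreal c"
      proof -
        have "(\<integral>\<^sup>+x. f K (x + 1) \<partial>X n) \<le> (\<integral>\<^sup>+x. ennreal (1 + \<eta>) * f K x + ennreal c \<partial>X n)"
        proof (rule nn_integral_mono)
          fix x
          have "(min (real (x + 1)) (real K))\<^sup>2 \<le> (min (real x) (real K) + 1)\<^sup>2"
            by (intro power_mono) auto
          also note young
          finally have "f K (x + 1) \<le> ennreal ((1 + \<eta>) * (min (real x) (real K))\<^sup>2 + c)"
            unfolding f_def by (intro ennreal_leI)
          then show "f K (x + 1) \<le> ennreal (1 + \<eta>) * f K x + ennreal c"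
            using \<eta> c by (simp add: f_def ennreal_mult)
        qed
        also have "\<dots> = ennreal (1 + \<eta>) * u K + ennreal c"
          by (simp add: u_def nn_integral_add nn_integral_cmult measure_pmf.emeasure_space_1)
        finally show ?thesis .
      qed
      define E where "E i = (\<integral>\<^sup>+x. \<integral>\<^sup>+y. f K (x + y + 1) \<partial>X (n - i) \<partial>X i)" for i
      have E_mid: "E i \<le> Y i" for i
        unfolding E_def Y_def f_def by (intro nn_integral_mono ennreal_leI power_mono) auto
      have E0: "E 0 = (\<integral>\<^sup>+x. f K (x + 1) \<partial>X n)" and En: "E n = (\<integral>\<^sup>+x. f K (x + 1) \<partial>X n)"
        using X0 by (simp_all add: E_def)
      have split: "{..n} = insert 0 (insert n {0<..<n})" using n by auto
      have "u K = (\<Sum>i\<le>n. ennreal (w i) * E i)"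
        unfolding u_def E_def w_def by (rule trie_laws_nn_integral[OF X p n])
      also have "\<dots> = ennreal ((1 - p) ^ n) * E 0 + ennreal (p ^ n) * E n + (\<Sum>i\<in>{0<..<n}. ennreal (w i) * E i)"
        unfolding split using n by (simp add: w_def add.assoc)
      also have "ennreal ((1 - p) ^ n) * E 0 + ennreal (p ^ n) * E n = ennreal \<sigma> * E 0"
        using p by (simp add: E0 En \<sigma>_def distrib_right add.commute)
      also have "ennreal \<sigma> * E 0 \<le> ennreal \<sigma> * (ennreal (1 + \<eta>) * u K + ennreal c)"
        unfolding E0 by (intro mult_left_mono edge) auto
      also have "\<dots> = ennreal \<rho> * u K + ennreal (\<sigma> * c)"
      proof -
        have "ennreal \<rho> = ennreal \<sigma> * ennreal (1 + \<eta>)" "ennreal (\<sigma> * c) = ennreal \<sigma> * ennreal c"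
          unfolding \<rho>_def using \<sigma> \<eta> c by (intro ennreal_mult; simp)+
        then show ?thesis by (simp only: distrib_left mult.assoc)
      qed
      also have "(\<Sum>i\<in>{0<..<n}. ennreal (w i) * E i) \<le> (\<Sum>i\<in>{0<..<n}. ennreal (w i) * Y i)"
        by (intro sum_mono mult_left_mono E_mid) auto
      finally show "u K \<le> ennreal \<rho> * u K + b"
        by (simp add: b_def add.assoc)
    qed (use \<rho> in auto)
    then have "(SUP K. u K) \<le> b / ennreal (1 - \<rho>)" by (intro SUP_least)
    moreover have "(SUP K. u K) = (\<integral>\<^sup>+x. (SUP K. f K x) \<partial>X n)"
      unfolding u_def
      by (intro nn_integral_monotone_convergence_SUP[symmetric])
         (auto simp: f_def incseq_def le_fun_def intro!: ennreal_leI power_mono)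
    moreover have "(SUP K. f K x) = ennreal ((real x)\<^sup>2)" for x
    proof (rule antisym)
      show "(SUP K. f K x) \<le> ennreal ((real x)\<^sup>2)"
        unfolding f_def by (intro SUP_least ennreal_leI power_mono) auto
      have "f x x \<le> (SUP K. f K x)" by (rule SUP_upper) simp
      then show "ennreal ((real x)\<^sup>2) \<le> (SUP K. f K x)" by (simp add: f_def)
    qed
    ultimately have "(\<integral>\<^sup>+x. ennreal ((real x)\<^sup>2) \<partial>X n) \<le> b / ennreal (1 - \<rho>)" by simp
    also have "\<dots> < \<infinity>"
    proof -
      have "b < \<infinity>" using Y by (simp add: b_def ennreal_mult_less_top)
      then show ?thesis using \<rho> by (cases b) (auto simp: divide_ennreal)
    qed
    finally show ?thesis .
  qed
qed

lemma trie_laws_integrable: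
  assumes X: "trie_size_laws p X" and p: "0 < p" "p < 1"
  shows "integrable (X n) (\<lambda>x. (real x)\<^sup>2)" "integrable (X n) real"
proof -
  show *: "integrable (X n) (\<lambda>x. (real x)\<^sup>2)"
    using trie_laws_second_moment_finite[OF assms] by (intro integrableI_nonneg) auto
  show "integrable (X n) real"
  proof (rule Bochner_Integration.integrable_bound[OF *])
    have "real x \<le> (real x)\<^sup>2" for x
      by (simp add: power2_eq_square flip: of_nat_mult)
    then show "AE x in X n. norm (real x) \<le> norm ((real x)\<^sup>2)" by simp
  qed simp
qed

lemma trie_laws_moments:
  assumes X: "trie_size_laws p X" and p: "0 < p" "p < 1"
  shows "trie_moments p (1 - p) (\<lambda>n. measure_pmf.expectation (X n) real)
           (\<lambda>n. measure_pmf.expectation (X n) (\<lambda>x. (real x)\<^sup>2))"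
proof -
  interpret bernoulli_split p "1 - p" using p by unfold_locales auto
  define m where "m n = measure_pmf.expectation (X n) real" for n
  define s where "s n = measure_pmf.expectation (X n) (\<lambda>x. (real x)\<^sup>2)" for n
  note int = trie_laws_integrable[OF X p]
  have m: "0 \<le> m n" and s: "0 \<le> s n" for n by (auto simp: m_def s_def)
  have nm: "(\<integral>\<^sup>+x. ennreal (real x) \<partial>X n) = ennreal (m n)" for n
    unfolding m_def using int by (intro nn_integral_eq_integral) auto
  have ns: "(\<integral>\<^sup>+x. ennreal ((real x)\<^sup>2) \<partial>X n) = ennreal (s n)" for n
    unfolding s_def using int by (intro nn_integral_eq_integral) auto
  have X0: "X 0 = return_pmf 0" "X (Suc 0) = return_pmf 0" using X by (auto simp: trie_size_laws_def)
  have m0: "m 0 = 0" "m (Suc 0) = 0" and s0: "s 0 = 0" "s (Suc 0) = 0"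
    by (simp_all add: m_def s_def X0)
  have m_rec: "m n = bin_avg n (\<lambda>i. m i + m (n - i)) + (if n \<ge> 2 then 1 else 0)" for n
  proof (cases "n \<ge> 2")
    case True
    have inner: "(\<integral>\<^sup>+x. \<integral>\<^sup>+y. ennreal (real (x + y + 1)) \<partial>X j \<partial>X i) = ennreal (m i + m j + 1)" for i j
      by (simp add: nn_integral_add nm measure_pmf.emeasure_space_1 m add_ac)
    have "ennreal (m n) = (\<Sum>i\<le>n. ennreal (real (n choose i) * p ^ i * (1 - p) ^ (n - i)) * ennreal (m i + m (n - i) + 1))"
      unfolding nm[symmetric] trie_laws_nn_integral[OF X p True] inner ..
    also have "\<dots> = ennreal (bin_avg n (\<lambda>i. m i + m (n - i) + 1))"
      unfolding bin_avg_def using m p bin_weight_nonneg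
      by (simp add: ennreal_mult[symmetric] sum_ennreal del: ennreal_plus)
    finally have "m n = bin_avg n (\<lambda>i. m i + m (n - i) + 1)"
      using m by (subst (asm) ennreal_inj) (auto intro!: bin_avg_nonneg)
    then show ?thesis using True by (simp add: bin_avg_add)
  next
    case False
    then have "n = 0 \<or> n = 1" by auto
    then show ?thesis using m0 by (auto simp: bin_avg_def)
  qed
  have s_rec: "s n = bin_avg n (\<lambda>i. s i + s (n - i) + 2 * m i * m (n - i) + 2 * m i + 2 * m (n - i))
      + (if n \<ge> 2 then 1 else 0)" for n
  proof (cases "n \<ge> 2")
    case True
    have inner: "(\<integral>\<^sup>+x. \<integral>\<^sup>+y. ennreal ((real (x + y + 1))\<^sup>2) \<partial>X j \<partial>X i)
        = ennreal (s i + s j + 2 * m i * m j + 2 * m i + 2 * m j + 1)" for i j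
    proof -
      have "ennreal ((real (x + y + 1))\<^sup>2) = ennreal ((real x)\<^sup>2 + 2 * real x + 1)
          + (ennreal ((real y)\<^sup>2) + ennreal (2 * real x + 2) * ennreal (real y))" for x y :: nat
        by (subst ennreal_mult[symmetric], simp, simp, subst ennreal_plus[symmetric], simp, simp,
            subst ennreal_plus[symmetric], simp, simp, rule arg_cong[where f = ennreal])
           (simp add: power2_eq_square algebra_simps)
      then have "(\<integral>\<^sup>+x. \<integral>\<^sup>+y. ennreal ((real (x + y + 1))\<^sup>2) \<partial>X j \<partial>X i)
          = (\<integral>\<^sup>+x. ennreal ((real x)\<^sup>2 + 2 * real x + 1)
              + (ennreal (s j) + ennreal (2 * real x + 2) * ennreal (m j)) \<partial>X i)"
        by (simp add: nn_integral_add nn_integral_cmult nm ns measure_pmf.emeasure_space_1 del: ennreal_plus)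
      also have "\<dots> = (\<integral>\<^sup>+x. ennreal ((real x)\<^sup>2) + (ennreal (2 + 2 * m j) * ennreal (real x)
              + ennreal (s j + 2 * m j + 1)) \<partial>X i)"
      proof (intro nn_integral_cong)
        fix x :: nat
        show "ennreal ((real x)\<^sup>2 + 2 * real x + 1) + (ennreal (s j) + ennreal (2 * real x + 2) * ennreal (m j))
          = ennreal ((real x)\<^sup>2) + (ennreal (2 + 2 * m j) * ennreal (real x) + ennreal (s j + 2 * m j + 1))"
          using m[of j] s[of j]
          by (simp add: ennreal_mult[symmetric] ennreal_plus[symmetric] algebra_simps del: ennreal_plus)
      qed
      also have "\<dots> = ennreal (s i) + (ennreal (2 + 2 * m j) * ennreal (m i) + ennreal (s j + 2 * m j + 1))"
        by (simp add: nn_integral_add nn_integral_cmult nm ns measure_pmf.emeasure_space_1 del: ennreal_plus)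
      also have "\<dots> = ennreal (s i + s j + 2 * m i * m j + 2 * m i + 2 * m j + 1)"
        using m[of j] m[of i] s[of i] s[of j]
        by (simp add: ennreal_mult[symmetric] ennreal_plus[symmetric] algebra_simps del: ennreal_plus)
      finally show ?thesis .
    qed
    have nonneg: "0 \<le> s i + s j + 2 * m i * m j + 2 * m i + 2 * m j + 1" for i j
      using m s by (intro add_nonneg_nonneg mult_nonneg_nonneg) auto
    have "ennreal (s n) = (\<Sum>i\<le>n. ennreal (real (n choose i) * p ^ i * (1 - p) ^ (n - i))
        * ennreal (s i + s (n - i) + 2 * m i * m (n - i) + 2 * m i + 2 * m (n - i) + 1))"
      unfolding ns[symmetric] trie_laws_nn_integral[OF X p True] inner ..
    also have "\<dots> = ennreal (bin_avg n (\<lambda>i. s i + s (n - i) + 2 * m i * m (n - i) + 2 * m i + 2 * m (n - i) + 1))"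
      unfolding bin_avg_def using nonneg p bin_weight_nonneg
      by (simp add: ennreal_mult[symmetric] sum_ennreal del: ennreal_plus)
    finally have "s n = bin_avg n (\<lambda>i. s i + s (n - i) + 2 * m i * m (n - i) + 2 * m i + 2 * m (n - i) + 1)"
      using s nonneg by (subst (asm) ennreal_inj) (auto intro!: bin_avg_nonneg)
    then show ?thesis using True by (simp add: bin_avg_add[of n _ "\<lambda>_. 1"])
  next
    case False
    then have "n = 0 \<or> n = 1" by auto
    then show ?thesis using m0 s0 by (auto simp: bin_avg_def)
  qed
  show ?thesis
    unfolding m_def[symmetric] s_def[symmetric]
    by unfold_locales (rule m_rec s_rec m0 s0)+
qed

section \<open>Poisson transforms\<close>

text \<open>At most exponential growth makes the Poisson series converge for every \<open>z\<close>.
  The class is closed under products, shifts and binomial averages, all of which occur in the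
  recurrences.\<close>

definition geom_bounded :: "(nat \<Rightarrow> real) \<Rightarrow> bool" where
  "geom_bounded f \<longleftrightarrow> (\<exists>C\<ge>0. \<exists>D\<ge>1. \<forall>n. \<bar>f n\<bar> \<le> C * D ^ n)"

lemma geom_boundedI: "(\<And>n. \<bar>f n\<bar> \<le> C * D ^ n) \<Longrightarrow> 0 \<le> C \<Longrightarrow> 1 \<le> D \<Longrightarrow> geom_bounded f"
  unfolding geom_bounded_def by blast

lemma geom_bounded_mono: "geom_bounded g \<Longrightarrow> (\<And>n. \<bar>f n\<bar> \<le> \<bar>g n\<bar>) \<Longrightarrow> geom_bounded f"
  unfolding geom_bounded_def by (meson order.trans)

lemma geom_bounded_const [simp]: "geom_bounded (\<lambda>_. c)"
  by (rule geom_boundedI[of _ "\<bar>c\<bar>" 1]) auto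

lemma geom_bounded_add:
  assumes "geom_bounded f" "geom_bounded g"
  shows "geom_bounded (\<lambda>n. f n + g n)"
proof -
  obtain C D where f: "C \<ge> 0" "D \<ge> 1" "\<And>n. \<bar>f n\<bar> \<le> C * D ^ n"
    using assms(1) unfolding geom_bounded_def by blast
  obtain C' D' where g: "C' \<ge> 0" "D' \<ge> 1" "\<And>n. \<bar>g n\<bar> \<le> C' * D' ^ n"
    using assms(2) unfolding geom_bounded_def by blast
  show ?thesis
  proof (rule geom_boundedI)
    fix n
    have "\<bar>f n + g n\<bar> \<le> C * D ^ n + C' * D' ^ n" using f(3)[of n] g(3)[of n] by linarith
    also have "\<dots> \<le> C * max D D' ^ n + C' * max D D' ^ n"
      using f g by (intro add_mono mult_left_mono power_mono) auto
    finally show "\<bar>f n + g n\<bar> \<le> (C + C') * max D D' ^ n" by (simp add: distrib_right)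
  qed (use f g in auto)
qed

lemma geom_bounded_mult:
  assumes "geom_bounded f" "geom_bounded g"
  shows "geom_bounded (\<lambda>n. f n * g n)"
proof -
  obtain C D where f: "C \<ge> 0" "D \<ge> 1" "\<And>n. \<bar>f n\<bar> \<le> C * D ^ n"
    using assms(1) unfolding geom_bounded_def by blast
  obtain C' D' where g: "C' \<ge> 0" "D' \<ge> 1" "\<And>n. \<bar>g n\<bar> \<le> C' * D' ^ n"
    using assms(2) unfolding geom_bounded_def by blast
  show ?thesis
  proof (rule geom_boundedI)
    fix n
    have "\<bar>f n * g n\<bar> \<le> (C * D ^ n) * (C' * D' ^ n)"
      unfolding abs_mult using f(3)[of n] g(3)[of n] by (intro mult_mono order.trans[OF abs_ge_zero]) auto
    then show "\<bar>f n * g n\<bar> \<le> (C * C') * (D * D') ^ n" by (simp add: power_mult_distrib mult_ac)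
    show "1 \<le> D * D'" using mult_mono[of 1 D 1 D'] f g by simp
  qed (use f g in auto)
qed

lemma geom_bounded_real [simp]: "geom_bounded real"
  by (rule geom_boundedI[of _ 1 2])
     (use of_nat_less_two_power in \<open>auto simp: less_imp_le\<close>)

lemma geom_bounded_uminus: "geom_bounded f \<Longrightarrow> geom_bounded (\<lambda>n. - f n)"
  by (erule geom_bounded_mono) simp

lemma geom_bounded_diff: "geom_bounded f \<Longrightarrow> geom_bounded g \<Longrightarrow> geom_bounded (\<lambda>n. f n - g n)"
  using geom_bounded_add[of f "\<lambda>n. - g n"] geom_bounded_uminus[of g] by simp

lemma geom_bounded_abs: "geom_bounded f \<Longrightarrow> geom_bounded (\<lambda>n. \<bar>f n\<bar>)"
  by (erule geom_bounded_mono) simp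

lemma geom_bounded_power: "geom_bounded f \<Longrightarrow> geom_bounded (\<lambda>n. f n ^ k)"
  by (induction k) (auto intro: geom_bounded_mult)

lemma geom_bounded_divide: "geom_bounded f \<Longrightarrow> geom_bounded (\<lambda>n. f n / c)"
  using geom_bounded_mult[of f "\<lambda>_. 1 / c"] by simp

lemma geom_bounded_Suc:
  assumes "geom_bounded f" shows "geom_bounded (\<lambda>n. f (Suc n))"
proof -
  obtain C D where f: "C \<ge> 0" "D \<ge> 1" "\<And>n. \<bar>f n\<bar> \<le> C * D ^ n"
    using assms(1) unfolding geom_bounded_def by blast
  show ?thesis
    by (rule geom_boundedI[of _ "C * D" D]) (use f(1,2) f(3)[of "Suc n" for n] in \<open>auto simp: mult_ac\<close>)
qed

lemma geom_bounded_if: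
  "geom_bounded f \<Longrightarrow> geom_bounded g \<Longrightarrow> geom_bounded (\<lambda>n. if P n then f n else g n)"
  by (rule geom_bounded_mono[of "\<lambda>n. \<bar>f n\<bar> + \<bar>g n\<bar>"]) (auto intro: geom_bounded_add geom_bounded_abs)

text \<open>The expectation of \<open>f\<close> at a Poisson(\<open>z\<close>) variable, written as
  a power series so that it makes sense for all real \<open>z\<close>; two-sided derivatives at 0
  are taken later.\<close>

definition pois :: "(nat \<Rightarrow> real) \<Rightarrow> real \<Rightarrow> real" where
  "pois f z = exp (- z) * (\<Sum>n. f n * (z ^ n / fact n))"

lemma summable_pois:
  assumes "geom_bounded f"
  shows "summable (\<lambda>n. norm (f n * (z ^ n / fact n)))"
proof -
  obtain C D where f: "C \<ge> 0" "D \<ge> 1" "\<And>n. \<bar>f n\<bar> \<le> C * D ^ n"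
    using assms(1) unfolding geom_bounded_def by blast
  show ?thesis
  proof (rule summable_comparison_test')
    show "summable (\<lambda>n. C * (inverse (fact n) * (D * \<bar>z\<bar>) ^ n))"
      by (intro summable_mult summable_exp)
    fix n
    have "\<bar>f n\<bar> * \<bar>z ^ n / fact n\<bar> \<le> C * D ^ n * \<bar>z ^ n / fact n\<bar>"
      by (intro mult_right_mono f) auto
    then show "norm (norm (f n * (z ^ n / fact n))) \<le> C * (inverse (fact n) * (D * \<bar>z\<bar>) ^ n)"
      by (simp add: abs_mult power_abs power_mult_distrib field_simps)
  qed
qed

lemmas geom_bounded_intros = geom_bounded_add geom_bounded_diff geom_bounded_mult geom_bounded_divide
  geom_bounded_power geom_bounded_if geom_bounded_abs geom_bounded_real geom_bounded_const

lemmas summable_pois' = summable_norm_cancel[OF summable_pois]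

lemma pois_add: "geom_bounded f \<Longrightarrow> geom_bounded g \<Longrightarrow> pois (\<lambda>n. f n + g n) z = pois f z + pois g z"
  using suminf_add[OF summable_pois'[of f z] summable_pois'[of g z]]
  by (simp only: pois_def distrib_right distrib_left[symmetric])

lemma pois_diff: "geom_bounded f \<Longrightarrow> geom_bounded g \<Longrightarrow> pois (\<lambda>n. f n - g n) z = pois f z - pois g z"
  using suminf_diff[OF summable_pois'[of f z] summable_pois'[of g z]]
  by (simp only: pois_def left_diff_distrib right_diff_distrib[symmetric])

lemma pois_cmult: "geom_bounded f \<Longrightarrow> pois (\<lambda>n. c * f n) z = c * pois f z"
  using suminf_mult[OF summable_pois'[of f z], of c] by (simp add: pois_def algebra_simps)

lemma pois_divide: "geom_bounded f \<Longrightarrow> pois (\<lambda>n. f n / c) z = pois f z / c"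
  using pois_cmult[of f "1 / c" z] by simp

lemma pois_const [simp]: "pois (\<lambda>_. c) z = c"
proof -
  have "(\<Sum>n. c * (z ^ n / fact n)) = c * exp z"
    using sums_mult[OF exp_converges[of z], of c] by (simp add: sums_iff field_simps)
  then show ?thesis by (simp add: pois_def exp_minus field_simps)
qed

lemma pois_mono:
  assumes "geom_bounded f" "geom_bounded g" "0 \<le> z" "\<And>n. f n \<le> g n"
  shows "pois f z \<le> pois g z"
  unfolding pois_def using assms
  by (intro mult_left_mono suminf_le mult_right_mono summable_pois') auto

lemma pois_nonneg: "geom_bounded f \<Longrightarrow> 0 \<le> z \<Longrightarrow> (\<And>n. 0 \<le> f n) \<Longrightarrow> 0 \<le> pois f z"
  using pois_mono[of "\<lambda>_. 0" f z] by simp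

lemma abs_pois_le: "geom_bounded f \<Longrightarrow> 0 \<le> z \<Longrightarrow> \<bar>pois f z\<bar> \<le> pois (\<lambda>n. \<bar>f n\<bar>) z"
proof -
  assume *: "geom_bounded f" "0 \<le> z"
  have "pois f z \<le> pois (\<lambda>n. \<bar>f n\<bar>) z" "pois (\<lambda>n. -1 * f n) z \<le> pois (\<lambda>n. \<bar>f n\<bar>) z"
    using * by (intro pois_mono geom_bounded_abs geom_bounded_mult geom_bounded_const; simp)+
  then show ?thesis using pois_cmult[of f "-1" z] * by simp
qed

lemma pois_single: "pois (\<lambda>n. if n = k then c else 0) z = c * exp (- z) * z ^ k / fact k"
proof -
  have "(\<lambda>n. (if n = k then c else 0) * (z ^ n / fact n)) = (\<lambda>n. if n = k then c * (z ^ n / fact n) else 0)"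
    by auto
  then have "(\<Sum>n. (if n = k then c else 0) * (z ^ n / fact n)) = c * (z ^ k / fact k)"
    using sums_single[of k "\<lambda>k. c * (z ^ k / fact k)"] by (simp only: sums_iff)
  then show ?thesis by (simp add: pois_def)
qed

lemma pois_ge_2: "pois (\<lambda>n. if n \<ge> 2 then 1 else 0) z = 1 - (1 + z) * exp (- z)"
proof -
  have "(\<lambda>n::nat. if n \<ge> 2 then 1 else 0 :: real)
      = (\<lambda>n. 1 - (if n = 0 then 1 else 0) - (if n = 1 then 1 else 0))" by auto
  then have "pois (\<lambda>n. if n \<ge> 2 then 1 else 0) z
      = pois (\<lambda>n. 1 - (if n = 0 then 1 else 0) - (if n = 1 then 1 else 0)) z" by (rule arg_cong)
  also have "\<dots> = 1 - exp (- z) - exp (- z) * z"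
    by (subst pois_diff, (intro geom_bounded_intros)+, subst pois_diff, (intro geom_bounded_intros)+)
       (simp add: pois_single del: One_nat_def)
  finally show ?thesis by (simp add: algebra_simps)
qed

text \<open>The Stein-Chen identity; it yields the Poisson moments up to order four, each from the
  preceding ones.\<close>

lemma pois_of_nat_mult:
  assumes "geom_bounded f"
  shows "pois (\<lambda>n. real n * f n) z = z * pois (\<lambda>n. f (Suc n)) z"
proof -
  have "(\<Sum>n. real n * f n * (z ^ n / fact n)) = (\<Sum>n. real (Suc n) * f (Suc n) * (z ^ Suc n / fact (Suc n)))"
    using suminf_split_head[OF summable_pois'[OF geom_bounded_mult[OF geom_bounded_real assms]], of z] by simp
  also have "\<dots> = (\<Sum>n. z * (f (Suc n) * (z ^ n / fact n)))"
    by (intro suminf_cong) (simp add: field_simps del: of_nat_Suc)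
  also have "\<dots> = z * (\<Sum>n. f (Suc n) * (z ^ n / fact n))"
    using assms by (intro suminf_mult summable_pois' geom_bounded_Suc)
  finally show ?thesis by (simp add: pois_def)
qed

lemma pois_id: "pois real z = z"
  using pois_of_nat_mult[of "\<lambda>_. 1" z] by simp

lemma pois_square: "pois (\<lambda>n. (real n)\<^sup>2) z = z\<^sup>2 + z"
proof -
  have "pois (\<lambda>n. (real n)\<^sup>2) z = pois (\<lambda>n. real n * real n) z" by (simp add: power2_eq_square)
  also have "\<dots> = z * pois (\<lambda>n. real n + 1) z"
    by (subst pois_of_nat_mult) (auto simp: add.commute)
  also have "pois (\<lambda>n. real n + 1) z = z + 1" by (subst pois_add) (auto simp: pois_id)
  finally show ?thesis by (simp add: power2_eq_square algebra_simps)
qed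

lemma pois_cube: "pois (\<lambda>n. (real n) ^ 3) z = z ^ 3 + 3 * z\<^sup>2 + z"
proof -
  have "pois (\<lambda>n. (real n) ^ 3) z = pois (\<lambda>n. real n * (real n)\<^sup>2) z"
    by (simp add: power2_eq_square power3_eq_cube mult.assoc)
  also have "\<dots> = z * pois (\<lambda>n. (real n)\<^sup>2 + 2 * real n + 1) z"
    by (subst pois_of_nat_mult[OF geom_bounded_power[OF geom_bounded_real]])
       (simp add: power2_eq_square algebra_simps)
  also have "pois (\<lambda>n. (real n)\<^sup>2 + 2 * real n + 1) z = (z\<^sup>2 + z) + 2 * z + 1"
    by (subst pois_add pois_cmult pois_square pois_id pois_const;
        (intro geom_bounded_intros)?)+ simp
  finally show ?thesis by (simp add: power2_eq_square power3_eq_cube algebra_simps)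
qed

lemma pois_fourth: "pois (\<lambda>n. (real n) ^ 4) z = z ^ 4 + 6 * z ^ 3 + 7 * z\<^sup>2 + z"
proof -
  have "pois (\<lambda>n. (real n) ^ 4) z = pois (\<lambda>n. real n * (real n) ^ 3) z"
    by (simp add: eval_nat_numeral)
  also have "\<dots> = z * pois (\<lambda>n. (real n) ^ 3 + 3 * (real n)\<^sup>2 + 3 * real n + 1) z"
    by (subst pois_of_nat_mult[OF geom_bounded_power[OF geom_bounded_real]])
       (simp add: power2_eq_square power3_eq_cube algebra_simps)
  also have "pois (\<lambda>n. (real n) ^ 3 + 3 * (real n)\<^sup>2 + 3 * real n + 1) z
      = (z ^ 3 + 3 * z\<^sup>2 + z) + 3 * (z\<^sup>2 + z) + 3 * z + 1"
    by (subst pois_add pois_cmult pois_square pois_cube pois_id pois_const;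
        (intro geom_bounded_intros)?)+ simp
  finally show ?thesis by (simp add: eval_nat_numeral algebra_simps)
qed

lemma pois_central1: "pois (\<lambda>n. real n - z) z = 0"
  by (subst pois_diff) (auto simp: pois_id)

lemma pois_central2: "pois (\<lambda>n. (real n - z)\<^sup>2) z = z"
proof -
  have "(\<lambda>n. (real n - z)\<^sup>2) = (\<lambda>n. (real n)\<^sup>2 + ((-2 * z) * real n + z\<^sup>2))"
    by (auto simp: power2_eq_square algebra_simps)
  then have "pois (\<lambda>n. (real n - z)\<^sup>2) z = pois (\<lambda>n. (real n)\<^sup>2 + ((-2 * z) * real n + z\<^sup>2)) z"
    by (rule arg_cong)
  also have "\<dots> = (z\<^sup>2 + z) + ((-2 * z) * z + z\<^sup>2)"
    by (subst pois_add pois_cmult pois_square pois_id pois_const;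
        (intro geom_bounded_intros)?)+ simp
  finally show ?thesis by (simp add: power2_eq_square algebra_simps)
qed

lemma pois_central4: "pois (\<lambda>n. (real n - z) ^ 4) z = 3 * z\<^sup>2 + z"
proof -
  have "(\<lambda>n. (real n - z) ^ 4)
      = (\<lambda>n. (real n) ^ 4 + ((-4 * z) * (real n) ^ 3 + ((6 * z\<^sup>2) * (real n)\<^sup>2 + ((-4 * z ^ 3) * real n + z ^ 4))))"
    by (auto simp: eval_nat_numeral algebra_simps)
  then have "pois (\<lambda>n. (real n - z) ^ 4) z = pois (\<lambda>n. (real n) ^ 4
      + ((-4 * z) * (real n) ^ 3 + ((6 * z\<^sup>2) * (real n)\<^sup>2 + ((-4 * z ^ 3) * real n + z ^ 4)))) z"
    by (rule arg_cong)
  also have "\<dots> = (z ^ 4 + 6 * z ^ 3 + 7 * z\<^sup>2 + z) + ((-4 * z) * (z ^ 3 + 3 * z\<^sup>2 + z)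
      + ((6 * z\<^sup>2) * (z\<^sup>2 + z) + ((-4 * z ^ 3) * z + z ^ 4)))"
    by (subst pois_add pois_cmult pois_square pois_cube pois_fourth pois_id pois_const;
        (intro geom_bounded_intros)?)+ simp
  finally show ?thesis by (simp add: eval_nat_numeral algebra_simps)
qed

text \<open>The inequality \<open>\<bar>u\<bar> \<le> u\<^sup>2 / (2 * sqrt z) + sqrt z / 2\<close>
  is balanced at the standard deviation \<open>sqrt z\<close>.\<close>

lemma pois_abs_central: "z > 0 \<Longrightarrow> pois (\<lambda>n. \<bar>real n - z\<bar>) z \<le> sqrt z"
proof -
  assume z: "z > 0"
  have "pois (\<lambda>n. \<bar>real n - z\<bar>) z \<le> pois (\<lambda>n. (real n - z)\<^sup>2 / (2 * sqrt z) + sqrt z / 2) z"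
  proof (rule pois_mono)
    fix n
    have "0 \<le> (\<bar>real n - z\<bar> - sqrt z)\<^sup>2 / (2 * sqrt z)" using z by simp
    also have "\<dots> = (real n - z)\<^sup>2 / (2 * sqrt z) + sqrt z / 2 - \<bar>real n - z\<bar>"
      using z by (simp add: power2_eq_square field_simps)
    finally show "\<bar>real n - z\<bar> \<le> (real n - z)\<^sup>2 / (2 * sqrt z) + sqrt z / 2" by simp
  qed (use z in \<open>intro geom_bounded_intros | simp\<close>)+
  also have "\<dots> = z / (2 * sqrt z) + sqrt z / 2"
    by (subst pois_add pois_divide; (intro geom_bounded_intros)?)+ (simp add: pois_central2)
  also have "\<dots> = sqrt z" using z by (simp add: real_div_sqrt field_simps)
  finally show ?thesis .
qed

text \<open>Differentiation in the Poisson model is the forward difference in the model with fixed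
  \<open>n\<close>; in particular the derivative of the Poissonized mean is the Poisson transform of
  the first differences.\<close>

lemma has_real_derivative_pois:
  assumes "geom_bounded f"
  shows "(pois f has_real_derivative pois (\<lambda>n. f (Suc n) - f n) z) (at z)"
proof -
  define c where "c n = f n / fact n" for n
  have diffs: "diffs c = (\<lambda>n. f (Suc n) / fact n)"
    by (auto simp: diffs_def c_def field_simps simp del: of_nat_Suc)
  have "summable (\<lambda>n. c n * z ^ n)" for z
    using summable_pois'[OF assms, of z] by (simp add: c_def)
  then have "((\<lambda>z. \<Sum>n. c n * z ^ n) has_real_derivative (\<Sum>n. diffs c n * z ^ n)) (at z)"
    by (rule termdiffs_strong_converges_everywhere)
  then have "((\<lambda>z. exp (- z) * (\<Sum>n. c n * z ^ n)) has_real_derivative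
      exp (- z) * (\<Sum>n. diffs c n * z ^ n) - exp (- z) * (\<Sum>n. c n * z ^ n)) (at z)"
    by (auto intro!: derivative_eq_intros)
  moreover have "(\<lambda>z. exp (- z) * (\<Sum>n. c n * z ^ n)) = pois f"
    by (simp add: fun_eq_iff pois_def c_def)
  moreover have "exp (- z) * (\<Sum>n. diffs c n * z ^ n) - exp (- z) * (\<Sum>n. c n * z ^ n)
      = pois (\<lambda>n. f (Suc n) - f n) z"
    using assms by (subst pois_diff) (auto simp: pois_def diffs c_def intro: geom_bounded_Suc)
  ultimately show ?thesis by simp
qed

context bernoulli_split
begin

lemma geom_bounded_bin_avg:
  assumes "geom_bounded f" "geom_bounded g"
  shows "geom_bounded (\<lambda>n. bin_avg n (\<lambda>i. f i * g (n - i)))"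
proof -
  obtain C D where f: "C \<ge> 0" "D \<ge> 1" "\<And>n. \<bar>f n\<bar> \<le> C * D ^ n"
    using assms(1) unfolding geom_bounded_def by blast
  obtain C' D' where g: "C' \<ge> 0" "D' \<ge> 1" "\<And>n. \<bar>g n\<bar> \<le> C' * D' ^ n"
    using assms(2) unfolding geom_bounded_def by blast
  show ?thesis
  proof (rule geom_boundedI)
    fix n
    have "\<bar>bin_avg n (\<lambda>i. f i * g (n - i))\<bar> \<le> bin_avg n (\<lambda>i. \<bar>f i * g (n - i)\<bar>)"
      by (rule abs_bin_avg_le)
    also have "\<dots> \<le> bin_avg n (\<lambda>i. (C * C') * (D * D') ^ n)"
    proof (rule bin_avg_mono)
      fix i assume i: "i \<le> n"
      have "\<bar>f i * g (n - i)\<bar> \<le> (C * D ^ i) * (C' * D' ^ (n - i))"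
        unfolding abs_mult using f(3)[of i] g(3)[of "n - i"]
        by (intro mult_mono order.trans[OF abs_ge_zero]) auto
      also have "\<dots> \<le> (C * D ^ n) * (C' * D' ^ n)"
        using f g i by (intro mult_mono power_increasing mult_left_mono) auto
      finally show "\<bar>f i * g (n - i)\<bar> \<le> (C * C') * (D * D') ^ n"
        by (simp add: power_mult_distrib mult_ac)
    qed
    finally show "\<bar>bin_avg n (\<lambda>i. f i * g (n - i))\<bar> \<le> (C * C') * (D * D') ^ n" by simp
    show "1 \<le> D * D'" using mult_mono[of 1 D 1 D'] f g by simp
  qed (use f g in auto)
qed

text \<open>Poisson splitting: the two sides of a Poisson(\<open>z\<close>) number of keys are
  independent with parameters \<open>p * z\<close> and \<open>q * z\<close>. Analytically this is a
  Cauchy product of exponential series.\<close>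

lemma pois_bin_avg:
  assumes "geom_bounded f" "geom_bounded g"
  shows "pois (\<lambda>n. bin_avg n (\<lambda>i. f i * g (n - i))) z = pois f (p * z) * pois g (q * z)"
proof -
  have "(\<lambda>n. \<Sum>i\<le>n. (f i * ((p * z) ^ i / fact i)) * (g (n - i) * ((q * z) ^ (n - i) / fact (n - i))))
      sums ((\<Sum>n. f n * ((p * z) ^ n / fact n)) * (\<Sum>n. g n * ((q * z) ^ n / fact n)))"
    by (intro Cauchy_product_sums summable_pois assms)
  also have "(\<lambda>n. \<Sum>i\<le>n. (f i * ((p * z) ^ i / fact i)) * (g (n - i) * ((q * z) ^ (n - i) / fact (n - i))))
     = (\<lambda>n. bin_avg n (\<lambda>i. f i * g (n - i)) * (z ^ n / fact n))"
  proof
    fix n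
    show "(\<Sum>i\<le>n. (f i * ((p * z) ^ i / fact i)) * (g (n - i) * ((q * z) ^ (n - i) / fact (n - i))))
     = bin_avg n (\<lambda>i. f i * g (n - i)) * (z ^ n / fact n)"
      unfolding bin_avg_def sum_distrib_right
    proof (intro sum.cong refl)
      fix i assume "i \<in> {..n}"
      then have "real (n choose i) = fact n / (fact i * fact (n - i))" "z ^ n = z ^ i * z ^ (n - i)"
        by (auto simp: binomial_fact power_add[symmetric])
      then show "(f i * ((p * z) ^ i / fact i)) * (g (n - i) * ((q * z) ^ (n - i) / fact (n - i)))
         = real (n choose i) * p ^ i * q ^ (n - i) * (f i * g (n - i)) * (z ^ n / fact n)"
        by (simp add: power_mult_distrib)
    qed
  qed
  finally have "(\<Sum>n. bin_avg n (\<lambda>i. f i * g (n - i)) * (z ^ n / fact n))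
     = (\<Sum>n. f n * ((p * z) ^ n / fact n)) * (\<Sum>n. g n * ((q * z) ^ n / fact n))"
    by (simp add: sums_iff)
  moreover have "exp (- z) = exp (- (p * z)) * exp (- (q * z))"
  proof -
    have "- z = - (p * z) + - (q * z)" by (simp add: q_eq algebra_simps)
    then show ?thesis by (metis exp_add)
  qed
  ultimately show ?thesis by (simp add: pois_def)
qed

lemma pois_bin_avg_left: "geom_bounded f \<Longrightarrow> pois (\<lambda>n. bin_avg n f) z = pois f (p * z)"
  using pois_bin_avg[of f "\<lambda>_. 1" z] by simp

lemma pois_bin_avg_right: "geom_bounded f \<Longrightarrow> pois (\<lambda>n. bin_avg n (\<lambda>i. f (n - i))) z = pois f (q * z)"
  using pois_bin_avg[of "\<lambda>_. 1" f z] by simp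

lemma geom_bounded_bin_avg_left: "geom_bounded f \<Longrightarrow> geom_bounded (\<lambda>n. bin_avg n f)"
  using geom_bounded_bin_avg[of f "\<lambda>_. 1"] by simp

lemma geom_bounded_bin_avg_right: "geom_bounded f \<Longrightarrow> geom_bounded (\<lambda>n. bin_avg n (\<lambda>i. f (n - i)))"
  using geom_bounded_bin_avg[of "\<lambda>_. 1" f] by simp

lemma pois_recursion:
  assumes "\<And>n. a n = bin_avg n (\<lambda>i. \<alpha> * a i + \<beta> * a (n - i)) + t n"
    and "geom_bounded a" "geom_bounded t"
  shows "pois a z = \<alpha> * pois a (p * z) + \<beta> * pois a (q * z) + pois t z"
proof -
  have "a = (\<lambda>n. \<alpha> * bin_avg n a + \<beta> * bin_avg n (\<lambda>i. a (n - i)) + t n)"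
    by (rule ext) (metis assms(1) bin_avg_add bin_avg_cmult)
  then have "pois a z = pois (\<lambda>n. \<alpha> * bin_avg n a + \<beta> * bin_avg n (\<lambda>i. a (n - i)) + t n) z"
    by (rule arg_cong)
  also have "\<dots> = \<alpha> * pois (\<lambda>n. bin_avg n a) z + \<beta> * pois (\<lambda>n. bin_avg n (\<lambda>i. a (n - i))) z + pois t z"
    using geom_bounded_bin_avg_left[of a] geom_bounded_bin_avg_right[of a]
    by (simp add: pois_add pois_cmult geom_bounded_add geom_bounded_mult assms(2,3))
  finally show ?thesis by (simp add: pois_bin_avg_left pois_bin_avg_right assms(2))
qed

end


section \<open>Depoissonization\<close>

context trie_moments
begin

lemma geom_bounded_m [simp]: "geom_bounded m"
  by (rule geom_bounded_mono[of "\<lambda>n. 1 / (p * q) * real n"])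
     (use m_nonneg m_le p_pos q_pos in \<open>auto simp: abs_mult intro!: geom_bounded_intros\<close>)

lemma geom_bounded_mu [simp]: "geom_bounded mu"
  by (rule geom_bounded_mono[of "\<lambda>n. 1 / (p * q)"]) (use mu_nonneg mu_le p_pos q_pos in auto)

text \<open>Summing the logarithmic increments crudely gives quadratic growth, which is enough for
  convergence.\<close>

lemma geom_bounded_V [simp]: "geom_bounded V"
proof -
  obtain K where K: "K > 0" "\<And>n. \<bar>V (Suc n) - V n\<bar> \<le> K * ln (real n + 1)"
    using V_diff_bound by blast
  have "\<bar>V n\<bar> \<le> K * (real n)\<^sup>2" for n
  proof (induction n)
    case (Suc n)
    have "\<bar>V (Suc n)\<bar> \<le> \<bar>V n\<bar> + \<bar>V (Suc n) - V n\<bar>" by simp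
    also have "\<dots> \<le> K * (real n)\<^sup>2 + K * ln (real n + 1)" using Suc K by (intro add_mono) auto
    also have "\<dots> \<le> K * (real n)\<^sup>2 + K * real n"
      using K ln_add_one_self_le_self[of "real n"] by (intro add_left_mono mult_left_mono) (auto simp: add.commute)
    also have "\<dots> \<le> K * (real (Suc n))\<^sup>2"
      using K unfolding distrib_left[symmetric]
      by (intro mult_left_mono) (auto simp: power2_eq_square algebra_simps)
    finally show ?case .
  qed simp
  then show ?thesis
    by (intro geom_bounded_mono[of "\<lambda>n. K * (real n)\<^sup>2" V] geom_bounded_intros)
       (use order.trans abs_ge_self in blast)
qed

lemma geom_bounded_s [simp]: "geom_bounded s"
proof -
  have "s = (\<lambda>n. V n + (m n)\<^sup>2)" by (auto simp: V_def)
  then show ?thesis by (metis geom_bounded_V geom_bounded_m geom_bounded_add geom_bounded_power)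
qed

lemma pois_m_eq: "pois m z = pois m (p * z) + pois m (q * z) + (1 - (1 + z) * exp (- z))"
proof -
  have "m n = bin_avg n (\<lambda>i. 1 * m i + 1 * m (n - i)) + (if n \<ge> 2 then 1 else 0)" for n
    by (simp only: mult_1 m_rec[symmetric])
  from pois_recursion[OF this, of z] show ?thesis
    by (simp add: pois_ge_2 geom_bounded_if)
qed

lemma pois_mu_eq: "pois mu z = p * pois mu (p * z) + q * pois mu (q * z) + z * exp (- z)"
  using pois_recursion[OF mu_rec, of z] by (simp add: pois_single geom_bounded_if)

lemma pois_s_eq: "pois s z = pois s (p * z) + pois s (q * z)
    + 2 * pois m (p * z) * pois m (q * z) + 2 * pois m (p * z) + 2 * pois m (q * z)
    + (1 - (1 + z) * exp (- z))"
proof -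
  define t where "t n = 2 * bin_avg n (\<lambda>i. m i * m (n - i)) + 2 * bin_avg n m
      + 2 * bin_avg n (\<lambda>i. m (n - i)) + (if n \<ge> 2 then 1 else 0)" for n
  note gb = geom_bounded_bin_avg[OF geom_bounded_m geom_bounded_m]
    geom_bounded_bin_avg_left[OF geom_bounded_m] geom_bounded_bin_avg_right[OF geom_bounded_m]
  have rec: "s n = bin_avg n (\<lambda>i. 1 * s i + 1 * s (n - i)) + t n" for n
  proof -
    have "s n = bin_avg n (\<lambda>i. (1 * s i + 1 * s (n - i)) + (2 * (m i * m (n - i)) + 2 * m i + 2 * m (n - i)))
      + (if n \<ge> 2 then 1 else 0)"
      by (subst s_rec) (simp add: algebra_simps)
    then show ?thesis
      unfolding t_def bin_avg_add[of n "\<lambda>i. 1 * s i + 1 * s (n - i)"]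
      by (simp only: bin_avg_add[of n _ "\<lambda>i. 2 * m (n - i)"] bin_avg_add[of n _ "\<lambda>i. 2 * m i"] bin_avg_cmult)
  qed
  have "geom_bounded t"
    unfolding t_def by (intro geom_bounded_intros gb)
  moreover have "pois t z = 2 * (pois m (p * z) * pois m (q * z)) + 2 * pois m (p * z)
      + 2 * pois m (q * z) + (1 - (1 + z) * exp (- z))"
  proof -
    have "pois t z = pois (\<lambda>n. 2 * bin_avg n (\<lambda>i. m i * m (n - i))) z + pois (\<lambda>n. 2 * bin_avg n m) z
        + pois (\<lambda>n. 2 * bin_avg n (\<lambda>i. m (n - i))) z + pois (\<lambda>n. if n \<ge> 2 then 1 else 0) z"
      unfolding t_def
      by (subst pois_add, (intro geom_bounded_intros gb)+, subst pois_add, (intro geom_bounded_intros gb)+,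
          subst pois_add, (intro geom_bounded_intros gb)+) (rule refl)
    then show ?thesis
      by (simp only: pois_cmult[OF gb(1)] pois_cmult[OF gb(2)] pois_cmult[OF gb(3)]
          pois_bin_avg[OF geom_bounded_m geom_bounded_m] pois_bin_avg_left[OF geom_bounded_m]
          pois_bin_avg_right[OF geom_bounded_m] pois_ge_2)
  qed
  ultimately show ?thesis
    using pois_recursion[OF rec geom_bounded_s, of z] by simp
qed

definition VP :: "real \<Rightarrow> real" where "VP z = pois s z - (pois m z)\<^sup>2"

text \<open>The variance of the indicator of at least two keys, plus twice its covariance with the
  total size of the two subtries. Those sizes vanish for fewer than two keys, so the covariance is
  \<open>(1 + z) * exp (- z)\<close> times their mean.\<close>

definition phi :: "real \<Rightarrow> real" where
  "phi z = (1 + z) * exp (- z) * (1 - (1 + z) * exp (- z))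
     + 2 * ((1 + z) * exp (- z)) * (pois m (p * z) + pois m (q * z))"

lemma VP_eq: "VP z = VP (p * z) + VP (q * z) + phi z"
proof -
  define A where "A = pois m (p * z)"
  define B where "B = pois m (q * z)"
  define g where "g = (1 + z) * exp (- z)"
  have m: "pois m z = A + B + (1 - g)"
    unfolding A_def B_def g_def by (rule pois_m_eq)
  have s: "pois s z = pois s (p * z) + pois s (q * z) + 2 * A * B + 2 * A + 2 * B + (1 - g)"
    unfolding A_def B_def g_def by (rule pois_s_eq)
  show ?thesis
    unfolding VP_def phi_def m s A_def[symmetric] B_def[symmetric] g_def[symmetric]
    by (simp add: power2_eq_square algebra_simps)
qed

text \<open>To the left of \<open>n\<close> every increment is at most
  \<open>K * ln (n + 1)\<close>. To the right the tangent of \<open>ln\<close> at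
  \<open>n + 1\<close> bounds the larger logarithms and causes the quadratic term.\<close>

lemma V_deviation: "\<exists>K>0. \<forall>i n. \<bar>V i - V n\<bar>
    \<le> K * ln (real n + 1) * \<bar>real i - real n\<bar> + K * (real i - real n)\<^sup>2 / real (Suc n)"
proof -
  obtain K where K: "K > 0" "\<And>n. \<bar>V (Suc n) - V n\<bar> \<le> K * ln (real n + 1)"
    using V_diff_bound by blast
  have tele: "\<bar>V j - V i\<bar> \<le> K * ln (real j + 1) * (real j - real i)" if "i \<le> j" for i j
    using that
  proof (induction j rule: dec_induct)
    case (step j)
    have "\<bar>V (Suc j) - V i\<bar> \<le> \<bar>V j - V i\<bar> + \<bar>V (Suc j) - V j\<bar>" by simp
    also have "\<dots> \<le> K * ln (real j + 1) * (real j - real i) + K * ln (real j + 1)"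
      using step K by (intro add_mono) auto
    also have "\<dots> = K * ln (real j + 1) * (real (Suc j) - real i)" by (simp add: algebra_simps)
    also have "\<dots> \<le> K * ln (real (Suc j) + 1) * (real (Suc j) - real i)"
      using K step by (intro mult_right_mono mult_left_mono ln_mono) auto
    finally show ?case .
  qed simp
  have "\<bar>V i - V n\<bar> \<le> K * ln (real n + 1) * \<bar>real i - real n\<bar> + K * (real i - real n)\<^sup>2 / real (Suc n)" for i n
  proof (cases "i \<le> n")
    case True
    then have "\<bar>V i - V n\<bar> \<le> K * ln (real n + 1) * \<bar>real i - real n\<bar>"
      using tele[of i n] by (simp add: abs_minus_commute)
    also have "\<dots> \<le> K * ln (real n + 1) * \<bar>real i - real n\<bar> + K * (real i - real n)\<^sup>2 / real (Suc n)"
      using K by simp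
    finally show ?thesis .
  next
    case False
    have "ln (real i + 1) - ln (real n + 1) = ln ((real i + 1) / (real n + 1))" by (simp add: ln_div)
    also have "\<dots> \<le> (real i + 1) / (real n + 1) - 1" by (intro ln_le_minus_one) auto
    also have "\<dots> = (real i - real n) / real (Suc n)" by (simp add: field_simps)
    finally have ln: "ln (real i + 1) \<le> ln (real n + 1) + (real i - real n) / real (Suc n)" by simp
    have "\<bar>V i - V n\<bar> \<le> K * ln (real i + 1) * (real i - real n)" using tele[of n i] False by simp
    also have "\<dots> \<le> K * (ln (real n + 1) + (real i - real n) / real (Suc n)) * (real i - real n)"
      using K False ln by (intro mult_right_mono mult_left_mono) auto
    also have "\<dots> = K * ln (real n + 1) * \<bar>real i - real n\<bar> + K * (real i - real n)\<^sup>2 / real (Suc n)"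
      using False by (simp add: power2_eq_square algebra_simps)
    finally show ?thesis .
  qed
  with K show ?thesis by blast
qed

text \<open>A second-order Taylor estimate by summation: a unit step changes the remainder by
  \<open>mu i - mu n\<close>, which \<open>mu_diff_bound\<close> makes linear in the
  distance.\<close>

lemma m_taylor:
  "\<bar>m i - m n - mu n * (real i - real n)\<bar> \<le> 4 / (p * q) / real (Suc n) * (real i - real n)\<^sup>2"
proof -
  define c where "c = 4 / (p * q) / real (Suc n)"
  have c: "0 \<le> c" using p_pos q_pos by (simp add: c_def)
  have mu: "\<bar>mu i - mu n\<bar> \<le> c * \<bar>real i - real n\<bar>" for i
    using mu_diff_bound[of i n] by (simp add: c_def)
  have "\<bar>m i - m n - mu n * (real i - real n)\<bar> \<le> c * (real i - real n)\<^sup>2"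
  proof (cases "n \<le> i")
    case True
    then show ?thesis
    proof (induction i rule: dec_induct)
      case (step i)
      have "m (Suc i) - m n - mu n * (real (Suc i) - real n)
          = (m i - m n - mu n * (real i - real n)) + (mu i - mu n)"
        by (simp add: mu_def algebra_simps)
      also have "\<bar>\<dots>\<bar> \<le> c * (real i - real n)\<^sup>2 + c * \<bar>real i - real n\<bar>"
        by (intro order.trans[OF abs_triangle_ineq] add_mono step mu)
      also have "\<dots> \<le> c * (real (Suc i) - real n)\<^sup>2"
        unfolding distrib_left[symmetric] using c step
        by (intro mult_left_mono) (auto simp: power2_eq_square algebra_simps)
      finally show ?case .
    qed simp
  next
    case False
    then have "i \<le> n" by simp
    then show ?thesis
    proof (induction i rule: inc_induct)
      case (step i)
      have "m i - m n - mu n * (real i - real n)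
          = (m (Suc i) - m n - mu n * (real (Suc i) - real n)) - (mu i - mu n)"
        by (simp add: mu_def algebra_simps)
      also have "\<bar>\<dots>\<bar> \<le> c * (real (Suc i) - real n)\<^sup>2 + c * \<bar>real i - real n\<bar>"
        by (intro order.trans[OF abs_triangle_ineq4] add_mono step mu)
      also have "\<dots> \<le> c * (real i - real n)\<^sup>2"
        unfolding distrib_left[symmetric]
      proof (intro mult_left_mono c)
        \<comment> \<open>The points are integers: for \<open>d = n - i \<ge> 1\<close> one has
          \<open>(d - 1)\<^sup>2 + d \<le> d\<^sup>2\<close>.\<close>
        have "real i + 1 \<le> real n" using step by linarith
        then show "(real (Suc i) - real n)\<^sup>2 + \<bar>real i - real n\<bar> \<le> (real i - real n)\<^sup>2"
          by (simp add: power2_eq_square algebra_simps)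
      qed
      finally show ?case .
    qed simp
  qed
  then show ?thesis by (simp add: c_def)
qed

text \<open>A Poisson(\<open>n\<close>) variable strays by order \<open>sqrt n\<close>, and
  \<open>V\<close> changes by order \<open>ln n\<close> per unit, so the error is negligible against
  \<open>n\<close>.\<close>

lemma pois_V_deviation: "\<exists>K>0. \<forall>n\<ge>1. \<bar>pois V (real n) - V n\<bar> \<le> K * (ln (real n + 1) * sqrt (real n) + 1)"
proof -
  obtain K where K: "K > 0" "\<And>i n. \<bar>V i - V n\<bar>
    \<le> K * ln (real n + 1) * \<bar>real i - real n\<bar> + K * (real i - real n)\<^sup>2 / real (Suc n)"
    using V_deviation by blast
  have "\<bar>pois V (real n) - V n\<bar> \<le> K * (ln (real n + 1) * sqrt (real n) + 1)" if n: "n \<ge> 1" for n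
  proof -
    have "pois V (real n) - V n = pois (\<lambda>i. V i - V n) (real n)" by (simp add: pois_diff)
    also have "\<bar>\<dots>\<bar> \<le> pois (\<lambda>i. \<bar>V i - V n\<bar>) (real n)"
      by (intro abs_pois_le geom_bounded_intros) auto
    also have "\<dots> \<le> pois (\<lambda>i. K * ln (real n + 1) * \<bar>real i - real n\<bar> + K * (real i - real n)\<^sup>2 / real (Suc n)) (real n)"
      by (intro pois_mono geom_bounded_intros K) auto
    also have "\<dots> = K * ln (real n + 1) * pois (\<lambda>i. \<bar>real i - real n\<bar>) (real n) + K * real n / real (Suc n)"
      by (subst pois_add pois_cmult pois_divide; (intro geom_bounded_intros)?)+
         (simp add: pois_central2)
    also have "\<dots> \<le> K * ln (real n + 1) * sqrt (real n) + K * 1"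
    proof (rule add_mono)
      show "K * ln (real n + 1) * pois (\<lambda>i. \<bar>real i - real n\<bar>) (real n) \<le> K * ln (real n + 1) * sqrt (real n)"
        using K n by (intro mult_left_mono pois_abs_central) auto
      show "K * real n / real (Suc n) \<le> K * 1" using K by (simp add: field_simps)
    qed
    finally show ?thesis by (simp add: algebra_simps)
  qed
  with K show ?thesis by blast
qed

text \<open>At a Poisson(\<open>n\<close>) variable \<open>N\<close>, write
  \<open>m N = m n + mu n * (N - n) + R\<close>. The linear part has variance
  \<open>n * (mu n)\<^sup>2\<close> and the remainder a bounded second moment, so the mixed term is
  of order at most \<open>sqrt n\<close>.\<close>

lemma pois_m_variance:
  "\<exists>C. \<forall>n\<ge>1. \<bar>pois (\<lambda>i. (m i)\<^sup>2) (real n) - (pois m (real n))\<^sup>2 - real n * (mu n)\<^sup>2\<bar> \<le> C * sqrt (real n)"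
proof -
  define c where "c = 1 / (p * q)"
  have c: "c > 0" using p_pos q_pos by (simp add: c_def)
  have "\<bar>pois (\<lambda>i. (m i)\<^sup>2) (real n) - (pois m (real n))\<^sup>2 - real n * (mu n)\<^sup>2\<bar>
      \<le> (c * (1 + 48 * c\<^sup>2) + 64 * c\<^sup>2) * sqrt (real n)" if n: "n \<ge> 1" for n
  proof -
    define d where "d i = real i - real n" for i
    define R where "R i = m i - m n - mu n * d i" for i
    have [simp]: "geom_bounded d" unfolding d_def by (intro geom_bounded_intros)
    have [simp]: "geom_bounded R" unfolding R_def by (intro geom_bounded_intros) auto
    have m_R: "m = (\<lambda>i. mu n * d i + R i + m n)" by (auto simp: R_def)
    have d1: "pois d (real n) = 0" unfolding d_def by (rule pois_central1)
    have d2: "pois (\<lambda>i. (d i)\<^sup>2) (real n) = real n" unfolding d_def by (rule pois_central2)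
    have d4: "pois (\<lambda>i. (d i) ^ 4) (real n) = 3 * (real n)\<^sup>2 + real n" unfolding d_def by (rule pois_central4)
    have R: "\<bar>R i\<bar> \<le> 4 * c / real (Suc n) * (d i)\<^sup>2" for i
      using m_taylor[of i n] by (simp add: R_def d_def c_def)
    have PR: "\<bar>pois R (real n)\<bar> \<le> 4 * c"
    proof -
      have "\<bar>pois R (real n)\<bar> \<le> pois (\<lambda>i. \<bar>R i\<bar>) (real n)" by (intro abs_pois_le) auto
      also have "\<dots> \<le> pois (\<lambda>i. 4 * c / real (Suc n) * (d i)\<^sup>2) (real n)"
        by (intro pois_mono R geom_bounded_intros) auto
      also have "\<dots> = 4 * c / real (Suc n) * real n"
        by (subst pois_cmult; (intro geom_bounded_intros)?) (simp_all add: d2)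
      also have "\<dots> \<le> 4 * c" using c by (simp add: field_simps)
      finally show ?thesis .
    qed
    have R2: "(R i)\<^sup>2 \<le> (4 * c / real (Suc n))\<^sup>2 * (d i) ^ 4" for i
    proof -
      have "\<bar>R i\<bar>\<^sup>2 \<le> (4 * c / real (Suc n) * (d i)\<^sup>2)\<^sup>2" using R[of i] by (intro power_mono) auto
      then show ?thesis by (simp only: power_mult_distrib power2_abs) (simp flip: power_mult)
    qed
    \<comment> \<open>The fourth central moment \<open>3 * n\<^sup>2 + n\<close> is at most
      \<open>3 * (n + 1)\<^sup>2\<close>, which cancels the denominator and leaves
      \<open>3 * 16 = 48\<close>.\<close>
    have PR2: "pois (\<lambda>i. (R i)\<^sup>2) (real n) \<le> 48 * c\<^sup>2"
    proof -
      have "pois (\<lambda>i. (R i)\<^sup>2) (real n) \<le> pois (\<lambda>i. (4 * c / real (Suc n))\<^sup>2 * (d i) ^ 4) (real n)"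
        by (intro pois_mono R2 geom_bounded_intros) auto
      also have "\<dots> = (4 * c / real (Suc n))\<^sup>2 * (3 * (real n)\<^sup>2 + real n)"
        by (subst pois_cmult; (intro geom_bounded_intros)?) (simp_all add: d4)
      also have "\<dots> \<le> (4 * c / real (Suc n))\<^sup>2 * (3 * (real (Suc n))\<^sup>2)"
        by (intro mult_left_mono) (auto simp: power2_eq_square algebra_simps)
      also have "\<dots> = 48 * c\<^sup>2" by (simp add: power_divide power_mult_distrib)
      finally show ?thesis .
    qed
    have PdR: "2 * \<bar>pois (\<lambda>i. d i * R i) (real n)\<bar> \<le> sqrt (real n) + sqrt (real n) * (48 * c\<^sup>2)"
    proof -
      have "2 * \<bar>pois (\<lambda>i. d i * R i) (real n)\<bar> \<le> 2 * pois (\<lambda>i. \<bar>d i * R i\<bar>) (real n)"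
        by (intro mult_left_mono abs_pois_le geom_bounded_intros) auto
      also have "\<dots> = pois (\<lambda>i. 2 * \<bar>d i * R i\<bar>) (real n)"
        by (intro pois_cmult[symmetric] geom_bounded_intros) auto
      \<comment> \<open>The weight \<open>sqrt n\<close> balances \<open>d\<close>, of order
        \<open>sqrt n\<close>, against \<open>R\<close>, of order 1.\<close>
      also have "\<dots> \<le> pois (\<lambda>i. (d i)\<^sup>2 / sqrt (real n) + sqrt (real n) * (R i)\<^sup>2) (real n)"
      proof (intro pois_mono geom_bounded_intros)
        fix i
        have "0 \<le> (\<bar>d i\<bar> - sqrt (real n) * \<bar>R i\<bar>)\<^sup>2 / sqrt (real n)" by simp
        also have "\<dots> = (d i)\<^sup>2 / sqrt (real n) + sqrt (real n) * (R i)\<^sup>2 - 2 * \<bar>d i * R i\<bar>"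
          using n by (simp add: power2_eq_square field_simps abs_mult)
        finally show "2 * \<bar>d i * R i\<bar> \<le> (d i)\<^sup>2 / sqrt (real n) + sqrt (real n) * (R i)\<^sup>2" by simp
      qed auto
      also have "\<dots> = real n / sqrt (real n) + sqrt (real n) * pois (\<lambda>i. (R i)\<^sup>2) (real n)"
        by (subst pois_add pois_cmult pois_divide; (intro geom_bounded_intros)?; simp?)+
           (simp add: d2)
      also have "\<dots> \<le> sqrt (real n) + sqrt (real n) * (48 * c\<^sup>2)"
        using PR2 by (intro add_mono mult_left_mono) (auto simp: real_div_sqrt)
      finally show ?thesis .
    qed
    have P1: "pois m (real n) = pois R (real n) + m n"
      by (subst m_R) (simp add: pois_add pois_cmult geom_bounded_intros d1)
    have "(\<lambda>i. (m i)\<^sup>2) = (\<lambda>i. (mu n)\<^sup>2 * (d i)\<^sup>2 + (2 * mu n) * (d i * R i) + (R i)\<^sup>2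
        + (2 * m n * mu n) * d i + (2 * m n) * R i + (m n)\<^sup>2)"
      by (rule ext, subst m_R) (simp add: power2_eq_square algebra_simps)
    then have "pois (\<lambda>i. (m i)\<^sup>2) (real n) = pois (\<lambda>i. (mu n)\<^sup>2 * (d i)\<^sup>2 + (2 * mu n) * (d i * R i) + (R i)\<^sup>2
        + (2 * m n * mu n) * d i + (2 * m n) * R i + (m n)\<^sup>2) (real n)" by (rule arg_cong)
    also have "\<dots> = (mu n)\<^sup>2 * real n + (2 * mu n) * pois (\<lambda>i. d i * R i) (real n)
        + pois (\<lambda>i. (R i)\<^sup>2) (real n) + (2 * m n) * pois R (real n) + (m n)\<^sup>2"
      by (simp add: pois_add pois_cmult geom_bounded_add geom_bounded_mult geom_bounded_power d1 d2)
    finally have "pois (\<lambda>i. (m i)\<^sup>2) (real n) - (pois m (real n))\<^sup>2 - real n * (mu n)\<^sup>2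
        = mu n * (2 * pois (\<lambda>i. d i * R i) (real n)) + (pois (\<lambda>i. (R i)\<^sup>2) (real n) - (pois R (real n))\<^sup>2)"
      unfolding P1 by (simp add: power2_eq_square algebra_simps)
    also have "\<bar>\<dots>\<bar> \<le> \<bar>mu n * (2 * pois (\<lambda>i. d i * R i) (real n))\<bar>
        + \<bar>pois (\<lambda>i. (R i)\<^sup>2) (real n) - (pois R (real n))\<^sup>2\<bar>" by (rule abs_triangle_ineq)
    also have "\<bar>mu n * (2 * pois (\<lambda>i. d i * R i) (real n))\<bar> \<le> c * (sqrt (real n) + sqrt (real n) * (48 * c\<^sup>2))"
      unfolding abs_mult using mu_nonneg[of n] mu_le[of n] PdR c
      by (intro mult_mono) (auto simp: c_def)
    also have "\<bar>pois (\<lambda>i. (R i)\<^sup>2) (real n) - (pois R (real n))\<^sup>2\<bar> \<le> 64 * c\<^sup>2"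
    proof -
      have *: "\<bar>x - y\<bar> \<le> 64 * e" if "0 \<le> x" "x \<le> 48 * e" "0 \<le> y" "y \<le> 16 * e" for x y e :: real
        using that by linarith
      have "\<bar>pois R (real n)\<bar>\<^sup>2 \<le> (4 * c)\<^sup>2" using PR by (intro power_mono) auto
      moreover have "0 \<le> pois (\<lambda>i. (R i)\<^sup>2) (real n)" by (intro pois_nonneg geom_bounded_power) auto
      ultimately show ?thesis using PR2 by (intro *) (auto simp: power_mult_distrib)
    qed
    also have "64 * c\<^sup>2 \<le> 64 * c\<^sup>2 * sqrt (real n)" using n c by simp
    finally show ?thesis by (simp add: algebra_simps)
  qed
  then show ?thesis by blast
qed

text \<open>Near \<open>n\<close>, \<open>mu\<close> changes by order \<open>1 / n\<close> per unit,
  over a range of order \<open>sqrt n\<close>. This lets the derivative of the Poissonized mean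
  replace \<open>mu n\<close>.\<close>

lemma pois_mu_deviation:
  assumes "n \<ge> 1"
  shows "\<bar>(pois mu (real n))\<^sup>2 - (mu n)\<^sup>2\<bar> \<le> 8 * (1 / (p * q))\<^sup>2 / sqrt (real n)"
proof -
  define c where "c = 1 / (p * q)"
  have c: "c > 0" using p_pos q_pos by (simp add: c_def)
  have "pois mu (real n) - mu n = pois (\<lambda>i. mu i - mu n) (real n)" by (simp add: pois_diff)
  also have "\<bar>\<dots>\<bar> \<le> pois (\<lambda>i. \<bar>mu i - mu n\<bar>) (real n)"
    by (intro abs_pois_le geom_bounded_intros) auto
  also have "\<dots> \<le> pois (\<lambda>i. 4 * c / real (Suc n) * \<bar>real i - real n\<bar>) (real n)"
    using mu_diff_bound[of _ n] by (intro pois_mono geom_bounded_intros) (auto simp: c_def)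
  also have "\<dots> = 4 * c / real (Suc n) * pois (\<lambda>i. \<bar>real i - real n\<bar>) (real n)"
    by (intro pois_cmult geom_bounded_intros)
  also have "\<dots> \<le> 4 * c / real (Suc n) * sqrt (real n)"
    using assms c by (intro mult_left_mono pois_abs_central) auto
  also have "\<dots> \<le> 4 * c / real n * sqrt (real n)"
    using assms c by (intro mult_right_mono divide_left_mono) auto
  also have "\<dots> = 4 * c / sqrt (real n)"
    using assms by (simp add: field_simps)
  finally have 1: "\<bar>pois mu (real n) - mu n\<bar> \<le> 4 * c / sqrt (real n)" .
  have "0 \<le> pois mu (real n)" by (intro pois_nonneg mu_nonneg) auto
  moreover have "pois mu (real n) \<le> pois (\<lambda>_. c) (real n)"
    using mu_le by (intro pois_mono) (auto simp: c_def)
  ultimately have 2: "\<bar>pois mu (real n) + mu n\<bar> \<le> 2 * c"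
    using mu_nonneg[of n] mu_le[of n] by (simp add: c_def)
  have "(pois mu (real n))\<^sup>2 - (mu n)\<^sup>2 = (pois mu (real n) - mu n) * (pois mu (real n) + mu n)"
    by (simp add: power2_eq_square algebra_simps)
  also have "\<bar>\<dots>\<bar> \<le> (4 * c / sqrt (real n)) * (2 * c)"
    unfolding abs_mult using 1 2 c by (intro mult_mono) auto
  finally show ?thesis by (simp add: c_def power2_eq_square mult_ac)
qed

text \<open>Total variance, conditioned on the Poisson number \<open>N\<close> of keys:
  \<open>VP n\<close> is the mean of \<open>V N\<close>, close to \<open>V n\<close>, plus the
  variance of \<open>m N\<close>, close to \<open>n * (mu n)\<^sup>2\<close>. The second part is the
  excess created by the random number of keys.\<close>

theorem depoissonization:
  "(\<lambda>n. V n / real n - (VP (real n) / real n - (pois mu (real n))\<^sup>2)) \<longlonglongrightarrow> 0"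
proof -
  obtain K where K: "K > 0" "\<And>n. n \<ge> 1 \<Longrightarrow> \<bar>pois V (real n) - V n\<bar> \<le> K * (ln (real n + 1) * sqrt (real n) + 1)"
    using pois_V_deviation by blast
  obtain C where C: "\<And>n. n \<ge> 1 \<Longrightarrow>
      \<bar>pois (\<lambda>i. (m i)\<^sup>2) (real n) - (pois m (real n))\<^sup>2 - real n * (mu n)\<^sup>2\<bar> \<le> C * sqrt (real n)"
    using pois_m_variance by blast
  define c where "c = 1 / (p * q)"
  define E where "E n = K * (ln (real n + 1) * sqrt (real n) + 1) / real n + C * sqrt (real n) / real n
      + 8 * c\<^sup>2 / sqrt (real n)" for n
  have bound: "\<bar>V n / real n - (VP (real n) / real n - (pois mu (real n))\<^sup>2)\<bar> \<le> E n" if n: "n \<ge> 1" for n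
  proof -
    define a where "a = pois V (real n) - V n"
    define b where "b = pois (\<lambda>i. (m i)\<^sup>2) (real n) - (pois m (real n))\<^sup>2 - real n * (mu n)\<^sup>2"
    define d where "d = (pois mu (real n))\<^sup>2 - (mu n)\<^sup>2"
    have "s = (\<lambda>i. V i + (m i)\<^sup>2)" by (auto simp: V_def)
    then have "pois s (real n) = pois (\<lambda>i. V i + (m i)\<^sup>2) (real n)" by (rule arg_cong)
    then have "pois s (real n) = pois V (real n) + pois (\<lambda>i. (m i)\<^sup>2) (real n)"
      by (simp add: pois_add geom_bounded_power)
    then have "VP (real n) = V n + a + b + real n * (mu n)\<^sup>2"
      by (simp add: VP_def a_def b_def)
    then have "V n / real n - (VP (real n) / real n - (pois mu (real n))\<^sup>2) = d - a / real n - b / real n"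
      using n by (simp add: d_def field_simps)
    also have "\<bar>\<dots>\<bar> \<le> \<bar>d\<bar> + \<bar>a\<bar> / real n + \<bar>b\<bar> / real n"
    proof -
      have "\<bar>d - a / real n - b / real n\<bar> \<le> \<bar>d\<bar> + \<bar>a / real n\<bar> + \<bar>b / real n\<bar>" by linarith
      then show ?thesis by simp
    qed
    also have "\<dots> \<le> 8 * c\<^sup>2 / sqrt (real n) + K * (ln (real n + 1) * sqrt (real n) + 1) / real n
        + C * sqrt (real n) / real n"
      using K(2)[OF n] C[OF n] pois_mu_deviation[OF n]
      by (intro add_mono divide_right_mono) (auto simp: a_def b_def d_def c_def)
    finally show ?thesis by (simp add: E_def)
  qed
  have "E \<longlonglongrightarrow> 0"
  proof -
    have "(\<lambda>n. (ln (real n + 1) * sqrt (real n) + 1) / real n) \<longlonglongrightarrow> 0"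
      "(\<lambda>n. sqrt (real n) / real n) \<longlonglongrightarrow> 0" "(\<lambda>n. 1 / sqrt (real n)) \<longlonglongrightarrow> 0"
      by real_asymp+
    from tendsto_add[OF tendsto_add[OF tendsto_mult_right_zero[OF this(1), of K]
        tendsto_mult_right_zero[OF this(2), of C]] tendsto_mult_right_zero[OF this(3), of "8 * c\<^sup>2"]]
    show ?thesis by (simp add: E_def[abs_def])
  qed
  then show ?thesis
  proof (rule Lim_null_comparison[rotated])
    show "\<forall>\<^sub>F n in sequentially.
        norm (V n / real n - (VP (real n) / real n - (pois mu (real n))\<^sup>2)) \<le> E n"
      unfolding real_norm_def by (rule eventually_sequentiallyI[of 1]) (rule bound)
  qed
qed

end

section \<open>The renewal equation\<close>

text \<open>The logistic density, which is the derivative of \<open>exp t / (1 + exp t)\<close>. It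
  decays exponentially on both sides and serves as common majorant of the tolls.\<close>

definition bump :: "real \<Rightarrow> real" where "bump t = exp t / (1 + exp t)\<^sup>2"

lemma bump_nonneg: "0 \<le> bump t" by (simp add: bump_def)

lemma bump_le_exp: "bump t \<le> exp t"
proof -
  have "1 \<le> (1 + exp t)\<^sup>2" by (rule one_le_power) simp
  moreover have "0 < (1 + exp t)\<^sup>2" by (intro zero_less_power add_pos_pos) auto
  ultimately show ?thesis by (simp add: bump_def divide_le_eq)
qed

lemma bump_le_exp_minus: "bump t \<le> exp (- t)"
proof -
  have "exp t * exp t \<le> (1 + exp t)\<^sup>2" unfolding power2_eq_square by (intro mult_mono) auto
  moreover have "0 < (1 + exp t)\<^sup>2" by (intro zero_less_power add_pos_pos) auto
  ultimately show ?thesis by (simp add: bump_def exp_minus field_simps)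
qed

lemma bump_le_exp_abs: "bump t \<le> exp (- \<bar>t\<bar>)"
  using bump_le_exp[of t] bump_le_exp_minus[of t] by (cases "t \<ge> 0") auto

lemma tendsto_bump_at_top: "(bump \<longlongrightarrow> 0) at_top"
proof (rule tendsto_sandwich[of "\<lambda>_. 0" _ _ "\<lambda>t. exp (- t)"])
  show "((\<lambda>t::real. exp (- t)) \<longlongrightarrow> 0) at_top"
    by (intro filterlim_compose[OF exp_at_bot] filterlim_uminus_at_bot_at_top)
qed (auto simp: bump_nonneg bump_le_exp_minus)

lemma continuous_on_locally_lipschitz:
  fixes f :: "real \<Rightarrow> real"
  assumes lip: "\<And>x y. \<bar>x - y\<bar> \<le> 1 \<Longrightarrow> \<bar>f x - f y\<bar> \<le> K * \<bar>x - y\<bar>"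
  shows "continuous_on S f"
  unfolding continuous_on_iff
proof (intro ballI allI impI)
  have K: "0 \<le> K" using lip[of 1 0] by (auto intro: order.trans[OF abs_ge_zero])
  fix x e :: real assume e: "e > 0"
  define d where "d = min 1 (e / (K + 1))"
  have d: "d > 0" "d \<le> 1" using e K by (auto simp: d_def)
  have "K * d \<le> K * (e / (K + 1))" using K by (intro mult_left_mono) (auto simp: d_def)
  also have "\<dots> < e" using e K by (simp add: field_simps)
  finally have Kd: "K * d < e" .
  show "\<exists>d>0. \<forall>x'\<in>S. dist x' x < d \<longrightarrow> dist (f x') (f x) < e"
  proof (intro exI[of _ d] conjI ballI impI d)
    fix x' assume *: "dist x' x < d"
    then have "\<bar>f x' - f x\<bar> \<le> K * \<bar>x' - x\<bar>"
      using d by (intro lip) (auto simp: dist_real_def)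
    also have "\<dots> \<le> K * d" using * K by (intro mult_left_mono) (auto simp: dist_real_def)
    finally show "dist (f x') (f x) < e" using Kd by (simp add: dist_real_def)
  qed
qed

context bernoulli_split
begin

definition A where "A = - ln p"
definition B where "B = - ln q"
text \<open>The mean shift in the renewal equation; it is the \<open>trie_h p\<close> of the
  statement.\<close>

definition entropy where "entropy = p * A + q * B"

lemma A_pos: "0 < A" and B_pos: "0 < B"
  using p_pos q_pos p_less1 q_less1 by (auto simp: A_def B_def)

lemma entropy_pos: "0 < entropy"
  using A_pos B_pos p_pos q_pos by (simp add: entropy_def add_pos_pos)

lemma exp_diff_A: "exp (t - A) = p * exp t" and exp_diff_B: "exp (t - B) = q * exp t"
  using p_pos q_pos by (simp_all add: A_def B_def exp_add)

text \<open>A bound \<open>\<epsilon>\<close> valid up to some point stays valid for a further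
  distance \<open>min A B\<close>, unchanged because \<open>p + q = 1\<close>, and so spreads over
  the whole line.\<close>

lemma renewal_comparison:
  assumes sub: "\<And>t. G t \<le> p * G (t - A) + q * G (t - B)"
    and lim: "\<And>\<epsilon>. \<epsilon> > 0 \<Longrightarrow> eventually (\<lambda>t. G t \<le> \<epsilon>) at_bot"
  shows "G t \<le> 0"
proof (rule field_le_epsilon)
  fix \<epsilon> :: real assume "\<epsilon> > 0"
  then obtain T where T: "\<And>t. t \<le> T \<Longrightarrow> G t \<le> \<epsilon>"
    using lim[of \<epsilon>] unfolding eventually_at_bot_linorder by blast
  define c where "c = min A B"
  have c: "c > 0" using A_pos B_pos by (simp add: c_def)
  have "\<forall>t \<le> T + real k * c. G t \<le> \<epsilon>" for k
  proof (induction k)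
    case (Suc k)
    show ?case
    proof (intro allI impI)
      fix t assume t: "t \<le> T + real (Suc k) * c"
      have "t - A \<le> T + real k * c" "t - B \<le> T + real k * c"
        using t by (auto simp: c_def algebra_simps)
      then have "p * G (t - A) + q * G (t - B) \<le> p * \<epsilon> + q * \<epsilon>"
        using Suc p_pos q_pos by (intro add_mono mult_left_mono) auto
      also have "\<dots> = \<epsilon>" by (simp add: distrib_right[symmetric] pq_sum)
      finally show "G t \<le> \<epsilon>" using sub[of t] by simp
    qed
  qed (use T in auto)
  moreover obtain k where "(t - T) / c \<le> real k" using real_arch_simple by blast
  then have "t \<le> T + real k * c" using c by (simp add: field_simps)
  ultimately show "G t \<le> 0 + \<epsilon>" by auto
qed

text \<open>With \<open>x = exp t\<close>, the function \<open>x / (1 + x)\<close> is a bounded supersolution of the renewal equation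
  whose defect dominates the bump.\<close>

lemma bump_supersolution:
  "2 * p * q * bump t + p * (exp (t - A) / (1 + exp (t - A))) + q * (exp (t - B) / (1 + exp (t - B)))
     \<le> exp t / (1 + exp t)"
proof -
  define x where "x = exp t"
  have x: "x > 0" by (simp add: x_def)
  have *: "u * (x / (1 + x)\<^sup>2) + v * x / (1 + v * x) \<le> x / (1 + x)" if "u + v = 1" "0 < u" "0 < v" for u v
  proof -
    have vx: "0 < v * x" "v * x \<le> x" using that x by auto
    have "x / (1 + x) - v * x / (1 + v * x) = u * x / ((1 + x) * (1 + v * x))"
    proof -
      have u: "u = 1 - v" using that by simp
      show ?thesis using x vx unfolding u by (simp add: field_simps)
    qed
    also have "\<dots> \<ge> u * x / ((1 + x) * (1 + x))"
      using that x vx by (intro divide_left_mono mult_left_mono mult_pos_pos) auto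
    finally show ?thesis by (simp add: power2_eq_square)
  qed
  have "p * (q * (x / (1 + x)\<^sup>2) + p * x / (1 + p * x)) + q * (p * (x / (1 + x)\<^sup>2) + q * x / (1 + q * x))
      \<le> p * (x / (1 + x)) + q * (x / (1 + x))"
    using *[of q p] *[of p q] pq_sum p_pos q_pos by (intro add_mono mult_left_mono) auto
  also have "\<dots> = x / (1 + x)" by (simp only: distrib_right[symmetric] pq_sum mult_1)
  finally show ?thesis
    unfolding bump_def exp_diff_A exp_diff_B x_def[symmetric] by (simp add: algebra_simps)
qed

text \<open>Both \<open>F\<close> and \<open>- F\<close> lie below \<open>C / (2 * p * q)\<close>
  times the supersolution \<open>exp t / (1 + exp t)\<close>, a factor less than 1.\<close>

lemma renewal_bound:
  assumes eq: "\<And>t. F t = \<Psi> t + p * F (t - A) + q * F (t - B)"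
    and lim: "(F \<longlongrightarrow> 0) at_bot"
    and toll: "\<And>t. \<bar>\<Psi> t\<bar> \<le> C * bump t"
  shows "\<bar>F t\<bar> \<le> C / (2 * p * q)"
proof -
  have C: "0 \<le> C"
    using toll[of 0] by (auto simp: bump_def zero_le_divide_iff zero_le_mult_iff intro: order.trans[OF abs_ge_zero])
  define U where "U t = C / (2 * p * q) * (exp t / (1 + exp t))" for t :: real
  have U_ge: "C * bump t + p * U (t - A) + q * U (t - B) \<le> U t" for t
  proof -
    define \<kappa> where "\<kappa> = C / (2 * p * q)"
    have \<kappa>: "0 \<le> \<kappa>" "C = \<kappa> * (2 * p * q)" using C p_pos q_pos by (auto simp: \<kappa>_def)
    have "\<kappa> * (2 * p * q * bump t + p * (exp (t - A) / (1 + exp (t - A)))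
        + q * (exp (t - B) / (1 + exp (t - B)))) \<le> \<kappa> * (exp t / (1 + exp t))"
      by (intro mult_left_mono bump_supersolution \<kappa>)
    then show ?thesis unfolding U_def \<kappa>_def[symmetric] \<kappa>(2) by (simp add: algebra_simps)
  qed
  have U0: "0 \<le> U t" for t using C p_pos q_pos by (simp add: U_def)
  have "\<epsilon> * F t - U t \<le> 0" if \<epsilon>: "\<bar>\<epsilon>\<bar> = 1" for \<epsilon> t
  proof (rule renewal_comparison[of "\<lambda>t. \<epsilon> * F t - U t"])
    fix t
    have "\<epsilon> * \<Psi> t \<le> \<bar>\<epsilon> * \<Psi> t\<bar>" by simp
    also have "\<dots> \<le> C * bump t" using \<epsilon> toll[of t] by (simp add: abs_mult)
    finally have "\<epsilon> * F t - U t \<le> C * bump t + \<epsilon> * (p * F (t - A) + q * F (t - B)) - U t"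
      by (subst eq) (simp add: algebra_simps)
    also have "\<dots> \<le> p * (\<epsilon> * F (t - A) - U (t - A)) + q * (\<epsilon> * F (t - B) - U (t - B))"
      using U_ge[of t] by (simp add: algebra_simps)
    finally show "\<epsilon> * F t - U t \<le> p * (\<epsilon> * F (t - A) - U (t - A)) + q * (\<epsilon> * F (t - B) - U (t - B))" .
  next
    fix e :: real assume "e > 0"
    then have "eventually (\<lambda>t. \<bar>F t\<bar> < e) at_bot"
      using lim by (auto simp: tendsto_iff dist_real_def)
    then show "eventually (\<lambda>t. \<epsilon> * F t - U t \<le> e) at_bot"
    proof eventually_elim
      case (elim t)
      have "\<epsilon> * F t \<le> \<bar>\<epsilon> * F t\<bar>" by simp
      also have "\<dots> \<le> e" using \<epsilon> elim by (simp add: abs_mult)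
      finally show ?case using U0[of t] by simp
    qed
  qed
  from this[of 1 t] this[of "-1" t] have "\<bar>F t\<bar> \<le> U t" by auto
  also have "U t \<le> C / (2 * p * q) * 1"
    unfolding U_def using C p_pos q_pos by (intro mult_left_mono) (auto simp: field_simps add_pos_pos)
  finally show ?thesis by simp
qed

end

text \<open>The Lipschitz condition on the toll carries the factor \<open>bump t\<close> so that the
  increments of \<open>F\<close> satisfy an equation of the same kind, with toll constant
  \<open>C * u\<close>.\<close>

locale renewal = bernoulli_split +
  fixes F \<Psi> :: "real \<Rightarrow> real" and C :: real
  assumes renewal_eq: "\<And>t. F t = \<Psi> t + p * F (t - A) + q * F (t - B)"
    and F_at_bot: "(F \<longlongrightarrow> 0) at_bot"
    and toll_bound: "\<And>t. \<bar>\<Psi> t\<bar> \<le> C * bump t"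
    and toll_lipschitz: "\<And>t u. 0 \<le> u \<Longrightarrow> u \<le> 1 \<Longrightarrow> \<bar>\<Psi> (t + u) - \<Psi> t\<bar> \<le> C * u * bump t"
begin

lemma C_nonneg: "0 \<le> C"
  using toll_bound[of 0] by (auto simp: bump_def zero_le_divide_iff zero_le_mult_iff intro: order.trans[OF abs_ge_zero])

lemma F_bounded: "\<bar>F t\<bar> \<le> C / (2 * p * q)"
  by (rule renewal_bound[OF renewal_eq F_at_bot toll_bound])

text \<open>The increment \<open>F (t + u) - F t\<close> solves the difference of the translated and
  the original equation, so \<open>renewal_bound\<close> applies to it.\<close>

lemma F_lipschitz: "0 \<le> u \<Longrightarrow> u \<le> 1 \<Longrightarrow> \<bar>F (t + u) - F t\<bar> \<le> C / (2 * p * q) * u"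
proof -
  assume u: "0 \<le> u" "u \<le> 1"
  have "\<bar>F (t + u) - F t\<bar> \<le> (C * u) / (2 * p * q)"
  proof (rule renewal_bound[of "\<lambda>t. F (t + u) - F t" "\<lambda>t. \<Psi> (t + u) - \<Psi> t"])
    fix t
    have "F (t + u) = \<Psi> (t + u) + p * F (t - A + u) + q * F (t - B + u)"
      using renewal_eq[of "t + u"] by (simp add: algebra_simps)
    then show "F (t + u) - F t = (\<Psi> (t + u) - \<Psi> t) + p * (F (t - A + u) - F (t - A)) + q * (F (t - B + u) - F (t - B))"
      using renewal_eq[of t] by (simp add: algebra_simps)
    show "\<bar>\<Psi> (t + u) - \<Psi> t\<bar> \<le> C * u * bump t" by (rule toll_lipschitz[OF u])
  next
    have "filterlim (\<lambda>t. t + u) at_bot at_bot"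
      unfolding filterlim_at_bot
    proof
      fix Z show "eventually (\<lambda>t. t + u \<le> Z) at_bot"
        using eventually_le_at_bot[of "Z - u"] by eventually_elim auto
    qed
    then have "((\<lambda>t. F (t + u) - F t) \<longlongrightarrow> 0 - 0) at_bot"
      by (intro tendsto_diff F_at_bot filterlim_compose[OF F_at_bot])
    then show "((\<lambda>t. F (t + u) - F t) \<longlongrightarrow> 0) at_bot" by simp
  qed
  then show ?thesis by simp
qed

lemma toll_at_top: "(\<Psi> \<longlongrightarrow> 0) at_top"
proof (rule Lim_null_comparison)
  show "((\<lambda>t. C * bump t) \<longlongrightarrow> 0) at_top"
    by (intro tendsto_mult_right_zero tendsto_bump_at_top)
qed (use toll_bound in auto)

lemma toll_continuous: "continuous_on S \<Psi>"
proof -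
  have b: "C * bump t \<le> C" for t
  proof -
    have "bump t \<le> exp (- \<bar>t\<bar>)" by (rule bump_le_exp_abs)
    also have "\<dots> \<le> 1" by simp
    finally show ?thesis using C_nonneg by (simp add: mult_left_le)
  qed
  have lip: "\<bar>\<Psi> t - \<Psi> u\<bar> \<le> C * \<bar>t - u\<bar>" if "\<bar>t - u\<bar> \<le> 1" for t u
  proof -
    have *: "\<bar>\<Psi> (t + u) - \<Psi> t\<bar> \<le> C * u" if "0 \<le> u" "u \<le> 1" for t u
    proof -
      have "\<bar>\<Psi> (t + u) - \<Psi> t\<bar> \<le> u * (C * bump t)" using toll_lipschitz[OF that] by (simp add: mult_ac)
      also have "\<dots> \<le> u * C" using b that by (intro mult_left_mono) auto
      finally show ?thesis by (simp add: mult.commute)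
    qed
    show ?thesis
      using *[of "t - u" u] *[of "u - t" t] that by (cases "u \<le> t") (auto simp: abs_minus_commute)
  qed
  show ?thesis by (rule continuous_on_locally_lipschitz[OF lip])
qed

lemma F_lipschitz': "\<bar>t - u\<bar> \<le> 1 \<Longrightarrow> \<bar>F t - F u\<bar> \<le> C / (2 * p * q) * \<bar>t - u\<bar>"
  using F_lipschitz[of "t - u" u] F_lipschitz[of "u - t" t]
  by (cases "u \<le> t") (auto simp: abs_minus_commute)

lemma F_continuous: "continuous_on S F"
  by (rule continuous_on_locally_lipschitz[OF F_lipschitz'])

end

section \<open>Values near the upper limit\<close>

lemma finite_limsup:
  fixes D :: "real \<Rightarrow> real"
  assumes bdd: "\<And>t. \<bar>D t\<bar> \<le> M"
  obtains L where "\<And>\<epsilon>. \<epsilon> > 0 \<Longrightarrow> eventually (\<lambda>t. D t \<le> L + \<epsilon>) at_top"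
    and "\<And>\<epsilon> T. \<epsilon> > 0 \<Longrightarrow> \<exists>t\<ge>T. D t \<ge> L - \<epsilon>"
proof -
  define Y where "Y = {y. eventually (\<lambda>t. D t \<le> y) at_top}"
  define L where "L = Inf Y"
  have "D t \<le> M" for t using bdd[of t] by linarith
  then have "M \<in> Y" by (simp add: Y_def)
  have "-M \<le> y" if y: "y \<in> Y" for y
  proof -
    obtain T where "\<And>t. t \<ge> T \<Longrightarrow> D t \<le> y"
      using y unfolding Y_def mem_Collect_eq eventually_at_top_linorder by blast
    then have "D T \<le> y" by simp
    with bdd[of T] show ?thesis by linarith
  qed
  then have below: "bdd_below Y" by (auto simp: bdd_below_def)
  show ?thesis
  proof
    fix \<epsilon> :: real assume \<epsilon>: "\<epsilon> > 0"
    then obtain y where y: "y \<in> Y" "y < L + \<epsilon>"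
      using cInf_lessD[of Y "L + \<epsilon>"] \<open>M \<in> Y\<close> by (auto simp: L_def)
    then have "eventually (\<lambda>t. D t \<le> y) at_top" by (simp add: Y_def)
    then show "eventually (\<lambda>t. D t \<le> L + \<epsilon>) at_top"
      by eventually_elim (use y in auto)
  next
    fix \<epsilon> T :: real assume \<epsilon>: "\<epsilon> > 0"
    show "\<exists>t\<ge>T. D t \<ge> L - \<epsilon>"
    proof (rule ccontr)
      assume "\<not> (\<exists>t\<ge>T. D t \<ge> L - \<epsilon>)"
      then have "\<forall>t\<ge>T. D t \<le> L - \<epsilon>" by (metis less_imp_le not_le)
      then have "L - \<epsilon> \<in> Y" by (auto simp: Y_def eventually_at_top_linorder)
      then have "L \<le> L - \<epsilon>" unfolding L_def using below by (intro cInf_lower)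
      with \<epsilon> show False by simp
    qed
  qed
qed

context bernoulli_split
begin

text \<open>A value of \<open>D\<close> that is close to the upper limit is a convex combination of earlier values (up to a
  vanishing toll), so these are close to the upper limit as well.\<close>

lemma limsup_propagation:
  assumes eq: "\<And>t. D t = \<Psi> t + p * D (t - A) + q * D (t - B)"
    and toll: "(\<Psi> \<longlongrightarrow> 0) at_top"
    and up: "\<And>\<epsilon>. \<epsilon> > 0 \<Longrightarrow> eventually (\<lambda>t. D t \<le> L + \<epsilon>) at_top"
    and \<epsilon>: "\<epsilon> > 0"
  shows "\<exists>\<delta>>0. \<exists>T. \<forall>t\<ge>T. D t \<ge> L - \<delta> \<longrightarrow> (\<forall>i j. i + j \<le> N \<longrightarrow> D (t - real i * A - real j * B) \<ge> L - \<epsilon>)"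
  using \<epsilon>
proof (induction N arbitrary: \<epsilon>)
  case 0
  then show ?case by (intro exI[of _ \<epsilon>]) auto
next
  case (Suc N)
  obtain \<delta> T where \<delta>: "\<delta> > 0" and T: "\<And>t i j. t \<ge> T \<Longrightarrow> D t \<ge> L - \<delta> \<Longrightarrow> i + j \<le> N \<Longrightarrow>
      D (t - real i * A - real j * B) \<ge> L - \<epsilon>"
    using Suc.IH[OF Suc.prems] by blast
  \<comment> \<open>Three errors of size \<open>\<gamma>\<close> have to fit into
    \<open>p * \<delta>\<close>: the distance of \<open>D t\<close> from \<open>L\<close>, the toll,
    and the excess of the other earlier value over \<open>L\<close>. The same holds with
    \<open>q\<close>.\<close>
  define \<gamma> where "\<gamma> = min \<epsilon> (\<delta> * min p q / 3)"
  have \<gamma>: "\<gamma> > 0" "\<gamma> \<le> \<epsilon>" "3 * \<gamma> \<le> p * \<delta>" "3 * \<gamma> \<le> q * \<delta>"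
  proof -
    show "\<gamma> > 0" "\<gamma> \<le> \<epsilon>" using Suc.prems \<delta> p_pos q_pos by (auto simp: \<gamma>_def)
    have "3 * \<gamma> \<le> \<delta> * min p q" by (simp add: \<gamma>_def)
    moreover have "\<delta> * min p q \<le> \<delta> * p" "\<delta> * min p q \<le> \<delta> * q" using \<delta> by (auto intro: mult_left_mono)
    ultimately show "3 * \<gamma> \<le> p * \<delta>" "3 * \<gamma> \<le> q * \<delta>" by (auto simp: mult.commute)
  qed
  obtain T1 where T1: "\<And>t. t \<ge> T1 \<Longrightarrow> D t \<le> L + \<gamma>"
    using up[OF \<gamma>(1)] unfolding eventually_at_top_linorder by blast
  have "eventually (\<lambda>t. \<bar>\<Psi> t\<bar> < \<gamma>) at_top" using toll \<gamma> by (auto simp: tendsto_iff dist_real_def)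
  then obtain T2 where T2: "\<And>t. t \<ge> T2 \<Longrightarrow> \<bar>\<Psi> t\<bar> < \<gamma>"
    unfolding eventually_at_top_linorder by blast
  define T' where "T' = max (max T T1) T2 + A + B"
  have main: "D (t - real i * A - real j * B) \<ge> L - \<epsilon>"
    if t: "t \<ge> T'" and D: "D t \<ge> L - \<gamma>" and ij: "i + j \<le> Suc N" for t i j
  proof -
    have ge: "t - A \<ge> T" "t - A \<ge> T1" "t - B \<ge> T" "t - B \<ge> T1" "t \<ge> T2"
      using t A_pos B_pos by (auto simp: T'_def)
    have ab: "D (t - A) \<le> L + \<gamma>" "D (t - B) \<le> L + \<gamma>" using T1 ge by auto
    have q: "q * D (t - B) \<le> q * L + \<gamma>" and p: "p * D (t - A) \<le> p * L + \<gamma>"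
    proof -
      have "q * D (t - B) \<le> q * (L + \<gamma>)" using ab q_pos by (intro mult_left_mono) auto
      also have "\<dots> \<le> q * L + \<gamma>" using \<gamma> q_less1 by (simp add: distrib_left mult_left_le_one_le q_pos less_imp_le)
      finally show "q * D (t - B) \<le> q * L + \<gamma>" .
      have "p * D (t - A) \<le> p * (L + \<gamma>)" using ab p_pos by (intro mult_left_mono) auto
      also have "\<dots> \<le> p * L + \<gamma>" using \<gamma> p_less1 by (simp add: distrib_left mult_left_le_one_le p_pos less_imp_le)
      finally show "p * D (t - A) \<le> p * L + \<gamma>" .
    qed
    have Lpq: "p * L + q * L = L" by (simp add: distrib_right[symmetric] pq_sum)
    have \<Psi>: "\<Psi> t \<le> \<gamma>" using T2[of t] ge by auto
    have "p * D (t - A) \<ge> p * (L - \<delta>)"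
      using eq[of t] D \<Psi> q Lpq \<gamma>(3) unfolding right_diff_distrib by linarith
    then have DA: "D (t - A) \<ge> L - \<delta>" using p_pos by simp
    have "q * D (t - B) \<ge> q * (L - \<delta>)"
      using eq[of t] D \<Psi> p Lpq \<gamma>(4) unfolding right_diff_distrib by linarith
    then have DB: "D (t - B) \<ge> L - \<delta>" using q_pos by simp
    show "D (t - real i * A - real j * B) \<ge> L - \<epsilon>"
    proof (cases i)
      case (Suc i')
      then show ?thesis using T[OF ge(1) DA, of i' j] ij by (simp add: algebra_simps)
    next
      case i: 0
      show ?thesis
      proof (cases j)
        case (Suc j')
        then show ?thesis using T[OF ge(3) DB, of i j'] ij i by (simp add: algebra_simps)
      next
        case 0
        then show ?thesis using i D \<gamma> by simp
      qed
    qed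
  qed
  then show ?case using \<gamma>(1) by blast
qed

text \<open>For \<open>s = t - K * j * B\<close> one has
  \<open>s - k * \<tau> = t - k * i * A - (K - k) * j * B\<close>, so every point of this
  progression is reached from \<open>t\<close> by at most \<open>K * (i + j)\<close> shifts. One
  value near the limit thus produces a whole window of them.\<close>

lemma limsup_window:
  assumes eq: "\<And>t. D t = \<Psi> t + p * D (t - A) + q * D (t - B)"
    and toll: "(\<Psi> \<longlongrightarrow> 0) at_top"
    and up: "\<And>\<epsilon>. \<epsilon> > 0 \<Longrightarrow> eventually (\<lambda>t. D t \<le> L + \<epsilon>) at_top"
    and freq: "\<And>\<epsilon> T. \<epsilon> > 0 \<Longrightarrow> \<exists>t\<ge>T. D t \<ge> L - \<epsilon>"
    and \<tau>: "\<tau> = real i * A - real j * B"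
    and \<epsilon>: "\<epsilon> > 0"
  shows "\<exists>s\<ge>T. \<forall>k\<le>K. D (s - real k * \<tau>) \<ge> L - \<epsilon>"
proof -
  obtain \<delta> T1 where \<delta>: "\<delta> > 0" and T1: "\<And>t i' j'. t \<ge> T1 \<Longrightarrow> D t \<ge> L - \<delta> \<Longrightarrow> i' + j' \<le> K * (i + j) \<Longrightarrow>
      D (t - real i' * A - real j' * B) \<ge> L - \<epsilon>"
    using limsup_propagation[OF eq toll up \<epsilon>, of "K * (i + j)"] by blast
  obtain t where t: "t \<ge> max T1 (T + real (K * j) * B)" "D t \<ge> L - \<delta>"
    using freq[OF \<delta>] by blast
  show ?thesis
  proof (intro exI[of _ "t - real (K * j) * B"] conjI allI impI)
    show "T \<le> t - real (K * j) * B" using t by simp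
    fix k assume k: "k \<le> K"
    have "k * i + (K - k) * j \<le> K * i + K * j" using k by (intro add_mono mult_right_mono) auto
    then have "D (t - real (k * i) * A - real ((K - k) * j) * B) \<ge> L - \<epsilon>"
      using T1[of t "k * i" "(K - k) * j"] t by (simp add: algebra_simps)
    then show "D (t - real (K * j) * B - real k * \<tau>) \<ge> L - \<epsilon>"
      using k by (simp add: \<tau> of_nat_diff algebra_simps)
  qed
qed

text \<open>The progression with difference \<open>d\<close> contains every point that occurs in the
  conserved sum. If \<open>L\<close> were positive, this sum would come near or above
  \<open>w * L\<close> at arbitrarily late times, against its limit 0.\<close>

theorem renewal_upper_lattice:
  assumes eq: "\<And>t. D t = \<Psi> t + p * D (t - A) + q * D (t - B)"
    and toll: "(\<Psi> \<longlongrightarrow> 0) at_top"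
    and bdd: "\<And>t. \<bar>D t\<bar> \<le> M"
    and d: "0 < d" "A = real r * d" "B = real l * d" "coprime r l"
    and conserved: "((\<lambda>t. p * (\<Sum>k<r. D (t - real k * d)) + q * (\<Sum>k<l. D (t - real k * d))) \<longlongrightarrow> 0) at_top"
    and e: "e > 0"
  shows "eventually (\<lambda>t. D t \<le> e) at_top"
proof -
  obtain L where up: "\<And>\<epsilon>. \<epsilon> > 0 \<Longrightarrow> eventually (\<lambda>t. D t \<le> L + \<epsilon>) at_top"
    and freq: "\<And>\<epsilon> T. \<epsilon> > 0 \<Longrightarrow> \<exists>t\<ge>T. D t \<ge> L - \<epsilon>"
    by (rule finite_limsup[of D, OF bdd]) (rule that; assumption)
  have r: "r \<noteq> 0" using A_pos d(2) by (intro notI) simp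
  \<comment> \<open>Bezout with nonnegative \<open>u\<close> and \<open>v\<close>: the lattice step
    \<open>d\<close> is itself a combination \<open>u * A - v * B\<close>.\<close>
  obtain u v where "r * u = l * v + gcd r l" using bezout_nat[OF r] by blast
  then have uv: "real r * real u = real l * real v + 1"
    using d(4) by (metis coprime_imp_gcd_eq_1 of_nat_1 of_nat_add of_nat_mult)
  have "real u * A - real v * B = (real r * real u - real l * real v) * d"
    unfolding d(2,3) by (simp add: algebra_simps)
  then have \<tau>: "d = real u * A - real v * B" using uv by simp
  define w where "w = p * real r + q * real l"
  have w: "w > 0" using p_pos q_pos r by (simp add: w_def add_pos_nonneg)
  have "L \<le> 0"
  proof (rule field_le_epsilon)
    fix \<epsilon> :: real assume "\<epsilon> > 0"
    \<comment> \<open>The window gives \<open>w * (L - \<gamma>) \<le> \<gamma>\<close>, that is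
      \<open>L \<le> \<gamma> * (1 + 1 / w)\<close>, and the right-hand side is to equal
      \<open>\<epsilon>\<close>.\<close>
    define \<gamma> where "\<gamma> = \<epsilon> / (1 + 1 / w)"
    have \<gamma>: "\<gamma> > 0" using \<open>\<epsilon> > 0\<close> w by (simp add: \<gamma>_def add_pos_pos)
    let ?Q = "\<lambda>t. p * (\<Sum>k<r. D (t - real k * d)) + q * (\<Sum>k<l. D (t - real k * d))"
    have "eventually (\<lambda>t. \<bar>?Q t\<bar> < \<gamma>) at_top"
      using conserved \<gamma> by (auto simp: tendsto_iff dist_real_def)
    then obtain T where T: "\<And>t. t \<ge> T \<Longrightarrow> \<bar>?Q t\<bar> < \<gamma>" unfolding eventually_at_top_linorder by blast
    obtain s where s: "s \<ge> T" "\<And>k. k \<le> max r l \<Longrightarrow> D (s - real k * d) \<ge> L - \<gamma>"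
      using limsup_window[OF eq toll up freq \<tau> \<gamma>, of T "max r l"] by blast
    have "w * (L - \<gamma>) = p * (\<Sum>k<r. L - \<gamma>) + q * (\<Sum>k<l. L - \<gamma>)" by (simp add: w_def algebra_simps)
    also have "\<dots> \<le> ?Q s"
      using s p_pos q_pos by (intro add_mono mult_left_mono sum_mono) auto
    also have "\<dots> \<le> \<gamma>" using T[OF s(1)] by simp
    finally have "L \<le> \<gamma> * (1 + 1 / w)" using w by (simp add: field_simps)
    also have "\<dots> = \<epsilon>"
    proof -
      have "1 + 1 / w > 0" using w by (simp add: add_pos_pos)
      then show ?thesis by (simp add: \<gamma>_def)
    qed
    finally show "L \<le> 0 + \<epsilon>" by simp
  qed
  then show ?thesis using up[OF e] by (auto elim!: eventually_mono)
qed

text \<open>Kronecker's theorem puts the fractional part of \<open>k * (A / B)\<close> below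
  \<open>\<eta> / B\<close>; irrationality keeps it positive.\<close>

lemma small_positive_combination:
  assumes "A / B \<notin> \<rat>" "\<eta> > 0"
  obtains i j :: nat where "0 < real i * A - real j * B" "real i * A - real j * B < \<eta>"
proof -
  obtain k :: nat where k: "k > 0" "\<bar>frac (real k * (A / B)) - 0\<bar> < \<eta> / B"
    using Kronecker_approx_1_explicit[OF assms(1), of 0 "\<eta> / B"] assms(2) B_pos by auto
  have "real k * (A / B) \<notin> \<int>"
  proof
    assume "real k * (A / B) \<in> \<int>"
    then have "real k * (A / B) / real k \<in> \<rat>" by (intro Rats_divide) (auto elim!: Ints_cases)
    with k assms show False by simp
  qed
  then have pos: "0 < frac (real k * (A / B))" by simp
  have fl: "0 \<le> \<lfloor>real k * (A / B)\<rfloor>" using A_pos B_pos by simp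
  define j where "j = nat \<lfloor>real k * (A / B)\<rfloor>"
  have "real k * A - real j * B = B * frac (real k * (A / B))"
    using fl B_pos by (simp add: j_def frac_def field_simps)
  moreover have "0 < B * frac (real k * (A / B))" "B * frac (real k * (A / B)) < \<eta>"
    using pos k B_pos by (auto simp: field_simps)
  ultimately show ?thesis using that[of k j] by simp
qed

text \<open>Points of spacing \<open>\<tau> < \<gamma>\<close> run through a window of length
  \<open>max A B\<close>, and the Lipschitz constant bridges the gaps. So \<open>D\<close> is
  bounded below by nearly \<open>L\<close> on the whole range of the conserved integrals, which
  forces \<open>L \<le> 0\<close>.\<close>

theorem renewal_upper_nonlattice:
  assumes eq: "\<And>t. D t = \<Psi> t + p * D (t - A) + q * D (t - B)"
    and toll: "(\<Psi> \<longlongrightarrow> 0) at_top"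
    and bdd: "\<And>t. \<bar>D t\<bar> \<le> M"
    and lip: "\<And>t u. \<bar>t - u\<bar> \<le> 1 \<Longrightarrow> \<bar>D t - D u\<bar> \<le> \<Lambda> * \<bar>t - u\<bar>"
    and cont: "continuous_on UNIV D"
    and irr: "A / B \<notin> \<rat>"
    and conserved: "((\<lambda>t. p * integral {t - A..t} D + q * integral {t - B..t} D) \<longlongrightarrow> 0) at_top"
    and e: "e > 0"
  shows "eventually (\<lambda>t. D t \<le> e) at_top"
proof -
  obtain L where up: "\<And>\<epsilon>. \<epsilon> > 0 \<Longrightarrow> eventually (\<lambda>t. D t \<le> L + \<epsilon>) at_top"
    and freq: "\<And>\<epsilon> T. \<epsilon> > 0 \<Longrightarrow> \<exists>t\<ge>T. D t \<ge> L - \<epsilon>"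
    by (rule finite_limsup[of D, OF bdd]) (rule that; assumption)
  have "0 \<le> \<Lambda>" using lip[of 1 0] by (auto intro: order.trans[OF abs_ge_zero])
  have "L \<le> 0"
  proof (rule field_le_epsilon)
    fix \<epsilon> :: real assume "\<epsilon> > 0"
    define \<gamma> where "\<gamma> = \<epsilon> / (1 + \<Lambda> + 1 / entropy)"
    have den: "1 + \<Lambda> + 1 / entropy > 0" using entropy_pos \<open>0 \<le> \<Lambda>\<close> by (simp add: add_pos_pos add_pos_nonneg)
    have \<gamma>: "\<gamma> > 0" using \<open>\<epsilon> > 0\<close> den by (simp add: \<gamma>_def)
    obtain i j :: nat where ij: "0 < real i * A - real j * B" "real i * A - real j * B < min 1 \<gamma>"
      using small_positive_combination[OF irr, of "min 1 \<gamma>"] \<gamma> by auto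
    define \<tau> where "\<tau> = real i * A - real j * B"
    have \<tau>: "0 < \<tau>" "\<tau> < 1" "\<tau> < \<gamma>" using ij by (auto simp: \<tau>_def)
    obtain K where K: "max A B / \<tau> \<le> real K" using real_arch_simple by blast
    let ?Q = "\<lambda>t. p * integral {t - A..t} D + q * integral {t - B..t} D"
    have "eventually (\<lambda>t. \<bar>?Q t\<bar> < \<gamma>) at_top"
      using conserved \<gamma> by (auto simp: tendsto_iff dist_real_def)
    then obtain T where T: "\<And>t. t \<ge> T \<Longrightarrow> \<bar>?Q t\<bar> < \<gamma>" unfolding eventually_at_top_linorder by blast
    obtain s where s: "s \<ge> T" "\<And>k. k \<le> K \<Longrightarrow> D (s - real k * \<tau>) \<ge> L - \<gamma>"
      using limsup_window[OF eq toll up freq \<tau>_def \<gamma>, of T K] by blast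
    have low: "D x \<ge> L - \<gamma> - \<Lambda> * \<gamma>" if x: "s - max A B \<le> x" "x \<le> s" for x
    proof -
      define k where "k = nat \<lfloor>(s - x) / \<tau>\<rfloor>"
      have fl: "0 \<le> \<lfloor>(s - x) / \<tau>\<rfloor>" using x \<tau> by simp
      have "real k = of_int \<lfloor>(s - x) / \<tau>\<rfloor>" using fl by (simp add: k_def)
      then have k: "real k \<le> (s - x) / \<tau>" "(s - x) / \<tau> < real k + 1" by linarith+
      have "(s - x) / \<tau> \<le> max A B / \<tau>" using x \<tau> by (intro divide_right_mono) auto
      then have "real k \<le> real K" using k K by linarith
      then have 1: "D (s - real k * \<tau>) \<ge> L - \<gamma>" using s by simp
      have "\<bar>(s - real k * \<tau>) - x\<bar> \<le> \<tau>" using k \<tau> by (simp add: field_simps abs_le_iff)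
      then have "\<bar>D (s - real k * \<tau>) - D x\<bar> \<le> \<Lambda> * \<bar>(s - real k * \<tau>) - x\<bar>"
        using \<tau> by (intro lip) auto
      also have "\<dots> \<le> \<Lambda> * \<gamma>" using \<open>\<bar>(s - real k * \<tau>) - x\<bar> \<le> \<tau>\<close> \<tau> \<open>0 \<le> \<Lambda>\<close>
        by (intro mult_left_mono) auto
      finally show ?thesis using 1 by linarith
    qed
    have int_low: "c * (L - \<gamma> - \<Lambda> * \<gamma>) \<le> integral {s - c..s} D" if c: "0 < c" "c \<le> max A B" for c
    proof -
      have "integral {s - c..s} (\<lambda>_. L - \<gamma> - \<Lambda> * \<gamma>) \<le> integral {s - c..s} D"
        using c low by (intro integral_le integrable_continuous_interval continuous_on_subset[OF cont]) auto
      then show ?thesis using c by simp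
    qed
    have "entropy * (L - \<gamma> - \<Lambda> * \<gamma>) = p * (A * (L - \<gamma> - \<Lambda> * \<gamma>)) + q * (B * (L - \<gamma> - \<Lambda> * \<gamma>))"
      by (simp add: entropy_def algebra_simps)
    also have "\<dots> \<le> ?Q s"
      using A_pos B_pos p_pos q_pos by (intro add_mono mult_left_mono int_low) auto
    also have "\<dots> \<le> \<gamma>" using T[OF s(1)] by simp
    finally have "L \<le> \<gamma> * (1 + \<Lambda> + 1 / entropy)" using entropy_pos by (simp add: field_simps)
    also have "\<dots> = \<epsilon>" using den by (simp add: \<gamma>_def)
    finally show "L \<le> 0 + \<epsilon>" by simp
  qed
  then show ?thesis using up[OF e] by (auto elim!: eventually_mono)
qed

end


section \<open>Sums over the integers and the conserved integral\<close>

lemma has_sum_int_split: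
  fixes f :: "int \<Rightarrow> 'a::banach"
  assumes "summable (\<lambda>n. norm (f (int n)))" "summable (\<lambda>n. norm (f (- int (Suc n))))"
  shows "(f has_sum ((\<Sum>n. f (int n)) + (\<Sum>n. f (- int (Suc n))))) UNIV"
proof -
  have "((\<lambda>n. f (int n)) has_sum (\<Sum>n. f (int n))) UNIV"
    by (rule norm_summable_imp_has_sum[OF assms(1) summable_sums[OF summable_norm_cancel[OF assms(1)]]])
  then have 1: "(f has_sum (\<Sum>n. f (int n))) (range int)"
    by (subst has_sum_reindex) (auto simp: o_def)
  have "((\<lambda>n. f (- int (Suc n))) has_sum (\<Sum>n. f (- int (Suc n)))) UNIV"
    by (rule norm_summable_imp_has_sum[OF assms(2) summable_sums[OF summable_norm_cancel[OF assms(2)]]])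
  then have 2: "(f has_sum (\<Sum>n. f (- int (Suc n)))) (range (\<lambda>n. - int (Suc n)))"
    by (subst has_sum_reindex) (auto simp: o_def inj_def)
  have "x \<in> range int \<union> range (\<lambda>n. - int (Suc n))" for x
    by (cases x rule: int_cases) auto
  then have "range int \<union> range (\<lambda>n. - int (Suc n)) = UNIV" by blast
  then show ?thesis
    using has_sum_Un_disjoint[OF 1 2] by fastforce
qed

lemma abs_summable_on_int_split:
  fixes f :: "int \<Rightarrow> 'a::banach"
  assumes "summable (\<lambda>n. norm (f (int n)))" "summable (\<lambda>n. norm (f (- int (Suc n))))"
  shows "f abs_summable_on UNIV"
  using has_sum_int_split[of "\<lambda>k. norm (f k)"] assms by (auto simp: summable_on_def)

text \<open>\<open>exp t / (1 + exp t)\<close> is an antiderivative with limits 0 and 1.\<close>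

lemma integrable_bump: "integrable lborel bump"
proof -
  have pos: "1 + exp t > 0" for t :: real by (simp add: add_pos_pos)
  have "((\<lambda>t::real. exp t / (1 + exp t)) \<longlongrightarrow> 0) at_bot"
  proof -
    have "((\<lambda>t::real. exp t / (1 + exp t)) \<longlongrightarrow> 0 / (1 + 0)) at_bot"
      by (intro tendsto_intros exp_at_bot) auto
    then show ?thesis by simp
  qed
  then have 1: "(((\<lambda>t::real. exp t / (1 + exp t)) \<circ> real_of_ereal) \<longlongrightarrow> 0) (at_right (-\<infinity>))"
    by (simp add: ereal_tendsto_simps)
  have "((\<lambda>t::real. 1 - exp t / (1 + exp t)) \<longlongrightarrow> 0) at_top"
  proof (rule tendsto_sandwich[of "\<lambda>_. 0" _ _ "\<lambda>t. exp (- t)"])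
    show "((\<lambda>t::real. exp (- t)) \<longlongrightarrow> 0) at_top"
      by (intro filterlim_compose[OF exp_at_bot] filterlim_uminus_at_bot_at_top)
    have "1 - exp t / (1 + exp t) \<le> exp (- t)" for t :: real
    proof -
      have "1 - exp t / (1 + exp t) = 1 / (1 + exp t)" using pos[of t] by (simp add: field_simps)
      also have "\<dots> \<le> 1 / exp t" using pos[of t] by (intro divide_left_mono) (auto intro: mult_pos_pos)
      finally show ?thesis by (simp add: exp_minus inverse_eq_divide)
    qed
    then show "eventually (\<lambda>t::real. 1 - exp t / (1 + exp t) \<le> exp (- t)) at_top" by simp
    show "eventually (\<lambda>t::real. 0 \<le> 1 - exp t / (1 + exp t)) at_top"
      using pos by (simp add: field_simps)
  qed auto
  from tendsto_diff[OF tendsto_const[of 1] this]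
  have 2: "(((\<lambda>t::real. exp t / (1 + exp t)) \<circ> real_of_ereal) \<longlongrightarrow> 1) (at_left \<infinity>)"
    by (simp add: ereal_tendsto_simps)
  have "set_integrable lborel (einterval (-\<infinity>) \<infinity>) bump"
  proof (rule interval_integral_FTC_nonneg(1)[OF _ _ _ _ 1 2])
    fix x :: real
    show "DERIV (\<lambda>t. exp t / (1 + exp t)) x :> bump x"
      using pos[of x] by (auto intro!: derivative_eq_intros simp: bump_def power2_eq_square field_simps)
    show "isCont bump x" unfolding bump_def using pos[of x] by (intro continuous_intros) auto
  qed (auto simp: bump_nonneg)
  then show ?thesis by (simp add: set_integrable_def)
qed

context renewal
begin

lemma toll_integrable: "integrable lborel \<Psi>"
proof (rule Bochner_Integration.integrable_bound[of lborel "\<lambda>t. C * bump t"])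
  show "\<Psi> \<in> borel_measurable lborel"
    using toll_continuous[of UNIV] by (simp add: borel_measurable_continuous_onI)
  show "AE t in lborel. norm (\<Psi> t) \<le> norm (C * bump t)"
    using toll_bound C_nonneg bump_nonneg by (auto simp: abs_mult)
qed (intro integrable_mult_right integrable_bump)

text \<open>When the renewal equation is integrated over \<open>{u..t}\<close> and the shifted terms
  are translated, the common parts cancel with weights \<open>p\<close> and \<open>q\<close>; only
  the windows at both ends remain.\<close>

lemma conserved_increment:
  assumes "u \<le> t"
  shows "(p * integral {t - A..t} F + q * integral {t - B..t} F)
    - (p * integral {u - A..u} F + q * integral {u - B..u} F) = integral {u..t} \<Psi>"
proof -
  have int: "F integrable_on {a..b}" for a b by (intro integrable_continuous_interval F_continuous)
  have shift: "integral {u..t} (\<lambda>x. F (x - c)) = integral {u - c..t - c} F" for c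
  proof -
    have "(F has_integral integral {u - c..t - c} F) (cbox (u - c) (t - c))"
      using integrable_integral[OF int[of "u - c" "t - c"]] by (simp add: cbox_interval)
    from has_integral_affinity[OF this, of 1 "- c"]
    have "((\<lambda>x. F (x - c)) has_integral integral {u - c..t - c} F) ((\<lambda>x. x + c) ` {u - c..t - c})"
      by (simp add: cbox_interval)
    then show ?thesis by (simp add: integral_unique)
  qed
  have window: "integral {u..t} F - integral {u - c..t - c} F = integral {t - c..t} F - integral {u - c..u} F"
    if c: "0 < c" for c
  proof -
    have "integral {u - c..t - c} F + integral {t - c..t} F = integral {u - c..t} F"
      using c assms by (intro Henstock_Kurzweil_Integration.integral_combine int) auto
    moreover have "integral {u - c..u} F + integral {u..t} F = integral {u - c..t} F"
      using c assms by (intro Henstock_Kurzweil_Integration.integral_combine int) auto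
    ultimately show ?thesis by linarith
  qed
  have int': "(\<lambda>x. F (x - c)) integrable_on {u..t}" for c
    by (intro integrable_continuous_interval continuous_on_compose2[OF F_continuous[of UNIV]] continuous_intros) auto
  have int\<Psi>: "\<Psi> integrable_on {u..t}" by (intro integrable_continuous_interval toll_continuous)
  have "integral {u..t} F = integral {u..t} (\<lambda>x. \<Psi> x + p * F (x - A) + q * F (x - B))"
    by (intro integral_cong renewal_eq)
  also have "\<dots> = integral {u..t} \<Psi> + p * integral {u..t} (\<lambda>x. F (x - A)) + q * integral {u..t} (\<lambda>x. F (x - B))"
    by (rule integral_unique) (intro has_integral_add has_integral_mult_right integrable_integral int\<Psi> int')
  finally have "integral {u..t} F = integral {u..t} \<Psi> + p * integral {u - A..t - A} F + q * integral {u - B..t - B} F"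
    by (simp add: shift)
  moreover have "p * integral {u..t} F + q * integral {u..t} F = integral {u..t} F"
    by (simp only: distrib_right[symmetric] pq_sum mult_1)
  moreover have "p * (integral {u..t} F - integral {u - A..t - A} F) = p * (integral {t - A..t} F - integral {u - A..u} F)"
    "q * (integral {u..t} F - integral {u - B..t - B} F) = q * (integral {t - B..t} F - integral {u - B..u} F)"
    using window A_pos B_pos by auto
  ultimately show ?thesis unfolding right_diff_distrib by linarith
qed

text \<open>The windows contribute nothing at minus infinity, where \<open>F\<close> vanishes, so
  the increments from there add up to the integral of the toll.\<close>

lemma conserved_limit:
  "((\<lambda>t. p * integral {t - A..t} F + q * integral {t - B..t} F) \<longlongrightarrow> (\<integral>t. \<Psi> t \<partial>lborel)) at_top"
proof -
  define I where "I t = p * integral {t - A..t} F + q * integral {t - B..t} F" for t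
  have I_bot: "(I \<longlongrightarrow> 0) at_bot"
    unfolding tendsto_iff dist_real_def
  proof (intro allI impI)
    fix e :: real assume e: "e > 0"
    define \<gamma> where "\<gamma> = e / (2 * entropy)"
    have \<gamma>: "\<gamma> > 0" using e entropy_pos by (simp add: \<gamma>_def)
    have "eventually (\<lambda>t. \<bar>F t\<bar> < \<gamma>) at_bot" using F_at_bot \<gamma> by (auto simp: tendsto_iff dist_real_def)
    then obtain T where T: "\<And>t. t \<le> T \<Longrightarrow> \<bar>F t\<bar> < \<gamma>" unfolding eventually_at_bot_linorder by blast
    have bnd: "\<bar>integral {t - c..t} F\<bar> \<le> \<gamma> * c" if "t \<le> T" "0 < c" for t c
    proof -
      have "norm (integral {t - c..t} F) \<le> \<gamma> * (t - (t - c))"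
        using that T by (intro integral_bound F_continuous) (auto intro: less_imp_le)
      then show ?thesis by simp
    qed
    have "\<bar>I t - 0\<bar> < e" if t: "t \<le> T" for t
    proof -
      have "\<bar>I t\<bar> \<le> p * \<bar>integral {t - A..t} F\<bar> + q * \<bar>integral {t - B..t} F\<bar>"
        unfolding I_def using p_pos q_pos by (intro order.trans[OF abs_triangle_ineq]) (simp add: abs_mult)
      also have "\<dots> \<le> p * (\<gamma> * A) + q * (\<gamma> * B)"
        using t bnd A_pos B_pos p_pos q_pos by (intro add_mono mult_left_mono) auto
      also have "\<dots> = \<gamma> * entropy" by (simp add: entropy_def algebra_simps)
      also have "\<dots> < e" using e entropy_pos by (simp add: \<gamma>_def)
      finally show ?thesis by simp
    qed
    then show "eventually (\<lambda>t. \<bar>I t - 0\<bar> < e) at_bot" unfolding eventually_at_bot_linorder by blast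
  qed
  \<comment> \<open>Symmetric intervals send one end to each infinity, so a single limit handles
    \<open>I t - I (- t)\<close>.\<close>
  have "((\<lambda>t. \<integral>x. indicator {-t..t} x *\<^sub>R \<Psi> x \<partial>lborel) \<longlongrightarrow> (\<integral>x. \<Psi> x \<partial>lborel)) at_top"
  proof (rule integral_dominated_convergence_at_top[where w = "\<lambda>x. norm (\<Psi> x)"])
    show "AE x in lborel. ((\<lambda>t. indicator {-t..t} x *\<^sub>R \<Psi> x) \<longlongrightarrow> \<Psi> x) at_top"
    proof (rule AE_I2)
      fix x
      have "eventually (\<lambda>t. indicator {-t..t} x *\<^sub>R \<Psi> x = \<Psi> x) at_top"
        using eventually_ge_at_top[of "\<bar>x\<bar>"] by eventually_elim (auto simp: indicator_def)
      then show "((\<lambda>t. indicator {-t..t} x *\<^sub>R \<Psi> x) \<longlongrightarrow> \<Psi> x) at_top" by (rule tendsto_eventually)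
    qed
  qed (use toll_integrable in \<open>auto simp: indicator_def intro!: always_eventually\<close>)
  moreover have "eventually (\<lambda>t. (\<integral>x. indicator {-t..t} x *\<^sub>R \<Psi> x \<partial>lborel) = I t - I (- t)) at_top"
    using eventually_ge_at_top[of 0]
  proof eventually_elim
    case (elim t)
    have "set_integrable lborel {-t..t} \<Psi>"
      unfolding set_integrable_def by (intro integrable_mult_indicator toll_integrable) auto
    from set_borel_integral_eq_integral(2)[OF this]
    have "(\<integral>x. indicator {-t..t} x *\<^sub>R \<Psi> x \<partial>lborel) = integral {-t..t} \<Psi>"
      unfolding set_lebesgue_integral_def .
    then show ?case using conserved_increment[of "- t" t] elim by (simp add: I_def)
  qed
  ultimately have "((\<lambda>t. I t - I (- t)) \<longlongrightarrow> (\<integral>x. \<Psi> x \<partial>lborel)) at_top"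
    by (rule Lim_transform_eventually)
  moreover have "((\<lambda>t. I (- t)) \<longlongrightarrow> 0) at_top"
    by (intro filterlim_compose[OF I_bot] filterlim_uminus_at_bot_at_top)
  ultimately have "((\<lambda>t. (I t - I (- t)) + I (- t)) \<longlongrightarrow> (\<integral>x. \<Psi> x \<partial>lborel) + 0) at_top"
    by (rule tendsto_add)
  then show ?thesis by (simp add: I_def)
qed

text \<open>A constant \<open>H\<close> solves the homogeneous equation and has conserved quantity
  \<open>entropy * H\<close>. The chosen value makes the conserved quantity of \<open>F - H\<close>
  tend to 0, and the upper estimate is applied with both signs.\<close>

theorem renewal_nonlattice:
  assumes "A / B \<notin> \<rat>"
  shows "(F \<longlongrightarrow> (\<integral>t. \<Psi> t \<partial>lborel) / entropy) at_top"
proof -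
  define H where "H = (\<integral>t. \<Psi> t \<partial>lborel) / entropy"
  have pqH: "p * H + q * H = H" by (simp only: distrib_right[symmetric] pq_sum mult_1)
  have upper: "eventually (\<lambda>t. \<epsilon> * (F t - H) \<le> e) at_top" if \<epsilon>: "\<bar>\<epsilon>\<bar> = 1" and e: "e > 0" for \<epsilon> e
  proof (rule renewal_upper_nonlattice[where \<Psi> = "\<lambda>t. \<epsilon> * \<Psi> t" and D = "\<lambda>t. \<epsilon> * (F t - H)"
        and M = "C / (2 * p * q) + \<bar>H\<bar>" and \<Lambda> = "C / (2 * p * q)"])
    fix t
    show "\<epsilon> * (F t - H) = \<epsilon> * \<Psi> t + p * (\<epsilon> * (F (t - A) - H)) + q * (\<epsilon> * (F (t - B) - H))"
      by (subst renewal_eq, subst (1) pqH[symmetric]) (simp add: algebra_simps)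
    have "\<bar>\<epsilon> * (F t - H)\<bar> = \<bar>F t - H\<bar>" using \<epsilon> by (simp add: abs_mult)
    also have "\<dots> \<le> \<bar>F t\<bar> + \<bar>H\<bar>" by (rule abs_triangle_ineq4)
    finally show "\<bar>\<epsilon> * (F t - H)\<bar> \<le> C / (2 * p * q) + \<bar>H\<bar>" using F_bounded[of t] by linarith
    fix u assume "\<bar>t - u\<bar> \<le> 1"
    moreover have "\<epsilon> * (F t - H) - \<epsilon> * (F u - H) = \<epsilon> * (F t - F u)" by (simp add: algebra_simps)
    ultimately show "\<bar>\<epsilon> * (F t - H) - \<epsilon> * (F u - H)\<bar> \<le> C / (2 * p * q) * \<bar>t - u\<bar>"
      using F_lipschitz'[of t u] \<epsilon> by (simp add: abs_mult)
  next
    show "((\<lambda>t. \<epsilon> * \<Psi> t) \<longlongrightarrow> 0) at_top" by (intro tendsto_mult_right_zero toll_at_top)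
    show "continuous_on UNIV (\<lambda>t. \<epsilon> * (F t - H))" by (intro continuous_intros F_continuous)
    have int: "F integrable_on {a..b}" for a b by (intro integrable_continuous_interval F_continuous)
    have part: "integral {t - c..t} (\<lambda>t. \<epsilon> * (F t - H)) = \<epsilon> * (integral {t - c..t} F - c * H)" if "0 < c" for t c
    proof -
      have "integral {t - c..t} (\<lambda>t. F t - H) = integral {t - c..t} F - integral {t - c..t} (\<lambda>_. H)"
        by (intro integral_diff int integrable_const_ivl)
      then show ?thesis using that by simp
    qed
    have "(p * integral {t - A..t} (\<lambda>t. \<epsilon> * (F t - H)) + q * integral {t - B..t} (\<lambda>t. \<epsilon> * (F t - H)))
        = \<epsilon> * ((p * integral {t - A..t} F + q * integral {t - B..t} F) - entropy * H)" for t
      unfolding part[OF A_pos] part[OF B_pos] entropy_def by (simp add: algebra_simps)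
    moreover have "((\<lambda>t. \<epsilon> * ((p * integral {t - A..t} F + q * integral {t - B..t} F) - entropy * H))
        \<longlongrightarrow> \<epsilon> * ((\<integral>t. \<Psi> t \<partial>lborel) - entropy * H)) at_top"
      by (intro tendsto_intros conserved_limit)
    ultimately show "((\<lambda>t. p * integral {t - A..t} (\<lambda>t. \<epsilon> * (F t - H))
        + q * integral {t - B..t} (\<lambda>t. \<epsilon> * (F t - H))) \<longlongrightarrow> 0) at_top"
      using entropy_pos by (simp add: H_def)
  qed (use assms e in auto)
  have "(F \<longlongrightarrow> H) at_top"
    unfolding tendsto_iff dist_real_def
  proof (intro allI impI)
    fix e :: real assume "e > 0"
    then have "eventually (\<lambda>t. 1 * (F t - H) \<le> e / 2) at_top" "eventually (\<lambda>t. -1 * (F t - H) \<le> e / 2) at_top"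
      by (intro upper; simp)+
    then show "eventually (\<lambda>t. \<bar>F t - H\<bar> < e) at_top"
      by eventually_elim (use \<open>e > 0\<close> in \<open>auto simp: abs_if\<close>)
  qed
  then show ?thesis by (simp add: H_def)
qed


section \<open>Periodization and the lattice limit\<close>

lemma toll_shift_bound:
  assumes "0 < d"
  shows "\<bar>\<Psi> (t - of_int k * d)\<bar> \<le> C * exp \<bar>t\<bar> * exp (- (d * of_int \<bar>k\<bar>))"
proof -
  have "\<bar>\<Psi> (t - of_int k * d)\<bar> \<le> C * bump (t - of_int k * d)" by (rule toll_bound)
  also have "\<dots> \<le> C * exp (- \<bar>t - of_int k * d\<bar>)"
    by (intro mult_left_mono bump_le_exp_abs C_nonneg)
  also have "\<dots> \<le> C * exp (\<bar>t\<bar> + - (d * of_int \<bar>k\<bar>))"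
  proof (intro mult_left_mono C_nonneg)
    have "\<bar>of_int k * d\<bar> = d * of_int \<bar>k\<bar>" using assms by (simp add: abs_mult)
    then show "exp (- \<bar>t - of_int k * d\<bar>) \<le> exp (\<bar>t\<bar> + - (d * of_int \<bar>k\<bar>))"
      unfolding exp_le_cancel_iff by linarith
  qed
  finally show ?thesis by (simp only: exp_add mult.assoc)
qed

lemma toll_shift_nat:
  assumes "0 < d"
  shows "\<bar>\<Psi> (t - of_int (int n) * d)\<bar> \<le> C * exp \<bar>t\<bar> * exp (- d) ^ n"
    and "\<bar>\<Psi> (t - of_int (- int (Suc n)) * d)\<bar> \<le> C * exp \<bar>t\<bar> * exp (- d) ^ n"
proof -
  have e: "exp (- d) ^ n = exp (- (d * real n))" for n
    by (simp add: exp_of_nat_mult[symmetric] mult.commute)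
  show "\<bar>\<Psi> (t - of_int (int n) * d)\<bar> \<le> C * exp \<bar>t\<bar> * exp (- d) ^ n"
    using toll_shift_bound[OF assms, of t "int n"] by (simp add: e)
  have "\<bar>\<Psi> (t - of_int (- int (Suc n)) * d)\<bar> \<le> C * exp \<bar>t\<bar> * exp (- d) ^ Suc n"
    using toll_shift_bound[OF assms, of t "- int (Suc n)"] unfolding e by (simp del: of_nat_Suc)
  also have "\<dots> \<le> C * exp \<bar>t\<bar> * exp (- d) ^ n"
    using assms C_nonneg by (intro mult_left_mono power_decreasing) auto
  finally show "\<bar>\<Psi> (t - of_int (- int (Suc n)) * d)\<bar> \<le> C * exp \<bar>t\<bar> * exp (- d) ^ n" .
qed

lemma summable_toll_shift:
  assumes "0 < d"
  shows "summable (\<lambda>n. norm (\<Psi> (t - of_int (int n) * d)))"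
    and "summable (\<lambda>n. norm (\<Psi> (t - of_int (- int (Suc n)) * d)))"
proof -
  have g: "summable (\<lambda>n. C * exp \<bar>t\<bar> * exp (- d) ^ n)"
    using assms by (intro summable_mult summable_geometric) auto
  show "summable (\<lambda>n. norm (\<Psi> (t - of_int (int n) * d)))"
    by (rule summable_comparison_test'[OF g]) (use toll_shift_nat(1)[OF assms] in auto)
  show "summable (\<lambda>n. norm (\<Psi> (t - of_int (- int (Suc n)) * d)))"
    by (rule summable_comparison_test'[OF g]) (use toll_shift_nat(2)[OF assms] in simp)
qed

text \<open>Its period \<open>d\<close> makes it invariant under the shifts \<open>A\<close> and
  \<open>B\<close> whenever these are multiples of \<open>d\<close>; it then solves the homogeneous
  equation.\<close>

definition periodization :: "real \<Rightarrow> real \<Rightarrow> real" where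
  "periodization d t = (\<Sum>\<^sub>\<infinity>k::int. \<Psi> (t - of_int k * d))"

lemma has_sum_periodization:
  assumes "0 < d"
  shows "((\<lambda>k::int. \<Psi> (t - of_int k * d)) has_sum periodization d t) UNIV"
    and "periodization d t = (\<Sum>n. \<Psi> (t - of_int (int n) * d)) + (\<Sum>n. \<Psi> (t - of_int (- int (Suc n)) * d))"
proof -
  note hs = has_sum_int_split[of "\<lambda>k. \<Psi> (t - of_int k * d)", OF summable_toll_shift[OF assms]]
  show "periodization d t = (\<Sum>n. \<Psi> (t - of_int (int n) * d)) + (\<Sum>n. \<Psi> (t - of_int (- int (Suc n)) * d))"
    unfolding periodization_def by (rule infsumI[OF hs])
  with hs show "((\<lambda>k::int. \<Psi> (t - of_int k * d)) has_sum periodization d t) UNIV" by simp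
qed

lemma periodization_shift: "periodization d (t - of_int j * d) = periodization d t"
proof -
  have "periodization d (t - of_int j * d) = (\<Sum>\<^sub>\<infinity>k::int. \<Psi> (t - of_int (k + j) * d))"
    unfolding periodization_def by (simp add: algebra_simps)
  also have "\<dots> = periodization d t"
    unfolding periodization_def
    by (rule infsum_reindex_bij_witness[of _ "\<lambda>k. k - j" "\<lambda>k. k + j"]) auto
  finally show ?thesis .
qed

text \<open>By periodicity \<open>t\<close> can be moved into \<open>{0..d}\<close>, where the
  geometric bounds on the shifted tolls are uniform.\<close>

lemma periodization_bounded:
  assumes "0 < d"
  shows "\<exists>M. \<forall>t. \<bar>periodization d t\<bar> \<le> M"
proof -
  define G where "G = (\<Sum>n. C * exp d * exp (- d) ^ n)"
  have g: "summable (\<lambda>n. C * exp d * exp (- d) ^ n)"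
    using assms by (intro summable_mult summable_geometric) auto
  have "\<bar>periodization d t\<bar> \<le> G + G" for t
  proof -
    define u where "u = t - of_int \<lfloor>t / d\<rfloor> * d"
    have "of_int \<lfloor>t / d\<rfloor> * d \<le> t / d * d" "t / d * d \<le> (of_int \<lfloor>t / d\<rfloor> + 1) * d"
      using assms by (intro mult_right_mono; linarith)+
    then have u: "0 \<le> u" "u \<le> d" using assms by (auto simp: u_def algebra_simps)
    have le: "C * exp \<bar>u\<bar> * exp (- d) ^ n \<le> C * exp d * exp (- d) ^ n" for n
      using u C_nonneg by (intro mult_right_mono mult_left_mono) auto
    have 1: "\<bar>\<Sum>n. \<Psi> (u - of_int (int n) * d)\<bar> \<le> G"
    proof -
      have "\<bar>\<Sum>n. \<Psi> (u - of_int (int n) * d)\<bar> \<le> (\<Sum>n. norm (\<Psi> (u - of_int (int n) * d)))"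
        using summable_norm[OF summable_toll_shift(1)[OF assms, of u]] by simp
      also have "\<dots> \<le> G" unfolding G_def
        by (intro suminf_le g summable_toll_shift assms)
           (use order.trans[OF toll_shift_nat(1)[OF assms] le] in simp)
      finally show ?thesis .
    qed
    have 2: "\<bar>\<Sum>n. \<Psi> (u - of_int (- int (Suc n)) * d)\<bar> \<le> G"
    proof -
      have "\<bar>\<Sum>n. \<Psi> (u - of_int (- int (Suc n)) * d)\<bar> \<le> (\<Sum>n. norm (\<Psi> (u - of_int (- int (Suc n)) * d)))"
        using summable_norm[OF summable_toll_shift(2)[OF assms, of u]] by simp
      also have "\<dots> \<le> G" unfolding G_def
      proof (intro suminf_le g summable_toll_shift assms)
        fix n show "norm (\<Psi> (u - of_int (- int (Suc n)) * d)) \<le> C * exp d * exp (- d) ^ n"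
          unfolding real_norm_def by (rule order.trans[OF toll_shift_nat(2)[OF assms] le])
      qed
      finally show ?thesis .
    qed
    have "\<bar>periodization d u\<bar> \<le> G + G"
      unfolding has_sum_periodization(2)[OF assms]
      by (rule order.trans[OF abs_triangle_ineq add_mono[OF 1 2]])
    then show ?thesis unfolding u_def periodization_shift .
  qed
  then show ?thesis by blast
qed

text \<open>The discrete conserved quantity \<open>Q F\<close> collects the toll at
  \<open>t\<close>, \<open>t - d\<close>, \<open>t - 2 * d\<close> and so on. For the periodic
  solution \<open>H\<close> it is the full two-sided sum, so \<open>Q F - Q H\<close> is minus the
  sum over later lattice points, which vanishes as \<open>t\<close> grows.\<close>

theorem renewal_lattice:
  assumes d: "0 < d" "A = real r * d" "B = real l * d" "coprime r l"
  shows "((\<lambda>t. F t - d / entropy * periodization d t) \<longlongrightarrow> 0) at_top"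
proof -
  define H where "H t = d / entropy * periodization d t" for t
  define w where "w = p * real r + q * real l"
  have ent: "entropy = w * d" by (simp add: entropy_def w_def d algebra_simps)
  have w: "w > 0" using entropy_pos d(1) by (simp add: ent zero_less_mult_iff)
  have H_shift: "H (t - of_int j * d) = H t" for t j by (simp add: H_def periodization_shift)
  have H_shift_nat: "H (t - real j * d) = H t" for t j using H_shift[of t "int j"] by simp
  have pqH: "p * H (t - A) + q * H (t - B) = H t" for t
    unfolding d H_shift_nat by (simp only: distrib_right[symmetric] pq_sum mult_1)
  define Q where "Q f t = p * (\<Sum>k<r. f (t - real k * d)) + q * (\<Sum>k<l. f (t - real k * d))" for f and t :: real
  have tele: "(\<Sum>k<n. f (t - real k * d)) - (\<Sum>k<n. f (t - d - real k * d)) = f t - f (t - real n * d)"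
    for n t and f :: "real \<Rightarrow> real"
    by (induction n) (auto simp: algebra_simps)
  have Q_step: "Q F t - Q F (t - d) = \<Psi> t" for t
  proof -
    have "Q F t - Q F (t - d) = p * (F t - F (t - real r * d)) + q * (F t - F (t - real l * d))"
      unfolding Q_def tele[symmetric] by (simp add: algebra_simps)
    also have "\<dots> = (p + q) * F t - p * F (t - A) - q * F (t - B)"
      unfolding d by (simp add: algebra_simps)
    finally show ?thesis using renewal_eq[of t] by (simp add: pq_sum)
  qed
  have Q_sum: "(\<Sum>n<N. \<Psi> (t - real n * d)) = Q F t - Q F (t - real N * d)" for N t
  proof (induction N)
    case (Suc N)
    then show ?case using Q_step[of "t - real N * d"] by (simp add: algebra_simps)
  qed simp
  have Q_sums: "(\<lambda>n. \<Psi> (t - real n * d)) sums Q F t" for t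
  proof -
    have lim: "filterlim (\<lambda>N. t - real N * d - c) at_bot sequentially" for c
      using d(1) by real_asymp
    have "(\<lambda>N. Q F (t - real N * d)) \<longlonglongrightarrow> p * (\<Sum>k<r. 0) + q * (\<Sum>k<l. 0)"
      unfolding Q_def by (intro tendsto_intros filterlim_compose[OF F_at_bot] lim)
    then have "(\<lambda>N. Q F t - Q F (t - real N * d)) \<longlonglongrightarrow> Q F t - 0"
      by (intro tendsto_intros) simp
    then show ?thesis unfolding sums_def Q_sum by simp
  qed
  \<comment> \<open>The relation \<open>entropy = w * d\<close> is what fixes the factor
    \<open>d / entropy\<close> in \<open>H\<close>.\<close>
  have Q_H: "Q H t = periodization d t" for t
  proof -
    have "Q H t = w * H t" unfolding Q_def H_shift_nat by (simp add: w_def algebra_simps)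
    then show ?thesis using w d(1) by (simp add: H_def ent)
  qed
  define R where "R t = (\<Sum>n. \<Psi> (t - of_int (- int (Suc n)) * d))" for t
  have Q_D: "Q F t - Q H t = - R t" for t
    using sums_unique[OF Q_sums[of t]] has_sum_periodization(2)[OF d(1), of t]
    unfolding Q_H R_def by simp
  have R: "(R \<longlongrightarrow> 0) at_top"
  proof (rule Lim_null_comparison)
    define G where "G = (\<Sum>n. C * exp (- d) ^ n)"
    have g: "summable (\<lambda>n. C * exp (- d) ^ n)"
      using d(1) by (intro summable_mult summable_geometric) auto
    have term_le: "norm (\<Psi> (t - of_int (- int (Suc n)) * d)) \<le> C * exp (- d) ^ n * exp (- t)" for n t
    proof -
      have "norm (\<Psi> (t - of_int (- int (Suc n)) * d)) \<le> C * bump (t - of_int (- int (Suc n)) * d)"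
        unfolding real_norm_def by (rule toll_bound)
      also have "\<dots> \<le> C * exp (- (t - of_int (- int (Suc n)) * d))"
        by (intro mult_left_mono bump_le_exp_minus C_nonneg)
      also have "\<dots> \<le> C * exp (- (d * real n) + - t)"
        using d(1) C_nonneg by (intro mult_left_mono) (auto simp: algebra_simps)
      also have "\<dots> = C * exp (- d) ^ n * exp (- t)"
        unfolding exp_add by (simp add: exp_of_nat_mult[symmetric] mult.commute[of d])
      finally show ?thesis .
    qed
    have "norm (R t) \<le> G * exp (- t)" for t
    proof -
      have "norm (R t) \<le> (\<Sum>n. norm (\<Psi> (t - of_int (- int (Suc n)) * d)))"
        unfolding R_def by (rule summable_norm[OF summable_toll_shift(2)[OF d(1)]])
      also have "\<dots> \<le> (\<Sum>n. C * exp (- d) ^ n * exp (- t))"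
        by (intro suminf_le term_le summable_toll_shift d summable_mult2 g)
      also have "\<dots> = G * exp (- t)" unfolding G_def by (intro suminf_mult2[symmetric] g)
      finally show ?thesis .
    qed
    then show "eventually (\<lambda>t. norm (R t) \<le> G * exp (- t)) at_top" by simp
    have "((\<lambda>t::real. exp (- t)) \<longlongrightarrow> 0) at_top"
      by (intro filterlim_compose[OF exp_at_bot] filterlim_uminus_at_bot_at_top)
    then show "((\<lambda>t. G * exp (- t)) \<longlongrightarrow> 0) at_top" by (rule tendsto_mult_right_zero)
  qed
  obtain M where M: "\<And>t. \<bar>periodization d t\<bar> \<le> M" using periodization_bounded[OF d(1)] by blast
  have upper: "eventually (\<lambda>t. \<epsilon> * (F t - H t) \<le> e) at_top" if \<epsilon>: "\<bar>\<epsilon>\<bar> = 1" and e: "e > 0" for \<epsilon> e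
  proof (rule renewal_upper_lattice[where \<Psi> = "\<lambda>t. \<epsilon> * \<Psi> t" and D = "\<lambda>t. \<epsilon> * (F t - H t)"
        and M = "C / (2 * p * q) + d / entropy * M", OF _ _ _ d])
    fix t
    show "\<epsilon> * (F t - H t) = \<epsilon> * \<Psi> t + p * (\<epsilon> * (F (t - A) - H (t - A))) + q * (\<epsilon> * (F (t - B) - H (t - B)))"
      by (subst renewal_eq, subst (1) pqH[symmetric]) (simp add: algebra_simps)
    have "\<bar>\<epsilon> * (F t - H t)\<bar> = \<bar>F t - H t\<bar>" using \<epsilon> by (simp add: abs_mult)
    also have "\<dots> \<le> \<bar>F t\<bar> + \<bar>H t\<bar>" by (rule abs_triangle_ineq4)
    also have "\<bar>H t\<bar> \<le> d / entropy * M"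
      unfolding H_def abs_mult using d entropy_pos M[of t]
      by (intro mult_mono) (auto simp: abs_of_pos)
    finally show "\<bar>\<epsilon> * (F t - H t)\<bar> \<le> C / (2 * p * q) + d / entropy * M" using F_bounded[of t] by linarith
  next
    show "((\<lambda>t. \<epsilon> * \<Psi> t) \<longlongrightarrow> 0) at_top" by (intro tendsto_mult_right_zero toll_at_top)
    have "p * (\<Sum>k<r. \<epsilon> * (F (t - real k * d) - H (t - real k * d)))
        + q * (\<Sum>k<l. \<epsilon> * (F (t - real k * d) - H (t - real k * d))) = \<epsilon> * (- R t)" for t
      unfolding Q_D[symmetric] Q_def sum_distrib_left[symmetric] sum_subtractf by (simp add: algebra_simps)
    moreover have "((\<lambda>t. \<epsilon> * (- R t)) \<longlongrightarrow> \<epsilon> * (- 0)) at_top" by (intro tendsto_intros R)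
    ultimately show "((\<lambda>t. p * (\<Sum>k<r. \<epsilon> * (F (t - real k * d) - H (t - real k * d)))
        + q * (\<Sum>k<l. \<epsilon> * (F (t - real k * d) - H (t - real k * d)))) \<longlongrightarrow> 0) at_top" by simp
  qed (use e in auto)
  have "((\<lambda>t. F t - H t) \<longlongrightarrow> 0) at_top"
    unfolding tendsto_iff dist_real_def
  proof (intro allI impI)
    fix e :: real assume "e > 0"
    then have "eventually (\<lambda>t. 1 * (F t - H t) \<le> e / 2) at_top" "eventually (\<lambda>t. -1 * (F t - H t) \<le> e / 2) at_top"
      by (intro upper; simp)+
    then show "eventually (\<lambda>t. \<bar>F t - H t - 0\<bar> < e) at_top"
      by eventually_elim (use \<open>e > 0\<close> in \<open>auto simp: abs_if\<close>)
  qed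
  then show ?thesis by (simp add: H_def)
qed

end

section \<open>Poisson summation\<close>

lemma periodic_shift_int:
  assumes per: "\<And>x::real. f (x + 1) = f x"
  shows "f (x + of_int k) = f x"
proof -
  have nat: "f (x + real n) = f x" for n x
  proof (induction n)
    case (Suc n)
    have "f (x + real (Suc n)) = f ((x + real n) + 1)" by (simp add: algebra_simps)
    then show ?case using per[of "x + real n"] Suc by simp
  qed simp
  show ?thesis
  proof (cases k rule: int_cases2)
    case (nonneg n)
    then show ?thesis using nat[of x n] by simp
  next
    case (nonpos n)
    then show ?thesis using nat[of "x - real n" n] by simp
  qed
qed

text \<open>Only the fractional part of \<open>a\<close> matters, and the piece that leaves
  \<open>{0..1}\<close> on one side returns on the other.\<close>

lemma integral_periodic_shift:
  fixes f :: "real \<Rightarrow> real"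
  assumes cont: "continuous_on UNIV f" and per: "\<And>x. f (x + 1) = f x"
  shows "integral {0..1} (\<lambda>x. f (x + a)) = integral {0..1} f"
proof -
  have int: "f integrable_on {u..v}" for u v
    by (intro integrable_continuous_interval continuous_on_subset[OF cont]) auto
  have sh: "integral {u..v} (\<lambda>x. f (x + c)) = integral {u + c..v + c} f" for u v c
  proof -
    have "(f has_integral integral {u + c..v + c} f) (cbox (u + c) (v + c))"
      using integrable_integral[OF int[of "u + c" "v + c"]] by (simp add: cbox_interval)
    from has_integral_affinity[OF this, of 1 c]
    have "((\<lambda>x. f (x + c)) has_integral integral {u + c..v + c} f) ((\<lambda>x. x - c) ` {u + c..v + c})"
      by (simp add: cbox_interval)
    then show ?thesis by (simp add: integral_unique)
  qed
  define b where "b = frac a"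
  have b: "0 \<le> b" "b < 1" by (auto simp: b_def frac_lt_1)
  have "f (x + a) = f (x + b)" for x
    using periodic_shift_int[of f "x + b" "\<lfloor>a\<rfloor>", OF per] by (simp add: b_def frac_def algebra_simps)
  then have "integral {0..1} (\<lambda>x. f (x + a)) = integral {b..1 + b} f" using sh[of 0 1 b] by simp
  also have "\<dots> = integral {b..1} f + integral {1..1 + b} f"
    using b by (intro Henstock_Kurzweil_Integration.integral_combine[symmetric] int) auto
  also have "integral {1..1 + b} f = integral {0..b} f" using sh[of 0 b 1] by (simp add: per add.commute)
  also have "integral {b..1} f + integral {0..b} f = integral {0..1} f"
    using b by (subst add.commute) (intro Henstock_Kurzweil_Integration.integral_combine int; simp)
  finally show ?thesis .
qed

text \<open>Evaluating the even part of \<open>D\<close> about \<open>t\<^sub>0\<close> as a function of the cosine reduces the uniqueness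
  theorem for Fourier coefficients to the Weierstrass approximation theorem on an interval.\<close>

lemma fourier_uniqueness_real:
  fixes D :: "real \<Rightarrow> real"
  assumes cont: "continuous_on UNIV D" and per: "\<And>x. D (x + 1) = D x"
    and cos0: "\<And>n::nat. integral {0..1} (\<lambda>x. D x * cos (2 * pi * real n * x)) = 0"
    and sin0: "\<And>n::nat. integral {0..1} (\<lambda>x. D x * sin (2 * pi * real n * x)) = 0"
  shows "D t0 = 0"
proof -
  note cont_comp = continuous_on_compose2[OF cont]
  \<comment> \<open>\<open>E\<close> is even and periodic, hence determined by its values on a half
    period, where the cosine is injective.\<close>
  define E where "E t = D (t0 + t) + D (t0 - t)" for t
  have E_cont: "continuous_on S E" for S
    unfolding E_def by (intro continuous_intros cont_comp) auto
  have E_per: "E (t + 1) = E t" for t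
    using per[of "t0 + t"] per[of "t0 - t - 1"] by (simp add: E_def algebra_simps)
  have E_even: "E (- t) = E t" for t by (simp add: E_def)
  have int: "f integrable_on {0..1}" if "continuous_on UNIV f" for f :: "real \<Rightarrow> real"
    using that by (intro integrable_continuous_interval) (rule continuous_on_subset, auto)
  have trig_per: "cos (2 * pi * real n * (x + 1)) = cos (2 * pi * real n * x)"
    "sin (2 * pi * real n * (x + 1)) = sin (2 * pi * real n * x)" for n x
  proof -
    have *: "2 * pi * real n * (x + 1) = 2 * pi * real n * x + 2 * real n * pi" by (simp add: algebra_simps)
    have "sin (2 * real n * pi) = 0" using sin_npi[of "2 * n"] by simp
    then show "cos (2 * pi * real n * (x + 1)) = cos (2 * pi * real n * x)"
      "sin (2 * pi * real n * (x + 1)) = sin (2 * pi * real n * x)"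
      unfolding * cos_add sin_add cos_2npi by simp_all
  qed
  have base: "integral {0..1} (\<lambda>x. E x * cos (2 * pi * real n * x)) = 0" for n
  proof -
    have plus: "integral {0..1} (\<lambda>x. D (t0 + x) * cos (2 * pi * real n * x)) = 0"
    proof -
      define f where "f x = D x * cos (2 * pi * real n * (x - t0))" for x
      have "continuous_on UNIV f" unfolding f_def by (intro continuous_intros cont)
      moreover have "f (x + 1) = f x" for x
      proof -
        have "x + 1 - t0 = x - t0 + 1" by simp
        then show ?thesis unfolding f_def by (simp only: per trig_per)
      qed
      ultimately have "integral {0..1} (\<lambda>x. f (x + t0)) = integral {0..1} f"
        by (rule integral_periodic_shift)
      moreover have "integral {0..1} f = 0"
      proof -
        have "f = (\<lambda>x. cos (2 * pi * real n * t0) * (D x * cos (2 * pi * real n * x))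
            + sin (2 * pi * real n * t0) * (D x * sin (2 * pi * real n * x)))"
          by (auto simp: f_def right_diff_distrib cos_diff algebra_simps)
        then have "integral {0..1} f = integral {0..1} (\<lambda>x. cos (2 * pi * real n * t0) * (D x * cos (2 * pi * real n * x))
            + sin (2 * pi * real n * t0) * (D x * sin (2 * pi * real n * x)))" by (rule arg_cong)
        also have "\<dots> = 0"
          by (subst integral_add) (auto simp: cos0 sin0 intro!: int continuous_intros cont)
        finally show ?thesis .
      qed
      ultimately show ?thesis by (simp add: f_def add.commute)
    qed
    have minus: "integral {0..1} (\<lambda>x. D (t0 - x) * cos (2 * pi * real n * x)) = 0"
    proof -
      define f where "f x = D (t0 + x) * cos (2 * pi * real n * x)" for x
      have fc: "continuous_on UNIV f" unfolding f_def by (intro continuous_intros cont_comp) auto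
      have fp: "f (x + 1) = f x" for x
        using trig_per(1)[of n x] per[of "t0 + x"] by (simp add: f_def add.assoc)
      have "integral {0..1} (\<lambda>x. f (- x)) = integral {-1..0} f"
        using Henstock_Kurzweil_Integration.integral_reflect_real[of "0" "-1" f] by simp
      also have "\<dots> = integral {0..1} (\<lambda>x. f (x + (- 1)))"
      proof -
        have "f integrable_on {-1..0}" by (intro integrable_continuous_interval continuous_on_subset[OF fc]) auto
        then have "(f has_integral integral {-1..0} f) (cbox (-1) 0)"
          using integrable_integral by (simp add: cbox_interval)
        from has_integral_affinity[OF this, of 1 "-1"] show ?thesis
          by (simp add: cbox_interval integral_unique)
      qed
      also have "\<dots> = integral {0..1} f" by (rule integral_periodic_shift[OF fc fp])
      also have "\<dots> = 0" unfolding f_def by (rule plus)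
      finally show ?thesis by (simp add: f_def)
    qed
    have "integral {0..1} (\<lambda>x. E x * cos (2 * pi * real n * x))
        = integral {0..1} (\<lambda>x. D (t0 + x) * cos (2 * pi * real n * x) + D (t0 - x) * cos (2 * pi * real n * x))"
      by (simp add: E_def algebra_simps)
    also have "\<dots> = 0"
      by (subst integral_add) (auto simp: plus minus intro!: int continuous_intros cont_comp)
    finally show ?thesis .
  qed
  \<comment> \<open>A factor \<open>cos (2 * pi * x)\<close> shifts the frequency by one in both
    directions, so vanishing at all frequencies is preserved; frequency 0 only moves to 1.\<close>
  have pow: "integral {0..1} (\<lambda>x. E x * cos (2 * pi * x) ^ j * cos (2 * pi * real n * x)) = 0" for j n
  proof (induction j arbitrary: n)
    case 0
    then show ?case using base by simp
  next
    case (Suc j)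
    show ?case
    proof (cases n)
      case 0
      then show ?thesis using Suc[of 1] by (simp add: mult_ac)
    next
      case (Suc n')
      have product: "cos (2 * pi * x) * cos (2 * pi * real n * x)
          = (cos (2 * pi * real (Suc n) * x) + cos (2 * pi * real n' * x)) / 2" for x
      proof -
        have "2 * pi * real (Suc n) * x = 2 * pi * real n * x + 2 * pi * x"
          "2 * pi * real n' * x = 2 * pi * real n * x - 2 * pi * x" using Suc by (simp_all add: algebra_simps)
        then show ?thesis by (simp only: cos_add cos_diff) simp
      qed
      have "integral {0..1} (\<lambda>x. E x * cos (2 * pi * x) ^ Suc j * cos (2 * pi * real n * x))
          = integral {0..1} (\<lambda>x. (1 / 2) * (E x * cos (2 * pi * x) ^ j * cos (2 * pi * real (Suc n) * x)
              + E x * cos (2 * pi * x) ^ j * cos (2 * pi * real n' * x)))"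
      proof (rule integral_cong)
        fix x
        have "E x * cos (2 * pi * x) ^ Suc j * cos (2 * pi * real n * x)
            = E x * cos (2 * pi * x) ^ j * (cos (2 * pi * x) * cos (2 * pi * real n * x))" by (simp add: mult_ac)
        then show "E x * cos (2 * pi * x) ^ Suc j * cos (2 * pi * real n * x)
            = (1 / 2) * (E x * cos (2 * pi * x) ^ j * cos (2 * pi * real (Suc n) * x)
              + E x * cos (2 * pi * x) ^ j * cos (2 * pi * real n' * x))"
          unfolding product distrib_left[symmetric] by (simp del: of_nat_Suc)
      qed
      also have "\<dots> = 1 / 2 * (integral {0..1} (\<lambda>x. E x * cos (2 * pi * x) ^ j * cos (2 * pi * real (Suc n) * x))
              + integral {0..1} (\<lambda>x. E x * cos (2 * pi * x) ^ j * cos (2 * pi * real n' * x)))"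
        by (subst integral_mult_right, subst integral_add) (auto intro!: int continuous_intros E_cont)
      finally show ?thesis unfolding Suc.IH by simp
    qed
  qed
  \<comment> \<open>\<open>arccos\<close> inverts the cosine on the first half period; on the second
    half the symmetry \<open>E (1 - t) = E t\<close> takes over.\<close>
  define f where "f x = E (arccos x / (2 * pi))" for x
  have f_cont: "continuous_on {-1..1} f"
    unfolding f_def by (rule continuous_on_compose2[OF E_cont[of UNIV]]) (auto intro!: continuous_intros continuous_on_arccos')
  have f_cos: "f (cos (2 * pi * t)) = E t" if t: "t \<in> {0..1}" for t
  proof (cases "t \<le> 1 / 2")
    case True
    then have "arccos (cos (2 * pi * t)) = 2 * pi * t" using t by (intro arccos_cos) auto
    then show ?thesis by (simp add: f_def)
  next
    case False
    have "cos (2 * pi * t) = cos (2 * pi * (1 - t))" by (simp add: right_diff_distrib cos_diff)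
    moreover have "arccos (cos (2 * pi * (1 - t))) = 2 * pi * (1 - t)"
      using t False by (intro arccos_cos) auto
    ultimately have "f (cos (2 * pi * t)) = E (1 - t)" by (simp add: f_def)
    also have "\<dots> = E t" using E_per[of "- t"] E_even[of t] by (simp add: add.commute)
    finally show ?thesis .
  qed
  \<comment> \<open>\<open>E\<close> is orthogonal to all polynomials in the cosine and is uniformly
    approximated by them, so it is orthogonal to itself. Its value at 0 is
    \<open>2 * D t0\<close>.\<close>
  have "integral {0..1} (\<lambda>x. E x * E x) = 0"
  proof -
    define J where "J = integral {0..1} (\<lambda>x. \<bar>E x\<bar>)"
    have J: "J \<ge> 0" unfolding J_def by (intro integral_nonneg int continuous_intros E_cont) auto
    have le: "integral {0..1} (\<lambda>x. E x * E x) \<le> \<epsilon> * J" if \<epsilon>: "\<epsilon> > 0" for \<epsilon>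
    proof -
      obtain g where g: "real_polynomial_function g" "\<And>x. x \<in> {-1..1} \<Longrightarrow> \<bar>f x - g x\<bar> < \<epsilon>"
        using Stone_Weierstrass_real_polynomial_function[OF compact_Icc f_cont \<epsilon>] by blast
      obtain a N where gs: "g = (\<lambda>x. \<Sum>i\<le>N. a i * x ^ i)"
        using g(1) by (auto simp: real_polynomial_function_iff_sum)
      have "integral {0..1} (\<lambda>x. E x * g (cos (2 * pi * x))) = (\<Sum>i\<le>N. a i * integral {0..1} (\<lambda>x. E x * cos (2 * pi * x) ^ i))"
      proof -
        have "integral {0..1} (\<lambda>x. E x * g (cos (2 * pi * x)))
            = integral {0..1} (\<lambda>x. \<Sum>i\<le>N. a i * (E x * cos (2 * pi * x) ^ i))"
          by (simp add: gs sum_distrib_left mult_ac)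
        also have "\<dots> = (\<Sum>i\<le>N. integral {0..1} (\<lambda>x. a i * (E x * cos (2 * pi * x) ^ i)))"
          by (intro integral_sum int continuous_intros E_cont) auto
        finally show ?thesis by simp
      qed
      also have "\<dots> = 0" using pow[of _ 0] by simp
      finally have g0: "integral {0..1} (\<lambda>x. E x * g (cos (2 * pi * x))) = 0" .
      have gc: "continuous_on UNIV (\<lambda>x. g (cos (2 * pi * x)))" unfolding gs by (intro continuous_intros)
      have "integral {0..1} (\<lambda>x. E x * E x)
          = integral {0..1} (\<lambda>x. E x * E x) - integral {0..1} (\<lambda>x. E x * g (cos (2 * pi * x)))" using g0 by simp
      also have "\<dots> = integral {0..1} (\<lambda>x. E x * E x - E x * g (cos (2 * pi * x)))"
        by (intro integral_diff[symmetric] int continuous_intros E_cont gc)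
      also have "\<dots> \<le> integral {0..1} (\<lambda>x. \<epsilon> * \<bar>E x\<bar>)"
      proof (intro integral_le int continuous_intros E_cont gc)
        fix x :: real assume x: "x \<in> {0..1}"
        have "E x * E x - E x * g (cos (2 * pi * x)) = E x * (f (cos (2 * pi * x)) - g (cos (2 * pi * x)))"
          using f_cos[OF x] by (simp add: algebra_simps)
        also have "\<dots> \<le> \<bar>E x\<bar> * \<bar>f (cos (2 * pi * x)) - g (cos (2 * pi * x))\<bar>"
          unfolding abs_mult[symmetric] by simp
        also have "\<dots> \<le> \<bar>E x\<bar> * \<epsilon>" using g(2)[of "cos (2 * pi * x)"] by (intro mult_left_mono) auto
        finally show "E x * E x - E x * g (cos (2 * pi * x)) \<le> \<epsilon> * \<bar>E x\<bar>" by (simp add: mult.commute)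
      qed
      finally show ?thesis by (simp add: J_def)
    qed
    have "integral {0..1} (\<lambda>x. E x * E x) \<le> 0"
    proof (rule field_le_epsilon)
      fix e :: real assume e: "e > 0"
      have "integral {0..1} (\<lambda>x. E x * E x) \<le> e / (J + 1) * J" using e J by (intro le) auto
      also have "\<dots> \<le> 0 + e" using e J by (simp add: field_simps)
      finally show "integral {0..1} (\<lambda>x. E x * E x) \<le> 0 + e" .
    qed
    moreover have "0 \<le> integral {0..1} (\<lambda>x. E x * E x)" by (intro integral_nonneg int continuous_intros E_cont) auto
    ultimately show ?thesis by simp
  qed
  then have "\<forall>x\<in>{0..1}. E x * E x = 0"
    by (subst (asm) integral_eq_0_iff) (auto intro!: continuous_intros E_cont)
  then have "E 0 = 0" by simp
  then show ?thesis by (simp add: E_def)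
qed

text \<open>The characters of the circle of length 1.\<close>

definition ee :: "int \<Rightarrow> real \<Rightarrow> complex" where "ee k x = cis (2 * pi * of_int k * x)"

lemma norm_ee [simp]: "norm (ee k x) = 1" by (simp add: ee_def)

lemma ee_add: "ee (j + k) x = ee j x * ee k x"
  by (simp add: ee_def cis_mult algebra_simps)

lemma ee_periodic: "ee k (x + of_int n) = ee k x"
proof -
  have "cis (2 * pi * of_int k * (x + of_int n)) = cis (2 * pi * of_int k * x) * cis (2 * pi * of_int (k * n))"
    by (simp add: cis_mult algebra_simps)
  also have "cis (2 * pi * of_int (k * n)) = 1"
    by (rule cis_multiple_2pi) simp
  finally show ?thesis by (simp add: ee_def)
qed

lemma continuous_on_ee [continuous_intros]: "continuous_on S (ee k)"
  unfolding ee_def by (intro continuous_intros)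

text \<open>Cosine and sine coefficients are combinations of those at \<open>n\<close> and
  \<open>- n\<close>; then real and imaginary parts are treated separately. \<open>L\<close> stands
  for either part, both of which commute with real factors.\<close>

lemma fourier_uniqueness:
  fixes D :: "real \<Rightarrow> complex"
  assumes cont: "continuous_on UNIV D" and per: "\<And>x. D (x + 1) = D x"
    and coeff: "\<And>k. integral {0..1} (\<lambda>x. D x * ee (- k) x) = 0"
  shows "D t = 0"
proof -
  have int: "f integrable_on {0..1}" if "continuous_on UNIV f" for f :: "real \<Rightarrow> complex"
    using that by (intro integrable_continuous_interval) (rule continuous_on_subset, auto)
  have c: "integral {0..1} (\<lambda>x. D x * complex_of_real (cos (2 * pi * real n * x))) = 0" for n
  proof -
    have "D x * complex_of_real (cos (2 * pi * real n * x)) = 1 / 2 * (D x * ee (- int n) x + D x * ee (- (- int n)) x)" for x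
      by (simp add: ee_def complex_eq_iff field_simps)
    then have "integral {0..1} (\<lambda>x. D x * complex_of_real (cos (2 * pi * real n * x)))
        = 1 / 2 * integral {0..1} (\<lambda>x. D x * ee (- int n) x + D x * ee (- (- int n)) x)"
      by (simp only: integral_mult_right)
    also have "\<dots> = 1 / 2 * (0 + 0)"
      by (subst integral_add) (auto intro!: int continuous_intros cont simp: coeff[of "int n"] coeff[of "- int n", simplified])
    finally show ?thesis by simp
  qed
  have s: "integral {0..1} (\<lambda>x. D x * complex_of_real (sin (2 * pi * real n * x))) = 0" for n
  proof -
    have "D x * complex_of_real (sin (2 * pi * real n * x)) = \<i> / 2 * (D x * ee (- int n) x - D x * ee (- (- int n)) x)" for x
      by (simp add: ee_def complex_eq_iff field_simps)
    then have "integral {0..1} (\<lambda>x. D x * complex_of_real (sin (2 * pi * real n * x)))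
        = \<i> / 2 * integral {0..1} (\<lambda>x. D x * ee (- int n) x - D x * ee (- (- int n)) x)"
      by (simp only: integral_mult_right)
    also have "\<dots> = \<i> / 2 * (0 - 0)"
      by (subst integral_diff) (auto intro!: int continuous_intros cont simp: coeff[of "int n"] coeff[of "- int n", simplified])
    finally show ?thesis by simp
  qed
  have part: "L (D t) = 0" if L: "bounded_linear L" and L_mult: "\<And>z x. L (z * complex_of_real x) = L z * x"
    for L :: "complex \<Rightarrow> real"
  proof (rule fourier_uniqueness_real[of "\<lambda>x. L (D x)"])
    have lin: "integral {0..1} (\<lambda>x. L (g x)) = L (integral {0..1} g)" if "continuous_on UNIV g" for g :: "real \<Rightarrow> complex"
      using integral_linear[OF int[OF that] L] by (simp add: o_def)
    show "continuous_on UNIV (\<lambda>x. L (D x))"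
      by (intro continuous_on_compose2[OF linear_continuous_on[OF L, of UNIV] cont]) auto
    show "L (D (x + 1)) = L (D x)" for x by (simp add: per)
    have L0: "L 0 = 0" using L by (simp add: bounded_linear.linear linear_0)
    show "integral {0..1} (\<lambda>x. L (D x) * cos (2 * pi * real n * x)) = 0" for n
      unfolding L_mult[symmetric] by (subst lin) (auto simp: c L0 intro!: continuous_intros cont)
    show "integral {0..1} (\<lambda>x. L (D x) * sin (2 * pi * real n * x)) = 0" for n
      unfolding L_mult[symmetric] by (subst lin) (auto simp: s L0 intro!: continuous_intros cont)
  qed
  show ?thesis
    using part[OF bounded_linear_Re] part[OF bounded_linear_Im] by (auto simp: complex_eq_iff)
qed

lemma integral_ee: "integral {0..1} (ee k) = (if k = 0 then 1 else 0)"
proof (cases "k = 0")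
  case False
  define c where "c = 2 * pi * of_int k"
  have c: "c \<noteq> 0" using False by (simp add: c_def)
  have "((\<lambda>x. cis (c * x) / (\<i> * of_real c)) has_vector_derivative cis (c * x)) (at x within {0..1})" for x
  proof -
    define w where "w = \<i> * complex_of_real c"
    have w: "w \<noteq> 0" using c by (simp add: w_def)
    have "((\<lambda>x. exp (w * of_real x) / w) has_vector_derivative exp (w * of_real x)) (at x within {0..1})"
      using w by (intro has_vector_derivative_real_field) (auto intro!: derivative_eq_intros)
    then show ?thesis by (simp add: cis_conv_exp w_def mult.assoc)
  qed
  then have "((\<lambda>x. cis (c * x)) has_integral (cis (c * 1) / (\<i> * of_real c) - cis (c * 0) / (\<i> * of_real c))) {0..1}"
    by (intro fundamental_theorem_of_calculus) auto
  moreover have "cis (c * 1) = 1" unfolding c_def by (simp add: cis_multiple_2pi)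
  ultimately show ?thesis using False by (auto simp: ee_def[abs_def] c_def integral_unique)
qed (simp add: ee_def[abs_def])

text \<open>The M-test gives uniform convergence on each half of the integers. The integrated series
  pairs \<open>n\<close> with \<open>- (n + 1)\<close>, so that its partial sums in Poisson
  summation become integrals over growing intervals.\<close>

lemma has_sum_integral_int:
  fixes f :: "int \<Rightarrow> real \<Rightarrow> complex"
  assumes cont: "\<And>k. continuous_on {a..b} (f k)"
    and bound: "\<And>k x. x \<in> {a..b} \<Longrightarrow> norm (f k x) \<le> M k"
    and M: "summable (\<lambda>n. M (int n))" "summable (\<lambda>n. M (- int (Suc n)))"
  shows "continuous_on {a..b} (\<lambda>x. \<Sum>\<^sub>\<infinity>k. f k x)"
    and "(\<lambda>n. integral {a..b} (f (int n)) + integral {a..b} (f (- int (Suc n)))) sums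
           integral {a..b} (\<lambda>x. \<Sum>\<^sub>\<infinity>k. f k x)"
proof -
  have series: "continuous_on {a..b} (\<lambda>x. \<Sum>n. g n x)
      \<and> (\<lambda>n. integral {a..b} (g n)) sums integral {a..b} (\<lambda>x. \<Sum>n. g n x)"
    if c: "\<And>n. continuous_on {a..b} (g n)" and g: "\<And>n x. x \<in> {a..b} \<Longrightarrow> norm (g n x) \<le> m n" and m: "summable m"
    for g :: "nat \<Rightarrow> real \<Rightarrow> complex" and m
  proof
    have ul: "uniform_limit {a..b} (\<lambda>N x. \<Sum>n<N. g n x) (\<lambda>x. \<Sum>n. g n x) sequentially"
      by (rule Weierstrass_m_test[OF g m])
    have cs: "continuous_on {a..b} (\<lambda>x. \<Sum>n<N. g n x)" for N by (intro continuous_intros c)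
    show ct: "continuous_on {a..b} (\<lambda>x. \<Sum>n. g n x)"
      by (rule uniform_limit_theorem[OF _ ul]) (auto intro!: always_eventually cs)
    obtain I J where IJ: "\<And>N. ((\<lambda>x. \<Sum>n<N. g n x) has_integral I N) {a..b}"
       "((\<lambda>x. \<Sum>n. g n x) has_integral J) {a..b}" "I \<longlonglongrightarrow> J"
      using uniform_limit_integral[OF ul cs sequentially_bot] by blast
    have "I = (\<lambda>N. \<Sum>n<N. integral {a..b} (g n))"
    proof
      fix N
      have "I N = integral {a..b} (\<lambda>x. \<Sum>n<N. g n x)" using IJ(1)[of N] by (simp add: integral_unique)
      also have "\<dots> = (\<Sum>n<N. integral {a..b} (g n))" by (intro integral_sum integrable_continuous_interval c) auto
      finally show "I N = (\<Sum>n<N. integral {a..b} (g n))" .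
    qed
    moreover have "J = integral {a..b} (\<lambda>x. \<Sum>n. g n x)" using IJ(2) by (simp add: integral_unique)
    ultimately show "(\<lambda>n. integral {a..b} (g n)) sums integral {a..b} (\<lambda>x. \<Sum>n. g n x)"
      using IJ(3) by (simp add: sums_def)
  qed
  note s1 = series[of "\<lambda>n. f (int n)" "\<lambda>n. M (int n)", OF cont bound M(1)]
  note s2 = series[of "\<lambda>n. f (- int (Suc n))" "\<lambda>n. M (- int (Suc n))", OF cont bound M(2)]
  have eq: "(\<Sum>\<^sub>\<infinity>k. f k x) = (\<Sum>n. f (int n) x) + (\<Sum>n. f (- int (Suc n)) x)" if x: "x \<in> {a..b}" for x
  proof (rule infsumI, rule has_sum_int_split)
    show "summable (\<lambda>n. norm (f (int n) x))"
      by (rule summable_comparison_test'[OF M(1)]) (use bound x in auto)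
    show "summable (\<lambda>n. norm (f (- int (Suc n)) x))"
      by (rule summable_comparison_test'[OF M(2)]) (use bound x in auto)
  qed
  show "continuous_on {a..b} (\<lambda>x. \<Sum>\<^sub>\<infinity>k. f k x)"
    using s1 s2 by (subst continuous_on_cong[OF refl eq]) (auto intro!: continuous_intros)
  have "integral {a..b} (\<lambda>x. \<Sum>\<^sub>\<infinity>k. f k x)
      = integral {a..b} (\<lambda>x. (\<Sum>n. f (int n) x) + (\<Sum>n. f (- int (Suc n)) x))"
    by (intro integral_cong eq)
  also have "\<dots> = integral {a..b} (\<lambda>x. \<Sum>n. f (int n) x) + integral {a..b} (\<lambda>x. \<Sum>n. f (- int (Suc n)) x)"
    using s1 s2 by (intro integral_add integrable_continuous_interval) auto
  finally show "(\<lambda>n. integral {a..b} (f (int n)) + integral {a..b} (f (- int (Suc n)))) sums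
           integral {a..b} (\<lambda>x. \<Sum>\<^sub>\<infinity>k. f k x)"
    using s1 s2 by (simp add: sums_add)
qed


lemma continuous_on_UNIV_local:
  fixes f :: "real \<Rightarrow> 'a::topological_space"
  assumes "\<And>x. continuous_on {x - 1..x + 1} f"
  shows "continuous_on UNIV f"
proof (rule continuous_at_imp_continuous_on, rule ballI)
  fix x
  show "isCont f x" by (rule continuous_on_interior[OF assms[of x]]) (simp add: interior_atLeastAtMost_real)
qed

text \<open>The intervals are centred at \<open>d\<close> because the periods
  \<open>{- k * d..d - k * d}\<close> for \<open>k\<close> from \<open>- N\<close> to
  \<open>N - 1\<close> fill exactly \<open>{d - N * d..d + N * d}\<close>.\<close>

lemma tendsto_integral_symmetric_intervals:
  fixes g :: "real \<Rightarrow> complex"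
  assumes g: "integrable lborel g" and d: "0 < d"
  shows "(\<lambda>N. integral {d - real N * d..d + real N * d} g) \<longlonglongrightarrow> (\<integral>x. g x \<partial>lborel)"
proof -
  have "(\<lambda>N. \<integral>x. indicator {d - real N * d..d + real N * d} x *\<^sub>R g x \<partial>lborel) \<longlonglongrightarrow> (\<integral>x. g x \<partial>lborel)"
  proof (rule integral_dominated_convergence[where w = "\<lambda>x. norm (g x)"])
    show "AE x in lborel. (\<lambda>N. indicator {d - real N * d..d + real N * d} x *\<^sub>R g x) \<longlonglongrightarrow> g x"
    proof (rule AE_I2)
      fix x
      have "filterlim (\<lambda>N. real N * d) at_top sequentially" using d by real_asymp
      then have "eventually (\<lambda>N. real N * d \<ge> \<bar>x\<bar> + d) sequentially" by (simp add: filterlim_at_top)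
      then have "eventually (\<lambda>N. indicator {d - real N * d..d + real N * d} x *\<^sub>R g x = g x) sequentially"
        by eventually_elim (use d in \<open>auto simp: indicator_def\<close>)
      then show "(\<lambda>N. indicator {d - real N * d..d + real N * d} x *\<^sub>R g x) \<longlonglongrightarrow> g x" by (rule tendsto_eventually)
    qed
  qed (use g in \<open>auto simp: indicator_def\<close>)
  moreover have "(\<integral>x. indicator {d - real N * d..d + real N * d} x *\<^sub>R g x \<partial>lborel) = integral {d - real N * d..d + real N * d} g" for N
  proof -
    have "set_integrable lborel {d - real N * d..d + real N * d} g"
      unfolding set_integrable_def by (intro integrable_mult_indicator g) auto
    from set_borel_integral_eq_integral(2)[OF this] show ?thesis unfolding set_lebesgue_integral_def .
  qed
  ultimately show ?thesis by simp
qed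

context renewal
begin

text \<open>An affine substitution carries the unit interval to one period of the line; the
  character is unaffected, since \<open>k\<close> shifts its argument by an integer.\<close>

lemma integral_toll_period:
  fixes k j :: int
  assumes d: "0 < d"
  defines "G \<equiv> (\<lambda>t. complex_of_real (\<Psi> t) * ee (- j) (t / d))"
  shows "integral {0..1} (\<lambda>x. complex_of_real (d * \<Psi> (d * x - of_int k * d)) * ee (- j) x)
      = integral {- of_int k * d..d - of_int k * d} G"
proof -
  have cont: "continuous_on S G" for S
    unfolding G_def by (intro continuous_intros toll_continuous continuous_on_compose2[OF continuous_on_ee[of UNIV]]) (use d in auto)
  have "(G has_integral integral {- of_int k * d..d - of_int k * d} G) (cbox (- of_int k * d) (d - of_int k * d))"
    using integrable_integral[OF integrable_continuous_interval[OF cont]] by (simp only: cbox_interval)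
  from has_integral_affinity[OF this, of d "- of_int k * d"] d
  have "((\<lambda>x. G (d * x - of_int k * d)) has_integral (1 / d) *\<^sub>R integral {- of_int k * d..d - of_int k * d} G)
      ((\<lambda>x. (1 / d) * x + of_int k) ` {- of_int k * d..d - of_int k * d})"
    by (simp add: cbox_interval)
  also have "(\<lambda>x. (1 / d) * x + of_int k) ` {- of_int k * d..d - of_int k * d} = {0..1}"
    using d by (subst image_affinity_atLeastAtMost) (auto simp: field_simps)
  finally have "((\<lambda>x. d *\<^sub>R G (d * x - of_int k * d)) has_integral d *\<^sub>R (1 / d) *\<^sub>R integral {- of_int k * d..d - of_int k * d} G) {0..1}"
    by (rule has_integral_cmul)
  moreover have "d *\<^sub>R G (d * x - of_int k * d) = complex_of_real (d * \<Psi> (d * x - of_int k * d)) * ee (- j) x" for x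
  proof -
    have "(d * x - of_int k * d) / d = x + of_int (- k)" using d by (simp add: field_simps)
    then show ?thesis unfolding G_def by (simp only: ee_periodic) (simp add: scaleR_conv_of_real)
  qed
  ultimately show ?thesis using d by (simp add: integral_unique)
qed

text \<open>Rescaled to period 1, both sides are continuous, and unfolding the coefficient integral
  over all periods shows that their Fourier coefficients agree. The summability of \<open>c\<close>
  will come from the decay of Mellin transforms along the imaginary axis.\<close>

theorem poisson_summation:
  assumes d: "0 < d"
    and c: "\<And>k. c k = (\<integral>t. complex_of_real (\<Psi> t) * ee (- k) (t / d) \<partial>lborel)"
    and c_summable: "summable (\<lambda>n. norm (c (int n)))" "summable (\<lambda>n. norm (c (- int (Suc n))))"
  shows "complex_of_real (d * periodization d t) = (\<Sum>\<^sub>\<infinity>k. c k * ee k (t / d))"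
proof -
  define f where "f k x = complex_of_real (d * \<Psi> (d * x - of_int k * d))" for k x
  define h where "h x = complex_of_real (d * periodization d (d * x))" for x
  define K where "K x = (\<Sum>\<^sub>\<infinity>k. c k * ee k x)" for x
  have f_cont: "continuous_on S (f k)" for S k
    unfolding f_def by (intro continuous_intros continuous_on_compose2[OF toll_continuous[of UNIV]]) auto
  define M where "M R k = d * (C * exp (d * R) * exp (- (d * of_int \<bar>k\<bar>)))" for R :: real and k :: int
  have f_bound: "norm (f k x) \<le> M R k" if "\<bar>x\<bar> \<le> R" for k x R
  proof -
    have "\<bar>\<Psi> (d * x - of_int k * d)\<bar> \<le> C * exp \<bar>d * x\<bar> * exp (- (d * of_int \<bar>k\<bar>))"
      by (rule toll_shift_bound[OF d])
    also have "\<dots> \<le> C * exp (d * R) * exp (- (d * of_int \<bar>k\<bar>))"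
      using that d C_nonneg by (intro mult_right_mono mult_left_mono) (auto simp: abs_mult)
    finally show ?thesis using d by (simp add: f_def M_def norm_mult del: of_int_abs)
  qed
  have M_summable: "summable (\<lambda>n. M R (int n))" "summable (\<lambda>n. M R (- int (Suc n)))" for R
  proof -
    have e: "exp (- d) ^ n = exp (- (d * real n))" for n
      by (simp add: exp_of_nat_mult[symmetric] mult.commute)
    have g: "summable (\<lambda>n. exp (- d) ^ n)" using d by (intro summable_geometric) auto
    have "summable (\<lambda>n. exp (- (d * of_int \<bar>int n\<bar>)))" using g by (simp add: e)
    then show "summable (\<lambda>n. M R (int n))" unfolding M_def by (intro summable_mult)
    have "summable (\<lambda>n. exp (- d) ^ Suc n)" using g by (subst summable_Suc_iff)
    then have "summable (\<lambda>n. exp (- (d * of_int \<bar>- int (Suc n)\<bar>)))"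
      unfolding e by (simp add: algebra_simps)
    then show "summable (\<lambda>n. M R (- int (Suc n)))" unfolding M_def by (intro summable_mult)
  qed
  have h_sum: "((\<lambda>k. f k x) has_sum h x) UNIV" for x
    unfolding f_def h_def
    using has_sum_cmult_right[OF has_sum_periodization(1)[OF d, of "d * x"], of d]
    by (intro has_sum_of_real) simp
  have h_eq: "h = (\<lambda>x. \<Sum>\<^sub>\<infinity>k. f k x)" using infsumI[OF h_sum] by auto
  have h_cont: "continuous_on UNIV h"
  proof (rule continuous_on_UNIV_local)
    fix x show "continuous_on {x - 1..x + 1} h"
      unfolding h_eq
      by (rule has_sum_integral_int(1)[OF f_cont f_bound[of _ "\<bar>x\<bar> + 1"] M_summable]) auto
  qed
  have K_sum: "((\<lambda>k. c k * ee k x) has_sum K x) UNIV" for x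
    unfolding K_def using c_summable
    by (intro has_sum_infsum[OF abs_summable_summable[OF abs_summable_on_int_split]])
       (auto simp: norm_mult)
  have K_cont: "continuous_on UNIV K"
  proof (rule continuous_on_UNIV_local)
    fix x show "continuous_on {x - 1..x + 1} K"
      unfolding K_def
      by (rule has_sum_integral_int(1)[of _ _ _ "\<lambda>k. norm (c k)"])
         (auto intro!: continuous_intros c_summable simp: norm_mult simp del: of_nat_Suc)
  qed
  have "h (t / d) - K (t / d) = 0"
  proof (rule fourier_uniqueness[of "\<lambda>x. h x - K x"])
    show "continuous_on UNIV (\<lambda>x. h x - K x)" by (intro continuous_intros h_cont K_cont)
    fix x
    have "h (x + 1) = h x"
      using periodization_shift[of d "d * x" "- 1"] by (simp add: h_def algebra_simps)
    moreover have "K (x + 1) = K x" using ee_periodic[of _ x 1] by (simp add: K_def)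
    ultimately show "h (x + 1) - K (x + 1) = h x - K x" by simp
  next
    fix j :: int
    have K_int: "integral {0..1} (\<lambda>x. K x * ee (- j) x) = c j"
    proof -
      have "(\<lambda>n. integral {0..1} (\<lambda>x. c (int n) * ee (int n - j) x)
            + integral {0..1} (\<lambda>x. c (- int (Suc n)) * ee (- int (Suc n) - j) x)) sums
          integral {0..1} (\<lambda>x. \<Sum>\<^sub>\<infinity>k. c k * ee (k - j) x)"
        by (rule has_sum_integral_int(2)[of _ _ "\<lambda>k x. c k * ee (k - j) x" "\<lambda>k. norm (c k)"])
           (auto intro!: continuous_intros c_summable simp: norm_mult simp del: of_nat_Suc)
      also have "(\<lambda>x. \<Sum>\<^sub>\<infinity>k. c k * ee (k - j) x) = (\<lambda>x. K x * ee (- j) x)"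
        unfolding K_def using ee_add[of _ "- j"] by (simp add: infsum_cmult_left' mult.assoc[symmetric])
      finally have sums: "(\<lambda>n. (if int n = j then c (int n) else 0) + (if - int (Suc n) = j then c (- int (Suc n)) else 0))
          sums integral {0..1} (\<lambda>x. K x * ee (- j) x)"
        by (simp add: integral_ee if_distrib cong: if_cong del: of_nat_Suc)
      have "(\<lambda>n. (if int n = j then c (int n) else 0) + (if - int (Suc n) = j then c (- int (Suc n)) else 0)) sums c j"
      proof (cases "0 \<le> j")
        case True
        then have "(\<lambda>n. (if int n = j then c (int n) else 0) + (if - int (Suc n) = j then c (- int (Suc n)) else 0))
            = (\<lambda>n. if n = nat j then c (int n) else 0)" by (auto simp: fun_eq_iff)
        then show ?thesis using sums_single[of "nat j" "\<lambda>n. c (int n)"] True by simp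
      next
        case False
        then have "(\<lambda>n. (if int n = j then c (int n) else 0) + (if - int (Suc n) = j then c (- int (Suc n)) else 0))
            = (\<lambda>n. if n = nat (- j - 1) then c (- int (Suc n)) else 0)" by (auto simp: fun_eq_iff)
        then show ?thesis using sums_single[of "nat (- j - 1)" "\<lambda>n. c (- int (Suc n))"] False by simp
      qed
      from sums_unique2[OF sums this] show ?thesis .
    qed
    define G where "G t = complex_of_real (\<Psi> t) * ee (- j) (t / d)" for t
    have G_cont: "continuous_on S G" for S
      unfolding G_def by (intro continuous_intros toll_continuous continuous_on_compose2[OF continuous_on_ee[of UNIV]]) (use d in auto)
    have G_int: "G integrable_on {u..v}" for u v by (intro integrable_continuous_interval G_cont)
    have G_lebesgue: "integrable lborel G"
    proof (rule Bochner_Integration.integrable_bound[OF toll_integrable])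
      show "G \<in> borel_measurable lborel" using G_cont[of UNIV] by (simp add: borel_measurable_continuous_onI)
    qed (simp add: G_def norm_mult)
    have h_int: "integral {0..1} (\<lambda>x. h x * ee (- j) x) = c j"
    proof -
      define a where "a k = integral {- of_int k * d..d - of_int k * d} G" for k :: int
      have a: "integral {0..1} (\<lambda>x. f k x * ee (- j) x) = a k" for k
        unfolding f_def a_def G_def by (rule integral_toll_period[OF d])
      have "(\<lambda>n. integral {0..1} (\<lambda>x. f (int n) x * ee (- j) x)
            + integral {0..1} (\<lambda>x. f (- int (Suc n)) x * ee (- j) x)) sums
          integral {0..1} (\<lambda>x. \<Sum>\<^sub>\<infinity>k. f k x * ee (- j) x)"
        by (rule has_sum_integral_int(2)[of _ _ "\<lambda>k x. f k x * ee (- j) x" "M 1"])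
           (use f_bound in \<open>auto intro!: continuous_intros f_cont M_summable simp: norm_mult simp del: of_nat_Suc\<close>)
      then have "(\<lambda>n. a (int n) + a (- int (Suc n))) sums integral {0..1} (\<lambda>x. h x * ee (- j) x)"
        unfolding a h_eq by (simp add: infsum_cmult_left')
      moreover have "(\<Sum>n<N. a (int n) + a (- int (Suc n))) = integral {d - real N * d..d + real N * d} G" for N
      proof (induction N)
        case (Suc N)
        have 1: "a (int N) = integral {d - real (Suc N) * d..d - real N * d} G" by (simp add: a_def algebra_simps)
        have 2: "a (- int (Suc N)) = integral {d + real N * d..d + real (Suc N) * d} G" by (simp add: a_def algebra_simps)
        have 3: "integral {d - real (Suc N) * d..d - real N * d} G + integral {d - real N * d..d + real N * d} G
            = integral {d - real (Suc N) * d..d + real N * d} G"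
          using d by (intro Henstock_Kurzweil_Integration.integral_combine G_int) (auto simp: algebra_simps)
        have 4: "integral {d - real (Suc N) * d..d + real N * d} G + integral {d + real N * d..d + real (Suc N) * d} G
            = integral {d - real (Suc N) * d..d + real (Suc N) * d} G"
          using d by (intro Henstock_Kurzweil_Integration.integral_combine G_int) (auto simp: algebra_simps)
        show ?case unfolding sum.lessThan_Suc Suc.IH 1 2 4[symmetric] 3[symmetric] by (simp only: ac_simps)
      qed simp
      ultimately have "(\<lambda>N. integral {d - real N * d..d + real N * d} G) \<longlonglongrightarrow> integral {0..1} (\<lambda>x. h x * ee (- j) x)"
        unfolding sums_def by simp
      moreover have "(\<lambda>N. integral {d - real N * d..d + real N * d} G) \<longlonglongrightarrow> c j"
        using tendsto_integral_symmetric_intervals[OF G_lebesgue d] by (simp add: c G_def)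
      ultimately show ?thesis by (rule LIMSEQ_unique)
    qed
    have int: "g integrable_on {0..1}" if "continuous_on UNIV g" for g :: "real \<Rightarrow> complex"
      using that by (intro integrable_continuous_interval) (rule continuous_on_subset, auto)
    have "integral {0..1} (\<lambda>x. (h x - K x) * ee (- j) x)
        = integral {0..1} (\<lambda>x. h x * ee (- j) x) - integral {0..1} (\<lambda>x. K x * ee (- j) x)"
      unfolding left_diff_distrib by (intro integral_diff int continuous_intros h_cont K_cont)
    then show "integral {0..1} (\<lambda>x. (h x - K x) * ee (- j) x) = 0" using K_int h_int by simp
  qed
  then show ?thesis using d by (simp add: h_def K_def)
qed

end

section \<open>Gamma integrals and Mellin transforms\<close>

text \<open>Euler's integral after the substitution \<open>x = exp t\<close>, the scale in which
  Mellin transforms on a vertical line are Fourier transforms.\<close>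

lemma Gamma_exp_integral:
  assumes "Re z > 0"
  shows "integrable lborel (\<lambda>t. exp (z * of_real t - of_real (exp t)))"
    and "(\<integral>t. exp (z * of_real t - of_real (exp t)) \<partial>lborel) = Gamma z"
proof -
  define f where "f t = complex_of_real t powr (z - 1) / of_real (exp t)" for t
  define F where "F t = exp (z * of_real t - complex_of_real (exp t))" for t
  have img: "range (exp :: real \<Rightarrow> real) = {0<..}"
  proof
    show "{0<..} \<subseteq> range (exp :: real \<Rightarrow> real)"
    proof
      fix x :: real assume "x \<in> {0<..}"
      then have "x = exp (ln x)" by simp
      then show "x \<in> range exp" by (rule range_eqI)
    qed
  qed auto
  have eq: "\<bar>exp t\<bar> *\<^sub>R f (exp t) = F t" for t :: real
  proof -
    have "complex_of_real (exp t) powr (z - 1) = exp ((z - 1) * of_real t)"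
      unfolding powr_def exp_of_real[symmetric] by (simp add: Ln_exp)
    then have "\<bar>exp t\<bar> *\<^sub>R f (exp t) = exp (of_real t) * exp ((z - 1) * of_real t) / exp (of_real (exp t))"
      by (simp add: f_def scaleR_conv_of_real exp_of_real)
    also have "\<dots> = exp (of_real t + (z - 1) * of_real t - of_real (exp t))" by (simp only: exp_add exp_diff)
    also have "of_real t + (z - 1) * of_real t - of_real (exp t) = z * of_real t - of_real (exp t)"
      by (simp add: algebra_simps)
    finally show ?thesis by (simp add: F_def)
  qed
  have "f absolutely_integrable_on range exp \<and> integral (range exp) f = Gamma z"
    unfolding img f_def using absolutely_integrable_Gamma_integral'[OF assms] Gamma_integral_complex'[OF assms]
    by (auto simp: integral_unique)
  then have F: "F absolutely_integrable_on UNIV \<and> integral UNIV F = Gamma z"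
    using has_absolute_integral_change_of_variables_real[of UNIV exp exp f "Gamma z"]
    unfolding eq by (auto intro: DERIV_exp inj_onI)
  have "continuous_on UNIV F" unfolding F_def by (intro continuous_intros)
  then have meas: "F \<in> borel_measurable lborel" by (simp add: borel_measurable_continuous_onI)
  have int: "integrable lborel F"
    using F meas by (simp add: set_integrable_def integrable_completion)
  have "(\<integral>t. F t \<partial>lborel) = Gamma z"
    using has_integral_integral_lborel[OF int] F by (simp add: integral_unique)
  with int show "integrable lborel (\<lambda>t. exp (z * of_real t - of_real (exp t)))"
    "(\<integral>t. exp (z * of_real t - of_real (exp t)) \<partial>lborel) = Gamma z"
    by (simp_all add: F_def[abs_def])
qed

lemma Gamma_exp_integral_scaled:
  assumes "Re z > 0" "c > 0"
  shows "integrable lborel (\<lambda>t. exp (z * of_real t - of_real (c * exp t)))"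
    and "(\<integral>t. exp (z * of_real t - of_real (c * exp t)) \<partial>lborel) = exp (- (z * of_real (ln c))) * Gamma z"
proof -
  define F where "F t = exp (z * of_real t - complex_of_real (exp t))" for t
  have eq: "exp (z * of_real t - of_real (c * exp t)) = exp (- (z * of_real (ln c))) * F (ln c + 1 * t)" for t
  proof -
    have "exp (ln c + 1 * t) = c * exp t" using assms by (simp add: exp_add)
    then have "exp (- (z * of_real (ln c))) * F (ln c + 1 * t)
        = exp (- (z * of_real (ln c)) + (z * of_real (ln c + 1 * t) - of_real (c * exp t)))"
      by (simp only: F_def exp_add)
    also have "- (z * of_real (ln c)) + (z * of_real (ln c + 1 * t) - of_real (c * exp t))
        = z * of_real t - of_real (c * exp t)" by (simp add: algebra_simps)
    finally show ?thesis by simp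
  qed
  have int: "integrable lborel F" using Gamma_exp_integral(1)[OF assms(1)] by (simp add: F_def[abs_def])
  have int': "integrable lborel (\<lambda>t. F (ln c + 1 * t))"
    using lborel_integrable_real_affine[OF int, of 1 "ln c"] by simp
  then show "integrable lborel (\<lambda>t. exp (z * of_real t - of_real (c * exp t)))"
    unfolding eq by (intro integrable_mult_right)
  have "(\<integral>t. F (ln c + 1 * t) \<partial>lborel) = Gamma z"
    using lborel_integral_real_affine[of 1 F "ln c"] Gamma_exp_integral(2)[OF assms(1)] by (simp add: F_def)
  then show "(\<integral>t. exp (z * of_real t - of_real (c * exp t)) \<partial>lborel) = exp (- (z * of_real (ln c))) * Gamma z"
    unfolding eq using int' by simp
qed

text \<open>The modulus of the integrand depends on the real part of \<open>z\<close> only, so the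
  modulus of Gamma is at most its value at \<open>Re z\<close>, a factorial.\<close>

lemma norm_Gamma_le_fact:
  assumes "Re z = real (Suc n)"
  shows "norm (Gamma z) \<le> fact n"
    and "(\<integral>t. norm (exp (z * of_real t - of_real (exp t))) \<partial>lborel) = fact n"
proof -
  have z: "Re z > 0" using assms by simp
  have re: "norm (exp (z * of_real t - of_real (exp t))) = exp (real (Suc n) * t - exp t)" for t
    using assms by (simp del: of_nat_Suc)
  have "complex_of_real (exp (real (Suc n) * t - exp t)) = exp (of_nat (Suc n) * of_real t - of_real (exp t))" for t
    by (simp add: exp_of_real[symmetric] del: of_nat_Suc)
  then have "complex_of_real (\<integral>t. exp (real (Suc n) * t - exp t) \<partial>lborel) = Gamma (of_nat (Suc n))"
    using Gamma_exp_integral(2)[of "of_nat (Suc n)"]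
    by (simp add: integral_complex_of_real[symmetric] del: of_nat_Suc)
  also have "\<dots> = of_real (fact n)" using Gamma_fact[of n, where 'a = complex] by simp
  finally have "(\<integral>t. exp (real (Suc n) * t - exp t) \<partial>lborel) = fact n" by (simp only: of_real_eq_iff)
  then show norm: "(\<integral>t. norm (exp (z * of_real t - of_real (exp t))) \<partial>lborel) = fact n"
    unfolding re .
  show "norm (Gamma z) \<le> fact n"
    using integral_norm_bound[of lborel "\<lambda>t. exp (z * of_real t - of_real (exp t))"] norm
      Gamma_exp_integral(2)[OF z] by simp
qed

lemma Gamma_plus1_pos: "Re z > 0 \<Longrightarrow> Gamma (z + 1) = z * Gamma z"
  by (rule Gamma_plus1) (auto elim!: nonpos_Ints_cases)

text \<open>Two applications of the functional equation lead to the line of real part 3, where the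
  modulus is at most 2; each factor divided out has modulus at least
  \<open>\<bar>Im z\<bar> = norm z\<close>.\<close>

lemma norm_Gamma_decay:
  assumes "Re z = 0" "z \<noteq> 0"
  shows "norm (Gamma (z + 1)) \<le> 2 / (norm z)\<^sup>2"
proof -
  have "Gamma (z + 1 + 1 + 1) = (z + 2) * ((z + 1) * Gamma (z + 1))"
    using Gamma_plus1_pos[of "z + 1"] Gamma_plus1_pos[of "z + 1 + 1"] assms by (simp add: add.assoc)
  then have "norm (Gamma (z + 1 + 1 + 1)) = norm (z + 2) * (norm (z + 1) * norm (Gamma (z + 1)))"
    by (simp add: norm_mult)
  moreover have "norm (Gamma (z + 1 + 1 + 1)) \<le> 2"
    using norm_Gamma_le_fact(1)[of "z + 1 + 1 + 1" 2] assms by simp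
  moreover have "norm z * (norm z * norm (Gamma (z + 1))) \<le> norm (z + 2) * (norm (z + 1) * norm (Gamma (z + 1)))"
  proof -
    have "norm z = \<bar>Im z\<bar>" using assms by (simp add: cmod_def)
    then have "norm z \<le> norm (z + 2)" "norm z \<le> norm (z + 1)"
      using abs_Im_le_cmod[of "z + 2"] abs_Im_le_cmod[of "z + 1"] by simp_all
    then show ?thesis by (intro mult_mono) auto
  qed
  ultimately have "norm z * (norm z * norm (Gamma (z + 1))) \<le> 2" by simp
  then show ?thesis using assms by (simp add: power2_eq_square field_simps)
qed

text \<open>Over a unit distance to the right the numerator of the bump grows by at most the factor
  \<open>exp 1\<close>, and its denominator does not shrink.\<close>

lemma toll_lipschitz_from_derivative:
  assumes der: "\<And>t. (f has_real_derivative f' t) (at t)"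
    and bound: "\<And>t. \<bar>f' t\<bar> \<le> C * bump t" and u: "0 \<le> u" "u \<le> 1"
  shows "\<bar>f (t + u) - f t\<bar> \<le> C * exp 1 * u * bump t"
proof (cases "u = 0")
  case False
  have C: "0 \<le> C"
    using bound[of 0] by (auto simp: bump_def zero_le_divide_iff zero_le_mult_iff intro: order.trans[OF abs_ge_zero])
  obtain x where x: "t < x" "x < t + u" "f (t + u) - f t = (t + u - t) * f' x"
    using MVT2[of t "t + u" f f'] der u False by auto
  have "bump x \<le> exp 1 * bump t"
  proof -
    have pos: "0 < (1 + exp y)\<^sup>2" for y :: real by (intro zero_less_power add_pos_pos) auto
    have "bump x \<le> exp x / (1 + exp t)\<^sup>2"
      unfolding bump_def using x pos by (intro divide_left_mono power_mono mult_pos_pos) auto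
    also have "\<dots> \<le> exp (1 + t) / (1 + exp t)\<^sup>2"
      using x u by (intro divide_right_mono) auto
    finally show ?thesis by (simp add: exp_add bump_def)
  qed
  then have "\<bar>f' x\<bar> \<le> C * (exp 1 * bump t)" using bound[of x] C by (meson mult_left_mono order.trans)
  then show ?thesis using x u by (simp add: abs_mult mult_left_mono mult_ac)
qed simp

text \<open>The fourth power of \<open>(1 + x) / 4 \<le> exp (x / 4)\<close>, whence
  \<open>256 = 4 ^ 4\<close>. The exponent 4 suits tolls of size
  \<open>x * (1 + x)\<^sup>2 * exp (- x)\<close>, which become multiples of the bump.\<close>

lemma exp_minus_le: "x \<ge> 0 \<Longrightarrow> exp (- x) \<le> 256 / (1 + x) ^ 4" for x :: real
proof -
  assume x: "x \<ge> 0"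
  have "(1 + x) / 4 \<le> 1 + x / 4" by (simp add: field_simps)
  also have "\<dots> \<le> exp (x / 4)" by (rule exp_ge_add_one_self)
  finally have "(1 + x) / 4 \<le> exp (x / 4)" .
  then have "((1 + x) / 4) ^ 4 \<le> exp (x / 4) ^ 4" using x by (intro power_mono) auto
  also have "\<dots> = exp x" by (simp add: exp_of_nat_mult[symmetric])
  finally have "(1 + x) ^ 4 \<le> 256 * exp x" by (simp add: power_divide)
  moreover have "(1 + x) ^ 4 > 0" using x by simp
  ultimately show ?thesis by (simp add: exp_minus field_simps)
qed

text \<open>With \<open>x = exp t\<close>, the behaviour at minus infinity is that of a difference
  quotient at 0.\<close>

lemma tendsto_exp_at_bot_quotient:
  fixes f :: "real \<Rightarrow> real"
  assumes "(f has_real_derivative 0) (at 0)" "f 0 = 0"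
  shows "((\<lambda>t. f (exp t) * exp (- t)) \<longlongrightarrow> 0) at_bot"
proof -
  have "((\<lambda>x. (f x - f 0) / (x - 0)) \<longlongrightarrow> 0) (at 0)"
    using assms(1) by (simp add: has_field_derivative_iff)
  moreover have "filterlim (exp :: real \<Rightarrow> real) (at 0) at_bot"
    using exp_at_bot by (auto simp: filterlim_at)
  ultimately have "((\<lambda>t. (f (exp t) - f 0) / (exp t - 0)) \<longlongrightarrow> 0) at_bot"
    by (rule filterlim_compose)
  then show ?thesis using assms(2) by (simp add: exp_minus divide_inverse)
qed

lemma bump_eq: "bump t = x / (1 + x)\<^sup>2" if "x = exp t"
  using that by (simp add: bump_def)

context bernoulli_split
begin

text \<open>Uniqueness for the renewal equation, from the bound with toll constant 0.\<close>

lemma renewal_zero: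
  assumes eq: "\<And>t. G t = p * G (t - A) + q * G (t - B)" and lim: "(G \<longlongrightarrow> 0) at_bot"
  shows "G t = 0"
proof -
  have "G t = 0 + p * G (t - A) + q * G (t - B)" for t using eq[of t] by simp
  from renewal_bound[OF this lim, of 0 t] show ?thesis by simp
qed

text \<open>This is \<open>1 / (1 - p ^ i - q ^ i) - 1\<close>: the reciprocal belongs to the Taylor
  coefficients of the mean, and subtracting the toll leaves a geometrically small factor.\<close>

definition beta :: "nat \<Rightarrow> real" where "beta i = (p ^ i + q ^ i) / (1 - p ^ i - q ^ i)"

definition rho where "rho = max p q"

lemma rho: "0 < rho" "rho < 1" using p_pos p_less1 q_less1 by (auto simp: rho_def)

lemma beta_nonneg: "0 \<le> beta (n + 2)"
  using pow_sum_less_1[of "n + 2"] p_pos q_pos by (auto simp: beta_def intro!: divide_nonneg_pos)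

lemma beta_bound: "beta (n + 2) \<le> 2 / (1 - p\<^sup>2 - q\<^sup>2) * rho ^ n"
proof -
  have le: "x ^ (n + 2) \<le> x\<^sup>2" "x ^ (n + 2) \<le> rho ^ n" if "0 < x" "x \<le> rho" for x
  proof -
    have "x ^ (n + 2) \<le> x ^ n" "x ^ (n + 2) \<le> x\<^sup>2" using that rho by (intro power_decreasing; simp)+
    moreover have "x ^ n \<le> rho ^ n" using that by (intro power_mono) auto
    ultimately show "x ^ (n + 2) \<le> x\<^sup>2" "x ^ (n + 2) \<le> rho ^ n" by auto
  qed
  have "0 < 1 - p\<^sup>2 - q\<^sup>2" using pow_sum_less_1[of 2] by simp
  moreover have "p ^ (n + 2) \<le> p\<^sup>2" "q ^ (n + 2) \<le> q\<^sup>2" "p ^ (n + 2) \<le> rho ^ n" "q ^ (n + 2) \<le> rho ^ n"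
    using le[of p] le[of q] p_pos q_pos by (auto simp: rho_def)
  ultimately have "beta (n + 2) \<le> (rho ^ n + rho ^ n) / (1 - p\<^sup>2 - q\<^sup>2)"
    unfolding beta_def using rho by (intro frac_le) (auto simp del: add_2_eq_Suc')
  then show ?thesis by simp
qed

text \<open>Taylor coefficients of the mean after the first split, with the index shifted by two
  because those of order 0 and 1 vanish.\<close>

definition mean_coeff :: "nat \<Rightarrow> real" where
  "mean_coeff n = beta (n + 2) * (-1) ^ n * real (n + 1) / fact (n + 2)"

lemma summable_rho_poly: "summable (\<lambda>n. (real n + 1) * (real n + 3) * rho ^ n)"
proof (rule summable_comparison_test_bigo)
  \<comment> \<open>Half of the geometric decay, \<open>sqrt rho ^ n\<close>, absorbs the
    polynomial.\<close>
  have "0 < sqrt rho" "sqrt rho < 1" using rho by auto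
  then show "summable (\<lambda>n. norm (sqrt rho ^ n))" by (simp add: summable_geometric)
  have "(\<lambda>n. (real n + 1) * (real n + 3) * (sqrt rho) ^ n) \<in> O(\<lambda>_. 1)"
    using \<open>0 < sqrt rho\<close> \<open>sqrt rho < 1\<close> by real_asymp
  then have "(\<lambda>n. (real n + 1) * (real n + 3) * (sqrt rho) ^ n * (sqrt rho) ^ n) \<in> O(\<lambda>n. 1 * (sqrt rho) ^ n)"
    by (intro landau_o.big.mult) auto
  then show "(\<lambda>n. (real n + 1) * (real n + 3) * rho ^ n) \<in> O(\<lambda>n. sqrt rho ^ n)"
    using rho by (simp add: mult.assoc power_mult_distrib[symmetric])
qed

lemma summable_beta: "summable (\<lambda>n. beta (n + 2))"
  by (rule summable_comparison_test'[of "\<lambda>n. 2 / (1 - p\<^sup>2 - q\<^sup>2) * rho ^ n"])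
     (use beta_nonneg beta_bound rho in \<open>auto intro!: summable_mult summable_geometric simp del: add_2_eq_Suc'\<close>)

lemma summable_beta_poly: "summable (\<lambda>n. beta (n + 2) * ((real n + 1) * (real n + 3)))"
proof (rule summable_comparison_test')
  show "summable (\<lambda>n. 2 / (1 - p\<^sup>2 - q\<^sup>2) * ((real n + 1) * (real n + 3) * rho ^ n))"
    by (intro summable_mult summable_rho_poly)
  fix n
  have "beta (n + 2) * ((real n + 1) * (real n + 3)) \<le> 2 / (1 - p\<^sup>2 - q\<^sup>2) * rho ^ n * ((real n + 1) * (real n + 3))"
    by (intro mult_right_mono beta_bound) auto
  then show "norm (beta (n + 2) * ((real n + 1) * (real n + 3))) \<le> 2 / (1 - p\<^sup>2 - q\<^sup>2) * ((real n + 1) * (real n + 3) * rho ^ n)"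
    using beta_nonneg[of n] by (simp add: abs_mult mult_ac)
qed

end

definition pois_le_1 :: "real \<Rightarrow> real" where "pois_le_1 x = (1 + x) * exp (- x)"

lemma pois_le_1_bounds:
  assumes "0 \<le> x"
  shows "0 \<le> pois_le_1 x" "pois_le_1 x \<le> 1" "1 - pois_le_1 x \<le> x\<^sup>2"
proof -
  show "0 \<le> pois_le_1 x" using assms by (simp add: pois_le_1_def)
  have "1 + x \<le> exp x" by (rule exp_ge_add_one_self)
  then show "pois_le_1 x \<le> 1" by (simp add: pois_le_1_def exp_minus field_simps)
  have "1 - x \<le> exp (- x)" using exp_ge_add_one_self[of "- x"] by simp
  then have "(1 + x) * (1 - x) \<le> (1 + x) * exp (- x)" using assms by (intro mult_left_mono) auto
  then show "1 - pois_le_1 x \<le> x\<^sup>2" by (simp add: pois_le_1_def power2_eq_square algebra_simps)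
qed

lemma DERIV_pois_le_1: "(pois_le_1 has_real_derivative - x * exp (- x)) (at x)"
  unfolding pois_le_1_def[abs_def] by (auto intro!: derivative_eq_intros simp: algebra_simps)

lemma poly_exp_bump:
  assumes "0 \<le> c" "y \<le> c * x * (1 + x)\<^sup>2 * exp (- x)" "x = exp t"
  shows "y \<le> 256 * c * bump t"
proof -
  have x: "0 < x" "0 < 1 + x" using assms(3) by (auto simp: add_pos_pos)
  have "c * x * (1 + x)\<^sup>2 * exp (- x) \<le> c * x * (1 + x)\<^sup>2 * (256 / (1 + x) ^ 4)"
    using assms x by (intro mult_left_mono exp_minus_le) auto
  also have "(1 + x) ^ 4 = (1 + x)\<^sup>2 * (1 + x)\<^sup>2" by (simp flip: power_add)
  also have "c * x * (1 + x)\<^sup>2 * (256 / ((1 + x)\<^sup>2 * (1 + x)\<^sup>2)) = 256 * c * (x / (1 + x)\<^sup>2)"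
    using x by (simp add: field_simps)
  finally show ?thesis using assms(2) bump_eq[OF assms(3)] by simp
qed

lemma power2_le_plus: "1 + x \<le> (1 + x)\<^sup>2" "1 \<le> (1 + x)\<^sup>2" "x\<^sup>2 \<le> (1 + x)\<^sup>2"
  if "0 \<le> x" for x :: real
  using that by (auto simp: power2_eq_square algebra_simps intro: add_nonneg_nonneg mult_nonneg_nonneg)

text \<open>The summands of the expanded toll cannot be transformed one by one, as they behave like
  \<open>exp (- t)\<close> at minus infinity. Integration by parts replaces \<open>a\<close> by its
  derivative, whose terms are convergent Gamma integrals, at the price of the factor
  \<open>\<xi> - 1\<close>.\<close>

lemma mellin_variance_term:
  assumes \<xi>: "Re \<xi> = 0"
  shows "integrable lborel (\<lambda>t. complex_of_real (exp (- t) * (pois_le_1 (exp t) * (1 - pois_le_1 (exp t)))) * exp (\<xi> * of_real t))"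
    and "(\<integral>t. complex_of_real (exp (- t) * (pois_le_1 (exp t) * (1 - pois_le_1 (exp t)))) * exp (\<xi> * of_real t) \<partial>lborel)
      = Gamma (\<xi> + 1) / (\<xi> - 1) * (1 - (\<xi> + 3) / 2 powr (1 + \<xi>))"
proof -
  define a where "a t = pois_le_1 (exp t) * (1 - pois_le_1 (exp t))" for t
  define a' where "a' t = - exp (2 * t - exp t) + 2 * exp (2 * t - 2 * exp t) + 2 * exp (3 * t - 2 * exp t)" for t :: real
  define Q where "Q t = complex_of_real (a t) * exp ((\<xi> - 1) * of_real t)" for t
  define R where "R t = complex_of_real (a' t) * exp ((\<xi> - 1) * of_real t)" for t
  have Q_eq: "complex_of_real (exp (- t) * (pois_le_1 (exp t) * (1 - pois_le_1 (exp t)))) * exp (\<xi> * of_real t) = Q t" for t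
  proof -
    have "exp ((\<xi> - 1) * of_real t) = complex_of_real (exp (- t)) * exp (\<xi> * of_real t)"
      by (simp add: exp_of_real[symmetric] exp_add[symmetric] algebra_simps)
    then show ?thesis by (simp add: Q_def a_def)
  qed
  have norm_exp: "norm (exp ((\<xi> - 1) * of_real t)) = exp (- t)" for t using \<xi> by simp
  have Q_bound: "norm (Q t) \<le> 256 * 1 * bump t" for t
  proof (rule poly_exp_bump)
    define x where "x = exp t"
    show "x = exp t" by (rule x_def)
    have x: "0 < x" by (simp add: x_def)
    have "0 \<le> a t" using pois_le_1_bounds[of "exp t"] by (simp add: a_def)
    then have "norm (Q t) = a t * exp (- t)"
      by (simp only: Q_def norm_mult norm_exp norm_of_real abs_of_nonneg)
    also have "\<dots> = pois_le_1 x * (1 - pois_le_1 x) / x" by (simp add: a_def x_def exp_minus divide_inverse)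
    also have "\<dots> \<le> pois_le_1 x * x\<^sup>2 / x"
      using pois_le_1_bounds[of x] x by (intro divide_right_mono mult_left_mono) auto
    also have "\<dots> = x * (1 + x) * exp (- x)" using x by (simp add: pois_le_1_def power2_eq_square)
    also have "\<dots> \<le> x * (1 + x)\<^sup>2 * exp (- x)" using x power2_le_plus[of x] by (intro mult_right_mono mult_left_mono) auto
    finally show "norm (Q t) \<le> 1 * x * (1 + x)\<^sup>2 * exp (- x)" by simp
  qed simp
  have a_der: "(a has_real_derivative a' t) (at t)" for t
  proof -
    define x where "x = exp t"
    define y where "y = exp (- exp t)"
    have xy: "exp (2 * t - exp t) = x\<^sup>2 * y" "exp (2 * t - 2 * exp t) = x\<^sup>2 * y\<^sup>2" "exp (3 * t - 2 * exp t) = x ^ 3 * y\<^sup>2"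
      by (simp_all add: x_def y_def exp_of_nat_mult[symmetric] exp_add[symmetric])
    have G: "((\<lambda>t. pois_le_1 (exp t)) has_real_derivative - (x\<^sup>2 * y)) (at t)"
      using DERIV_chain2[OF DERIV_pois_le_1[of "exp t"] DERIV_exp[of t]]
      by (simp add: x_def y_def power2_eq_square mult_ac)
    have "(a has_real_derivative - (x\<^sup>2 * y) * (1 - pois_le_1 (exp t)) + (0 - - (x\<^sup>2 * y)) * pois_le_1 (exp t)) (at t)"
      unfolding a_def by (intro DERIV_mult DERIV_diff DERIV_const G)
    moreover have "- (x\<^sup>2 * y) * (1 - pois_le_1 (exp t)) + (0 - - (x\<^sup>2 * y)) * pois_le_1 (exp t) = a' t"
    proof -
      have "pois_le_1 (exp t) = (1 + x) * y" by (simp add: pois_le_1_def x_def y_def)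
      then show ?thesis unfolding a'_def xy by (simp add: power2_eq_square power3_eq_cube algebra_simps)
    qed
    ultimately show ?thesis by simp
  qed
  have Q_der: "(Q has_vector_derivative R t + (\<xi> - 1) * Q t) (at t)" for t
  proof -
    have 1: "((\<lambda>t. complex_of_real (a t)) has_vector_derivative complex_of_real (a' t)) (at t)"
      by (rule has_vector_derivative_of_real[OF a_der])
    have 2: "((\<lambda>t. exp ((\<xi> - 1) * of_real t)) has_vector_derivative (\<xi> - 1) * exp ((\<xi> - 1) * of_real t)) (at t)"
      by (rule has_vector_derivative_real_field) (auto intro!: derivative_eq_intros)
    from has_vector_derivative_mult[OF 1 2] show ?thesis
      unfolding Q_def R_def by (simp add: algebra_simps)
  qed
  define E where "E z c t = exp (z * of_real t - of_real (c * exp t))" for z :: complex and c t :: real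
  have R_eq: "R t = - E (\<xi> + 1) 1 t + 2 * E (\<xi> + 1) 2 t + 2 * E (\<xi> + 2) 2 t" for t
  proof -
    have *: "complex_of_real (exp (k * t - c * exp t)) * exp ((\<xi> - 1) * of_real t) = E (\<xi> + (of_real k - 1)) c t" for k c
      unfolding E_def exp_of_real[symmetric] exp_add[symmetric] by (simp add: exp_of_real algebra_simps)
    show ?thesis
      using *[of 2 1] *[of 2 2] *[of 3 2] by (simp add: R_def a'_def distrib_right left_diff_distrib mult.assoc)
  qed
  have E: "integrable lborel (E z c)" "(\<integral>t. E z c t \<partial>lborel) = exp (- (z * of_real (ln c))) * Gamma z"
    if "Re z > 0" "c > 0" for z c
    using Gamma_exp_integral_scaled[OF that] by (simp_all add: E_def[abs_def])
  have E3: "integrable lborel (E (\<xi> + 1) 1)" "integrable lborel (E (\<xi> + 1) 2)" "integrable lborel (E (\<xi> + 2) 2)"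
    using \<xi> by (intro E(1); simp)+
  have R_int: "integrable lborel R"
    unfolding R_eq[abs_def] by (intro Bochner_Integration.integrable_add Bochner_Integration.integrable_minus integrable_mult_right E3)
  have R_val: "(\<integral>t. R t \<partial>lborel) = - Gamma (\<xi> + 1) * (1 - (\<xi> + 3) / 2 powr (1 + \<xi>))"
  proof -
    have "(\<integral>t. R t \<partial>lborel) = - (\<integral>t. E (\<xi> + 1) 1 t \<partial>lborel) + 2 * (\<integral>t. E (\<xi> + 1) 2 t \<partial>lborel) + 2 * (\<integral>t. E (\<xi> + 2) 2 t \<partial>lborel)"
      unfolding R_eq using E3 by simp
    also have "(\<integral>t. E (\<xi> + 1) 1 t \<partial>lborel) = Gamma (\<xi> + 1)" using E(2)[of "\<xi> + 1" 1] \<xi> by simp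
    also have "(\<integral>t. E (\<xi> + 1) 2 t \<partial>lborel) = Gamma (\<xi> + 1) / 2 powr (1 + \<xi>)"
    proof -
      have "2 powr (1 + \<xi>) = exp ((\<xi> + 1) * of_real (ln 2))"
        by (simp add: powr_def add.commute flip: Ln_of_real)
      then show ?thesis using E(2)[of "\<xi> + 1" 2] \<xi> unfolding exp_minus by (simp add: divide_inverse mult.commute)
    qed
    also have "(\<integral>t. E (\<xi> + 2) 2 t \<partial>lborel) = (\<xi> + 1) * Gamma (\<xi> + 1) / (2 * 2 powr (1 + \<xi>))"
    proof -
      have g: "Gamma (\<xi> + 2) = (\<xi> + 1) * Gamma (\<xi> + 1)"
        using Gamma_plus1_pos[of "\<xi> + 1"] \<xi> by (simp add: add.assoc)
      have "exp (- ((\<xi> + 2) * of_real (ln 2))) = 1 / (2 * 2 powr (1 + \<xi>))"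
      proof -
        have "2 * 2 powr (1 + \<xi>) = exp (of_real (ln 2)) * exp ((1 + \<xi>) * of_real (ln 2))"
          by (simp add: powr_def exp_of_real flip: Ln_of_real)
        also have "\<dots> = exp ((\<xi> + 2) * of_real (ln 2))" by (simp add: exp_add[symmetric] algebra_simps)
        finally show ?thesis by (simp add: exp_minus divide_inverse)
      qed
      then show ?thesis using E(2)[of "\<xi> + 2" 2] \<xi> by (simp add: g)
    qed
    also have "- Gamma (\<xi> + 1) + 2 * (Gamma (\<xi> + 1) / 2 powr (1 + \<xi>)) + 2 * ((\<xi> + 1) * Gamma (\<xi> + 1) / (2 * 2 powr (1 + \<xi>)))
        = - Gamma (\<xi> + 1) * (1 - (\<xi> + 3) / 2 powr (1 + \<xi>))"
    proof -
      have "- x + 2 * (x / P) + 2 * ((z + 1) * x / (2 * P)) = - x * (1 - (z + 3) / P)" if "P \<noteq> 0" for x P z :: complex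
        using that by (simp add: field_simps)
      then show ?thesis by simp
    qed
    finally show ?thesis .
  qed
  have Q_cont: "continuous_on UNIV Q"
    unfolding Q_def a_def pois_le_1_def by (intro continuous_intros)
  have Q_int: "integrable lborel Q"
  proof (rule Bochner_Integration.integrable_bound[of lborel "\<lambda>t. 256 * 1 * bump t"])
    show "Q \<in> borel_measurable lborel" using Q_cont by (simp add: borel_measurable_continuous_onI)
    show "AE t in lborel. norm (Q t) \<le> norm (256 * 1 * bump t)"
      using Q_bound bump_nonneg by simp
  qed (intro integrable_mult_right integrable_bump)
  \<comment> \<open>The boundary values vanish because the bump does at both ends, so the integral
    of \<open>R\<close> is \<open>- (\<xi> - 1)\<close> times the wanted one.\<close>
  have "(LBINT t=-\<infinity>..\<infinity>. R t + (\<xi> - 1) * Q t) = 0 - 0"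
  proof (rule interval_integral_FTC_integrable)
    show "(Q has_vector_derivative R t + (\<xi> - 1) * Q t) (at t)" for t by (rule Q_der)
    have "continuous_on UNIV R" unfolding R_def a'_def by (intro continuous_intros)
    then have "continuous_on UNIV (\<lambda>t. R t + (\<xi> - 1) * Q t)" by (intro continuous_intros Q_cont)
    then show "isCont (\<lambda>t. R t + (\<xi> - 1) * Q t) t" for t by (simp add: continuous_on_eq_continuous_at)
    show "set_integrable lborel (einterval (-\<infinity>) \<infinity>) (\<lambda>t. R t + (\<xi> - 1) * Q t)"
      using R_int Q_int by (simp add: set_integrable_def)
    have "(Q \<longlongrightarrow> 0) at_bot"
    proof (rule Lim_null_comparison)
      have "((\<lambda>t. 256 * exp t) \<longlongrightarrow> 256 * (0::real)) at_bot" by (intro tendsto_intros exp_at_bot)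
      then show "((\<lambda>t. 256 * exp t) \<longlongrightarrow> (0::real)) at_bot" by simp
      have "norm (Q t) \<le> 256 * exp t" for t using Q_bound[of t] bump_le_exp[of t] by linarith
      then show "eventually (\<lambda>t. norm (Q t) \<le> 256 * exp t) at_bot" by simp
    qed
    then show "((Q \<circ> real_of_ereal) \<longlongrightarrow> 0) (at_right (-\<infinity>))" by (simp add: ereal_tendsto_simps)
    have "(Q \<longlongrightarrow> 0) at_top"
    proof (rule Lim_null_comparison)
      show "((\<lambda>t. 256 * 1 * bump t) \<longlongrightarrow> 0) at_top"
        by (intro tendsto_mult_right_zero tendsto_bump_at_top)
    qed (use Q_bound in auto)
    then show "((Q \<circ> real_of_ereal) \<longlongrightarrow> 0) (at_left \<infinity>)" by (simp add: ereal_tendsto_simps)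
  qed simp
  then have "(\<integral>t. R t + (\<xi> - 1) * Q t \<partial>lborel) = 0"
    by (simp add: interval_lebesgue_integral_def set_lebesgue_integral_def)
  then have "(\<integral>t. R t \<partial>lborel) + (\<xi> - 1) * (\<integral>t. Q t \<partial>lborel) = 0"
    using R_int Q_int by simp
  moreover have "\<xi> - 1 \<noteq> 0" using \<xi> by (auto simp: complex_eq_iff)
  ultimately have "(\<integral>t. Q t \<partial>lborel) = Gamma (\<xi> + 1) / (\<xi> - 1) * (1 - (\<xi> + 3) / 2 powr (1 + \<xi>))"
    unfolding R_val by (simp add: field_simps)
  then show "(\<integral>t. complex_of_real (exp (- t) * (pois_le_1 (exp t) * (1 - pois_le_1 (exp t)))) * exp (\<xi> * of_real t) \<partial>lborel)
      = Gamma (\<xi> + 1) / (\<xi> - 1) * (1 - (\<xi> + 3) / 2 powr (1 + \<xi>))"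
    unfolding Q_eq .
  show "integrable lborel (\<lambda>t. complex_of_real (exp (- t) * (pois_le_1 (exp t) * (1 - pois_le_1 (exp t)))) * exp (\<xi> * of_real t))"
    unfolding Q_eq by (rule Q_int)
qed

context bernoulli_split
begin

lemma mean_coeff_abs: "\<bar>mean_coeff n\<bar> = beta (n + 2) * real (n + 1) / fact (n + 2)"
  using beta_nonneg[of n] by (simp add: mean_coeff_def abs_mult power_abs)

text \<open>Two neighbouring Gamma values contribute at most
  \<open>n! + (n + 1)! = (n + 2) * n!\<close>. The coefficient cancels this exactly, so that
  summability rests on \<open>beta\<close> alone.\<close>

lemma mean_coeff_fact: "\<bar>mean_coeff n\<bar> * ((real n + 2) * fact n) = beta (n + 2)"
proof -
  have "(fact (n + 2) :: real) = (real n + 2) * (real (n + 1) * fact n)"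
    by (simp add: algebra_simps)
  moreover have "x * a / (b * (a * f)) * (b * f) = x" if "a \<noteq> 0" "b \<noteq> 0" "f \<noteq> 0" for x a b f :: real
    using that by (simp add: field_simps)
  from this[of "real (n + 1)" "real n + 2" "fact n"]
  have "beta (n + 2) * real (n + 1) / ((real n + 2) * (real (n + 1) * fact n)) * ((real n + 2) * fact n) = beta (n + 2)"
    by (metis add_pos_pos fact_nonzero of_nat_0_less_iff of_nat_eq_0_iff of_nat_add of_nat_numeral add_eq_0_iff_both_eq_0 zero_neq_numeral one_neq_zero)
  ultimately show ?thesis unfolding mean_coeff_abs by (simp only:)
qed

text \<open>Each Taylor term times \<open>pois_le_1\<close> gives two neighbouring Gamma integrals,
  which the functional equation merges into one. Their absolute integrals are at most
  \<open>beta (n + 2)\<close>, so sum and integral may be exchanged.\<close>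

lemma mellin_mean_term:
  assumes \<xi>: "Re \<xi> = 0" and h: "\<And>x. 0 < x \<Longrightarrow> (\<lambda>n. mean_coeff n * x ^ (n + 2)) sums h x"
  shows "(\<lambda>n. of_real (mean_coeff n) * ((of_nat n + 2 + \<xi>) * Gamma (of_nat n + 1 + \<xi>))) sums
      (\<integral>t. complex_of_real (exp (- t) * (pois_le_1 (exp t) * h (exp t))) * exp (\<xi> * of_real t) \<partial>lborel)"
    and "integrable lborel (\<lambda>t. complex_of_real (exp (- t) * (pois_le_1 (exp t) * h (exp t))) * exp (\<xi> * of_real t))"
proof -
  define E where "E z t = exp (z * of_real t - complex_of_real (exp t))" for z t
  define f where "f n t = of_real (mean_coeff n) * (E (of_nat n + 1 + \<xi>) t + E (of_nat n + 2 + \<xi>) t)" for n t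
  have E: "integrable lborel (E z)" "(\<integral>t. E z t \<partial>lborel) = Gamma z" if "Re z > 0" for z
    using Gamma_exp_integral[OF that] by (simp_all add: E_def[abs_def])
  have pos: "Re (of_nat n + 1 + \<xi>) > 0" "Re (of_nat n + 2 + \<xi>) > 0" for n using \<xi> by auto
  have f_int: "integrable lborel (f n)" for n
    unfolding f_def by (intro integrable_mult_right Bochner_Integration.integrable_add E pos)
  have f_val: "(\<integral>t. f n t \<partial>lborel) = of_real (mean_coeff n) * ((of_nat n + 2 + \<xi>) * Gamma (of_nat n + 1 + \<xi>))" for n
  proof -
    have "Gamma (of_nat n + 2 + \<xi>) = (of_nat n + 1 + \<xi>) * Gamma (of_nat n + 1 + \<xi>)"
      using Gamma_plus1_pos[OF pos(1)[of n]] by (simp add: algebra_simps)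
    then show ?thesis unfolding f_def using E[OF pos(1)] E[OF pos(2)] by (simp add: algebra_simps)
  qed
  have f_eq: "f n t = complex_of_real (exp (- t) * pois_le_1 (exp t)) * exp (\<xi> * of_real t) * of_real (mean_coeff n * exp t ^ (n + 2))" for n t
  proof -
    have *: "E (of_nat k + \<xi>) t = complex_of_real (exp (- exp t)) * exp (\<xi> * of_real t) * complex_of_real (exp t ^ k)" for k
      unfolding exp_of_nat_mult[symmetric] E_def exp_of_real[symmetric] exp_add[symmetric]
      by (simp add: exp_of_real algebra_simps)
    have 1: "exp (- t) * pois_le_1 (exp t) * (mean_coeff n * exp t ^ (n + 2)) = mean_coeff n * (exp (- exp t) * (exp t ^ (n + 1) + exp t ^ (n + 2)))"
    proof -
      have "exp (- t) * exp t ^ (n + 2) = exp t ^ (n + 1)" by (simp add: exp_minus field_simps)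
      moreover have "exp (- t) * pois_le_1 (exp t) * (mean_coeff n * exp t ^ (n + 2)) = mean_coeff n * pois_le_1 (exp t) * (exp (- t) * exp t ^ (n + 2))"
        by (simp only: mult_ac)
      ultimately have "exp (- t) * pois_le_1 (exp t) * (mean_coeff n * exp t ^ (n + 2)) = mean_coeff n * pois_le_1 (exp t) * exp t ^ (n + 1)"
        by (simp only:)
      then show ?thesis by (simp add: pois_le_1_def algebra_simps)
    qed
    have "f n t = of_real (mean_coeff n) * (E (of_nat (n + 1) + \<xi>) t + E (of_nat (n + 2) + \<xi>) t)" by (simp add: f_def add_ac)
    also have "\<dots> = exp (\<xi> * of_real t) * of_real (mean_coeff n * (exp (- exp t) * (exp t ^ (n + 1) + exp t ^ (n + 2))))"
      unfolding * by (simp add: algebra_simps del: power_Suc add_2_eq_Suc')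
    finally show ?thesis unfolding 1[symmetric] by (simp add: mult_ac del: power_Suc add_2_eq_Suc')
  qed
  have norm_f: "norm (f n t) \<le> \<bar>mean_coeff n\<bar> * (norm (E (of_nat n + 1 + \<xi>) t) + norm (E (of_nat n + 2 + \<xi>) t))" for n t
    unfolding f_def norm_mult by (intro mult_mono norm_triangle_ineq) auto
  have int_norm: "(\<integral>t. norm (f n t) \<partial>lborel) \<le> beta (n + 2)" for n
  proof -
    have "(\<integral>t. norm (f n t) \<partial>lborel) \<le> (\<integral>t. \<bar>mean_coeff n\<bar> * (norm (E (of_nat n + 1 + \<xi>) t) + norm (E (of_nat n + 2 + \<xi>) t)) \<partial>lborel)"
      by (intro integral_mono norm_f f_int integrable_norm integrable_mult_right Bochner_Integration.integrable_add E pos)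
    also have "\<dots> = \<bar>mean_coeff n\<bar> * ((\<integral>t. norm (E (of_nat n + 1 + \<xi>) t) \<partial>lborel) + (\<integral>t. norm (E (of_nat n + 2 + \<xi>) t) \<partial>lborel))"
      using integrable_norm[OF E(1)[OF pos(1)[of n]]] integrable_norm[OF E(1)[OF pos(2)[of n]]] by simp
    also have "(\<integral>t. norm (E (of_nat n + 1 + \<xi>) t) \<partial>lborel) = fact n"
      unfolding E_def using \<xi> by (intro norm_Gamma_le_fact(2)) simp
    also have "(\<integral>t. norm (E (of_nat n + 2 + \<xi>) t) \<partial>lborel) = fact (Suc n)"
      unfolding E_def using \<xi> by (intro norm_Gamma_le_fact(2)) simp
    also have "\<bar>mean_coeff n\<bar> * (fact n + fact (Suc n)) = \<bar>mean_coeff n\<bar> * ((real n + 2) * fact n)" by (simp add: algebra_simps)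
    finally show ?thesis unfolding mean_coeff_fact .
  qed
  have sum_int: "summable (\<lambda>n. \<integral>t. norm (f n t) \<partial>lborel)"
    by (rule summable_comparison_test'[OF summable_beta]) (use int_norm in auto)
  have mean_coeff_summable: "summable (\<lambda>n. \<bar>mean_coeff n\<bar> * x ^ (n + 2))" if x: "0 < x" for x
  proof -
    obtain K where K: "\<And>n. norm (beta (n + 2)) \<le> K"
      using summable_imp_Bseq[OF summable_beta] by (auto simp: Bseq_def)
    show ?thesis
    proof (rule summable_comparison_test')
      show "summable (\<lambda>n. K * x\<^sup>2 * (inverse (fact n) * x ^ n))" by (intro summable_mult summable_exp)
      fix n
      have "\<bar>mean_coeff n\<bar> * fact n \<le> beta (n + 2)"
        unfolding mean_coeff_fact[symmetric] by (intro mult_left_mono) (auto simp: mult_le_cancel_right1)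
      then have "\<bar>mean_coeff n\<bar> * fact n \<le> K" using K[of n] by simp
      then have "\<bar>mean_coeff n\<bar> \<le> K * inverse (fact n)" by (simp add: field_simps)
      then have "\<bar>mean_coeff n\<bar> * x ^ (n + 2) \<le> K * inverse (fact n) * x ^ (n + 2)"
        using x by (intro mult_right_mono) auto
      then show "norm (\<bar>mean_coeff n\<bar> * x ^ (n + 2)) \<le> K * x\<^sup>2 * (inverse (fact n) * x ^ n)"
        using x by (simp add: power2_eq_square mult_ac)
    qed
  qed
  have f_summable: "summable (\<lambda>n. norm (f n t))" for t
  proof -
    have "norm (f n t) = norm (complex_of_real (exp (- t) * pois_le_1 (exp t)) * exp (\<xi> * of_real t)) * (\<bar>mean_coeff n\<bar> * exp t ^ (n + 2))" for n
      unfolding f_eq by (simp add: norm_mult norm_power abs_mult del: power_Suc add_2_eq_Suc')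
    then show ?thesis using summable_mult[OF mean_coeff_summable[of "exp t"]] by simp
  qed
  have f_sum: "(\<Sum>n. f n t) = complex_of_real (exp (- t) * (pois_le_1 (exp t) * h (exp t))) * exp (\<xi> * of_real t)" for t
  proof -
    have "(\<lambda>n. complex_of_real (mean_coeff n * exp t ^ (n + 2))) sums of_real (h (exp t))"
      using h[of "exp t"] by (subst sums_of_real_iff) auto
    from sums_mult[OF this, of "complex_of_real (exp (- t) * pois_le_1 (exp t)) * exp (\<xi> * of_real t)"]
    show ?thesis unfolding f_eq by (simp add: sums_iff mult_ac)
  qed
  have "(\<lambda>n. \<integral>t. f n t \<partial>lborel) sums (\<integral>t. (\<Sum>n. f n t) \<partial>lborel)"
    by (rule sums_integral[OF f_int _ sum_int]) (use f_summable in auto)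
  then show "(\<lambda>n. of_real (mean_coeff n) * ((of_nat n + 2 + \<xi>) * Gamma (of_nat n + 1 + \<xi>))) sums
      (\<integral>t. complex_of_real (exp (- t) * (pois_le_1 (exp t) * h (exp t))) * exp (\<xi> * of_real t) \<partial>lborel)"
    unfolding f_val f_sum .
  have "integrable lborel (\<lambda>t. \<Sum>n. f n t)"
    by (rule integrable_suminf[OF f_int _ sum_int]) (use f_summable in auto)
  then show "integrable lborel (\<lambda>t. complex_of_real (exp (- t) * (pois_le_1 (exp t) * h (exp t))) * exp (\<xi> * of_real t))"
    unfolding f_sum .
qed

end

section \<open>The tolls of mean and variance\<close>

lemma pois_at_0: "pois f 0 = f 0"
proof -
  have "(\<lambda>n. f n * (0 ^ n / fact n)) = (\<lambda>n. if n = 0 then f n else 0)" by (auto simp: fun_eq_iff)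
  then show ?thesis using sums_single[of 0 f] by (simp add: pois_def sums_iff)
qed

text \<open>The Poisson calculus for the sequence \<open>(-1) ^ n\<close>, whose transform is
  \<open>exp (- 2 * z)\<close>, supplies this Taylor series of the toll of the mean.\<close>

lemma alternating_pois_le_1_sums:
  "(\<lambda>n. (if n < 2 then 0 else (-1) ^ n * (real n - 1)) * (z ^ n / fact n)) sums (1 - pois_le_1 z)"
proof -
  define a :: "nat \<Rightarrow> real" where "a n = (-1) ^ n" for n
  have gb_a: "geom_bounded a" unfolding a_def by (rule geom_bounded_mono[of "\<lambda>_. 1"]) (auto simp: power_abs)
  define e where "e n = (if n < 2 then 0 else (-1) ^ n * (real n - 1))" for n
  have e: "e = (\<lambda>n. real n * a n - a n + (if n = 0 then 1 else 0))"
    by (auto simp: e_def a_def fun_eq_iff algebra_simps less_2_cases_iff)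
  have gb: "geom_bounded e" unfolding e by (intro geom_bounded_intros gb_a)
  have pa: "pois a z = exp (- z) * exp (- z)"
  proof -
    have "(\<Sum>n. a n * (z ^ n / fact n)) = exp (- z)"
      using sums_unique[OF exp_converges[of "- z"]]
      by (simp add: a_def power_minus[of z] divide_inverse mult_ac)
    then show ?thesis by (simp add: pois_def)
  qed
  have "pois (\<lambda>n. real n * a n) z = z * pois (\<lambda>n. a (Suc n)) z" by (rule pois_of_nat_mult[OF gb_a])
  also have "(\<lambda>n. a (Suc n)) = (\<lambda>n. (-1) * a n)" by (simp add: a_def)
  also have "pois \<dots> z = - 1 * pois a z" by (rule pois_cmult[OF gb_a])
  finally have pna: "pois (\<lambda>n. real n * a n) z = - z * (exp (- z) * exp (- z))" by (simp add: pa)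
  have pe: "pois e z = - z * (exp (- z) * exp (- z)) - exp (- z) * exp (- z) + exp (- z)"
    unfolding e
    by (subst pois_add, (intro geom_bounded_intros gb_a)+, subst pois_diff, (intro geom_bounded_intros gb_a)+)
       (simp add: pna pa pois_single)
  have "exp z * pois e z = (exp z * exp (- z)) * (- z * exp (- z) - exp (- z) + 1)"
    unfolding pe by (simp add: algebra_simps)
  then have "exp z * pois e z = 1 - pois_le_1 z"
    unfolding exp_minus_inverse by (simp add: pois_le_1_def algebra_simps)
  then have "(\<Sum>n. e n * (z ^ n / fact n)) = 1 - pois_le_1 z"
    by (simp add: pois_def exp_minus mult.assoc[symmetric])
  then show ?thesis using summable_sums[OF summable_pois'[OF gb, of z]] by (simp add: e_def)
qed

text \<open>Division by \<open>exp t\<close> supplies the weights: an unweighted sum over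
  \<open>p * z\<close> and \<open>q * z\<close> becomes a renewal equation with weights
  \<open>p\<close> and \<open>q\<close>.\<close>

lemma (in bernoulli_split) exp_uminus_diff:
  "p * (x * exp (- (t - A))) = x * exp (- t)" "q * (x * exp (- (t - B))) = x * exp (- t)"
proof -
  have "exp (- (t - A)) = exp A * exp (- t)" "exp (- (t - B)) = exp B * exp (- t)"
    by (simp_all flip: exp_add)
  moreover have "p * exp A = 1" "q * exp B = 1"
    using p_pos q_pos by (simp_all add: A_def B_def exp_minus)
  ultimately show "p * (x * exp (- (t - A))) = x * exp (- t)" "q * (x * exp (- (t - B))) = x * exp (- t)"
    by (metis (no_types) mult.assoc mult.left_commute mult_1)+
qed

context trie_moments
begin

definition mean_split :: "real \<Rightarrow> real" where
  "mean_split x = pois m (p * x) + pois m (q * x)"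

lemma phi_eq: "phi x = pois_le_1 x * (1 - pois_le_1 x) + 2 * (pois_le_1 x * mean_split x)"
  by (simp add: phi_def pois_le_1_def mean_split_def)

text \<open>Dividing the coefficients of the toll by \<open>1 - p ^ n - q ^ n\<close> gives a power
  series \<open>N\<close> with the functional equation of \<open>pois m\<close>. Both have value and
  derivative 0 at 0, so their difference divided by \<open>exp t\<close> is a homogeneous renewal
  solution vanishing at minus infinity, hence 0.\<close>

lemma mean_split_sums:
  assumes z: "0 < z"
  shows "(\<lambda>n. mean_coeff n * z ^ (n + 2)) sums mean_split z"
proof -
  define e where "e n = (if n < 2 then 0 else (-1) ^ n * (real n - 1))" for n :: nat
  define f where "f n = e n / (1 - p ^ n - q ^ n)" for n
  have den: "1 - p ^ n - q ^ n \<ge> 1 - p\<^sup>2 - q\<^sup>2" "1 - p\<^sup>2 - q\<^sup>2 > 0" if "n \<ge> 2" for n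
  proof -
    have "p ^ n \<le> p\<^sup>2" "q ^ n \<le> q\<^sup>2"
      using that p_pos q_pos p_less1 q_less1 by (intro power_decreasing; simp)+
    then show "1 - p ^ n - q ^ n \<ge> 1 - p\<^sup>2 - q\<^sup>2" by simp
    show "1 - p\<^sup>2 - q\<^sup>2 > 0" using pow_sum_less_1[of 2] by simp
  qed
  have gb: "geom_bounded f"
  proof (rule geom_bounded_mono[of "\<lambda>n. 1 / (1 - p\<^sup>2 - q\<^sup>2) * real n"])
    show "geom_bounded (\<lambda>n. 1 / (1 - p\<^sup>2 - q\<^sup>2) * real n)" by (intro geom_bounded_intros)
    fix n
    show "\<bar>f n\<bar> \<le> \<bar>1 / (1 - p\<^sup>2 - q\<^sup>2) * real n\<bar>"
    proof (cases "n < 2")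
      case False
      then have n: "n \<ge> 2" by simp
      have "\<bar>f n\<bar> = (real n - 1) / (1 - p ^ n - q ^ n)"
        using n den[OF n] by (simp add: f_def e_def abs_mult power_abs)
      also have "\<dots> \<le> real n / (1 - p\<^sup>2 - q\<^sup>2)" using n den[OF n] by (intro frac_le) auto
      finally show ?thesis using den[OF n] by simp
    qed (simp add: f_def e_def)
  qed
  define N where "N z = (\<Sum>n. f n * (z ^ n / fact n))" for z
  have N: "(\<lambda>n. f n * (z ^ n / fact n)) sums N z" for z
    unfolding N_def by (rule summable_sums[OF summable_pois'[OF gb]])
  have e_sums: "(\<lambda>n. e n * (z ^ n / fact n)) sums (1 - pois_le_1 z)" for z
    unfolding e_def by (rule alternating_pois_le_1_sums)
  have fe: "f n * (1 - p ^ n - q ^ n) = e n" for n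
    using den[of n] by (cases "n < 2") (auto simp: f_def e_def)
  have N_eq: "N z = N (p * z) + N (q * z) + (1 - pois_le_1 z)" for z
  proof -
    have "(\<lambda>n. f n * (z ^ n / fact n) - f n * ((p * z) ^ n / fact n) - f n * ((q * z) ^ n / fact n))
        sums (N z - N (p * z) - N (q * z))" by (intro sums_diff N)
    also have "(\<lambda>n. f n * (z ^ n / fact n) - f n * ((p * z) ^ n / fact n) - f n * ((q * z) ^ n / fact n))
        = (\<lambda>n. e n * (z ^ n / fact n))"
    proof
      fix n
      have "f n * (z ^ n / fact n) - f n * ((p * z) ^ n / fact n) - f n * ((q * z) ^ n / fact n)
          = f n * (1 - p ^ n - q ^ n) * (z ^ n / fact n)"
        by (simp add: power_mult_distrib algebra_simps)
      then show "f n * (z ^ n / fact n) - f n * ((p * z) ^ n / fact n) - f n * ((q * z) ^ n / fact n) = e n * (z ^ n / fact n)"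
        by (simp only: fe)
    qed
    finally have "N z - N (p * z) - N (q * z) = 1 - pois_le_1 z" using e_sums[of z] by (rule sums_unique2)
    then show ?thesis by simp
  qed
  have N_pois: "N = (\<lambda>z. exp z * pois f z)" by (auto simp: N_def pois_def exp_minus)
  have f01: "f 0 = 0" "f (Suc 0) = 0" by (simp_all add: f_def e_def)
  define \<Delta> where "\<Delta> z = pois m z - N z" for z
  have "\<Delta> (exp t) * exp (- t) = 0" for t
  proof (rule renewal_zero[of "\<lambda>t. \<Delta> (exp t) * exp (- t)"])
    fix t
    have "\<Delta> (exp t) = \<Delta> (p * exp t) + \<Delta> (q * exp t)"
      using pois_m_eq[of "exp t"] N_eq[of "exp t"] by (simp add: \<Delta>_def pois_le_1_def)
    moreover have "p * (\<Delta> (exp (t - A)) * exp (- (t - A))) = \<Delta> (p * exp t) * exp (- t)"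
      "q * (\<Delta> (exp (t - B)) * exp (- (t - B))) = \<Delta> (q * exp t) * exp (- t)"
      unfolding exp_uminus_diff exp_diff_A exp_diff_B by (rule refl)+
    ultimately show "\<Delta> (exp t) * exp (- t) = p * (\<Delta> (exp (t - A)) * exp (- (t - A))) + q * (\<Delta> (exp (t - B)) * exp (- (t - B)))"
      by (simp add: distrib_right)
  next
    show "((\<lambda>t. \<Delta> (exp t) * exp (- t)) \<longlongrightarrow> 0) at_bot"
    proof (rule tendsto_exp_at_bot_quotient)
      have "(pois m has_real_derivative 0) (at 0)"
        using has_real_derivative_pois[OF geom_bounded_m, of 0] by (simp add: pois_at_0)
      moreover have "((\<lambda>z. exp z * pois f z) has_real_derivative 0) (at 0)"
        using DERIV_mult[OF DERIV_exp[of 0] has_real_derivative_pois[OF gb, of 0]] by (simp add: pois_at_0 f01)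
      ultimately show "(\<Delta> has_real_derivative 0) (at 0)"
        unfolding \<Delta>_def N_pois using DERIV_diff by fastforce
      show "\<Delta> 0 = 0" by (simp add: \<Delta>_def N_pois pois_at_0 f01)
    qed
  qed
  from this[of "ln z"] have "pois m z = N z" using z by (simp add: \<Delta>_def)
  then have "mean_split z = N z - (1 - pois_le_1 z)"
    using pois_m_eq[of z] by (simp add: mean_split_def pois_le_1_def)
  then have ms: "(\<lambda>n. f n * (z ^ n / fact n) - e n * (z ^ n / fact n)) sums mean_split z"
    using sums_diff[OF N e_sums, of z z] by simp
  have "(\<lambda>n. f (n + 2) * (z ^ (n + 2) / fact (n + 2)) - e (n + 2) * (z ^ (n + 2) / fact (n + 2))) sums mean_split z"
    by (subst sums_iff_shift) (use ms in \<open>simp add: f_def e_def numeral_2_eq_2\<close>)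
  also have "(\<lambda>n. f (n + 2) * (z ^ (n + 2) / fact (n + 2)) - e (n + 2) * (z ^ (n + 2) / fact (n + 2))) = (\<lambda>n. mean_coeff n * z ^ (n + 2))"
  proof
    fix n
    have "1 - p ^ (n + 2) - q ^ (n + 2) > 0" using den[of "n + 2"] by simp
    then have "f (n + 2) - e (n + 2) = e (n + 2) * beta (n + 2)"
      by (simp add: f_def beta_def field_simps del: power_Suc add_2_eq_Suc')
    moreover have "e (n + 2) = (-1) ^ n * real (n + 1)" by (simp add: e_def)
    ultimately have "f (n + 2) - e (n + 2) = beta (n + 2) * (-1) ^ n * real (n + 1)" by (simp only: mult_ac)
    then show "f (n + 2) * (z ^ (n + 2) / fact (n + 2)) - e (n + 2) * (z ^ (n + 2) / fact (n + 2)) = mean_coeff n * z ^ (n + 2)"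
      unfolding left_diff_distrib[symmetric] mean_coeff_def by (simp only: times_divide_eq_right times_divide_eq_left)
  qed
  finally show ?thesis .
qed

lemma pois_mu_bounds:
  assumes "0 \<le> z"
  shows "0 \<le> pois mu z" "pois mu z \<le> 1 / (p * q) * z"
proof -
  show "0 \<le> pois mu z" using assms by (intro pois_nonneg mu_nonneg) auto
  have "mu n \<le> 1 / (p * q) * real n" for n
  proof (cases n)
    case (Suc k)
    have "1 / (p * q) * 1 \<le> 1 / (p * q) * real n" using p_pos q_pos Suc by (intro mult_left_mono) auto
    then show ?thesis using mu_le[of n] by linarith
  qed simp
  then have "pois mu z \<le> pois (\<lambda>n. 1 / (p * q) * real n) z"
    using assms by (intro pois_mono geom_bounded_intros) auto
  also have "\<dots> = 1 / (p * q) * z" by (subst pois_cmult) (auto simp: pois_id)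
  finally show "pois mu z \<le> 1 / (p * q) * z" .
qed

text \<open>\<open>m\<close> vanishes at 0 and 1 and grows at most linearly, so
  \<open>n * (n - 1) / (p * q)\<close> dominates it; the Poisson mean of that is a pure
  square.\<close>

lemma pois_m_bounds:
  assumes "0 \<le> z"
  shows "0 \<le> pois m z" "pois m z \<le> 1 / (p * q) * z\<^sup>2"
proof -
  show "0 \<le> pois m z" using assms by (intro pois_nonneg m_nonneg) auto
  have "m n \<le> 1 / (p * q) * ((real n)\<^sup>2 - real n)" for n
  proof (cases "n < 2")
    case True
    then show ?thesis by (auto simp: less_2_cases_iff)
  next
    case False
    then have "real n * 2 \<le> real n * real n" by (intro mult_left_mono) auto
    then have "1 / (p * q) * real n \<le> 1 / (p * q) * ((real n)\<^sup>2 - real n)"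
      using p_pos q_pos by (intro mult_left_mono) (auto simp: power2_eq_square)
    then show ?thesis using m_le[of n] by linarith
  qed
  then have "pois m z \<le> pois (\<lambda>n. 1 / (p * q) * ((real n)\<^sup>2 - real n)) z"
    using assms by (intro pois_mono geom_bounded_intros) auto
  also have "\<dots> = 1 / (p * q) * z\<^sup>2"
    by (subst pois_cmult, (intro geom_bounded_intros)+, subst pois_diff, (intro geom_bounded_intros)+)
       (simp add: pois_id pois_square)
  finally show "pois m z \<le> 1 / (p * q) * z\<^sup>2" .
qed

definition mean_split' :: "real \<Rightarrow> real" where
  "mean_split' x = p * pois mu (p * x) + q * pois mu (q * x)"

lemma mean_split_bounds:
  assumes "0 \<le> x"
  shows "0 \<le> mean_split x" "mean_split x \<le> 1 / (p * q) * x\<^sup>2"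
    "0 \<le> mean_split' x" "mean_split' x \<le> 1 / (p * q) * x"
proof -
  define c where "c = 1 / (p * q)"
  have c: "c > 0" using p_pos q_pos by (simp add: c_def)
  have nn: "0 \<le> p * x" "0 \<le> q * x" using assms p_pos q_pos by auto
  show "0 \<le> mean_split x" "0 \<le> mean_split' x"
    using pois_m_bounds(1)[OF nn(1)] pois_m_bounds(1)[OF nn(2)] pois_mu_bounds(1)[OF nn(1)] pois_mu_bounds(1)[OF nn(2)] p_pos q_pos
    by (auto simp: mean_split_def mean_split'_def)
  have pq: "p\<^sup>2 + q\<^sup>2 \<le> 1" using pow_sum_less_1[of 2] by simp
  have "mean_split x \<le> c * (p * x)\<^sup>2 + c * (q * x)\<^sup>2"
    using pois_m_bounds(2)[OF nn(1)] pois_m_bounds(2)[OF nn(2)] by (simp add: mean_split_def c_def)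
  also have "\<dots> = (p\<^sup>2 + q\<^sup>2) * (c * x\<^sup>2)" by (simp add: power_mult_distrib algebra_simps)
  also have "\<dots> \<le> 1 * (c * x\<^sup>2)" using pq c by (intro mult_right_mono) auto
  finally show "mean_split x \<le> 1 / (p * q) * x\<^sup>2" by (simp add: c_def)
  have "mean_split' x \<le> p * (c * (p * x)) + q * (c * (q * x))"
    using pois_mu_bounds(2)[OF nn(1)] pois_mu_bounds(2)[OF nn(2)] p_pos q_pos
    unfolding mean_split'_def c_def by (intro add_mono mult_left_mono) auto
  also have "\<dots> = (p\<^sup>2 + q\<^sup>2) * (c * x)" by (simp add: power2_eq_square algebra_simps)
  also have "\<dots> \<le> 1 * (c * x)" using pq c assms by (intro mult_right_mono) auto
  finally show "mean_split' x \<le> 1 / (p * q) * x" by (simp add: c_def)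
qed

lemma DERIV_mean_split: "(mean_split has_real_derivative mean_split' x) (at x)"
proof -
  have d: "(pois m has_real_derivative pois mu z) (at z)" for z
    using has_real_derivative_pois[OF geom_bounded_m, of z] by (simp add: mu_def[abs_def])
  have "((\<lambda>x. pois m (c * x)) has_real_derivative pois mu (c * x) * c) (at x)" for c
    by (rule DERIV_chain2[OF d]) (auto intro!: derivative_eq_intros)
  from DERIV_add[OF this[of p] this[of q]] show ?thesis
    by (simp add: mean_split_def[abs_def] mean_split'_def mult.commute)
qed

definition psi :: "real \<Rightarrow> real" where "psi t = exp (- t) * phi (exp t)"

definition phi' :: "real \<Rightarrow> real" where
  "phi' x = - x * exp (- x) * (1 - 2 * pois_le_1 x) + 2 * (- x * exp (- x) * mean_split x + pois_le_1 x * mean_split' x)"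

lemma DERIV_phi: "(phi has_real_derivative phi' x) (at x)"
proof -
  have "((\<lambda>x. pois_le_1 x * (1 - pois_le_1 x) + 2 * (pois_le_1 x * mean_split x)) has_real_derivative phi' x) (at x)"
    by (rule derivative_eq_intros DERIV_pois_le_1 DERIV_mean_split refl)+ (simp add: phi'_def algebra_simps)
  then show ?thesis by (simp add: phi_eq[abs_def])
qed

lemma DERIV_psi: "(psi has_real_derivative phi' (exp t) - psi t) (at t)"
proof -
  have "((\<lambda>t. phi (exp t)) has_real_derivative phi' (exp t) * exp t) (at t)"
    by (rule DERIV_chain2[OF DERIV_phi DERIV_exp])
  then have "((\<lambda>t. exp (- t) * phi (exp t)) has_real_derivative
      exp (- t) * (phi' (exp t) * exp t) + - exp (- t) * phi (exp t)) (at t)"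
    by (auto intro!: derivative_eq_intros)
  moreover have "exp (- t) * (phi' (exp t) * exp t) = phi' (exp t)" by (simp add: exp_minus)
  ultimately show ?thesis by (simp add: psi_def[abs_def])
qed

lemma psi_bound: "\<bar>psi t\<bar> \<le> 256 * (1 + 2 * (1 / (p * q))) * bump t"
proof (rule poly_exp_bump)
  define x where "x = exp t"
  show "x = exp t" by (rule x_def)
  define c where "c = 1 / (p * q)"
  have c: "c > 0" using p_pos q_pos by (simp add: c_def)
  then show "0 \<le> 1 + 2 * (1 / (p * q))" by (simp add: c_def)
  have x: "0 < x" by (simp add: x_def)
  note g = pois_le_1_bounds[of x] and h = mean_split_bounds[of x]
  have "0 \<le> phi x" using g h x by (simp add: phi_eq)
  have "phi x = pois_le_1 x * ((1 - pois_le_1 x) + 2 * mean_split x)" by (simp add: phi_eq algebra_simps)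
  also have "\<dots> \<le> pois_le_1 x * (x\<^sup>2 + 2 * (c * x\<^sup>2))"
    using g h x by (intro mult_left_mono add_mono) (auto simp: c_def)
  also have "\<dots> = x * ((1 + 2 * c) * x * (1 + x) * exp (- x))" by (simp add: pois_le_1_def power2_eq_square algebra_simps)
  finally have "phi x / x \<le> (1 + 2 * c) * x * (1 + x) * exp (- x)" using x by (simp add: field_simps)
  also have "\<dots> \<le> (1 + 2 * c) * x * (1 + x)\<^sup>2 * exp (- x)"
    using x c power2_le_plus[of x] by (intro mult_right_mono mult_left_mono) auto
  finally have "phi x / x \<le> (1 + 2 * c) * x * (1 + x)\<^sup>2 * exp (- x)" .
  moreover have "\<bar>psi t\<bar> = phi x / x"
    using \<open>0 \<le> phi x\<close> x by (simp add: psi_def x_def[symmetric] exp_minus abs_mult divide_inverse mult.commute)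
  ultimately show "\<bar>psi t\<bar> \<le> (1 + 2 * (1 / (p * q))) * x * (1 + x)\<^sup>2 * exp (- x)" by (simp add: c_def)
qed

lemma phi'_bound: "\<bar>phi' (exp t)\<bar> \<le> 256 * (1 + 4 * (1 / (p * q))) * bump t"
proof (rule poly_exp_bump)
  define x where "x = exp t"
  show "x = exp t" by (rule x_def)
  define c where "c = 1 / (p * q)"
  have c: "c > 0" using p_pos q_pos by (simp add: c_def)
  then show "0 \<le> 1 + 4 * (1 / (p * q))" by (simp add: c_def)
  have x: "0 < x" by (simp add: x_def)
  note g = pois_le_1_bounds[of x] and h = mean_split_bounds[of x]
  have 1: "\<bar>- x * exp (- x) * (1 - 2 * pois_le_1 x)\<bar> \<le> x * exp (- x) * 1"
    unfolding abs_mult using g x by (intro mult_mono) auto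
  have 2: "\<bar>- x * exp (- x) * mean_split x\<bar> \<le> x * exp (- x) * (c * x\<^sup>2)"
    unfolding abs_mult using h x by (intro mult_mono) (auto simp: c_def)
  have 3: "\<bar>pois_le_1 x * mean_split' x\<bar> \<le> (1 + x) * exp (- x) * (c * x)"
    unfolding abs_mult using g h x by (intro mult_mono) (auto simp: c_def pois_le_1_def)
  have "\<bar>u + 2 * (v + w)\<bar> \<le> U + 2 * (V + W)" if "\<bar>u\<bar> \<le> U" "\<bar>v\<bar> \<le> V" "\<bar>w\<bar> \<le> W" for u v w U V W :: real
    using that by (auto simp: abs_le_iff)
  from this[OF 1 2 3] have "\<bar>phi' x\<bar> \<le> x * exp (- x) * 1 + 2 * (x * exp (- x) * (c * x\<^sup>2) + (1 + x) * exp (- x) * (c * x))"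
    unfolding phi'_def .
  also have "\<dots> = x * exp (- x) * (1 + 2 * c * (x\<^sup>2 + (1 + x)))" by (simp add: algebra_simps)
  also have "\<dots> \<le> x * exp (- x) * ((1 + 4 * c) * (1 + x)\<^sup>2)"
  proof (intro mult_left_mono)
    have "2 * c * (x\<^sup>2 + (1 + x)) \<le> 2 * c * ((1 + x)\<^sup>2 + (1 + x)\<^sup>2)"
      using c x power2_le_plus[of x] by (intro mult_left_mono add_mono) auto
    moreover have "(1 + 4 * c) * (1 + x)\<^sup>2 = (1 + x)\<^sup>2 + 2 * c * ((1 + x)\<^sup>2 + (1 + x)\<^sup>2)"
      by (simp add: algebra_simps)
    ultimately show "1 + 2 * c * (x\<^sup>2 + (1 + x)) \<le> (1 + 4 * c) * (1 + x)\<^sup>2"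
      using power2_le_plus(2)[of x] x by linarith
  qed (use x in simp)
  finally show "\<bar>phi' (exp t)\<bar> \<le> (1 + 4 * (1 / (p * q))) * x * (1 + x)\<^sup>2 * exp (- x)"
    by (simp add: c_def x_def[symmetric] mult_ac)
qed

text \<open>With \<open>c = 1 / (p * q)\<close>, the two parts of the derivative of
  \<open>psi\<close> contribute \<open>1 + 4 * c\<close> and \<open>1 + 2 * c\<close>; the factor
  256 comes from \<open>exp_minus_le\<close> and \<open>exp 1\<close> from the mean value
  argument.\<close>

definition variance_const :: real where
  "variance_const = 256 * (2 + 6 * (1 / (p * q))) * exp 1"

text \<open>At minus infinity the quotient tends to the derivative of \<open>VP\<close> at 0, which
  vanishes because \<open>s\<close> is 0 at 0 and 1 and \<open>m 0 = 0\<close>.\<close>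

lemma renewal_variance: "renewal p q (\<lambda>t. VP (exp t) * exp (- t)) psi variance_const"
proof
  define c where "c = 1 / (p * q)"
  have c: "0 < c" using p_pos q_pos by (simp add: c_def)
  have "256 * (1 + 2 * c) \<le> 256 * (2 + 6 * c) * 1" using c by simp
  also have "\<dots> \<le> variance_const" unfolding variance_const_def c_def[symmetric] using c by (intro mult_left_mono) auto
  finally have const: "256 * (1 + 2 * (1 / (p * q))) \<le> variance_const" by (simp add: c_def)
  fix t
  have "p * (VP (exp (t - A)) * exp (- (t - A))) = VP (p * exp t) * exp (- t)"
    "q * (VP (exp (t - B)) * exp (- (t - B))) = VP (q * exp t) * exp (- t)"
    unfolding exp_uminus_diff exp_diff_A exp_diff_B by (rule refl)+
  then show "VP (exp t) * exp (- t) = psi t + p * (VP (exp (t - A)) * exp (- (t - A))) + q * (VP (exp (t - B)) * exp (- (t - B)))"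
    by (subst VP_eq) (simp add: psi_def algebra_simps)
  show "\<bar>psi t\<bar> \<le> variance_const * bump t"
    using psi_bound[of t] mult_right_mono[OF const bump_nonneg[of t]] by linarith
  fix u :: real assume u: "0 \<le> u" "u \<le> 1"
  show "\<bar>psi (t + u) - psi t\<bar> \<le> variance_const * u * bump t"
    unfolding variance_const_def
  proof (rule toll_lipschitz_from_derivative[OF DERIV_psi _ u])
    fix t
    have "\<bar>phi' (exp t) - psi t\<bar> \<le> \<bar>phi' (exp t)\<bar> + \<bar>psi t\<bar>" by (rule abs_triangle_ineq4)
    also have "\<dots> \<le> 256 * (1 + 4 * (1 / (p * q))) * bump t + 256 * (1 + 2 * (1 / (p * q))) * bump t"
      by (intro add_mono phi'_bound psi_bound)
    also have "\<dots> = 256 * (2 + 6 * (1 / (p * q))) * bump t" by (simp add: algebra_simps)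
    finally show "\<bar>phi' (exp t) - psi t\<bar> \<le> 256 * (2 + 6 * (1 / (p * q))) * bump t" .
  qed
next
  show "((\<lambda>t. VP (exp t) * exp (- t)) \<longlongrightarrow> 0) at_bot"
  proof (rule tendsto_exp_at_bot_quotient)
    have "(VP has_real_derivative pois (\<lambda>n. s (Suc n) - s n) 0 - 2 * pois m 0 * pois (\<lambda>n. m (Suc n) - m n) 0) (at 0)"
      unfolding VP_def
      by (rule derivative_eq_intros has_real_derivative_pois geom_bounded_s geom_bounded_m refl)+ simp
    then show "(VP has_real_derivative 0) (at 0)" by (simp add: pois_at_0)
    show "VP 0 = 0" by (simp add: VP_def pois_at_0)
  qed
qed

definition kappa :: "real \<Rightarrow> real" where "kappa t = exp t * exp (- exp t)"

lemma renewal_mean: "renewal p q (\<lambda>t. pois mu (exp t)) kappa (256 * 1 * exp 1)"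
proof
  fix t
  show "pois mu (exp t) = kappa t + p * pois mu (exp (t - A)) + q * pois mu (exp (t - B))"
    using pois_mu_eq[of "exp t"] by (simp add: kappa_def exp_diff_A exp_diff_B)
  have "\<bar>kappa t\<bar> \<le> 256 * 1 * bump t" for t
  proof (rule poly_exp_bump)
    have "exp t * 1 * exp (- exp t) \<le> exp t * (1 + exp t)\<^sup>2 * exp (- exp t)"
      using power2_le_plus(2)[of "exp t"] by (intro mult_right_mono mult_left_mono) auto
    then show "\<bar>kappa t\<bar> \<le> 1 * exp t * (1 + exp t)\<^sup>2 * exp (- exp t)" by (simp add: kappa_def)
  qed auto
  moreover have "256 * 1 * bump t \<le> (256 * 1 * exp 1) * bump t" using bump_nonneg[of t] by (intro mult_right_mono) auto
  ultimately show "\<bar>kappa t\<bar> \<le> 256 * 1 * exp 1 * bump t" by (meson order.trans)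
  fix u :: real assume u: "0 \<le> u" "u \<le> 1"
  show "\<bar>kappa (t + u) - kappa t\<bar> \<le> 256 * 1 * exp 1 * u * bump t"
  proof (rule toll_lipschitz_from_derivative[OF _ _ u])
    fix t :: real
    show "(kappa has_real_derivative exp t * (1 - exp t) * exp (- exp t)) (at t)"
      unfolding kappa_def[abs_def] by (auto intro!: derivative_eq_intros simp: algebra_simps)
    show "\<bar>exp t * (1 - exp t) * exp (- exp t)\<bar> \<le> 256 * 1 * bump t"
    proof (rule poly_exp_bump)
      have "\<bar>1 - exp t\<bar> \<le> 1 + exp t" by (simp add: abs_le_iff)
      also have "\<dots> \<le> (1 + exp t)\<^sup>2" by (rule power2_le_plus) simp
      finally have "exp t * \<bar>1 - exp t\<bar> * exp (- exp t) \<le> exp t * (1 + exp t)\<^sup>2 * exp (- exp t)"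
        by (intro mult_right_mono mult_left_mono) auto
      then show "\<bar>exp t * (1 - exp t) * exp (- exp t)\<bar> \<le> 1 * exp t * (1 + exp t)\<^sup>2 * exp (- exp t)"
        by (simp add: abs_mult)
    qed auto
  qed
next
  have "isCont (pois mu) 0" by (rule DERIV_isCont[OF has_real_derivative_pois[OF geom_bounded_mu]])
  then have "(pois mu \<longlongrightarrow> 0) (nhds 0)" by (simp add: isCont_def tendsto_nhds_iff pois_at_0)
  then show "((\<lambda>t. pois mu (exp t)) \<longlongrightarrow> 0) at_bot"
    by (rule filterlim_compose) (rule exp_at_bot)
qed

text \<open>For \<open>Re z = 0\<close> this is the Mellin transform of \<open>phi\<close> at
  \<open>z - 1\<close>; the shift by 1, due to the division by \<open>exp t\<close>, explains the
  arguments \<open>-1\<close> and \<open>-1 + \<chi>\<close> of \<open>G\<close>.\<close>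

definition variance_mellin :: "complex \<Rightarrow> complex" where
  "variance_mellin z = Gamma (z + 1) / (z - 1) * (1 - (z + 3) / 2 powr (1 + z))
     + 2 * (\<Sum>n. of_real (mean_coeff n) * ((of_nat n + 2 + z) * Gamma (of_nat n + 1 + z)))"

lemma mellin_psi:
  assumes "Re z = 0"
  shows "(\<integral>t. complex_of_real (psi t) * exp (z * of_real t) \<partial>lborel) = variance_mellin z"
    and "summable (\<lambda>n. complex_of_real (mean_coeff n) * ((of_nat n + 2 + z) * Gamma (of_nat n + 1 + z)))"
proof -
  note 1 = mellin_variance_term[OF assms] and 2 = mellin_mean_term[OF assms mean_split_sums]
  have "complex_of_real (psi t) * exp (z * of_real t)
      = complex_of_real (exp (- t) * (pois_le_1 (exp t) * (1 - pois_le_1 (exp t)))) * exp (z * of_real t)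
        + 2 * (complex_of_real (exp (- t) * (pois_le_1 (exp t) * mean_split (exp t))) * exp (z * of_real t))" for t
    by (simp add: psi_def phi_eq algebra_simps)
  then show "(\<integral>t. complex_of_real (psi t) * exp (z * of_real t) \<partial>lborel) = variance_mellin z"
    using 1 2 sums_unique[OF 2(1)] by (simp add: variance_mellin_def)
  show "summable (\<lambda>n. complex_of_real (mean_coeff n) * ((of_nat n + 2 + z) * Gamma (of_nat n + 1 + z)))"
    using 2(1) by (rule sums_summable)
qed

lemma mellin_kappa:
  assumes "Re z = 0"
  shows "(\<integral>t. complex_of_real (kappa t) * exp (z * of_real t) \<partial>lborel) = Gamma (z + 1)"
proof -
  have "complex_of_real (kappa t) * exp (z * of_real t) = exp ((z + 1) * of_real t - of_real (exp t))" for t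
  proof -
    have "exp ((z + 1) * of_real t - of_real (exp t)) = exp (of_real t + (- of_real (exp t)) + z * of_real t)"
      by (simp add: algebra_simps)
    then show ?thesis unfolding exp_add by (simp add: kappa_def exp_of_real[symmetric])
  qed
  then show ?thesis using Gamma_exp_integral(2)[of "z + 1"] assms by simp
qed

text \<open>Quadratic decay gives absolute summability over the frequencies. In the series, with
  \<open>w = n + 1 + z\<close>, the value \<open>Gamma (w + 3)\<close> is bounded by a factorial;
  two factors released by the functional equation yield \<open>(norm z)\<^sup>2\<close>, and the
  third, \<open>w + 1\<close>, is already present in the term.\<close>

lemma variance_mellin_decay: "\<exists>K. \<forall>z. Re z = 0 \<longrightarrow> z \<noteq> 0 \<longrightarrow> norm (variance_mellin z) \<le> K / (norm z)\<^sup>2"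
proof -
  define S where "S = (\<Sum>n. beta (n + 2) * ((real n + 1) * (real n + 3)))"
  have "norm (variance_mellin z) \<le> (6 + 2 * S) / (norm z)\<^sup>2" if z: "Re z = 0" "z \<noteq> 0" for z
  proof -
    have nz: "norm z = \<bar>Im z\<bar>" using z by (simp add: cmod_def)
    have ge: "norm z \<le> norm (of_real a + z)" for a
      using abs_Im_le_cmod[of "of_real a + z"] nz by simp
    have zpos: "norm z > 0" using z by simp
    have 1: "norm (Gamma (z + 1) / (z - 1) * (1 - (z + 3) / 2 powr (1 + z))) \<le> 6 / (norm z)\<^sup>2"
    proof -
      have z1: "norm (z - 1) \<ge> norm z" using ge[of "-1"] by (simp add: add.commute)
      have z1': "norm (z - 1) \<ge> 1" using abs_Re_le_cmod[of "z - 1"] z by simp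
      have "norm (2 powr (1 + z)) = 2" using z by (simp add: norm_powr_real_powr)
      then have "norm (1 - (z + 3) / 2 powr (1 + z)) \<le> 1 + norm (z + 3) / 2"
        using norm_triangle_ineq4[of 1 "(z + 3) / 2 powr (1 + z)"] by (simp add: norm_divide)
      moreover have "norm (z + 3) \<le> norm z + 3" using norm_triangle_ineq[of z 3] by simp
      ultimately have "norm (1 - (z + 3) / 2 powr (1 + z)) \<le> 3 * norm (z - 1)"
        using z1 z1' by linarith
      then have "norm (Gamma (z + 1)) / norm (z - 1) * norm (1 - (z + 3) / 2 powr (1 + z))
          \<le> norm (Gamma (z + 1)) / norm (z - 1) * (3 * norm (z - 1))"
        by (intro mult_left_mono) auto
      also have "\<dots> = 3 * norm (Gamma (z + 1))" using z1' by auto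
      also have "\<dots> \<le> 3 * (2 / (norm z)\<^sup>2)" by (intro mult_left_mono norm_Gamma_decay z) auto
      finally show ?thesis by (simp add: norm_mult norm_divide)
    qed
    have 2: "norm (\<Sum>n. of_real (mean_coeff n) * ((of_nat n + 2 + z) * Gamma (of_nat n + 1 + z))) \<le> S / (norm z)\<^sup>2"
    proof -
      have term_le: "norm (of_real (mean_coeff n) * ((of_nat n + 2 + z) * Gamma (of_nat n + 1 + z)))
          \<le> beta (n + 2) * ((real n + 1) * (real n + 3)) / (norm z)\<^sup>2" for n
      proof -
        define w where "w = of_nat n + 1 + z"
        have w: "Re w > 0" using z by (simp add: w_def)
        have "Gamma (w + 1 + 1 + 1) = (w + 2) * ((w + 1) * (w * Gamma w))"
          using Gamma_plus1_pos[of w] Gamma_plus1_pos[of "w + 1"] Gamma_plus1_pos[of "w + 1 + 1"] w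
          by (simp add: add.assoc)
        then have "norm (Gamma (w + 1 + 1 + 1)) = norm (w + 2) * (norm w * norm ((w + 1) * Gamma w))"
          by (simp add: norm_mult)
        moreover have "norm (Gamma (w + 1 + 1 + 1)) \<le> fact (n + 3)"
          using z by (intro norm_Gamma_le_fact(1)) (simp add: w_def)
        moreover have "norm z * (norm z * norm ((w + 1) * Gamma w)) \<le> norm (w + 2) * (norm w * norm ((w + 1) * Gamma w))"
        proof -
          have "norm z \<le> norm (w + 2)" using ge[of "real n + 3"] by (simp add: w_def add_ac)
          moreover have "norm z \<le> norm w" using ge[of "real n + 1"] by (simp add: w_def add_ac)
          ultimately show ?thesis by (intro mult_mono) auto
        qed
        ultimately have "norm ((w + 1) * Gamma w) \<le> fact (n + 3) / (norm z)\<^sup>2"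
          using zpos by (simp add: power2_eq_square field_simps del: fact_Suc)
        then have "\<bar>mean_coeff n\<bar> * norm ((w + 1) * Gamma w) \<le> \<bar>mean_coeff n\<bar> * (fact (n + 3) / (norm z)\<^sup>2)"
          by (intro mult_left_mono) auto
        also have "\<bar>mean_coeff n\<bar> * (fact (n + 3) / (norm z)\<^sup>2) = (\<bar>mean_coeff n\<bar> * ((real n + 2) * fact n)) * ((real n + 1) * (real n + 3)) / (norm z)\<^sup>2"
        proof -
          have "(fact (n + 3) :: real) = (real n + 3) * ((real n + 2) * ((real n + 1) * fact n))"
            by (simp add: eval_nat_numeral algebra_simps)
          then show ?thesis by (simp add: mult_ac)
        qed
        finally show ?thesis unfolding mean_coeff_fact by (simp add: w_def norm_mult add_ac)
      qed
      have sm: "summable (\<lambda>n. beta (n + 2) * ((real n + 1) * (real n + 3)) / (norm z)\<^sup>2)"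
        by (intro summable_divide summable_beta_poly)
      have "norm (\<Sum>n. of_real (mean_coeff n) * ((of_nat n + 2 + z) * Gamma (of_nat n + 1 + z)))
          \<le> (\<Sum>n. beta (n + 2) * ((real n + 1) * (real n + 3)) / (norm z)\<^sup>2)"
        by (rule norm_suminf_le[OF term_le sm])
      also have "\<dots> = S / (norm z)\<^sup>2" unfolding S_def by (rule suminf_divide[OF summable_beta_poly])
      finally show ?thesis .
    qed
    have "norm (variance_mellin z) \<le> 6 / (norm z)\<^sup>2 + 2 * (S / (norm z)\<^sup>2)"
      unfolding variance_mellin_def
      by (intro order.trans[OF norm_triangle_ineq] add_mono 1) (use 2 in \<open>simp add: norm_mult\<close>)
    then show ?thesis by (simp add: add_divide_distrib)
  qed
  then show ?thesis by blast
qed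

end

section \<open>The limit of the variance\<close>

text \<open>The family over pairs is absolutely summable, so it may be summed by rows or along the
  diagonals \<open>i + j = k\<close>.\<close>

lemma convolution_square:
  fixes a :: "int \<Rightarrow> complex"
  assumes a: "(\<lambda>k. norm (a k)) summable_on UNIV"
  shows "((\<lambda>k. \<Sum>\<^sub>\<infinity>j. a j * a (k - j)) has_sum (infsum a UNIV)\<^sup>2) UNIV"
proof -
  define S where "S = infsum a UNIV"
  have aS: "(a has_sum S) UNIV" unfolding S_def by (rule has_sum_infsum[OF abs_summable_summable[OF a]])
  obtain N where N: "((\<lambda>j. norm (a j)) has_sum N) UNIV" using a by (auto simp: summable_on_def)
  have "(\<lambda>z. norm (a (fst z)) * norm (a (snd z))) summable_on (SIGMA i:UNIV. UNIV)"
  proof (rule summable_on_SigmaI)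
    show "((\<lambda>j. norm (a (fst (i, j))) * norm (a (snd (i, j)))) has_sum norm (a i) * N) UNIV" for i
      using has_sum_cmult_right[OF N, of "norm (a i)"] by simp
    show "(\<lambda>i. norm (a i) * N) summable_on UNIV" by (intro summable_on_cmult_left a)
  qed auto
  then have "(\<lambda>z. norm (a (fst z) * a (snd z))) summable_on UNIV" by (simp add: norm_mult)
  from has_sum_infsum[OF abs_summable_summable[OF this]]
  obtain T where T: "((\<lambda>z. a (fst z) * a (snd z)) has_sum T) UNIV" by blast
  have "((\<lambda>i. a i * S) has_sum T) UNIV"
  proof (rule has_sum_SigmaD)
    show "((\<lambda>z. a (fst z) * a (snd z)) has_sum T) (SIGMA i:UNIV. UNIV)" using T by simp
    show "((\<lambda>j. a (fst (i, j)) * a (snd (i, j))) has_sum a i * S) UNIV" for i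
      using has_sum_cmult_right[OF aS, of "a i"] by simp
  qed
  moreover have "((\<lambda>i. a i * S) has_sum S * S) UNIV" by (rule has_sum_cmult_left[OF aS])
  ultimately have TS: "T = S * S" by (rule has_sum_unique)
  have R: "((\<lambda>(k, j). a j * a (k - j)) has_sum T) UNIV"
    by (subst has_sum_reindex_bij_witness[of UNIV "\<lambda>(i, j). (i + j, i)" "\<lambda>(k, j). (j, k - j)" UNIV
          "\<lambda>z. a (fst z) * a (snd z)" _ T T]) (use T in auto)
  then have sm: "(\<lambda>(k, j). a j * a (k - j)) summable_on (SIGMA k:UNIV. UNIV)"
    by (auto simp: summable_on_def)
  show ?thesis
    unfolding S_def[symmetric] power2_eq_square TS[symmetric]
  proof (rule has_sum_SigmaD)
    show "((\<lambda>(k, j). a j * a (k - j)) has_sum T) (SIGMA k:UNIV. UNIV)" using R by simp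
    show "((\<lambda>j. (case (k, j) of (k, j) \<Rightarrow> a j * a (k - j))) has_sum (\<Sum>\<^sub>\<infinity>j. a j * a (k - j))) UNIV" for k
      using has_sum_infsum[OF summable_on_SigmaD1[OF sm, of k]] by simp
  qed
qed

lemma infsum_nat_from:
  fixes f :: "nat \<Rightarrow> 'a::banach"
  assumes "summable (\<lambda>n. norm (f (n + k)))"
  shows "infsum f {k..} = (\<Sum>n. f (n + k))"
proof -
  have "{k..} = range (\<lambda>n. n + k)" by (auto simp: image_iff) (metis add.commute le_Suc_ex)
  then have "infsum f {k..} = infsum (\<lambda>n. f (n + k)) UNIV"
    by (simp add: infsum_reindex o_def inj_def)
  also have "\<dots> = (\<Sum>n. f (n + k))"
    by (rule infsumI[OF norm_summable_imp_has_sum[OF assms summable_sums[OF summable_norm_cancel[OF assms]]]])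
  finally show ?thesis .
qed

lemma summable_int_inverse_square:
  fixes c :: "int \<Rightarrow> complex"
  assumes "\<And>k. k \<noteq> 0 \<Longrightarrow> norm (c k) \<le> K / (of_int k)\<^sup>2"
  shows "summable (\<lambda>n. norm (c (int n)))" "summable (\<lambda>n. norm (c (- int (Suc n))))"
proof -
  have "summable (\<lambda>n. inverse ((real n)\<^sup>2))" by (rule inverse_power_summable) simp
  then have "summable (\<lambda>n. K * inverse ((real (Suc n))\<^sup>2))" by (subst summable_Suc_iff) (rule summable_mult)
  then have s: "summable (\<lambda>n. K / (real (Suc n))\<^sup>2)" by (simp only: divide_inverse)
  have "summable (\<lambda>n. norm (c (int (Suc n))))"
  proof (rule summable_comparison_test'[OF s])
    fix n show "norm (norm (c (int (Suc n)))) \<le> K / (real (Suc n))\<^sup>2"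
      using assms[of "int (Suc n)"] by (simp del: of_nat_Suc)
  qed
  then show "summable (\<lambda>n. norm (c (int n)))" by (subst (asm) summable_Suc_iff)
  show "summable (\<lambda>n. norm (c (- int (Suc n))))"
  proof (rule summable_comparison_test'[OF s])
    fix n show "norm (norm (c (- int (Suc n)))) \<le> K / (real (Suc n))\<^sup>2"
      using assms[of "- int (Suc n)"] by (simp del: of_nat_Suc)
  qed
qed

text \<open>The reflection formula; the hyperbolic sine of \<open>trie_E\<close> originates
  here.\<close>

lemma Gamma_product_imaginary:
  assumes "y \<noteq> 0"
  shows "Gamma (\<i> * of_real y + 1) * Gamma (- (\<i> * of_real y) + 1) = of_real (pi * y / sinh (pi * y))"
proof -
  define z where "z = \<i> * complex_of_real y"
  have z: "z \<notin> \<int>\<^sub>\<le>\<^sub>0" using assms by (auto simp: z_def elim!: nonpos_Ints_cases dest: arg_cong[of _ _ Im])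
  have "Gamma (z + 1) * Gamma (- z + 1) = z * (Gamma z * Gamma (1 - z))"
    using Gamma_plus1[OF z] by simp
  also have "\<dots> = z * (of_real pi / sin (of_real pi * z))" by (simp only: Gamma_reflection_complex)
  also have "sin (of_real pi * z) = \<i> * of_real (sinh (pi * y))"
  proof -
    have 1: "of_real pi * z = \<i> * of_real (pi * y)" by (simp add: z_def)
    have "sinh (complex_of_real x) = of_real (sinh x)" for x
      by (simp add: sinh_field_def exp_of_real[symmetric])
    then have 2: "of_real (sinh (pi * y)) = - \<i> * sin (\<i> * of_real (pi * y))"
      using sinh_conv_sin[of "complex_of_real (pi * y)"] by metis
    show ?thesis unfolding 1 2 by (simp add: mult.assoc[symmetric])
  qed
  also have "z * (of_real pi / (\<i> * of_real (sinh (pi * y)))) = of_real (pi * y / sinh (pi * y))"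
    by (simp add: z_def)
  finally show ?thesis by (simp add: z_def)
qed

context trie_moments
begin

text \<open>Agrees with \<open>trie_chi\<close> when \<open>d = A / r\<close>; the minus sign is
  that of \<open>ln p = - (r * d)\<close>.\<close>

definition freq :: "real \<Rightarrow> int \<Rightarrow> complex" where "freq d k = \<i> * of_real (- (2 * pi * of_int k / d))"

lemma Re_freq [simp]: "Re (freq d k) = 0" by (simp add: freq_def)

lemma freq_0 [simp]: "freq d 0 = 0" by (simp add: freq_def)

lemma norm_freq: "0 < d \<Longrightarrow> norm (freq d k) = 2 * pi / d * \<bar>of_int k\<bar>"
  unfolding freq_def norm_mult norm_of_real by (simp add: abs_mult)

lemma ee_freq: "ee (- k) (t / d) = exp (freq d k * of_real t)"
  by (simp add: ee_def cis_conv_exp freq_def mult_ac)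

definition gam :: "real \<Rightarrow> int \<Rightarrow> complex" where "gam d k = Gamma (freq d k + 1)"

definition conv :: "real \<Rightarrow> int \<Rightarrow> complex" where "conv d k = (\<Sum>\<^sub>\<infinity>j. gam d j * gam d (k - j))"

text \<open>The first part stems from the Poisson variance, the second from the squared derivative
  of the Poissonized mean; these numbers will be identified with \<open>trie_G0\<close> and
  \<open>trie_G\<close>.\<close>

definition coeff :: "real \<Rightarrow> int \<Rightarrow> complex" where
  "coeff d k = variance_mellin (freq d k) - 1 / of_real entropy * conv d k"

lemma decay_freq:
  assumes d: "0 < d" and f: "\<And>z. Re z = 0 \<Longrightarrow> z \<noteq> 0 \<Longrightarrow> norm (f z) \<le> K / (norm z)\<^sup>2" and k: "k \<noteq> 0"
  shows "norm (f (freq d k)) \<le> K / (2 * pi / d)\<^sup>2 / (of_int k)\<^sup>2"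
proof -
  have "freq d k \<noteq> 0" using k d by (simp add: freq_def)
  then have "norm (f (freq d k)) \<le> K / (2 * pi / d * \<bar>of_int k\<bar>)\<^sup>2" using f[of "freq d k"] norm_freq[OF d] by simp
  also have "(2 * pi / d * \<bar>of_int k\<bar>)\<^sup>2 = (2 * pi / d)\<^sup>2 * (of_int k)\<^sup>2"
    by (simp only: power_mult_distrib power2_abs)
  finally show ?thesis by simp
qed

lemma summable_gam:
  assumes "0 < d"
  shows "summable (\<lambda>n. norm (gam d (int n)))" "summable (\<lambda>n. norm (gam d (- int (Suc n))))"
  using summable_int_inverse_square[of "gam d"] decay_freq[OF assms, of "\<lambda>z. Gamma (z + 1)"] norm_Gamma_decay
  unfolding gam_def by blast+

lemma summable_variance_mellin:
  assumes "0 < d"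
  shows "summable (\<lambda>n. norm (variance_mellin (freq d (int n))))"
    "summable (\<lambda>n. norm (variance_mellin (freq d (- int (Suc n)))))"
proof -
  obtain K where K: "\<And>z. Re z = 0 \<Longrightarrow> z \<noteq> 0 \<Longrightarrow> norm (variance_mellin z) \<le> K / (norm z)\<^sup>2"
    using variance_mellin_decay by blast
  have "norm (variance_mellin (freq d k)) \<le> K / (2 * pi / d)\<^sup>2 / (of_int k)\<^sup>2" if "k \<noteq> 0" for k
    by (rule decay_freq[OF assms _ that]) (rule K)
  from summable_int_inverse_square[of "\<lambda>k. variance_mellin (freq d k)", OF this]
  show "summable (\<lambda>n. norm (variance_mellin (freq d (int n))))"
    "summable (\<lambda>n. norm (variance_mellin (freq d (- int (Suc n)))))" by blast+
qed

text \<open>Squaring the series of the mean gives a convolution because the characters multiply: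
  \<open>ee j x * ee (k - j) x = ee k x\<close>.\<close>

lemma has_sum_coeff:
  assumes d: "0 < d"
  defines "u \<equiv> \<lambda>x. (\<Sum>\<^sub>\<infinity>k. variance_mellin (freq d k) * ee k x)"
    and "v \<equiv> \<lambda>x. (\<Sum>\<^sub>\<infinity>k. gam d k * ee k x)"
  shows "((\<lambda>k. coeff d k * ee k x) has_sum (u x - 1 / of_real entropy * (v x)\<^sup>2)) UNIV"
proof -
  have "(\<lambda>k. norm (variance_mellin (freq d k) * ee k x)) summable_on UNIV"
    by (rule abs_summable_on_int_split) (use summable_variance_mellin[OF d] in \<open>simp_all add: norm_mult del: of_nat_Suc\<close>)
  then have 1: "((\<lambda>k. variance_mellin (freq d k) * ee k x) has_sum u x) UNIV"
    unfolding u_def by (intro has_sum_infsum[OF abs_summable_summable])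
  have "(\<lambda>k. norm (gam d k * ee k x)) summable_on UNIV"
    by (rule abs_summable_on_int_split) (use summable_gam[OF d] in \<open>simp_all add: norm_mult del: of_nat_Suc\<close>)
  from convolution_square[OF this]
  have "((\<lambda>k. \<Sum>\<^sub>\<infinity>j. gam d j * ee j x * (gam d (k - j) * ee (k - j) x)) has_sum (v x)\<^sup>2) UNIV"
    unfolding v_def .
  moreover have "(\<Sum>\<^sub>\<infinity>j. gam d j * ee j x * (gam d (k - j) * ee (k - j) x)) = conv d k * ee k x" for k
  proof -
    have "gam d j * ee j x * (gam d (k - j) * ee (k - j) x) = gam d j * gam d (k - j) * ee k x" for j
      using ee_add[of j "k - j" x] by simp
    then show ?thesis unfolding conv_def by (simp only: infsum_cmult_left')
  qed
  ultimately have "((\<lambda>k. conv d k * ee k x) has_sum (v x)\<^sup>2) UNIV" by simp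
  from has_sum_add[OF 1 has_sum_cmult_right[OF this, of "- (1 / of_real entropy)"]]
  show ?thesis by (simp add: coeff_def algebra_simps)
qed

lemma tendsto_ln_sequentially:
  assumes "(f \<longlongrightarrow> L) at_top"
  shows "(\<lambda>n. f (ln (real n))) \<longlonglongrightarrow> L"
  by (rule filterlim_compose[OF assms]) real_asymp

lemma VP_ln: "n \<ge> 1 \<Longrightarrow> VP (exp (ln (real n))) * exp (- ln (real n)) = VP (real n) / real n"
  by (simp add: exp_minus divide_inverse)

theorem variance_limit_nonlattice:
  assumes irr: "A / B \<notin> \<rat>"
  shows "(\<lambda>n. V n / real n) \<longlonglongrightarrow> (\<integral>t. psi t \<partial>lborel) / entropy - ((\<integral>t. kappa t \<partial>lborel) / entropy)\<^sup>2"
proof -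
  interpret var: renewal p q "\<lambda>t. VP (exp t) * exp (- t)" psi variance_const by (rule renewal_variance)
  interpret mean: renewal p q "\<lambda>t. pois mu (exp t)" kappa "256 * 1 * exp 1" by (rule renewal_mean)
  have v: "(\<lambda>n. VP (real n) / real n) \<longlonglongrightarrow> (\<integral>t. psi t \<partial>lborel) / entropy"
    by (rule Lim_transform_eventually[OF tendsto_ln_sequentially[OF var.renewal_nonlattice[OF irr]]])
       (intro eventually_sequentiallyI[of 1] VP_ln)
  have "(\<lambda>n. pois mu (real n)) \<longlonglongrightarrow> (\<integral>t. kappa t \<partial>lborel) / entropy"
    by (rule Lim_transform_eventually[OF tendsto_ln_sequentially[OF mean.renewal_nonlattice[OF irr]]])
       (auto intro!: eventually_sequentiallyI[of 1])
  from tendsto_add[OF depoissonization tendsto_diff[OF v tendsto_power[OF this, of 2]]]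
  show ?thesis by simp
qed

theorem variance_limit_lattice:
  assumes d: "0 < d" "A = real r * d" "B = real l * d" "coprime r l"
  shows "(\<lambda>n. complex_of_real (V n / real n)
      - 1 / of_real entropy * (\<Sum>\<^sub>\<infinity>k. coeff d k * ee k (ln (real n) / d))) \<longlonglongrightarrow> 0"
proof -
  interpret var: renewal p q "\<lambda>t. VP (exp t) * exp (- t)" psi variance_const by (rule renewal_variance)
  interpret mean: renewal p q "\<lambda>t. pois mu (exp t)" kappa "256 * 1 * exp 1" by (rule renewal_mean)
  define a where "a n = pois mu (real n)" for n
  define b where "b n = d / entropy * mean.periodization d (ln (real n))" for n
  define w where "w n = d / entropy * var.periodization d (ln (real n))" for n
  have vw: "(\<lambda>n. VP (real n) / real n - w n) \<longlonglongrightarrow> 0"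
    unfolding w_def
    by (rule Lim_transform_eventually[OF tendsto_ln_sequentially[OF var.renewal_lattice[OF d]]])
       (auto intro!: eventually_sequentiallyI[of 1] simp: exp_minus divide_inverse)
  have ab: "(\<lambda>n. a n - b n) \<longlonglongrightarrow> 0"
    unfolding a_def b_def
    by (rule Lim_transform_eventually[OF tendsto_ln_sequentially[OF mean.renewal_lattice[OF d]]])
       (auto intro!: eventually_sequentiallyI[of 1])
  obtain M where M: "\<And>t. \<bar>mean.periodization d t\<bar> \<le> M" using mean.periodization_bounded[OF d(1)] by blast
  have b_bound: "\<bar>b n\<bar> \<le> d / entropy * M" for n
    unfolding b_def abs_mult using d(1) entropy_pos M by (intro mult_mono) auto
  \<comment> \<open>Passing to squares needs a bounded factor:
    \<open>a\<^sup>2 - b\<^sup>2 = (a - b)\<^sup>2 + 2 * b * (a - b)\<close>, and the periodic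
    \<open>b\<close> is bounded.\<close>
  have "(\<lambda>n. 2 * b n * (a n - b n)) \<longlonglongrightarrow> 0"
  proof (rule Lim_null_comparison)
    show "(\<lambda>n. 2 * (d / entropy * M) * \<bar>a n - b n\<bar>) \<longlonglongrightarrow> 0"
      by (intro tendsto_mult_right_zero tendsto_rabs_zero ab)
    have "norm (2 * b n * (a n - b n)) \<le> 2 * (d / entropy * M) * \<bar>a n - b n\<bar>" for n
      unfolding real_norm_def abs_mult using b_bound[of n] by (intro mult_right_mono) auto
    then show "eventually (\<lambda>n. norm (2 * b n * (a n - b n)) \<le> 2 * (d / entropy * M) * \<bar>a n - b n\<bar>) sequentially"
      by simp
  qed
  from tendsto_add[OF tendsto_power[OF ab, of 2] this]
  have "(\<lambda>n. (a n - b n)\<^sup>2 + 2 * b n * (a n - b n)) \<longlonglongrightarrow> 0" by simp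
  moreover have "(a n - b n)\<^sup>2 + 2 * b n * (a n - b n) = (a n)\<^sup>2 - (b n)\<^sup>2" for n
    by (simp add: power2_eq_square algebra_simps)
  ultimately have sq: "(\<lambda>n. (a n)\<^sup>2 - (b n)\<^sup>2) \<longlonglongrightarrow> 0" by simp
  have "(\<lambda>n. V n / real n - (w n - (b n)\<^sup>2)) \<longlonglongrightarrow> 0"
    using tendsto_add[OF depoissonization tendsto_diff[OF vw sq]] by (simp add: a_def algebra_simps)
  then have "(\<lambda>n. complex_of_real (V n / real n - (w n - (b n)\<^sup>2))) \<longlonglongrightarrow> of_real 0"
    by (rule tendsto_of_real)
  moreover have "complex_of_real (w n - (b n)\<^sup>2) = 1 / of_real entropy * (\<Sum>\<^sub>\<infinity>k. coeff d k * ee k (ln (real n) / d))" for n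
  proof -
    have u: "complex_of_real (d * var.periodization d t) = (\<Sum>\<^sub>\<infinity>k. variance_mellin (freq d k) * ee k (t / d))" for t
      by (rule var.poisson_summation[OF d(1) _ summable_variance_mellin[OF d(1)]])
         (simp add: ee_freq mellin_psi(1))
    have v: "complex_of_real (d * mean.periodization d t) = (\<Sum>\<^sub>\<infinity>k. gam d k * ee k (t / d))" for t
      by (rule mean.poisson_summation[OF d(1) _ summable_gam[OF d(1)]])
         (simp add: ee_freq mellin_kappa gam_def)
    define U where "U = (\<Sum>\<^sub>\<infinity>k. variance_mellin (freq d k) * ee k (ln (real n) / d))"
    define Y where "Y = (\<Sum>\<^sub>\<infinity>k. gam d k * ee k (ln (real n) / d))"
    have "complex_of_real (w n) = 1 / of_real entropy * complex_of_real (d * var.periodization d (ln (real n)))"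
      by (simp add: w_def)
    then have wU: "complex_of_real (w n) = 1 / of_real entropy * U" unfolding u U_def .
    have "complex_of_real (b n) = 1 / of_real entropy * complex_of_real (d * mean.periodization d (ln (real n)))"
      by (simp add: b_def)
    then have bY: "complex_of_real (b n) = 1 / of_real entropy * Y" unfolding v Y_def .
    have "complex_of_real (w n - (b n)\<^sup>2) = 1 / of_real entropy * (U - 1 / of_real entropy * Y\<^sup>2)"
      unfolding of_real_diff of_real_power wU bY by (simp add: power2_eq_square algebra_simps)
    also have "U - 1 / of_real entropy * Y\<^sup>2 = (\<Sum>\<^sub>\<infinity>k. coeff d k * ee k (ln (real n) / d))"
      unfolding U_def Y_def by (rule infsumI[OF has_sum_coeff[OF d(1)], symmetric])
    finally show ?thesis .
  qed
  ultimately show ?thesis by simp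
qed


section \<open>Matching the constants of the statement\<close>

lemma mean_coeff_alt: "mean_coeff n = (-1) ^ n * (p ^ (n + 2) + q ^ (n + 2)) / (fact n * (real n + 2) * (1 - p ^ (n + 2) - q ^ (n + 2)))"
proof -
  have fact: "(fact (n + 2) :: real) = fact n * (real n + 2) * real (n + 1)" by (simp add: algebra_simps)
  have cancel: "x / D * e * a / (f * b * a) = e * x / (f * b * D)" if "a \<noteq> 0" for x D e a f b :: real
    using that by (simp add: mult_ac)
  show ?thesis unfolding mean_coeff_def beta_def fact by (rule cancel) simp
qed

text \<open>The statement sums its series without an order, which calls for absolute convergence
  beyond the convergence that \<open>mellin_psi\<close> provides.\<close>

lemma series_term_bound:
  assumes "Re z = 0"
  shows "norm (complex_of_real (mean_coeff n) * ((of_nat n + 2 + z) * Gamma (of_nat n + 1 + z))) \<le> beta (n + 2)"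
proof -
  have "Gamma (of_nat n + 2 + z) = (of_nat n + 1 + z) * Gamma (of_nat n + 1 + z)"
    using Gamma_plus1_pos[of "of_nat n + 1 + z"] assms by (simp add: algebra_simps)
  then have "(of_nat n + 2 + z) * Gamma (of_nat n + 1 + z) = Gamma (of_nat n + 1 + z) + Gamma (of_nat n + 2 + z)"
    by (simp add: algebra_simps)
  also have "norm \<dots> \<le> norm (Gamma (of_nat n + 1 + z)) + norm (Gamma (of_nat n + 2 + z))" by (rule norm_triangle_ineq)
  also have "\<dots> \<le> fact n + fact (Suc n)"
    using assms by (intro add_mono norm_Gamma_le_fact) auto
  also have "\<dots> = (real n + 2) * fact n" by (simp add: algebra_simps)
  finally have "\<bar>mean_coeff n\<bar> * norm ((of_nat n + 2 + z) * Gamma (of_nat n + 1 + z)) \<le> \<bar>mean_coeff n\<bar> * ((real n + 2) * fact n)"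
    by (intro mult_left_mono) auto
  then show ?thesis unfolding mean_coeff_fact by (simp add: norm_mult)
qed

text \<open>At 0 the closed part is \<open>(1 - 3 / 2) / (- 1) = 1 / 2\<close>, and
  \<open>Gamma (n + 1) = n!\<close> cancels the factorials of the coefficients.\<close>

lemma variance_mellin_0: "variance_mellin 0 = of_real (1 / 2 + 2 * (\<Sum>n. (-1) ^ n * beta (n + 2)))"
proof -
  have "of_real (mean_coeff n) * ((of_nat n + 2 + 0) * Gamma (of_nat n + 1 + 0)) = complex_of_real ((-1) ^ n * beta (n + 2))" for n
  proof -
    have mean_coeff: "mean_coeff n * ((real n + 2) * fact n) = (-1) ^ n * beta (n + 2)"
    proof -
      have "mean_coeff n = (-1) ^ n * \<bar>mean_coeff n\<bar>" unfolding mean_coeff_abs by (simp add: mean_coeff_def)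
      then show ?thesis using mean_coeff_fact[of n] by (metis mult.assoc)
    qed
    have "Gamma (of_nat n + 1) = (fact n :: complex)"
      using Gamma_fact[of n, where 'a = complex] by (simp add: add.commute)
    then have "of_real (mean_coeff n) * ((of_nat n + 2 + 0) * Gamma (of_nat n + 1 + 0)) = complex_of_real (mean_coeff n * ((real n + 2) * fact n))"
      by simp
    then show ?thesis unfolding mean_coeff .
  qed
  then have "(\<Sum>n. of_real (mean_coeff n) * ((of_nat n + 2 + 0) * Gamma (of_nat n + 1 + 0))) = (\<Sum>n. complex_of_real ((-1) ^ n * beta (n + 2)))"
    by (simp only:)
  also have "\<dots> = of_real (\<Sum>n. (-1) ^ n * beta (n + 2))"
  proof (rule suminf_of_real[symmetric])
    show "summable (\<lambda>n. (-1) ^ n * beta (n + 2))"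
      by (rule summable_comparison_test'[OF summable_beta]) (use beta_nonneg in \<open>auto simp: abs_mult power_abs\<close>)
  qed
  finally show ?thesis by (simp add: variance_mellin_def)
qed

text \<open>Away from 0 the functional equation gives
  \<open>Gamma (z + 1) / (z - 1) = z * Gamma (-1 + z)\<close>. At 0 the right-hand side would
  multiply 0 by a pole, so that value is computed separately.\<close>

lemma variance_mellin_imaginary:
  assumes "Re z = 0" "z \<noteq> 0"
  shows "variance_mellin z = z * Gamma (-1 + z) * (1 - (z + 3) / 2 powr (1 + z))
    + 2 * (\<Sum>n. of_real (mean_coeff n) * ((of_nat n + 2 + z) * Gamma (of_nat n + 1 + z)))"
proof -
  have im: "Im z \<noteq> 0" using assms by (auto simp: complex_eq_iff)
  then have "z \<notin> \<int>\<^sub>\<le>\<^sub>0" "- 1 + z \<notin> \<int>\<^sub>\<le>\<^sub>0"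
    by (auto elim!: nonpos_Ints_cases dest: arg_cong[of _ _ Im])
  from Gamma_plus1[OF this(1)] Gamma_plus1[OF this(2)]
  have "Gamma (z + 1) = z * Gamma z" "Gamma z = (z - 1) * Gamma (- 1 + z)" by simp_all
  then have "Gamma (z + 1) = z * ((z - 1) * Gamma (- 1 + z))" by (simp only:)
  moreover have "z - 1 \<noteq> 0" using im by auto
  ultimately show ?thesis by (simp add: variance_mellin_def)
qed

text \<open>The summands at \<open>j\<close> and \<open>- j\<close> agree. The one at 0 is 1 and
  gives the \<open>1 / trie_h p\<close> of \<open>trie_G0\<close>; the others give
  \<open>trie_E\<close>.\<close>

lemma conv_0:
  assumes d: "0 < d"
  defines "w \<equiv> \<lambda>n. 2 * pi\<^sup>2 * real (Suc n) / d / sinh (2 * pi\<^sup>2 * real (Suc n) / d)"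
  shows "conv d 0 = of_real (1 + 2 * (\<Sum>n. w n))" and "summable (\<lambda>n. norm (w n))"
proof -
  define g where "g j = gam d j * gam d (0 - j)" for j
  have g0: "g 0 = 1" by (simp add: g_def gam_def)
  have even: "g (- j) = g j" for j by (simp add: g_def)
  have gw: "g (int (Suc n)) = of_real (w n)" for n
  proof -
    define y where "y = - (2 * pi * real (Suc n) / d)"
    have y: "y \<noteq> 0" using d by (simp add: y_def del: of_nat_Suc)
    have "freq d (int (Suc n)) = \<i> * of_real y" "freq d (- int (Suc n)) = - (\<i> * of_real y)"
      by (simp_all add: freq_def y_def del: of_nat_Suc)
    then have "g (int (Suc n)) = of_real (pi * y / sinh (pi * y))"
      using Gamma_product_imaginary[OF y] by (simp add: g_def gam_def del: of_nat_Suc)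
    also have "pi * y = - (2 * pi\<^sup>2 * real (Suc n) / d)" by (simp add: y_def power2_eq_square del: of_nat_Suc)
    finally show ?thesis by (simp add: w_def del: of_nat_Suc)
  qed
  have bound: "norm (g j) \<le> norm (gam d j)" for j
  proof -
    have "norm (gam d (0 - j)) \<le> 1" using norm_Gamma_le_fact(1)[of "freq d (0 - j) + 1" 0] by (simp add: gam_def)
    then show ?thesis unfolding g_def norm_mult by (intro mult_right_le_one_le) auto
  qed
  have s1: "summable (\<lambda>n. norm (g (int n)))"
    by (rule summable_comparison_test'[OF summable_gam(1)[OF d]]) (use bound in auto)
  then have s1': "summable (\<lambda>n. norm (g (int (Suc n))))" by (subst summable_Suc_iff)
  have s2: "summable (\<lambda>n. norm (g (- int (Suc n))))" unfolding even by (rule s1')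
  show sw: "summable (\<lambda>n. norm (w n))" using s1' unfolding gw by simp
  have "conv d 0 = (\<Sum>n. g (int n)) + (\<Sum>n. g (- int (Suc n)))"
    unfolding conv_def using infsumI[OF has_sum_int_split[OF s1 s2]] by (simp add: g_def)
  also have "(\<Sum>n. g (int n)) = g 0 + (\<Sum>n. g (int (Suc n)))"
    using suminf_split_head[OF summable_norm_cancel[OF s1]] by simp
  finally have "conv d 0 = 1 + 2 * (\<Sum>n. g (int (Suc n)))" unfolding even g0 by simp
  also have "(\<Sum>n. g (int (Suc n))) = of_real (\<Sum>n. w n)"
    unfolding gw by (rule suminf_of_real[symmetric, OF summable_norm_cancel[OF sw]])
  finally show "conv d 0 = of_real (1 + 2 * (\<Sum>n. w n))" by simp
qed

end

theorem theorem5p2: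
  fixes p :: real and r l :: nat and X :: "nat \<Rightarrow> nat pmf"
  assumes "0 < p" and "p < 1" and "p \<noteq> 1 / 2"
    and "trie_size_laws p X"
    and "trie_rational p \<Longrightarrow>
           0 < r \<and> 0 < l \<and> coprime r l \<and> ln p / ln (1 - p) = real r / real l"
  shows "(\<lambda>n. complex_of_real (measure_pmf.variance (X n) real / real n)
              - (complex_of_real (trie_G0 p r / trie_h p)
                 + trie_F p r (real r * log (1 / p) (real n))))
         \<in> o(\<lambda>_. 1)"
proof -
  interpret trie_moments p "1 - p" "\<lambda>n. measure_pmf.expectation (X n) real"
    "\<lambda>n. measure_pmf.expectation (X n) (\<lambda>x. (real x)\<^sup>2)"
    by (rule trie_laws_moments[OF assms(4,1,2)])
  have var: "measure_pmf.variance (X n) real = V n" for n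
    unfolding V_def by (rule measure_pmf.variance_eq[OF trie_laws_integrable(2,1)[OF assms(4,1,2)]])
  have ent: "entropy = trie_h p" by (simp add: entropy_def A_def B_def trie_h_def)
  have h: "trie_h p > 0" using entropy_pos ent by simp
  define S where "S = (\<Sum>n. (-1) ^ n * beta (n + 2))"
  have S: "(\<Sum>\<^sub>\<infinity>j\<in>{2::nat..}. (-1) ^ j * (p ^ j + (1 - p) ^ j) / (1 - p ^ j - (1 - p) ^ j)) = S"
  proof -
    have eq: "(-1) ^ (n + 2) * (p ^ (n + 2) + (1 - p) ^ (n + 2)) / (1 - p ^ (n + 2) - (1 - p) ^ (n + 2)) = (-1) ^ n * beta (n + 2)" for n
      by (simp add: beta_def)
    show ?thesis
      unfolding S_def eq[symmetric]
    proof (rule infsum_nat_from)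
      show "summable (\<lambda>n. norm ((-1) ^ (n + 2) * (p ^ (n + 2) + (1 - p) ^ (n + 2)) / (1 - p ^ (n + 2) - (1 - p) ^ (n + 2))))"
        unfolding eq by (rule summable_comparison_test'[OF summable_beta])
          (use beta_nonneg in \<open>auto simp: abs_mult power_abs\<close>)
    qed
  qed
  have lim: "(\<lambda>n. complex_of_real (V n / real n)
      - (complex_of_real (trie_G0 p r / trie_h p) + trie_F p r (real r * log (1 / p) (real n)))) \<longlonglongrightarrow> 0"
  proof (cases "trie_rational p")
    case False
    then have irr: "A / B \<notin> \<rat>" by (simp add: A_def B_def trie_rational_def)
    have "complex_of_real (\<integral>t. psi t \<partial>lborel) = variance_mellin 0"
      using mellin_psi(1)[of 0] by simp
    then have psi_int: "(\<integral>t. psi t \<partial>lborel) = 1 / 2 + 2 * S"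
      unfolding variance_mellin_0 S_def[symmetric] by (simp only: of_real_eq_iff)
    have "complex_of_real (\<integral>t. kappa t \<partial>lborel) = of_real 1" using mellin_kappa[of 0] by simp
    then have kappa_int: "(\<integral>t. kappa t \<partial>lborel) = 1" by (simp only: of_real_eq_iff)
    \<comment> \<open>The derivative of the Poissonized mean tends to \<open>1 / trie_h p\<close>,
      as its toll has integral \<open>Gamma 1 = 1\<close>; the square of this limit accounts for the
      summand \<open>- 1 / trie_h p\<close> of \<open>trie_G0\<close>.\<close>
    have "trie_G0 p r / trie_h p = (1 / 2 + 2 * S) / trie_h p - (1 / trie_h p)\<^sup>2"
      using False h unfolding trie_G0_def S by (simp add: trie_E_def power2_eq_square field_simps)
    then have "(\<lambda>n. V n / real n) \<longlonglongrightarrow> trie_G0 p r / trie_h p"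
      using variance_limit_nonlattice[OF irr] unfolding psi_int kappa_int ent by simp
    then have "(\<lambda>n. complex_of_real (V n / real n)) \<longlonglongrightarrow> of_real (trie_G0 p r / trie_h p)"
      by (rule tendsto_of_real)
    from tendsto_diff[OF this tendsto_const[of "complex_of_real (trie_G0 p r / trie_h p)"]]
    show ?thesis using False by (simp add: trie_F_def)
  next
    case True
    then have rl: "0 < r" "0 < l" "coprime r l" "ln p / ln (1 - p) = real r / real l" using assms(5) by auto
    \<comment> \<open>The common lattice step of \<open>A\<close> and \<open>B\<close>; coprimality
      makes it the largest one.\<close>
    define d where "d = A / real r"
    have d: "0 < d" "A = real r * d" using rl A_pos by (auto simp: d_def)
    have B: "B = real l * d"
    proof -
      have "A / B = real r / real l" using rl(4) by (simp add: A_def B_def)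
      then show ?thesis using rl B_pos A_pos by (simp add: d_def field_simps)
    qed
    have lnp: "ln p = - (real r * d)" using d(2) by (simp add: A_def)
    have chi: "trie_chi p r = freq d"
    proof
      fix k
      show "trie_chi p r k = freq d k"
        using rl(1) d(1) by (simp add: trie_chi_def freq_def lnp field_simps)
    qed
    have x: "real r * log (1 / p) (real n) = ln (real n) / d" for n
      using rl(1) d(1) assms(1,2) by (simp add: log_def ln_div lnp)
    have exp_ee: "exp (2 * of_int k * of_real pi * \<i> * of_real x) = ee k x" for k x
      by (simp add: ee_def cis_conv_exp mult_ac)
    define w where "w n = 2 * pi\<^sup>2 * real (Suc n) / d / sinh (2 * pi\<^sup>2 * real (Suc n) / d)" for n
    have w: "conv d 0 = of_real (1 + 2 * (\<Sum>n. w n))" "summable (\<lambda>n. norm (w n))"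
      using conv_0[OF d(1)] unfolding w_def by blast+
    have E: "trie_E p r = 2 / trie_h p * (\<Sum>n. w n)"
    proof -
      \<comment> \<open>Substituting \<open>ln p = - (r * d)\<close> flips the sign of the odd
        function \<open>sinh\<close>; the prefactor \<open>1 / ln p\<close> of \<open>trie_E\<close>
        flips it back.\<close>
      have eq: "4 * real r * real (n + 1) * pi\<^sup>2 / sinh (2 * real r * real (n + 1) * pi\<^sup>2 / ln p) = - (2 * (real r * d)) * w n" for n
      proof -
        define Y where "Y = 2 * pi\<^sup>2 * real (Suc n) / d"
        have 1: "2 * real r * real (n + 1) * pi\<^sup>2 / ln p = - Y"
          using rl(1) d(1) by (simp add: lnp Y_def field_simps)
        have 2: "4 * real r * real (n + 1) * pi\<^sup>2 = 2 * (real r * d) * Y"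
          using d(1) by (simp add: Y_def field_simps)
        show ?thesis unfolding 1 2 w_def Y_def[symmetric] by simp
      qed
      have "(\<Sum>\<^sub>\<infinity>j\<in>{1::nat..}. 4 * real r * real j * pi\<^sup>2 / sinh (2 * real r * real j * pi\<^sup>2 / ln p))
          = (\<Sum>n. 4 * real r * real (n + 1) * pi\<^sup>2 / sinh (2 * real r * real (n + 1) * pi\<^sup>2 / ln p))"
      proof (rule infsum_nat_from)
        show "summable (\<lambda>n. norm (4 * real r * real (n + 1) * pi\<^sup>2 / sinh (2 * real r * real (n + 1) * pi\<^sup>2 / ln p)))"
          unfolding eq norm_mult by (intro summable_mult w)
      qed
      also have "\<dots> = - (2 * (real r * d)) * (\<Sum>n. w n)"
        unfolding eq by (rule suminf_mult[OF summable_norm_cancel[OF w(2)]])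
      finally show ?thesis using True rl(1) d(1) h by (simp add: trie_E_def lnp field_simps)
    qed
    have c0: "coeff d 0 = complex_of_real (trie_G0 p r)"
      unfolding coeff_def freq_0 variance_mellin_0 S_def[symmetric] w(1) ent trie_G0_def S E
      using h by (simp add: field_simps)
    have ck: "coeff d k = trie_G p r k" if k: "k \<noteq> 0" for k
    proof -
      define z where "z = freq d k"
      have z: "Re z = 0" "z \<noteq> 0" using k d(1) by (simp_all add: z_def freq_def)
      define T where "T j = (-1) ^ j * (of_nat j + 1 + z) * Gamma (of_nat j + z) * complex_of_real (p ^ (j + 1) + (1 - p) ^ (j + 1))
          / (fact (j - 1) * (of_nat j + 1) * of_real (1 - p ^ (j + 1) - (1 - p) ^ (j + 1)))" for j :: nat
      \<comment> \<open>The series of the statement starts at \<open>j = 1\<close>, so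
        \<open>j = n + 1\<close>; the sign \<open>(-1) ^ j\<close> turns its factor
        \<open>- 2\<close> into \<open>+ 2\<close>.\<close>
      have T: "T (n + 1) = - (of_real (mean_coeff n) * ((of_nat n + 2 + z) * Gamma (of_nat n + 1 + z)))" for n
      proof -
        have "n + 1 + 1 = n + 2" "n + 1 - 1 = n" by simp_all
        moreover have "complex_of_nat (n + 1) + 1 = of_nat n + 2" by simp
        ultimately have "T (n + 1) = (-1) ^ (n + 1) * (of_nat n + 2 + z) * Gamma (of_nat n + 1 + z) * complex_of_real (p ^ (n + 2) + (1 - p) ^ (n + 2))
          / (fact n * (of_nat n + 2) * of_real (1 - p ^ (n + 2) - (1 - p) ^ (n + 2)))"
          unfolding T_def by (simp only: of_nat_add of_nat_1)
        also have "\<dots> = - (of_real (mean_coeff n) * ((of_nat n + 2 + z) * Gamma (of_nat n + 1 + z)))"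
        proof -
          have "(-1) ^ (n + 1) = - ((-1) ^ n :: complex)" by simp
          then show ?thesis unfolding mean_coeff_alt by (simp add: mult_ac del: power_Suc add_2_eq_Suc' Suc_eq_plus1)
        qed
        finally show ?thesis .
      qed
      have sb: "summable (\<lambda>n. norm (of_real (mean_coeff n) * ((of_nat n + 2 + z) * Gamma (of_nat n + 1 + z))))"
        by (rule summable_comparison_test'[OF summable_beta]) (use series_term_bound[OF z(1)] in simp)
      have "infsum T {1..} = (\<Sum>n. T (n + 1))"
        by (rule infsum_nat_from) (use sb in \<open>simp only: T norm_minus_cancel\<close>)
      also have "\<dots> = - (\<Sum>n. of_real (mean_coeff n) * ((of_nat n + 2 + z) * Gamma (of_nat n + 1 + z)))"
        unfolding T by (rule suminf_minus[OF summable_norm_cancel[OF sb]])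
      finally have iT: "infsum T {1..} = - (\<Sum>n. of_real (mean_coeff n) * ((of_nat n + 2 + z) * Gamma (of_nat n + 1 + z)))" .
      have "trie_G p r k = z * Gamma (-1 + z) * (1 - (z + 3) / 2 powr (1 + z)) - 1 / of_real (trie_h p) * conv d k - 2 * infsum T {1..}"
        unfolding trie_G_def Let_def chi conv_def gam_def T_def z_def ..
      also have "\<dots> = coeff d k"
        unfolding coeff_def iT variance_mellin_imaginary[OF z, unfolded z_def] ent z_def by simp
      finally show ?thesis by simp
    qed
    have split: "1 / complex_of_real entropy * (\<Sum>\<^sub>\<infinity>k. coeff d k * ee k (ln (real n) / d))
        = complex_of_real (trie_G0 p r / trie_h p) + trie_F p r (real r * log (1 / p) (real n))" for n
    proof -
      define y where "y = ln (real n) / d"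
      have sm: "(\<lambda>k. coeff d k * ee k y) summable_on UNIV"
        using has_sum_coeff[OF d(1), of y] by (auto simp: summable_on_def)
      \<comment> \<open>The constant Fourier term is the value \<open>G(-1)\<close>; the other
        frequencies make up \<open>trie_F\<close>.\<close>
      have "(\<Sum>\<^sub>\<infinity>k. coeff d k * ee k y) = (\<Sum>\<^sub>\<infinity>k\<in>insert 0 {k. k \<noteq> 0}. coeff d k * ee k y)"
        by (rule infsum_cong_neutral) auto
      also have "\<dots> = coeff d 0 * ee 0 y + (\<Sum>\<^sub>\<infinity>k\<in>{k. k \<noteq> 0}. coeff d k * ee k y)"
        by (rule infsum_insert) (auto intro: summable_on_subset_banach[OF sm])
      also have "(\<Sum>\<^sub>\<infinity>k\<in>{k. k \<noteq> 0}. coeff d k * ee k y)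
          = (\<Sum>\<^sub>\<infinity>k\<in>{k. k \<noteq> 0}. trie_G p r k * exp (2 * of_int k * of_real pi * \<i> * of_real y))"
        by (intro infsum_cong) (simp add: ck exp_ee)
      finally show ?thesis
        unfolding x y_def[symmetric] using True by (simp add: trie_F_def c0 ent ee_def distrib_left)
    qed
    show ?thesis using variance_limit_lattice[OF d B rl(3)] unfolding split .
  qed
  show ?thesis unfolding var by (rule smalloI_tendsto) (use lim in simp_all)
qed

end
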